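(* Let $g \geq 3$ and $r$ be integers with $5 \leq r \leq 2g-1$. Then there exist infinitely many imaginary hyperelliptic curves $\mathcal{X}$ defined over $\mathbb{Q}(T)$ with genus $g$ such that the Jacobian variety satisfies $\operatorname{rank} J_{\mathcal{X}}(\mathbb{Q}(T)) = r$.
   Context: A hyperelliptic curve of genus $g$ over $\mathbb{Q}(T)$ is a curve $\mathcal{X}: y^2 = f(x,T)$ of genus $g$ (meaning the smooth projective model of this affine equation, regarded as a curve over the field $\mathbb{Q}(T)$), so that $\deg_x f$ is either $2g+1$ or $2g+2$. It is called imaginary if $\deg_x f = 2g+1$ and real if $\deg_x f = 2g+2$. $J_{\mathcal{X}}$ denotes its Jacobian variety, an abelian variety of dimension $g$ over $\mathbb{Q}(T)$. If $(B,\tau)$ is the $\mathbb{Q}(T)/\mathbb{Q}$-trace of $J_{\mathcal{X}}$, then $J_{\mathcal{X}}(\mathbb{Q}(T))/\tau(B(\mathbb{Q}))$ is a finitely generated abelian group (Lang--N\'eron); it is assumed throughout that $\tau(B(\mathbb{Q}))$ is trivial, and $\operatorname{rank} J_{\mathcal{X}}(\mathbb{Q}(T))$ is the number of free generators of this group. *)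

theory Defs
  imports
    "HOL-Algebra.Algebraic_Closure_Type"
    "HOL-Algebra.Free_Abelian_Groups"
    "HOL-Algebra.Coset"
    "HOL-Computational_Algebra.Computational_Algebra"
begin

section \<open>Function fields of one variable\<close>

text \<open>
  A smooth projective curve over a field is given by its function field \<open>F\<close> over the field of
  constants \<open>K\<close>; its closed points are the places of \<open>F\<close> over \<open>K\<close>. All fields
  are subsets of one ambient field, so that extension of constants is an inclusion of sets. A place
  is represented by its valuation ring.
\<close>

definition is_subfield :: "'a::field set \<Rightarrow> bool" where
  "is_subfield L \<longleftrightarrow> 0 \<in> L \<and> 1 \<in> L \<and>
     (\<forall>a\<in>L. \<forall>b\<in>L. a - b \<in> L \<and> a * b \<in> L) \<and> (\<forall>a\<in>L. inverse a \<in> L)"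

definition places :: "'a::field set \<Rightarrow> 'a set \<Rightarrow> 'a set set" where
  "places K F = {V. K \<subset> V \<and> V \<subset> F \<and>
     (\<forall>a\<in>V. \<forall>b\<in>V. a - b \<in> V \<and> a * b \<in> V) \<and> (\<forall>z\<in>F. z \<in> V \<or> inverse z \<in> V)}"

definition max_ideal :: "'a::field set \<Rightarrow> 'a set" where
  "max_ideal V = {z\<in>V. z = 0 \<or> inverse z \<notin> V}"

definition uniformizer :: "'a::field set \<Rightarrow> 'a \<Rightarrow> bool" where
  "uniformizer V t \<longleftrightarrow> max_ideal V = (\<lambda>z. t * z) ` V"

text \<open>The normalized discrete valuation at a place, for nonzero arguments.\<close>

definition ord_at :: "'a::field set \<Rightarrow> 'a \<Rightarrow> int" where
  "ord_at V z = (THE n. \<exists>t. uniformizer V t \<and> (\<exists>u \<in> V - max_ideal V. z = t powi n * u))"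

text \<open>
  The dimension over \<open>K\<close> of the quotient \<open>V / W\<close> of \<open>K\<close>-vector spaces
  \<open>W \<subseteq> V\<close>, used only where it is finite.
\<close>

definition quot_dim :: "'a::field set \<Rightarrow> 'a set \<Rightarrow> 'a set \<Rightarrow> nat" where
  "quot_dim K V W = (LEAST n. \<exists>B. finite B \<and> card B = n \<and> B \<subseteq> V \<and>
     (\<forall>z\<in>V. \<exists>c. (\<forall>b\<in>B. c b \<in> K) \<and> z - (\<Sum>b\<in>B. c b * b) \<in> W))"

definition place_degree :: "'a::field set \<Rightarrow> 'a set \<Rightarrow> nat" where
  "place_degree K V = quot_dim K V (max_ideal V)"


section \<open>Divisors, genus and divisor classes of degree zero\<close>

definition divisor_group :: "'a::field set \<Rightarrow> 'a set \<Rightarrow> ('a set \<Rightarrow>\<^sub>0 int) monoid" where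
  "divisor_group K F = free_Abelian_group (places K F)"

definition div_degree :: "'a::field set \<Rightarrow> ('a set \<Rightarrow>\<^sub>0 int) \<Rightarrow> int" where
  "div_degree K D = (\<Sum>V\<in>Poly_Mapping.keys D. Poly_Mapping.lookup D V * int (place_degree K V))"

definition div_of :: "'a::field set \<Rightarrow> 'a set \<Rightarrow> 'a \<Rightarrow> ('a set \<Rightarrow>\<^sub>0 int)" where
  "div_of K F z = Abs_poly_mapping (\<lambda>V. if V \<in> places K F then ord_at V z else 0)"

definition riemann_roch_space :: "'a::field set \<Rightarrow> 'a set \<Rightarrow> ('a set \<Rightarrow>\<^sub>0 int) \<Rightarrow> 'a set" where
  "riemann_roch_space K F D =
     {z\<in>F. z = 0 \<or> (\<forall>V\<in>places K F. ord_at V z \<ge> - Poly_Mapping.lookup D V)}"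

text \<open>
  The genus as in Riemann's theorem: the maximum of \<open>deg D - l(D) + 1\<close> over all divisors.
\<close>

definition genus :: "'a::field set \<Rightarrow> 'a set \<Rightarrow> int" where
  "genus K F = Sup {div_degree K D - int (quot_dim K (riemann_roch_space K F D) {0}) + 1 | D.
     D \<in> carrier (divisor_group K F)}"

definition Div0 :: "'a::field set \<Rightarrow> 'a set \<Rightarrow> ('a set \<Rightarrow>\<^sub>0 int) monoid" where
  "Div0 K F = (divisor_group K F)
     \<lparr>carrier := {D \<in> carrier (divisor_group K F). div_degree K D = 0}\<rparr>"

definition principal_divisors :: "'a::field set \<Rightarrow> 'a set \<Rightarrow> ('a set \<Rightarrow>\<^sub>0 int) set" where
  "principal_divisors K F = div_of K F ` (F - {0})"

definition Pic0 :: "'a::field set \<Rightarrow> 'a set \<Rightarrow> ('a set \<Rightarrow>\<^sub>0 int) set monoid" where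
  "Pic0 K F = Div0 K F Mod principal_divisors K F"

text \<open>
  Pullback of divisors of \<open>F\<close> to an algebraic extension \<open>F'\<close> with constants \<open>K'\<close>:
  the coefficient at a place is multiplied by the ramification index, which is the valuation of a
  uniformizer of the place below.
\<close>

definition conorm ::
    "'a::field set \<Rightarrow> 'a set \<Rightarrow> 'a set \<Rightarrow> ('a set \<Rightarrow>\<^sub>0 int) \<Rightarrow> ('a set \<Rightarrow>\<^sub>0 int)" where
  "conorm F K' F' D = Abs_poly_mapping (\<lambda>V. if V \<in> places K' F'
     then ord_at V (SOME t. uniformizer (V \<inter> F) t) * Poly_Mapping.lookup D (V \<inter> F) else 0)"


section \<open>Abelian groups\<close>

definition finitely_generated_of_rank :: "('b, 'c) monoid_scheme \<Rightarrow> nat \<Rightarrow> bool" where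
  "finitely_generated_of_rank G r \<longleftrightarrow>
     (\<exists>H :: nat monoid. comm_group H \<and> finite (carrier H) \<and> G \<cong> free_Abelian_group {..<r} \<times>\<times> H)"

definition max_divisible :: "('b, 'c) monoid_scheme \<Rightarrow> 'b set" where
  "max_divisible G = \<Union>{H. subgroup H G \<and> (\<forall>h\<in>H. \<forall>n>0. \<exists>x\<in>H. x [^]\<^bsub>G\<^esub> (n::nat) = h)}"


section \<open>Hyperelliptic curves over the field of rational functions in \<open>T\<close>\<close>

text \<open>
  \<^typ>\<open>rat poly fract\<close> is the field of rational functions in \<open>T\<close>, and the curve
  \<open>y\<^sup>2 = f\<close> is given by a polynomial in \<open>x\<close> over that field. The ambient field is an
  algebraic closure of the rational functions in \<open>T\<close> and \<open>x\<close>.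
\<close>

type_synonym QT = "rat poly fract"
type_synonym ambient = "rat poly fract poly fract alg_closure"

definition const_field :: "ambient set" where
  "const_field = range (\<lambda>c::QT. to_ac (to_fract [:c:]))"

text \<open>
  Both square roots of \<open>f\<close> are adjoined, but they differ only by sign.
\<close>

definition curve_field :: "QT poly \<Rightarrow> ambient set" where
  "curve_field f = is_subfield hull (range to_ac \<union> {y. y ^ 2 = to_ac (to_fract f)})"

definition imaginary_hyperelliptic :: "nat \<Rightarrow> QT poly \<Rightarrow> bool" where
  "imaginary_hyperelliptic g f \<longleftrightarrow>
     squarefree f \<and> genus const_field (curve_field f) = int g \<and> degree f = 2 * g + 1"

text \<open>Isomorphism of the smooth projective models over the rational functions in \<open>T\<close>.\<close>

definition isomorphic_curves :: "QT poly \<Rightarrow> QT poly \<Rightarrow> bool" where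
  "isomorphic_curves f1 f2 \<longleftrightarrow>
     (\<exists>\<phi>. bij_betw \<phi> (curve_field f1) (curve_field f2) \<and>
       (\<forall>a\<in>curve_field f1. \<forall>b\<in>curve_field f1. \<phi> (a + b) = \<phi> a + \<phi> b \<and> \<phi> (a * b) = \<phi> a * \<phi> b) \<and>
       (\<forall>c\<in>const_field. \<phi> c = c))"

text \<open>
  When \<open>deg f\<close> is odd the curve has a rational point at infinity, so the points of the
  Jacobian over any extension of the constants are the divisor classes of degree zero over that
  extension.
\<close>

definition jacobian_points :: "QT poly \<Rightarrow> (ambient set \<Rightarrow>\<^sub>0 int) set monoid" where
  "jacobian_points f = Pic0 const_field (curve_field f)"

text \<open>Extension of constants from the rational numbers to the algebraic numbers.\<close>

definition const_field_bar :: "ambient set" where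
  "const_field_bar = is_subfield hull (const_field \<union> {z. algebraic z})"

definition curve_field_bar :: "QT poly \<Rightarrow> ambient set" where
  "curve_field_bar f = is_subfield hull (curve_field f \<union> {z. algebraic z})"

text \<open>
  The subgroup \<open>\<tau>(B(\<rat>))\<close> of the points of the Jacobian, where \<open>(B, \<tau>)\<close> is its trace
  to \<open>\<rat>\<close>. Let \<open>k\<close> be the field of algebraic numbers. By Lang--Neron the quotient of
  \<open>J(k(T))\<close> by \<open>\<tau>(B(k))\<close> is finitely generated, while \<open>B(k)\<close> is divisible; hence
  \<open>\<tau>(B(k))\<close> is the largest divisible subgroup of \<open>J(k(T))\<close>. As \<open>\<tau>\<close> is injective
  and Galois equivariant, \<open>\<tau>(B(\<rat>))\<close> consists of the points over the rational functions in
  \<open>T\<close> that lie in \<open>\<tau>(B(k))\<close>.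
\<close>

definition trace_points :: "QT poly \<Rightarrow> (ambient set \<Rightarrow>\<^sub>0 int) set set" where
  "trace_points f = {C \<in> carrier (jacobian_points f).
     \<exists>D\<in>C. \<exists>C' \<in> max_divisible (Pic0 const_field_bar (curve_field_bar f)).
       conorm (curve_field f) const_field_bar (curve_field_bar f) D \<in> C'}"

end

theory Submission
  imports Defs
begin

text \<open>
  The curves are the members \<open>y\<^sup>2 = A T + B\<close> of a pencil, with \<open>A = x (x - 1) ... (x - (r - 1))\<close> and
  \<open>B\<close> monic of degree \<open>2 g + 1\<close> such that \<open>B = 1\<close> at the zeros of \<open>A\<close>. The equation is linear in
  \<open>T\<close>, so \<open>T = (y\<^sup>2 - B) / A\<close> and the function field over \<open>k(T)\<close>, for a field \<open>k\<close> of
  characteristic zero, is the rational function field \<open>k(x, y)\<close>: the surface swept out by the pencil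
  is rational, which makes the class group of the generic member computable by hand. The coordinate
  ring \<open>O = K[x, y]\<close> over \<open>K = k(T)\<close> becomes, once \<open>A\<close> is inverted, the ring \<open>k[x, y, 1/A]\<close>
  localized at the nonzero polynomials in \<open>T\<close>, hence a unique factorization domain
  (\<open>centre\<close>, \<open>pencil_normal\<close>). So every place outside the fibre over \<open>A = 0\<close> is
  principal up to that fibre and infinity (\<open>principal_place\<close>). Over the zero \<open>\<alpha> i\<close> of \<open>A\<close> lie two
  rational points, one with \<open>y = 1\<close> and one with \<open>y = - 1\<close>, and \<open>x - \<alpha> i\<close> has divisor their sum minus
  twice infinity. Finally, a function all of whose zeros and poles lie in the fibre over \<open>A = 0\<close> or at
  infinity has the same order at both points (\<open>units_symmetric\<close>): after multiplication by a power of \<open>A\<close>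
  it divides a power of \<open>A\<close> in \<open>O\<close>, its norm \<open>u\<^sup>2 - f v\<^sup>2\<close> has degree zero in \<open>T\<close> after division by
  its content, and a parity count of degrees in \<open>T\<close> gives \<open>v = 0\<close> (\<open>factor_of_A_power\<close>). Therefore
  the classes of degree zero form a free abelian group on the \<open>r\<close> points with \<open>y = 1\<close>
  (\<open>Pic0_iso\<close>).

  The argument works over every such \<open>k\<close>. Over the algebraic numbers it shows that the class group has
  no nonzero divisible subgroup, and over both fields together that a divisor which becomes
  principal after extension of constants was principal before (\<open>conorm_principal\<close>). Hence the trace is
  trivial.

  For the genus, the functions whose only pole is at infinity are the polynomials \<open>u + v y\<close>, with
  pole order \<open>2 deg u\<close> or \<open>2 g + 1 + 2 deg v\<close>, whichever is larger; the \<open>g\<close> odd numbers below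
  \<open>2 g\<close> are the missing pole orders. Comparing any divisor with a multiple of infinity turns this
  count into the maximum in Riemann's theorem (\<open>genus_eq\<close>).

  An isomorphism of two members of the family preserves the place at infinity, because that
  is the only rational place which is the double pole of a function without other poles: a second one
  would be possible only if \<open>f\<close>, which is irreducible, had a root in \<open>K\<close> (\<open>double_pole\<close>). So it maps \<open>x\<close> to \<open>a x + b\<close>
  (\<open>curve_isomorphism_affine\<close>). The polynomials \<open>B\<close> are chosen
  without term of degree \<open>2 g\<close>, so that \<open>b = 0\<close>, and such that the coefficient of \<open>x\<^sup>r\<close> in \<open>f\<close> is
  \<open>T + \<rho> + c\<close> with a parameter \<open>c\<close>. Members with parameters \<open>c1\<close> and \<open>c2\<close> are then isomorphic only if
  \<open>(T + \<rho> + c1) / (T + \<rho> + c2)\<close> is a power \<open>a\<^sup>k\<close> with \<open>k = 2 g + 1 - r \<ge> 2\<close>, which forces \<open>c1 = c2\<close>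
  (\<open>family_affine_rigid\<close>).
\<close>

section \<open>Dimensions of quotients\<close>

locale field_embedding =
  fixes \<iota> :: "'k::field \<Rightarrow> 'a::field"
  assumes emb_add: "\<iota> (a + b) = \<iota> a + \<iota> b"
    and emb_mult: "\<iota> (a * b) = \<iota> a * \<iota> b"
    and emb_1: "\<iota> 1 = 1"
begin

lemma emb_0 [simp]: "\<iota> 0 = 0"
  using emb_add[of 0 0] by (metis add_cancel_right_right add.right_neutral)

lemma emb_uminus: "\<iota> (- a) = - \<iota> a"
  using emb_add[of a "- a"] by (simp add: eq_neg_iff_add_eq_0 add.commute)

lemma emb_diff: "\<iota> (a - b) = \<iota> a - \<iota> b"
  using emb_add[of a "- b"] emb_uminus by simp

lemma emb_inverse: "\<iota> (inverse a) = inverse (\<iota> a)"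
proof (cases "a = 0")
  case False
  then have "\<iota> a * \<iota> (inverse a) = 1" using emb_mult[of a "inverse a"] emb_1 by simp
  then show ?thesis by (simp add: inverse_unique)
qed simp

lemma emb_divide: "\<iota> (a / b) = \<iota> a / \<iota> b"
  by (simp add: divide_inverse emb_mult emb_inverse)

lemma emb_eq_0_iff [simp]: "\<iota> a = 0 \<longleftrightarrow> a = 0"
proof
  assume "\<iota> a = 0"
  show "a = 0"
  proof (rule ccontr)
    assume "a \<noteq> 0"
    then have "\<iota> a * \<iota> (inverse a) = 1" using emb_mult[of a "inverse a"] emb_1 by simp
    then show False using \<open>\<iota> a = 0\<close> by simp
  qed
qed simp

lemma emb_eq_iff [simp]: "\<iota> a = \<iota> b \<longleftrightarrow> a = b"
  using emb_diff[of a b] emb_eq_0_iff[of "a - b"] by simp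

lemma emb_of_nat: "\<iota> (of_nat n) = of_nat n"
  by (induction n) (simp_all add: emb_add emb_1)

lemma emb_power: "\<iota> (a ^ n) = \<iota> a ^ n"
  by (induction n) (simp_all add: emb_mult emb_1)

sublocale vs: vector_space "\<lambda>c v. \<iota> c * v"
  by unfold_locales (simp_all add: emb_add emb_mult emb_1 algebra_simps)

declare vs.scale_scale [simp del] vs.scale_eq_0_iff [simp del] vs.scale_cancel_left [simp del]
  vs.scale_cancel_right [simp del]

abbreviation lincomb :: "('a \<Rightarrow> 'k) \<Rightarrow> 'a set \<Rightarrow> 'a" where
  "lincomb c E \<equiv> (\<Sum>e\<in>E. \<iota> (c e) * e)"

text \<open>
  A family of representatives of a basis of \<open>V / W\<close>.
\<close>

definition quot_basis :: "'a set \<Rightarrow> 'a set \<Rightarrow> 'a set \<Rightarrow> bool" where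
  "quot_basis V W E \<longleftrightarrow> finite E \<and> E \<subseteq> V \<and> (\<forall>z\<in>V. \<exists>c. z - lincomb c E \<in> W) \<and>
     (\<forall>c. lincomb c E \<in> W \<longrightarrow> (\<forall>e\<in>E. c e = 0))"

definition qdim :: "'a set \<Rightarrow> 'a set \<Rightarrow> nat \<Rightarrow> bool" where
  "qdim V W n \<longleftrightarrow> (\<exists>E. quot_basis V W E \<and> card E = n)"

lemma quot_basisD: "quot_basis V W E \<Longrightarrow> lincomb c E \<in> W \<Longrightarrow> e \<in> E \<Longrightarrow> c e = 0"
  by (simp add: quot_basis_def)

lemma lincomb_in_span: "lincomb c E \<in> vs.span E"
  by (intro vs.span_sum vs.span_scale vs.span_base)

lemma span_lincomb:
  assumes "finite E" "z \<in> vs.span E" obtains c where "z = lincomb c E"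
  using assms vs.span_finite[of E] by auto

lemma lincomb_in_subspace: "vs.subspace V \<Longrightarrow> E \<subseteq> V \<Longrightarrow> lincomb c E \<in> V"
  by (rule vs.subspace_sum) (auto intro: vs.subspace_scale)

text \<open>
  A projection with kernel \<open>W\<close> that fixes a basis of the quotient turns statements about
  \<open>V / W\<close> into statements about subspaces of a finite-dimensional space.
\<close>

lemma quot_basis_projection:
  assumes "quot_basis V W E" "vs.subspace W"
  obtains h where "Vector_Spaces.linear (\<lambda>c v. \<iota> c * v) (\<lambda>c v. \<iota> c * v) h"
    "\<And>w. w \<in> W \<Longrightarrow> h w = 0" "\<And>e. e \<in> vs.span E \<Longrightarrow> h e = e" "vs.independent E"
proof -
  interpret vp: vector_space_pair "\<lambda>c v. \<iota> c * v" "\<lambda>c v. \<iota> c * v" ..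
  obtain B where B: "B \<subseteq> W" "vs.independent B" "W \<subseteq> vs.span B"
    using vs.maximal_independent_subset[of W] by blast
  have spB: "vs.span B = W" using B assms(2) vs.span_minimal[of B W] by auto
  have E: "finite E" "\<And>c. lincomb c E \<in> W \<Longrightarrow> \<forall>e\<in>E. c e = 0"
    using assms(1) by (auto simp: quot_basis_def)
  have disj: "E \<inter> B = {}"
  proof (rule ccontr)
    assume "E \<inter> B \<noteq> {}"
    then obtain e where e: "e \<in> E" "e \<in> B" by auto
    have "lincomb (\<lambda>e'. if e' = e then 1 else 0) E = (\<Sum>e'\<in>E. if e' = e then e else 0)"
      by (intro sum.cong) (auto simp: emb_1)
    also have "\<dots> = e" using e E(1) by simp
    finally have "lincomb (\<lambda>e'. if e' = e then 1 else 0) E \<in> W" using e B by auto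
    from E(2)[OF this] e show False by auto
  qed
  have ind: "vs.independent (E \<union> B)"
    unfolding vs.independent_explicit_module
  proof (intro allI impI)
    fix S u v
    assume S: "finite S" "S \<subseteq> E \<union> B" "lincomb u S = 0" "v \<in> S"
    have fin: "finite (S \<inter> E)" "finite (S \<inter> B)" using S by auto
    have "lincomb u S = lincomb u (S \<inter> E) + lincomb u (S \<inter> B)"
      using S(2) disj fin by (subst sum.union_disjoint[symmetric]) (auto intro!: sum.cong)
    then have *: "lincomb u (S \<inter> E) = - lincomb u (S \<inter> B)" using S(3) by (simp add: eq_neg_iff_add_eq_0)
    have "lincomb (\<lambda>e. if e \<in> S then u e else 0) E = lincomb u (S \<inter> E)"
      using E(1) by (intro sum.mono_neutral_cong_right) auto
    also have "\<dots> \<in> W" unfolding *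
      by (intro vs.subspace_neg[OF assms(2)] lincomb_in_subspace[OF assms(2)]) (use B in auto)
    finally have z: "\<forall>e\<in>E. (if e \<in> S then u e else 0) = 0" by (rule E(2))
    then have "lincomb u (S \<inter> E) = 0" by (intro sum.neutral) auto
    with * have "lincomb u (S \<inter> B) = 0" by simp
    with vs.independentD[OF B(2) fin(2)] have "\<forall>v\<in>S \<inter> B. u v = 0" by auto
    with z S show "u v = 0" by (cases "v \<in> E") auto
  qed
  obtain h where h: "Vector_Spaces.linear (\<lambda>c v. \<iota> c * v) (\<lambda>c v. \<iota> c * v) h"
    "\<And>v. v \<in> E \<union> B \<Longrightarrow> h v = (if v \<in> E then v else 0)"
    using vp.linear_independent_extend[OF ind, of "\<lambda>v. if v \<in> E then v else 0"] by auto
  interpret h: Vector_Spaces.linear "\<lambda>c v. \<iota> c * v" "\<lambda>c v. \<iota> c * v" h by fact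
  show thesis
  proof (rule that[OF h(1)])
    show "h w = 0" if "w \<in> W" for w
    proof (rule vs.span_induct[of w B "\<lambda>w. h w = 0"])
      show "w \<in> vs.span B" using that spB by simp
      show "vs.subspace {w. h w = 0}"
        by (simp add: vs.subspace_def h.add h.scale h.zero)
      show "h b = 0" if "b \<in> B" for b using h(2)[of b] that disj by auto
    qed
    show "h e = e" if "e \<in> vs.span E" for e
    proof (rule vs.span_induct[of e E "\<lambda>w. h w = w"])
      show "vs.subspace {w. h w = w}"
        by (simp add: vs.subspace_def h.add h.scale h.zero)
    qed (use h(2) that in auto)
    show "vs.independent E" using ind vs.independent_mono by blast
  qed
qed

text \<open>
  A spanning set of least size is a basis: from a relation one element could be expressed by the others.
\<close>

lemma qdim_finite_span:
  assumes "finite B" "B \<subseteq> V" "\<And>z. z \<in> V \<Longrightarrow> \<exists>c. z - lincomb c B \<in> W" "vs.subspace W"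
  obtains n where "qdim V W n" "n \<le> card B"
proof -
  define P where "P = (\<lambda>n. \<exists>E. finite E \<and> card E = n \<and> E \<subseteq> V \<and> (\<forall>z\<in>V. \<exists>c. z - lincomb c E \<in> W))"
  have P: "P (card B)" using assms by (auto simp: P_def)
  define n where "n = (LEAST n. P n)"
  have "P n" unfolding n_def using P by (rule LeastI)
  then obtain E where E: "finite E" "card E = n" "E \<subseteq> V" "\<And>z. z \<in> V \<Longrightarrow> \<exists>c. z - lincomb c E \<in> W"
    by (auto simp: P_def)
  have "quot_basis V W E" unfolding quot_basis_def
  proof (intro conjI ballI allI impI E(1,3))
    fix c e assume c: "lincomb c E \<in> W" and eE: "e \<in> E"
    show "c e = 0"
    proof (rule ccontr)
    assume "c e \<noteq> 0"
    with eE have e: "e \<in> E" "c e \<noteq> 0" by auto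
    have "\<exists>c. z - lincomb c (E - {e}) \<in> W" if "z \<in> V" for z
    proof -
      from that
      obtain d where d: "z - lincomb d E \<in> W" using E(4) by blast
      define q where "q = d e / c e"
      have "lincomb (\<lambda>b. d b - q * c b) E = lincomb d E - \<iota> q * lincomb c E"
        by (simp add: emb_diff emb_mult sum_subtractf sum_distrib_left left_diff_distrib mult.assoc)
      moreover have "lincomb (\<lambda>b. d b - q * c b) E = lincomb (\<lambda>b. d b - q * c b) (E - {e})"
        using E(1) e by (subst sum.remove[of _ e]) (auto simp: q_def)
      ultimately have "z - lincomb (\<lambda>b. d b - q * c b) (E - {e}) = (z - lincomb d E) + \<iota> q * lincomb c E"
        by simp
      also have "\<dots> \<in> W"
        using vs.subspace_add[OF assms(4) d vs.subspace_scale[OF assms(4) c]] .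
      finally have "z - lincomb (\<lambda>b. d b - q * c b) (E - {e}) \<in> W" .
      then show "\<exists>c. z - lincomb c (E - {e}) \<in> W" by (rule exI[of _ "\<lambda>b. d b - q * c b"])
    qed
    then have "P (card (E - {e}))" unfolding P_def using E(1,3)
      by (intro exI[of _ "E - {e}"]) auto
    then have "n \<le> card (E - {e})" unfolding n_def by (rule Least_le)
    then show False using E(2) card_Diff1_less[OF E(1) e(1)] by simp
    qed
  qed (use E(4) in blast)
  moreover have "n \<le> card B" unfolding n_def using P by (rule Least_le)
  ultimately show thesis using that E(2) by (auto simp: qdim_def)
qed

lemma quot_basis_card_le:
  assumes qb: "quot_basis V W E" and W: "vs.subspace W"
    and B: "finite B" "\<And>z. z \<in> V \<Longrightarrow> \<exists>c. z - lincomb c B \<in> W"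
  shows "card E \<le> card B"
proof -
  obtain h where h: "Vector_Spaces.linear (\<lambda>c v. \<iota> c * v) (\<lambda>c v. \<iota> c * v) h"
    "\<And>w. w \<in> W \<Longrightarrow> h w = 0" "\<And>e. e \<in> vs.span E \<Longrightarrow> h e = e" "vs.independent E"
    using quot_basis_projection[OF qb W] by blast
  interpret h: Vector_Spaces.linear "\<lambda>c v. \<iota> c * v" "\<lambda>c v. \<iota> c * v" h by fact
  have "E \<subseteq> vs.span (h ` B)"
  proof
    fix e assume e: "e \<in> E"
    then obtain c where c: "e - lincomb c B \<in> W" using B(2) qb unfolding quot_basis_def by blast
    have "e = h e" using h(3)[OF vs.span_base[OF e]] by simp
    also have "\<dots> = h (lincomb c B)" using h(2)[OF c] h.diff by simp
    also have "\<dots> = (\<Sum>b\<in>B. \<iota> (c b) * h b)" by (simp add: h.sum h.scale)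
    also have "\<dots> \<in> vs.span (h ` B)" by (intro vs.span_sum vs.span_scale vs.span_base) auto
    finally show "e \<in> vs.span (h ` B)" .
  qed
  with vs.independent_span_bound[OF _ h(4)] B(1) have "card E \<le> card (h ` B)" by auto
  also have "\<dots> \<le> card B" by (rule card_image_le) fact
  finally show ?thesis .
qed

lemma qdim_unique:
  assumes "qdim V W m" "qdim V W n" "vs.subspace W" shows "m = n"
proof -
  have "card E \<le> card E'" if "quot_basis V W E" "quot_basis V W E'" for E E'
    using quot_basis_card_le[OF that(1) assms(3), of E'] that(2) by (auto simp: quot_basis_def)
  then show ?thesis using assms(1,2) unfolding qdim_def by (metis le_antisym)
qed

text \<open>
  Connects \<open>qdim\<close>, which asserts that a basis exists, with the least size of a spanning set.
\<close>

lemma quot_dim_eq: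
  assumes "qdim V W n" "vs.subspace W"
  shows "quot_dim (range \<iota>) V W = n"
proof -
  have conv: "(\<exists>c. (\<forall>b\<in>B. c b \<in> range \<iota>) \<and> z - (\<Sum>b\<in>B. c b * b) \<in> W) \<longleftrightarrow>
      (\<exists>c. z - lincomb c B \<in> W)" for B z
  proof
    assume "\<exists>c. (\<forall>b\<in>B. c b \<in> range \<iota>) \<and> z - (\<Sum>b\<in>B. c b * b) \<in> W"
    then obtain c where c: "\<forall>b\<in>B. c b \<in> range \<iota>" "z - (\<Sum>b\<in>B. c b * b) \<in> W" by blast
    have "lincomb (\<lambda>b. inv_into UNIV \<iota> (c b)) B = (\<Sum>b\<in>B. c b * b)"
      using c(1) by (intro sum.cong) (auto simp: f_inv_into_f)
    with c(2) show "\<exists>c. z - lincomb c B \<in> W" by metis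
  next
    assume "\<exists>c. z - lincomb c B \<in> W"
    then obtain c where "z - lincomb c B \<in> W" by blast
    then show "\<exists>c. (\<forall>b\<in>B. c b \<in> range \<iota>) \<and> z - (\<Sum>b\<in>B. c b * b) \<in> W"
      by (intro exI[of _ "\<lambda>b. \<iota> (c b)"]) auto
  qed
  obtain E where E: "quot_basis V W E" "card E = n" using assms(1) by (auto simp: qdim_def)
  show ?thesis unfolding quot_dim_def conv
  proof (rule Least_equality)
    show "\<exists>B. finite B \<and> card B = n \<and> B \<subseteq> V \<and> (\<forall>z\<in>V. \<exists>c. z - lincomb c B \<in> W)"
      using E by (auto simp: quot_basis_def)
  qed (use quot_basis_card_le[OF E(1) assms(2)] E(2) in blast)
qed

lemma qdim_add:
  assumes "qdim V U m" "qdim U W n" "vs.subspace U" "W \<subseteq> U" "U \<subseteq> V"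
  shows "qdim V W (m + n)"
proof -
  obtain E1 E2 where E1: "quot_basis V U E1" "card E1 = m" and E2: "quot_basis U W E2" "card E2 = n"
    using assms(1,2) by (auto simp: qdim_def)
  have fin: "finite E1" "finite E2" using E1 E2 by (auto simp: quot_basis_def)
  have disj: "E1 \<inter> E2 = {}"
  proof (rule ccontr)
    assume "E1 \<inter> E2 \<noteq> {}"
    then obtain e where e: "e \<in> E1" "e \<in> E2" by auto
    have "lincomb (\<lambda>e'. if e' = e then 1 else 0) E1 = (\<Sum>e'\<in>E1. if e' = e then e else 0)"
      by (intro sum.cong) (auto simp: emb_1)
    also have "\<dots> = e" using e fin by simp
    finally have "lincomb (\<lambda>e'. if e' = e then 1 else 0) E1 \<in> U"
      using e E2 by (auto simp: quot_basis_def)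
    moreover have E1z: "\<forall>e\<in>E1. c e = 0" if "lincomb c E1 \<in> U" for c
      using E1(1) that by (simp add: quot_basis_def)
    ultimately have "\<forall>e'\<in>E1. (if e' = e then 1 else 0) = (0::'k)" by (intro E1z)
    with e show False by auto
  qed
  have split: "lincomb c (E1 \<union> E2) = lincomb c E1 + lincomb c E2" for c
    using fin disj by (rule sum.union_disjoint)
  have E2U: "lincomb c E2 \<in> U" for c
    using E2 by (intro lincomb_in_subspace assms(3)) (auto simp: quot_basis_def)
  have "quot_basis V W (E1 \<union> E2)" unfolding quot_basis_def
  proof (intro conjI ballI allI impI)
    fix z assume "z \<in> V"
    then obtain c1 where c1: "z - lincomb c1 E1 \<in> U" using E1 by (auto simp: quot_basis_def)
    then obtain c2 where c2: "z - lincomb c1 E1 - lincomb c2 E2 \<in> W" using E2 by (auto simp: quot_basis_def)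
    let ?c = "\<lambda>e. if e \<in> E1 then c1 e else c2 e"
    have "lincomb ?c E1 = lincomb c1 E1" "lincomb ?c E2 = lincomb c2 E2"
      using disj by (auto intro!: sum.cong)
    then have "z - lincomb ?c (E1 \<union> E2) \<in> W" using c2 split[of ?c] by (simp add: algebra_simps)
    then show "\<exists>c. z - lincomb c (E1 \<union> E2) \<in> W" by (rule exI[of _ ?c])
  next
    fix c e assume c: "lincomb c (E1 \<union> E2) \<in> W" and e: "e \<in> E1 \<union> E2"
    then have "lincomb c E1 + lincomb c E2 \<in> U" using split assms(4) by auto
    then have "lincomb c E1 \<in> U"
      using vs.subspace_diff[OF assms(3) _ E2U[of c]] by fastforce
    then have 1: "\<forall>e\<in>E1. c e = 0" using E1 by (auto simp: quot_basis_def)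
    then have "lincomb c E1 = 0" by (intro sum.neutral) auto
    then have "lincomb c E2 \<in> W" using c split by simp
    then have "\<forall>e\<in>E2. c e = 0" using E2 by (auto simp: quot_basis_def)
    with 1 e show "c e = 0" by auto
  qed (use E1 E2 assms(5) in \<open>auto simp: quot_basis_def\<close>)
  moreover have "card (E1 \<union> E2) = m + n" using card_Un_disjoint[OF fin disj] E1(2) E2(2) by simp
  ultimately show ?thesis by (auto simp: qdim_def)
qed

text \<open>
  A finite-dimensional quotient is refined by every intermediate subspace: a basis of the image of
  \<open>U\<close> under the projection along \<open>W\<close> is lifted to \<open>U\<close>, and both steps are then finite-dimensional.
\<close>

lemma qdim_between:
  assumes "qdim V W n" "vs.subspace U" "vs.subspace W" "W \<subseteq> U" "U \<subseteq> V"
  obtains k l where "qdim V U k" "qdim U W l" "k + l = n"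
proof -
  obtain E where E: "quot_basis V W E" "card E = n" using assms(1) by (auto simp: qdim_def)
  have fin: "finite E" using E by (auto simp: quot_basis_def)
  obtain h where h: "Vector_Spaces.linear (\<lambda>c v. \<iota> c * v) (\<lambda>c v. \<iota> c * v) h"
    "\<And>w. w \<in> W \<Longrightarrow> h w = 0" "\<And>e. e \<in> vs.span E \<Longrightarrow> h e = e" "vs.independent E"
    using quot_basis_projection[OF E(1) assms(3)] by blast
  interpret h: Vector_Spaces.linear "\<lambda>c v. \<iota> c * v" "\<lambda>c v. \<iota> c * v" h by fact
  have hz: "h z \<in> vs.span E \<and> z - h z \<in> W" if "z \<in> V" for z
  proof -
    from that E(1) obtain c where c: "z - lincomb c E \<in> W" by (auto simp: quot_basis_def)
    have "h z = h (lincomb c E)" using h(2)[OF c] h.diff by simp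
    also have "\<dots> = lincomb c E" by (rule h(3)[OF lincomb_in_span])
    finally show ?thesis using c lincomb_in_span by simp
  qed
  obtain B where B: "B \<subseteq> h ` U" "vs.independent B" "h ` U \<subseteq> vs.span B"
    using vs.maximal_independent_subset[of "h ` U"] by blast
  have "B \<subseteq> vs.span E" using B(1) hz assms(5) by auto
  then have finB: "finite B" using vs.independent_span_bound[OF fin B(2)] by auto
  have BU: "B \<subseteq> U"
  proof
    fix b assume "b \<in> B"
    then obtain u where u: "u \<in> U" "b = h u" using B(1) by auto
    then have "u - b \<in> U" using hz assms(4,5) by auto
    then show "b \<in> U" using vs.subspace_diff[OF assms(2) u(1)] by force
  qed
  have "quot_basis U W B" unfolding quot_basis_def
  proof (intro conjI ballI allI impI finB BU)
    fix z assume z: "z \<in> U"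
    then have "h z \<in> vs.span B" using B(3) by auto
    then obtain c where "h z = lincomb c B" using span_lincomb[OF finB] by metis
    then show "\<exists>c. z - lincomb c B \<in> W" using hz[of z] z assms(5) by auto
  next
    fix c b assume c: "lincomb c B \<in> W" and b: "b \<in> B"
    have "lincomb c B \<in> vs.span E"
      using \<open>B \<subseteq> vs.span E\<close> by (intro lincomb_in_subspace vs.subspace_span)
    then have "lincomb c B = 0" using h(2)[OF c] h(3) by simp
    then show "c b = 0" using vs.independentD[OF B(2) finB] b by auto
  qed
  then have 1: "qdim U W (card B)" by (auto simp: qdim_def)
  obtain k where k: "qdim V U k"
  proof (rule qdim_finite_span[OF fin, of V U])
    show "E \<subseteq> V" using E(1) by (auto simp: quot_basis_def)
    show "\<exists>c. z - lincomb c E \<in> U" if "z \<in> V" for z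
      using E(1) that assms(4) unfolding quot_basis_def by (meson subsetD)
  qed (use assms(2) in auto)
  from qdim_unique[OF qdim_add[OF k 1 assms(2,4,5)] assms(1,3)] show thesis using that k 1 by auto
qed

text \<open>
  Multiplication by \<open>e\<close> induces an isomorphism from \<open>V / W\<close> to \<open>V' / W'\<close>. With \<open>e = 1\<close> this
  contains the second isomorphism theorem.
\<close>

lemma qdim_transport:
  assumes "qdim V W n" "vs.subspace W" "vs.subspace V" "e \<noteq> 0"
    "\<And>z. z \<in> V \<Longrightarrow> e * z \<in> V'" "\<And>z. z \<in> V' \<Longrightarrow> \<exists>v\<in>V. z - e * v \<in> W'"
    "\<And>z. z \<in> V \<Longrightarrow> e * z \<in> W' \<longleftrightarrow> z \<in> W" "vs.subspace W'"
  shows "qdim V' W' n"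
proof -
  obtain E where E: "quot_basis V W E" "card E = n" using assms(1) by (auto simp: qdim_def)
  let ?E = "(*) e ` E"
  have inj: "inj_on ((*) e) E" using assms(4) by (auto simp: inj_on_def)
  have lc: "lincomb c ?E = e * lincomb (\<lambda>z. c (e * z)) E" for c
    using sum.reindex[OF inj, of "\<lambda>v. \<iota> (c v) * v"] by (simp add: sum_distrib_left algebra_simps)
  have "quot_basis V' W' ?E" unfolding quot_basis_def
  proof (intro conjI ballI allI impI)
    fix z assume "z \<in> V'"
    then obtain v where v: "v \<in> V" "z - e * v \<in> W'" using assms(6) by blast
    then obtain c where c: "v - lincomb c E \<in> W" using E(1) by (auto simp: quot_basis_def)
    have "lincomb c E \<in> V" using E(1) by (intro lincomb_in_subspace assms(3)) (auto simp: quot_basis_def)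
    then have "v - lincomb c E \<in> V" using v(1) vs.subspace_diff[OF assms(3)] by auto
    with c have "e * (v - lincomb c E) \<in> W'" using assms(7) by blast
    from vs.subspace_add[OF assms(8) v(2) this] have "z - e * lincomb c E \<in> W'"
      by (simp add: algebra_simps)
    moreover have "lincomb (\<lambda>w. c (w / e)) ?E = e * lincomb c E" using assms(4) by (simp add: lc)
    ultimately show "\<exists>c. z - lincomb c ?E \<in> W'" by metis
  next
    fix c b assume c: "lincomb c ?E \<in> W'" and b: "b \<in> ?E"
    have "lincomb (\<lambda>z. c (e * z)) E \<in> V"
      using E(1) by (intro lincomb_in_subspace assms(3)) (auto simp: quot_basis_def)
    then have "lincomb (\<lambda>z. c (e * z)) E \<in> W" using c assms(7) unfolding lc by blast
    from quot_basisD[OF E(1) this] have "\<forall>z\<in>E. c (e * z) = 0" by auto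
    with b show "c b = 0" by auto
  qed (use E(1) assms(5) in \<open>auto simp: quot_basis_def\<close>)
  moreover have "card ?E = n" using card_image[OF inj] E(2) by simp
  ultimately show ?thesis by (auto simp: qdim_def)
qed

lemma qdim_0_iff: "qdim V W 0 \<longleftrightarrow> V \<subseteq> W"
proof
  assume "V \<subseteq> W"
  then show "qdim V W 0" unfolding qdim_def quot_basis_def by (intro exI[of _ "{}"]) auto
qed (auto simp: qdim_def quot_basis_def)

lemma qdim_1I:
  assumes "e \<in> V" "e \<notin> W" "vs.subspace W" "\<And>z. z \<in> V \<Longrightarrow> \<exists>c. z - \<iota> c * e \<in> W"
  shows "qdim V W 1"
proof -
  have "quot_basis V W {e}" unfolding quot_basis_def
  proof (intro conjI ballI allI impI)
    fix c b assume c: "lincomb c {e} \<in> W" and b: "b \<in> {e}"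
    show "c b = 0"
    proof (rule ccontr)
      assume "c b \<noteq> 0"
      then have "\<iota> (inverse (c e)) * (\<iota> (c e) * e) = e"
        using b \<open>c b \<noteq> 0\<close> by (simp add: emb_inverse)
      with vs.subspace_scale[OF assms(3), of "\<iota> (c e) * e" "inverse (c e)"] c assms(2) show False by simp
    qed
  next
    fix z assume "z \<in> V"
    then obtain c where "z - \<iota> c * e \<in> W" using assms(4) by blast
    then show "\<exists>c. z - lincomb c {e} \<in> W" by (intro exI[of _ "\<lambda>_. c"]) simp
  qed (use assms in auto)
  then show ?thesis by (auto simp: qdim_def)
qed

end

section \<open>Discrete places\<close>

lemma subfieldD:
  assumes "is_subfield L"
  shows "0 \<in> L" "1 \<in> L" "a \<in> L \<Longrightarrow> b \<in> L \<Longrightarrow> a - b \<in> L" "a \<in> L \<Longrightarrow> b \<in> L \<Longrightarrow> a * b \<in> L"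
    "a \<in> L \<Longrightarrow> inverse a \<in> L"
  using assms by (auto simp: is_subfield_def)

lemma subfield_closed:
  assumes "is_subfield L"
  shows "a \<in> L \<Longrightarrow> - a \<in> L" "a \<in> L \<Longrightarrow> b \<in> L \<Longrightarrow> a + b \<in> L" "a \<in> L \<Longrightarrow> b \<in> L \<Longrightarrow> a / b \<in> L"
    "a \<in> L \<Longrightarrow> a ^ n \<in> L" "a \<in> L \<Longrightarrow> a powi k \<in> L"
proof -
  note L = subfieldD[OF assms]
  show neg: "- a \<in> L" if "a \<in> L" for a using L(3)[OF L(1) that] by simp
  show "a + b \<in> L" if "a \<in> L" "b \<in> L" for a b using L(3)[OF that(1) neg[OF that(2)]] by simp
  show "a / b \<in> L" if "a \<in> L" "b \<in> L" for a b using L(4,5) that by (simp add: divide_inverse)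
  show pow: "a ^ n \<in> L" if "a \<in> L" for a n by (induction n) (use L(2,4) that in auto)
  show "a powi k \<in> L" if "a \<in> L" for a k using pow that L(5) by (simp add: power_int_def)
qed

locale place =
  fixes K F V :: "'a::field set"
  assumes subfield_F: "is_subfield F" and subfield_K: "is_subfield K" and place: "V \<in> places K F"
begin

lemma V_sub_F: "z \<in> V \<Longrightarrow> z \<in> F" and K_sub_V: "z \<in> K \<Longrightarrow> z \<in> V" and V_neq_F: "V \<noteq> F"
  and V_diff: "a \<in> V \<Longrightarrow> b \<in> V \<Longrightarrow> a - b \<in> V" and V_mult: "a \<in> V \<Longrightarrow> b \<in> V \<Longrightarrow> a * b \<in> V"
  and V_cases: "z \<in> F \<Longrightarrow> z \<in> V \<or> inverse z \<in> V"
  using place by (auto simp: places_def)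

lemma V_0 [simp]: "0 \<in> V" and V_1 [simp]: "1 \<in> V"
  using subfieldD(1,2)[OF subfield_K] K_sub_V by auto

lemma V_uminus: "a \<in> V \<Longrightarrow> - a \<in> V"
  using V_diff[of 0 a] by simp

lemma V_add: "a \<in> V \<Longrightarrow> b \<in> V \<Longrightarrow> a + b \<in> V"
  using V_diff[of a "- b"] V_uminus by simp

lemma V_power: "a \<in> V \<Longrightarrow> a ^ n \<in> V"
  by (induction n) (auto intro: V_mult)

lemma max_ideal_sub: "z \<in> max_ideal V \<Longrightarrow> z \<in> V"
  by (auto simp: max_ideal_def)

lemma max_ideal_0 [simp]: "0 \<in> max_ideal V"
  by (simp add: max_ideal_def)

lemma max_ideal_1 [simp]: "1 \<notin> max_ideal V"
  by (simp add: max_ideal_def)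

lemma unit_iff: "z \<in> V - max_ideal V \<longleftrightarrow> z \<noteq> 0 \<and> z \<in> V \<and> inverse z \<in> V"
  by (auto simp: max_ideal_def)

lemma max_ideal_mult: assumes "a \<in> max_ideal V" "v \<in> V" shows "a * v \<in> max_ideal V" "v * a \<in> max_ideal V"
proof -
  show "a * v \<in> max_ideal V"
  proof (rule ccontr)
    assume "a * v \<notin> max_ideal V"
    then have *: "a * v \<noteq> 0" "inverse (a * v) \<in> V"
      using V_mult[OF max_ideal_sub[OF assms(1)] assms(2)] by (auto simp: max_ideal_def)
    then have "v * inverse (a * v) \<in> V" using assms(2) V_mult by blast
    then have "inverse a \<in> V" using *(1) by (simp add: field_simps)
    with assms(1) *(1) show False by (auto simp: max_ideal_def)
  qed
  then show "v * a \<in> max_ideal V" by (simp add: mult.commute)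
qed

lemma max_ideal_uminus: "a \<in> max_ideal V \<Longrightarrow> - a \<in> max_ideal V"
  using max_ideal_mult(1)[of a "- 1"] V_uminus[OF V_1] by simp

lemma max_ideal_add: assumes "a \<in> max_ideal V" "b \<in> max_ideal V" shows "a + b \<in> max_ideal V"
proof (cases "a = 0 \<or> b = 0")
  case False
  have "a / b \<in> F" using assms max_ideal_sub V_sub_F subfield_closed(3)[OF subfield_F] by auto
  then consider "a / b \<in> V" | "b / a \<in> V" using V_cases[of "a / b"] by auto
  then show ?thesis
  proof cases
    case 1
    then have "b * (1 + a / b) \<in> max_ideal V" using assms by (intro max_ideal_mult V_add) auto
    then show ?thesis using False by (simp add: field_simps)
  next
    case 2
    then have "a * (1 + b / a) \<in> max_ideal V" using assms by (intro max_ideal_mult V_add) auto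
    then show ?thesis using False by (simp add: field_simps)
  qed
qed (use assms in auto)

lemma max_ideal_diff: "a \<in> max_ideal V \<Longrightarrow> b \<in> max_ideal V \<Longrightarrow> a - b \<in> max_ideal V"
  using max_ideal_add[of a "- b"] max_ideal_uminus by simp

lemma unit_mult: "a \<in> V - max_ideal V \<Longrightarrow> b \<in> V - max_ideal V \<Longrightarrow> a * b \<in> V - max_ideal V"
  unfolding unit_iff by (auto intro: V_mult)

lemma unit_inverse: "a \<in> V - max_ideal V \<Longrightarrow> inverse a \<in> V - max_ideal V"
  unfolding unit_iff by auto

lemma unit_divide: "a \<in> V - max_ideal V \<Longrightarrow> b \<in> V - max_ideal V \<Longrightarrow> a / b \<in> V - max_ideal V"
  using unit_mult[OF _ unit_inverse] by (simp add: divide_inverse)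

lemma unit_power: "a \<in> V - max_ideal V \<Longrightarrow> a ^ n \<in> V - max_ideal V"
proof (induction n)
  case (Suc n)
  show ?case unfolding power_Suc by (rule unit_mult[OF Suc(2) Suc(1)[OF Suc(2)]])
qed simp

lemma max_ideal_prime: "a \<in> V \<Longrightarrow> b \<in> V \<Longrightarrow> a * b \<in> max_ideal V \<Longrightarrow> a \<in> max_ideal V \<or> b \<in> max_ideal V"
  using unit_mult by blast

lemma max_ideal_power: "a \<in> V \<Longrightarrow> a ^ n \<in> max_ideal V \<Longrightarrow> a \<in> max_ideal V"
  using unit_power by blast

lemma const_unit: "c \<in> K \<Longrightarrow> c \<noteq> 0 \<Longrightarrow> c \<in> V - max_ideal V"
  unfolding unit_iff using K_sub_V subfieldD(5)[OF subfield_K] by auto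

lemma not_in_V: "z \<in> F \<Longrightarrow> z \<notin> V \<Longrightarrow> inverse z \<in> max_ideal V"
  using V_cases[of z] by (auto simp: max_ideal_def)

lemma V_divide: "a \<in> V \<Longrightarrow> b \<in> V - max_ideal V \<Longrightarrow> a / b \<in> V"
  using V_mult unit_iff by (auto simp: divide_inverse)

text \<open>The ultrametric strengthening: a sum of a unit and a non-unit is a unit.\<close>

lemma unit_add_max_ideal: "u \<in> V - max_ideal V \<Longrightarrow> a \<in> max_ideal V \<Longrightarrow> u + a \<in> V - max_ideal V"
  using max_ideal_diff[of "u + a" a] V_add[of u a] max_ideal_sub by auto

text \<open>
  An element whose powers, up to units, exhaust \<open>F\<close>. In contrast to \<open>uniformizer\<close> this makes the
  place discrete, so that \<open>ord_at\<close> is defined at every nonzero element.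
\<close>

definition local_param :: "'a \<Rightarrow> bool" where
  "local_param t \<longleftrightarrow> t \<noteq> 0 \<and> t \<in> max_ideal V \<and>
     (\<forall>z\<in>F - {0}. \<exists>n::int. \<exists>u\<in>V - max_ideal V. z = t powi n * u)"

lemma local_param_unique:
  assumes "t \<noteq> 0" "t \<in> max_ideal V" "u \<in> V - max_ideal V" "u' \<in> V - max_ideal V"
    and "t powi n * u = t powi n' * u'"
  shows "n = n'"
proof -
  have aux: False if "u \<in> V - max_ideal V" "u' \<in> V - max_ideal V" "n < n'"
    "t powi n * u = t powi n' * u'" for u u' n n'
  proof -
    have "t powi (n' - n) * u' = t powi n' * u' / t powi n" using assms(1) by (simp add: power_int_diff)
    also have "\<dots> = u" using assms(1) that(4)[symmetric] by simp
    finally have u: "u = t powi (n' - n) * u'" ..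
    have "t powi (n' - n) = t * t ^ nat (n' - n - 1)"
      using that(3) power_Suc[of t "nat (n' - n - 1)"]
      by (simp add: power_int_def nat_diff_distrib Suc_nat_eq_nat_zadd1)
    then have "u \<in> max_ideal V" unfolding u mult.assoc
      using that(2) max_ideal_mult(1)[OF assms(2) V_mult[OF V_power[OF max_ideal_sub[OF assms(2)]]]]
      by (simp add: mult.assoc)
    with that(1) show False by simp
  qed
  show ?thesis using aux[OF assms(3,4) _ assms(5)] aux[OF assms(4,3) _ assms(5)[symmetric]] by fastforce
qed

lemma local_param_powi_mem:
  assumes "t \<noteq> 0" "t \<in> max_ideal V" "u \<in> V - max_ideal V"
  shows "t powi n * u \<in> V \<longleftrightarrow> 0 \<le> n" "t powi n * u \<in> max_ideal V \<longleftrightarrow> 0 < n"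
proof -
  have pos: "t powi n * u \<in> max_ideal V" if "0 < n" "u \<in> V" for n u
  proof -
    have "t powi n = t * t ^ nat (n - 1)"
      using that(1) power_Suc[of t "nat (n - 1)"]
      by (simp add: power_int_def nat_diff_distrib Suc_nat_eq_nat_zadd1)
    then show ?thesis using that(2) max_ideal_mult(1)[OF assms(2) V_mult[OF V_power[OF max_ideal_sub[OF assms(2)]]]]
      by (simp add: mult.assoc)
  qed
  have neg: "t powi n * u \<notin> V" if "n < 0"
  proof
    assume *: "t powi n * u \<in> V"
    have "t powi (- n) * (t powi n * u) \<in> max_ideal V" using pos[of "- n"] * that by simp
    then show False using assms(1,3) by (simp add: power_int_minus mult.assoc[symmetric])
  qed
  show "t powi n * u \<in> V \<longleftrightarrow> 0 \<le> n"
    using pos[of n u] neg assms(3) max_ideal_sub by (cases n "0::int" rule: linorder_cases) auto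
  show "t powi n * u \<in> max_ideal V \<longleftrightarrow> 0 < n"
    using pos[of n u] neg assms(3) max_ideal_sub by (cases n "0::int" rule: linorder_cases) auto
qed

lemma local_param_uniformizer:
  assumes "local_param t" shows "uniformizer V t"
proof -
  have t: "t \<noteq> 0" "t \<in> max_ideal V" using assms by (auto simp: local_param_def)
  have "z \<in> (*) t ` V" if z: "z \<in> max_ideal V" for z
  proof (cases "z = 0")
    case False
    then obtain n u where nu: "u \<in> V - max_ideal V" "z = t powi n * u"
      using assms z max_ideal_sub V_sub_F unfolding local_param_def by blast
    then have "n > 0" using z local_param_powi_mem(2)[OF t nu(1)] by auto
    then have "z = t * (t powi (n - 1) * u)" using nu t by (simp add: power_int_diff)
    moreover have "t powi (n - 1) * u \<in> V" using local_param_powi_mem(1)[OF t nu(1)] \<open>n > 0\<close> by auto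
    ultimately show ?thesis by auto
  qed (auto intro!: image_eqI[of _ _ 0])
  then show ?thesis unfolding uniformizer_def using max_ideal_mult(1)[OF t(2)] by auto
qed

lemma uniformizer_mem: "uniformizer V t \<Longrightarrow> t \<in> max_ideal V"
  unfolding uniformizer_def by (metis V_1 image_eqI mult.right_neutral)

text \<open>
  Any choice of uniformizer gives the same valuation, since two of them differ by a unit.
\<close>

lemma uniformizers_associated:
  assumes "local_param t" "uniformizer V t'"
  obtains u where "u \<in> V - max_ideal V" "t' = t * u"
proof -
  have t: "t \<noteq> 0" "t \<in> max_ideal V" using assms by (auto simp: local_param_def)
  obtain a where a: "a \<in> V" "t = t' * a" using t(2) assms(2) by (auto simp: uniformizer_def)
  obtain b where b: "b \<in> V" "t' = t * b"
    using uniformizer_mem[OF assms(2)] local_param_uniformizer[OF assms(1)] by (auto simp: uniformizer_def)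
  have "a * b = 1" using a(2) b(2) t(1) by (metis mult.assoc mult.commute mult_cancel_left1)
  then have "b \<in> V - max_ideal V" unfolding unit_iff using a b inverse_unique[of b a]
    by (auto simp: mult.commute)
  then show thesis using that b by blast
qed

lemma ord_at_eq:
  assumes "local_param t" "u \<in> V - max_ideal V"
  shows "ord_at V (t powi n * u) = n"
  unfolding ord_at_def
proof (rule the_equality)
  have t: "t \<noteq> 0" "t \<in> max_ideal V" using assms by (auto simp: local_param_def)
  show "\<exists>t'. uniformizer V t' \<and> (\<exists>u'\<in>V - max_ideal V. t powi n * u = t' powi n * u')"
    using assms local_param_uniformizer by blast
  fix n' assume "\<exists>t'. uniformizer V t' \<and> (\<exists>u'\<in>V - max_ideal V. t powi n * u = t' powi n' * u')"
  then obtain t' u' where t': "uniformizer V t'" "u' \<in> V - max_ideal V" "t powi n * u = t' powi n' * u'"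
    by blast
  obtain w where w: "w \<in> V - max_ideal V" "t' = t * w" using uniformizers_associated[OF assms(1) t'(1)] .
  have "w powi n' \<in> V - max_ideal V"
    using unit_power[OF w(1)] unit_power[OF unit_inverse[OF w(1)]] by (simp add: power_int_def)
  then have "w powi n' * u' \<in> V - max_ideal V" using t'(2) unit_mult by blast
  moreover have "t powi n * u = t powi n' * (w powi n' * u')"
    using t'(3) w(2) by (simp add: power_int_mult_distrib mult.assoc)
  ultimately show "n' = n" using local_param_unique[OF t assms(2)] by metis
qed

end

locale discrete_place = place +
  assumes ex_local_param: "\<exists>t. local_param t"
begin

lemma uniformizer_local_param:
  assumes "uniformizer V t" shows "local_param t"
proof -
  obtain s where s: "local_param s" using ex_local_param ..
  obtain w where w: "w \<in> V - max_ideal V" "t = s * w" using uniformizers_associated[OF s assms] .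
  have "\<exists>n::int. \<exists>u\<in>V - max_ideal V. z = t powi n * u" if z: "z \<in> F - {0}" for z
  proof -
    obtain n u where u: "u \<in> V - max_ideal V" "z = s powi n * u" using s z unfolding local_param_def by blast
    have "inverse w powi n \<in> V - max_ideal V"
      using unit_power[OF w(1)] unit_power[OF unit_inverse[OF w(1)]] by (simp add: power_int_def)
    then have "inverse w powi n * u \<in> V - max_ideal V" using u unit_mult by blast
    moreover have "z = t powi n * (inverse w powi n * u)"
      using w u unit_iff[of w] by (simp add: power_int_mult_distrib power_int_inverse)
    ultimately show ?thesis by blast
  qed
  moreover have "t \<noteq> 0" using w s unit_iff[of w] by (auto simp: local_param_def)
  ultimately show ?thesis using uniformizer_mem[OF assms] by (auto simp: local_param_def)
qed

lemma uniformizer_obtain: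
  obtains t where "uniformizer V t" "local_param t" "t \<noteq> 0" "t \<in> max_ideal V" "t \<in> V" "t \<in> F"
  using ex_local_param local_param_uniformizer max_ideal_sub V_sub_F unfolding local_param_def by metis

lemma ord_decomp:
  assumes "z \<in> F" "z \<noteq> 0" "local_param t"
  obtains u where "u \<in> V - max_ideal V" "z = t powi (ord_at V z) * u"
  using assms ord_at_eq[OF assms(3)] unfolding local_param_def by (metis DiffI insertE empty_iff)

lemma ord_uniformizer: "uniformizer V t \<Longrightarrow> ord_at V t = 1"
  using ord_at_eq[OF uniformizer_local_param, of t 1 1] by simp

lemma ord_mult:
  assumes "z \<in> F" "z \<noteq> 0" "w \<in> F" "w \<noteq> 0"
  shows "ord_at V (z * w) = ord_at V z + ord_at V w"
proof -
  obtain t where t: "local_param t" using ex_local_param ..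
  then have t0: "t \<noteq> 0" by (auto simp: local_param_def)
  obtain u where u: "u \<in> V - max_ideal V" "z = t powi (ord_at V z) * u" using ord_decomp[OF assms(1,2) t] .
  obtain v where v: "v \<in> V - max_ideal V" "w = t powi (ord_at V w) * v" using ord_decomp[OF assms(3,4) t] .
  have "z * w = t powi (ord_at V z + ord_at V w) * (u * v)"
    using t0 by (subst u(2), subst v(2)) (simp add: power_int_add)
  then show ?thesis using ord_at_eq[OF t unit_mult[OF u(1) v(1)]] by simp
qed

lemma mem_iff_ord:
  assumes "z \<in> F" "z \<noteq> 0"
  shows "z \<in> V \<longleftrightarrow> 0 \<le> ord_at V z" "z \<in> max_ideal V \<longleftrightarrow> 0 < ord_at V z"
proof -
  obtain t where t: "local_param t" using ex_local_param ..
  then have t0: "t \<noteq> 0" "t \<in> max_ideal V" by (auto simp: local_param_def)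
  obtain u where u: "u \<in> V - max_ideal V" "z = t powi (ord_at V z) * u" using ord_decomp[OF assms t] .
  show "z \<in> V \<longleftrightarrow> 0 \<le> ord_at V z" "z \<in> max_ideal V \<longleftrightarrow> 0 < ord_at V z"
    using local_param_powi_mem[OF t0 u(1), of "ord_at V z"] u(2) by auto
qed

lemma ord_unit: "u \<in> V - max_ideal V \<Longrightarrow> ord_at V u = 0"
  using ex_local_param ord_at_eq[of _ u 0] by auto

lemma ord_1 [simp]: "ord_at V 1 = 0"
  by (rule ord_unit) simp

lemma ord_inverse:
  assumes "z \<in> F" "z \<noteq> 0" shows "ord_at V (inverse z) = - ord_at V z"
  using ord_mult[OF assms, of "inverse z"] assms subfieldD(5)[OF subfield_F] by auto

lemma ord_divide:
  assumes "z \<in> F" "z \<noteq> 0" "w \<in> F" "w \<noteq> 0"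
  shows "ord_at V (z / w) = ord_at V z - ord_at V w"
  using ord_mult[OF assms(1,2), of "inverse w"] assms ord_inverse subfieldD(5)[OF subfield_F]
  by (auto simp: divide_inverse)

lemma ord_power: "z \<in> F \<Longrightarrow> z \<noteq> 0 \<Longrightarrow> ord_at V (z ^ n) = int n * ord_at V z"
  by (induction n) (auto simp: ord_mult subfield_closed[OF subfield_F] algebra_simps)

lemma ord_powi: "z \<in> F \<Longrightarrow> z \<noteq> 0 \<Longrightarrow> ord_at V (z powi n) = n * ord_at V z"
  by (auto simp: power_int_def ord_power ord_inverse subfieldD(5)[OF subfield_F])

lemma ord_prod:
  "(\<And>i. i \<in> I \<Longrightarrow> h i \<in> F \<and> h i \<noteq> 0) \<Longrightarrow> ord_at V (prod h I) = (\<Sum>i\<in>I. ord_at V (h i)) \<and> prod h I \<in> F"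
  by (induction I rule: infinite_finite_induct) (auto simp: ord_mult subfieldD[OF subfield_F])

lemma ord_ge_iff:
  assumes "z \<in> F" "z \<noteq> 0" "w \<in> F" "w \<noteq> 0"
  shows "ord_at V w \<le> ord_at V z \<longleftrightarrow> z / w \<in> V"
  using mem_iff_ord(1)[of "z / w"] ord_divide[OF assms] assms subfield_closed(3)[OF subfield_F] by auto

lemma ord_add:
  assumes "z \<in> F" "z \<noteq> 0" "w \<in> F" "w \<noteq> 0" "z + w \<noteq> 0" "n \<le> ord_at V z" "n \<le> ord_at V w"
  shows "n \<le> ord_at V (z + w)"
proof -
  obtain t where t: "uniformizer V t" "t \<noteq> 0" "t \<in> F" using uniformizer_obtain by metis
  define s where "s = t powi n"
  have s: "s \<in> F" "s \<noteq> 0" "ord_at V s = n"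
    using t by (auto simp: s_def ord_powi ord_uniformizer subfield_closed[OF subfield_F])
  have "z / s + w / s \<in> V" using ord_ge_iff[OF _ _ s(1,2)] assms s(3) by (intro V_add) auto
  then have "(z + w) / s \<in> V" by (simp add: add_divide_distrib)
  then show ?thesis
    using ord_ge_iff[OF _ assms(5) s(1,2)] s(3) assms(1,3) subfield_closed(2)[OF subfield_F] by auto
qed

text \<open>
  An element outside \<open>V\<close> has negative order, so a ring that contains it and \<open>V\<close> contains the inverse
  of a local parameter, and therefore all of \<open>F\<close>.
\<close>

lemma place_maximal:
  assumes "V \<subseteq> W" "W \<in> places K F" shows "W = V"
proof (rule ccontr)
  interpret W: place K F W using assms(2) subfield_F subfield_K by unfold_locales
  assume "W \<noteq> V"
  then obtain z where z: "z \<in> W" "z \<notin> V" using assms(1) by blast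
  obtain t where t: "local_param t" using ex_local_param ..
  then have t0: "t \<noteq> 0" "t \<in> V" using max_ideal_sub by (auto simp: local_param_def)
  have zF: "z \<in> F" "z \<noteq> 0" using z W.V_sub_F by (auto intro: ccontr)
  obtain u where u: "u \<in> V - max_ideal V" "z = t powi (ord_at V z) * u" using ord_decomp[OF zF t] .
  have neg: "ord_at V z < 0" using z(2) mem_iff_ord(1)[OF zF] by auto
  define n where "n = nat (- ord_at V z - 1)"
  have "inverse t = z * (t ^ n * inverse u)"
  proof -
    have "t powi (ord_at V z) * t ^ n = t powi (- 1)"
      using neg t0(1) by (simp add: n_def power_int_add[symmetric] power_int_of_nat[symmetric] del: power_int_of_nat)
    moreover have "u * inverse u = 1" using u(1) by (auto simp: max_ideal_def)
    ultimately have "z * (t ^ n * inverse u) = t powi (- 1)"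
      by (subst u(2)) (metis mult.assoc mult.commute mult.right_neutral)
    then show ?thesis using t0(1) by (simp add: power_int_minus)
  qed
  moreover have "t ^ n * inverse u \<in> V" using t0 u(1) unit_iff by (auto intro!: V_mult V_power)
  ultimately have ti: "inverse t \<in> W" using z(1) assms(1) W.V_mult by auto
  have "w \<in> W" if w: "w \<in> F" for w
  proof (cases "w = 0")
    case False
    obtain v where v: "v \<in> V - max_ideal V" "w = t powi (ord_at V w) * v" using ord_decomp[OF w False t] .
    have "t powi k \<in> W" for k
      using ti t0 assms(1) by (auto simp: power_int_def intro: W.V_power)
    then show ?thesis using v assms(1) W.V_mult by (metis DiffD1 subsetD)
  qed simp
  then show False using W.V_neq_F W.V_sub_F by blast
qed

end

section \<open>Hyperelliptic function fields of odd degree\<close>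

lemma map_poly_hom_add:
  assumes "\<And>a b. h (a + b) = h a + h b" "h 0 = (0::'b::comm_ring_1)"
  shows "map_poly h (p + q) = map_poly h p + map_poly h (q :: 'c::comm_ring_1 poly)"
  by (rule poly_eqI) (simp add: coeff_map_poly assms)

lemma map_poly_hom_mult:
  assumes "\<And>a b. h (a + b) = h a + h b" "\<And>a b. h (a * b) = h a * h b" "h 0 = (0::'b::comm_ring_1)"
  shows "map_poly h (p * q) = map_poly h p * map_poly h (q :: 'c::comm_ring_1 poly)"
proof -
  have sum: "h (sum k S) = (\<Sum>s\<in>S. h (k s))" for k and S :: "nat set"
    by (induction S rule: infinite_finite_induct) (simp_all add: assms)
  show ?thesis by (rule poly_eqI) (simp add: coeff_map_poly coeff_mult sum assms)
qed

lemma (in field_embedding) subfield_K: "is_subfield (range \<iota>)"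
  unfolding is_subfield_def
proof (intro conjI ballI)
  show "0 \<in> range \<iota>" by (rule range_eqI[of _ _ 0]) simp
  show "1 \<in> range \<iota>" by (rule range_eqI[of _ _ 1]) (simp add: emb_1)
  fix a b assume "a \<in> range \<iota>" "b \<in> range \<iota>"
  then obtain c d where "a = \<iota> c" "b = \<iota> d" by auto
  then show "a - b \<in> range \<iota>" "a * b \<in> range \<iota>" by (auto simp: emb_diff[symmetric] emb_mult[symmetric])
next
  fix a assume "a \<in> range \<iota>"
  then obtain c where "a = \<iota> c" by auto
  then show "inverse a \<in> range \<iota>" by (auto simp: emb_inverse[symmetric])
qed

text \<open>
  The function field \<open>K(x, y)\<close>, \<open>y\<^sup>2 = f(x)\<close>, inside an ambient field; \<open>\<iota>\<close> embeds \<open>K\<close>.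
\<close>

locale hyperelliptic_field = field_embedding \<iota>
  for \<iota> :: "'k::field \<Rightarrow> 'a::field_char_0" +
  fixes x y :: 'a and f :: "'k poly" and g :: nat
  assumes transcendental_x: "poly (map_poly \<iota> p) x = 0 \<Longrightarrow> p = 0"
    and y_square: "y ^ 2 = poly (map_poly \<iota> f) x"
    and degree_f: "degree f = 2 * g + 1"
begin

definition pe :: "'k poly \<Rightarrow> 'a" where "pe p = poly (map_poly \<iota> p) x"

lemma pe_0 [simp]: "pe 0 = 0" and pe_1 [simp]: "pe 1 = 1"
  by (simp_all add: pe_def one_pCons map_poly_pCons emb_1)

lemma pe_pCons: "pe (pCons c p) = \<iota> c + x * pe p"
  by (simp add: pe_def map_poly_pCons)

lemma pe_const [simp]: "pe [:c:] = \<iota> c"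
  by (simp add: pe_pCons)

lemma pe_add: "pe (p + q) = pe p + pe q"
  by (simp add: pe_def map_poly_hom_add emb_add)

lemma pe_mult: "pe (p * q) = pe p * pe q"
  by (simp add: pe_def map_poly_hom_mult emb_add emb_mult)

lemma pe_uminus: "pe (- p) = - pe p"
  using pe_add[of p "- p"] by (simp add: eq_neg_iff_add_eq_0 add.commute)

lemma pe_diff: "pe (p - q) = pe p - pe q"
  using pe_add[of p "- q"] by (simp add: pe_uminus)

lemma pe_smult: "pe (smult c p) = \<iota> c * pe p"
  using pe_mult[of "[:c:]" p] by simp

lemma pe_power: "pe (p ^ n) = pe p ^ n"
  by (induction n) (simp_all add: pe_mult)

lemma pe_eq_0_iff [simp]: "pe p = 0 \<longleftrightarrow> p = 0"
  using transcendental_x by (auto simp: pe_def)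

lemma pe_eq_iff [simp]: "pe p = pe q \<longleftrightarrow> p = q"
  using pe_diff[of p q] pe_eq_0_iff[of "p - q"] by auto

lemma f_nonzero: "f \<noteq> 0"
  using degree_f by auto

lemma y_square': "y * y = pe f"
  using y_square by (simp add: pe_def power2_eq_square)

definition el :: "'k poly \<Rightarrow> 'k poly \<Rightarrow> 'a" where "el u v = pe u + pe v * y"

definition nm :: "'k poly \<Rightarrow> 'k poly \<Rightarrow> 'k poly" where "nm u v = u * u - f * (v * v)"

text \<open>
  No cancellation is possible in \<open>u\<^sup>2 - f v\<^sup>2\<close>, because the first term has even and the second term
  has odd degree.
\<close>

lemma nm_degree:
  assumes "u \<noteq> 0 \<or> v \<noteq> 0"
  shows "nm u v \<noteq> 0" "degree (nm u v) \<le> d \<longleftrightarrow> (u = 0 \<or> 2 * degree u \<le> d) \<and> (v = 0 \<or> 2 * g + 1 + 2 * degree v \<le> d)"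
proof -
  have dv: "degree (f * (v * v)) = 2 * g + 1 + 2 * degree v" if "v \<noteq> 0"
    using that f_nonzero by (simp add: degree_mult_eq degree_f)
  have du: "degree (u * u) = 2 * degree u" if "u \<noteq> 0"
    using that by (simp add: degree_mult_eq)
  have main: "nm u v \<noteq> 0 \<and> (degree (nm u v) \<le> d \<longleftrightarrow> (u = 0 \<or> 2 * degree u \<le> d) \<and> (v = 0 \<or> 2 * g + 1 + 2 * degree v \<le> d))"
  proof (cases "u = 0 \<or> v = 0")
    case True
    then show ?thesis using assms dv du f_nonzero by (auto simp: nm_def)
  next
    case False
    then have uv: "u \<noteq> 0" "v \<noteq> 0" by auto
    have ne: "2 * degree u \<noteq> 2 * g + 1 + 2 * degree v" by presburger
    consider "2 * degree u < 2 * g + 1 + 2 * degree v" | "2 * degree u > 2 * g + 1 + 2 * degree v"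
      using ne by linarith
    then show ?thesis
    proof cases
      case 1
      then have "degree (nm u v) = 2 * g + 1 + 2 * degree v"
        unfolding nm_def diff_conv_add_uminus using uv dv du by (subst degree_add_eq_right) auto
      then show ?thesis using uv 1 by (auto intro!: notI)
    next
      case 2
      then have "degree (nm u v) = 2 * degree u"
        unfolding nm_def diff_conv_add_uminus using uv dv du by (subst degree_add_eq_left) auto
      then show ?thesis using uv 2 by (auto intro!: notI)
    qed
  qed
  then show "nm u v \<noteq> 0"
    "degree (nm u v) \<le> d \<longleftrightarrow> (u = 0 \<or> 2 * degree u \<le> d) \<and> (v = 0 \<or> 2 * g + 1 + 2 * degree v \<le> d)" by auto
qed

lemma el_conj: "el u v * el u (- v) = pe (nm u v)"
proof -
  have "el u v * el u (- v) = pe u * pe u - pe v * pe v * (y * y)"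
    by (simp add: el_def pe_uminus algebra_simps)
  then show ?thesis by (simp add: y_square' nm_def pe_diff pe_mult)
qed

lemma el_eq_0_iff [simp]: "el u v = 0 \<longleftrightarrow> u = 0 \<and> v = 0"
proof
  assume "el u v = 0"
  then have "nm u v = 0" using el_conj[of u v] by simp
  then show "u = 0 \<and> v = 0" using nm_degree(1) by blast
qed (simp add: el_def)

lemma el_add: "el u v + el u' v' = el (u + u') (v + v')"
  and el_diff: "el u v - el u' v' = el (u - u') (v - v')"
  by (simp_all add: el_def pe_add pe_diff algebra_simps)

lemma el_mult: "el u v * el u' v' = el (u * u' + f * (v * v')) (u * v' + v * u')"
proof -
  have "el u v * el u' v' = pe u * pe u' + pe v * pe v' * (y * y) + (pe u * pe v' + pe v * pe u') * y"
    by (simp add: el_def algebra_simps)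
  then show ?thesis by (simp add: y_square' el_def pe_add pe_mult)
qed

lemma el_eq_iff [simp]: "el u v = el u' v' \<longleftrightarrow> u = u' \<and> v = v'"
  using el_diff[of u v u' v'] el_eq_0_iff[of "u - u'" "v - v'"] by auto

definition Oring :: "'a set" where "Oring = {el u v | u v. True}"

definition re :: "'a \<Rightarrow> 'k poly" where "re a = (THE u. \<exists>v. a = el u v)"
definition im :: "'a \<Rightarrow> 'k poly" where "im a = (THE v. \<exists>u. a = el u v)"

lemma re_el [simp]: "re (el u v) = u" and im_el [simp]: "im (el u v) = v"
  by (auto simp: re_def im_def)

lemma el_re_im: "a \<in> Oring \<Longrightarrow> el (re a) (im a) = a"
  by (auto simp: Oring_def)

lemma re_0 [simp]: "re 0 = 0" and im_0 [simp]: "im 0 = 0"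
proof -
  have "el 0 0 = 0" by simp
  then show "re 0 = 0" "im 0 = 0" using re_el[of 0 0] im_el[of 0 0] by metis+
qed

lemma re_im_nonzero: "a \<in> Oring \<Longrightarrow> a \<noteq> 0 \<Longrightarrow> re a \<noteq> 0 \<or> im a \<noteq> 0"
  using el_re_im[of a] el_eq_0_iff[of "re a" "im a"] by auto

text \<open>
  For an element of \<open>O\<close> its norm to \<open>K[x]\<close>, whose degree is the pole order at infinity, and its
  conjugate.
\<close>

definition nrm :: "'a \<Rightarrow> 'k poly" where "nrm a = nm (re a) (im a)"
definition dg :: "'a \<Rightarrow> nat" where "dg a = degree (nrm a)"
definition cnj' :: "'a \<Rightarrow> 'a" where "cnj' a = el (re a) (- im a)"

lemma el_in_O [simp]: "el u v \<in> Oring"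
  by (auto simp: Oring_def)

lemma pe_eq_el: "pe u = el u 0" and y_eq_el: "y = el 0 1" and emb_eq_el: "\<iota> c = el [:c:] 0" and pe_X: "pe [:0, 1:] = x"
  by (simp_all add: el_def pe_pCons emb_1)

lemma O_pe [simp]: "pe u \<in> Oring" and O_y [simp]: "y \<in> Oring" and O_emb [simp]: "\<iota> c \<in> Oring"
  using el_in_O pe_eq_el y_eq_el emb_eq_el by metis+

lemma O_x [simp]: "x \<in> Oring" and O_0 [simp]: "0 \<in> Oring" and O_1 [simp]: "1 \<in> Oring"
  using O_pe[of "[:0,1:]"] O_pe[of 0] O_pe[of 1] pe_X by auto

lemma O_add [intro]: "a \<in> Oring \<Longrightarrow> b \<in> Oring \<Longrightarrow> a + b \<in> Oring"
  and O_diff [intro]: "a \<in> Oring \<Longrightarrow> b \<in> Oring \<Longrightarrow> a - b \<in> Oring"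
  and O_mult [intro]: "a \<in> Oring \<Longrightarrow> b \<in> Oring \<Longrightarrow> a * b \<in> Oring"
  using el_add el_diff el_mult by (auto simp: Oring_def)

lemma O_uminus [intro]: "a \<in> Oring \<Longrightarrow> - a \<in> Oring"
  using O_diff[of 0 a] by simp

lemma O_power [intro]: "a \<in> Oring \<Longrightarrow> a ^ n \<in> Oring"
  by (induction n) auto

lemma O_prod: "(\<And>i. i \<in> I \<Longrightarrow> h i \<in> Oring) \<Longrightarrow> prod h I \<in> Oring"
  by (induction I rule: infinite_finite_induct) auto

lemma O_cnj [simp]: "cnj' a \<in> Oring"
  by (simp add: cnj'_def)

lemma mult_cnj: "a \<in> Oring \<Longrightarrow> a * cnj' a = pe (nrm a)"
  using el_conj[of "re a" "im a"] by (simp add: el_re_im cnj'_def nrm_def)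

lemma nrm_eq_0_iff: "a \<in> Oring \<Longrightarrow> nrm a = 0 \<longleftrightarrow> a = 0"
  using nm_degree(1)[of "re a" "im a"] re_im_nonzero[of a] by (cases "a = 0") (auto simp: nrm_def, simp add: nm_def)

lemma nrm_mult: "a \<in> Oring \<Longrightarrow> b \<in> Oring \<Longrightarrow> nrm (a * b) = nrm a * nrm b"
  by (auto simp: Oring_def nrm_def el_mult nm_def algebra_simps)

lemma dg_mult: "a \<in> Oring \<Longrightarrow> b \<in> Oring \<Longrightarrow> a \<noteq> 0 \<Longrightarrow> b \<noteq> 0 \<Longrightarrow> dg (a * b) = dg a + dg b"
  by (simp add: dg_def nrm_mult degree_mult_eq nrm_eq_0_iff)

lemma dg_le_iff:
  assumes "a \<in> Oring" "a \<noteq> 0"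
  shows "dg a \<le> d \<longleftrightarrow> (re a = 0 \<or> 2 * degree (re a) \<le> d) \<and> (im a = 0 \<or> 2 * g + 1 + 2 * degree (im a) \<le> d)"
  unfolding dg_def nrm_def by (rule nm_degree(2)[OF re_im_nonzero[OF assms]])

lemma dg_pe: "u \<noteq> 0 \<Longrightarrow> dg (pe u) = 2 * degree u"
  by (simp add: dg_def nrm_def pe_eq_el nm_def degree_mult_eq)

lemma dg_y: "dg y = 2 * g + 1"
proof -
  have "dg (el 0 1) = 2 * g + 1" by (simp add: dg_def nrm_def nm_def degree_f)
  then show ?thesis by (simp only: y_eq_el[symmetric])
qed

lemma dg_emb: "c \<noteq> 0 \<Longrightarrow> dg (\<iota> c) = 0"
  using dg_pe[of "[:c:]"] by simp

lemma dg_1 [simp]: "dg 1 = 0"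
  using dg_pe[of 1] by simp

lemma re_add: "a \<in> Oring \<Longrightarrow> b \<in> Oring \<Longrightarrow> re (a + b) = re a + re b \<and> im (a + b) = im a + im b"
  by (auto simp: Oring_def el_add)

lemma re_diff: "a \<in> Oring \<Longrightarrow> b \<in> Oring \<Longrightarrow> re (a - b) = re a - re b \<and> im (a - b) = im a - im b"
  by (auto simp: Oring_def el_diff)

lemma re_scale: "a \<in> Oring \<Longrightarrow> re (\<iota> c * a) = smult c (re a) \<and> im (\<iota> c * a) = smult c (im a)"
  by (auto simp: Oring_def emb_eq_el el_mult)

lemma dg_le_iff':
  assumes "a \<in> Oring"
  shows "(a = 0 \<or> dg a \<le> d) \<longleftrightarrow> (re a = 0 \<or> 2 * degree (re a) \<le> d) \<and> (im a = 0 \<or> 2 * g + 1 + 2 * degree (im a) \<le> d)"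
  using dg_le_iff[OF assms] by (cases "a = 0") auto

lemma dg_add_le:
  assumes "a \<in> Oring" "b \<in> Oring" "a = 0 \<or> dg a \<le> d" "b = 0 \<or> dg b \<le> d"
  shows "a + b = 0 \<or> dg (a + b) \<le> d"
proof -
  have sum: "p + q = 0 \<or> m + 2 * degree (p + q) \<le> d"
    if "p = 0 \<or> m + 2 * degree p \<le> d" "q = 0 \<or> m + 2 * degree q \<le> d" for p q :: "'k poly" and m
    using that degree_add_le_max[of p q] by (cases "p = 0"; cases "q = 0") (auto simp: max_def split: if_splits)
  have "re (a + b) = re a + re b" "im (a + b) = im a + im b" using re_add assms by auto
  then show ?thesis
    using assms(3,4) sum[of "re a" 0 "re b"] sum[of "im a" "2 * g + 1" "im b"]
    unfolding dg_le_iff'[OF assms(1)] dg_le_iff'[OF assms(2)] dg_le_iff'[OF O_add[OF assms(1,2)]] by auto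
qed

lemma dg_uminus:
  assumes "a \<in> Oring" shows "dg (- a) = dg a"
proof -
  obtain u v where uv: "a = el u v" using assms by (auto simp: Oring_def)
  have "- a = el (- u) (- v)" unfolding uv by (simp add: el_def pe_uminus)
  then show ?thesis unfolding uv by (simp add: dg_def nrm_def nm_def)
qed

lemma dg_diff_le:
  assumes "a \<in> Oring" "b \<in> Oring" "a = 0 \<or> dg a \<le> d" "b = 0 \<or> dg b \<le> d"
  shows "a - b = 0 \<or> dg (a - b) \<le> d"
  using dg_add_le[of a "- b" d] assms dg_uminus by auto

lemma degree_less_cancel: "degree p \<le> d \<Longrightarrow> coeff p d = 0 \<Longrightarrow> p \<noteq> 0 \<Longrightarrow> degree p < d"
  by (metis le_neq_implies_less leading_coeff_neq_0)

text \<open>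
  The parity of \<open>dg\<close> tells whether the leading term comes from \<open>K[x]\<close> or from \<open>K[x] y\<close>, so equal pole
  orders mean proportional leading terms.
\<close>

lemma lead_cancel:
  assumes "a \<in> Oring" "b \<in> Oring" "a \<noteq> 0" "b \<noteq> 0" "dg a = dg b"
  obtains c where "a - \<iota> c * b = 0 \<or> dg (a - \<iota> c * b) < dg b"
proof -
  define d where "d = dg b"
  have da: "(re a = 0 \<or> 2 * degree (re a) \<le> d) \<and> (im a = 0 \<or> 2 * g + 1 + 2 * degree (im a) \<le> d)"
    using dg_le_iff[of a d] assms d_def by auto
  have db: "(re b = 0 \<or> 2 * degree (re b) \<le> d) \<and> (im b = 0 \<or> 2 * g + 1 + 2 * degree (im b) \<le> d)"
    using dg_le_iff[of b d] assms d_def by auto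
  have sharp: "\<not> ((re b = 0 \<or> 2 * degree (re b) \<le> d - 1) \<and> (im b = 0 \<or> 2 * g + 1 + 2 * degree (im b) \<le> d - 1)) \<or> d = 0"
    using dg_le_iff[of b "d - 1"] assms d_def by auto
  have goal: "a - \<iota> c * b = 0 \<or> dg (a - \<iota> c * b) < dg b"
    if "re a - smult c (re b) = 0 \<or> 2 * degree (re a - smult c (re b)) < d"
      "im a - smult c (im b) = 0 \<or> 2 * g + 1 + 2 * degree (im a - smult c (im b)) < d" for c
  proof (cases "a - \<iota> c * b = 0")
    case False
    have O: "\<iota> c * b \<in> Oring" using assms by auto
    have ri: "re (a - \<iota> c * b) = re a - smult c (re b)" "im (a - \<iota> c * b) = im a - smult c (im b)"
      using re_diff[OF assms(1) O] re_scale[OF assms(2)] by auto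
    have aO: "a - \<iota> c * b \<in> Oring" using O assms by auto
    have "re (a - \<iota> c * b) \<noteq> 0 \<or> im (a - \<iota> c * b) \<noteq> 0" by (rule re_im_nonzero[OF aO False])
    then have "d \<noteq> 0" using that ri by auto
    then have "dg (a - \<iota> c * b) \<le> d - 1" unfolding dg_le_iff[OF aO False] using that ri by auto
    then show ?thesis using \<open>d \<noteq> 0\<close> d_def by auto
  qed auto
  have bound: "p - smult c q = 0 \<or> m + 2 * degree (p - smult c q) \<le> d"
    if "p = 0 \<or> m + 2 * degree p \<le> d" "q = 0 \<or> m + 2 * degree q \<le> d" for p q :: "'k poly" and m c
    using that degree_diff_le_max[of p "smult c q"] degree_smult_le[of c q]
    by (cases "p = 0"; cases "q = 0") (auto simp: max_def split: if_splits)
  have strict: "p - smult c q = 0 \<or> m + 2 * degree (p - smult c q) < d"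
    if "p = 0 \<or> m + 2 * degree p \<le> d" "q \<noteq> 0" "m + 2 * degree q = d"
      "c = coeff p (degree q) / coeff q (degree q)" for p q :: "'k poly" and m c
  proof -
    have "coeff (p - smult c q) (degree q) = 0" using that by simp
    moreover have "degree (p - smult c q) \<le> degree q"
      using bound[of p m q c] that by (cases "p - smult c q = 0") auto
    ultimately have "p - smult c q = 0 \<or> degree (p - smult c q) < degree q"
      using degree_less_cancel by blast
    then show ?thesis using that(3) by linarith
  qed
  show thesis
  proof (cases "even d")
    case True
    have reb: "re b \<noteq> 0 \<and> 2 * degree (re b) = d"
    proof (cases "d = 0")
      case True
      then have "im b = 0" using db by auto
      then have "re b \<noteq> 0" using re_im_nonzero[OF assms(2,4)] by auto
      then show ?thesis using True db by auto
    next
      case False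
      have "im b = 0 \<or> 2 * g + 1 + 2 * degree (im b) \<le> d - 1"
      proof -
        have "2 * g + 1 + 2 * degree (im b) \<noteq> d" using \<open>even d\<close> by presburger
        then show ?thesis using db by auto
      qed
      then have "\<not> (re b = 0 \<or> 2 * degree (re b) \<le> d - 1)" using sharp False by blast
      then show ?thesis using db by auto
    qed
    define c where "c = coeff (re a) (degree (re b)) / coeff (re b) (degree (re b))"
    have 1: "re a - smult c (re b) = 0 \<or> 2 * degree (re a - smult c (re b)) < d"
      using strict[of "re a" 0 "re b" c] reb da c_def by auto
    have 2: "im a - smult c (im b) = 0 \<or> 2 * g + 1 + 2 * degree (im a - smult c (im b)) \<le> d"
      using bound da db by blast
    have "2 * g + 1 + 2 * degree (im a - smult c (im b)) \<noteq> d" using True by presburger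
    with 2 have 3: "im a - smult c (im b) = 0 \<or> 2 * g + 1 + 2 * degree (im a - smult c (im b)) < d"
      using le_neq_implies_less by blast
    show thesis using goal[OF 1 3] that by blast
  next
    case False
    have "re b = 0 \<or> 2 * degree (re b) \<le> d - 1"
    proof -
      have "2 * degree (re b) \<noteq> d" using False by presburger
      then show ?thesis using db by auto
    qed
    moreover have "d \<noteq> 0" using False by (cases "d = 0") auto
    ultimately have "\<not> (im b = 0 \<or> 2 * g + 1 + 2 * degree (im b) \<le> d - 1)" using sharp by blast
    then have imb: "im b \<noteq> 0 \<and> 2 * g + 1 + 2 * degree (im b) = d" using db by auto
    define c where "c = coeff (im a) (degree (im b)) / coeff (im b) (degree (im b))"
    have 1: "im a - smult c (im b) = 0 \<or> 2 * g + 1 + 2 * degree (im a - smult c (im b)) < d"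
      using strict[of "im a" "2 * g + 1" "im b" c] imb da c_def by auto
    have 2: "re a - smult c (re b) = 0 \<or> 2 * degree (re a - smult c (re b)) \<le> d"
      using bound[of "re a" 0 "re b" c] da db by auto
    have "2 * degree (re a - smult c (re b)) \<noteq> d" using False by presburger
    with 2 have 3: "re a - smult c (re b) = 0 \<or> 2 * degree (re a - smult c (re b)) < d"
      using le_neq_implies_less by blast
    show thesis using goal[OF 3 1] that by blast
  qed
qed

definition FF :: "'a set" where "FF = {a / pe w | a w. a \<in> Oring \<and> w \<noteq> 0}"

lemma FF_I: assumes "a \<in> Oring" "b \<in> Oring" shows "a / b \<in> FF"
proof (cases "b = 0")
  case False
  have "a / b = a * cnj' b / pe (nrm b)" using mult_cnj[OF assms(2)] False nrm_eq_0_iff[OF assms(2)]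
    by (metis mult_divide_mult_cancel_right mult_eq_0_iff pe_eq_0_iff)
  moreover have "a * cnj' b \<in> Oring" using assms by auto
  ultimately show ?thesis using False nrm_eq_0_iff[OF assms(2)] unfolding FF_def by blast
next
  case True
  then have "a / b = 0 / pe 1" by simp
  then show ?thesis unfolding FF_def using O_0 one_neq_zero by blast
qed

lemma FF_cases:
  assumes "z \<in> FF" obtains a b where "a \<in> Oring" "b \<in> Oring" "b \<noteq> 0" "z = a / b"
  using assms O_pe pe_eq_0_iff unfolding FF_def by blast

lemma O_FF: "a \<in> Oring \<Longrightarrow> a \<in> FF"
  using FF_I[of a 1] by simp

lemma subfield_FF: "is_subfield FF"
  unfolding is_subfield_def
proof (intro conjI ballI)
  fix a b assume "a \<in> FF" "b \<in> FF"
  then obtain p q r s where a: "p \<in> Oring" "q \<in> Oring" "q \<noteq> 0" "a = p / q"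
    and b: "r \<in> Oring" "s \<in> Oring" "s \<noteq> 0" "b = r / s" using FF_cases by metis
  have "a - b = (p * s - r * q) / (q * s)" using a b by (simp add: diff_frac_eq)
  then show "a - b \<in> FF" using a b FF_I[of "p * s - r * q" "q * s"] by auto
  have "a * b = (p * r) / (q * s)" using a b by simp
  then show "a * b \<in> FF" using a b FF_I[of "p * r" "q * s"] by auto
next
  fix a assume "a \<in> FF"
  then obtain p q where a: "p \<in> Oring" "q \<in> Oring" "q \<noteq> 0" "a = p / q" using FF_cases by metis
  then show "inverse a \<in> FF" using FF_I[of q p] by simp
qed (use O_FF in auto)

abbreviation "plc \<equiv> places (range \<iota>) FF"

lemma placeI: "V \<in> plc \<Longrightarrow> place (range \<iota>) FF V"
  using subfield_FF subfield_K by unfold_locales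

lemma x_notin_K: "x \<noteq> \<iota> c"
  using pe_eq_iff[of "[:0,1:]" "[:c:]"] pe_X by auto

text \<open>
  The element \<open>y\<close> is integral over \<open>K[x]\<close>, and valuation rings are integrally closed.
\<close>

lemma O_sub_place:
  assumes "V \<in> plc" "x \<in> V" "a \<in> Oring" shows "a \<in> V"
proof -
  interpret place "range \<iota>" FF V by (rule placeI) fact
  have pe: "pe p \<in> V" for p
    by (induction p) (auto simp: pe_pCons intro!: V_add V_mult assms(2) K_sub_V[OF rangeI])
  have "y \<in> V"
  proof (rule ccontr)
    assume "y \<notin> V"
    then have "inverse y \<in> max_ideal V" using not_in_V O_FF by auto
    moreover from this have "y \<noteq> 0" using \<open>y \<notin> V\<close> by auto
    moreover have "pe f * inverse y * inverse y = 1" using y_square'[symmetric] \<open>y \<noteq> 0\<close> by (simp add: field_simps)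
    ultimately show False using max_ideal_mult max_ideal_sub pe[of f] max_ideal_1 by metis
  qed
  then show ?thesis using assms(3) pe by (auto simp: Oring_def el_def intro!: V_add V_mult)
qed

subsection \<open>The place at infinity\<close>

definition Vinf :: "'a set" where
  "Vinf = {a / b | a b. a \<in> Oring \<and> b \<in> Oring \<and> b \<noteq> 0 \<and> (a = 0 \<or> dg a \<le> dg b)}"

text \<open>
  The condition on \<open>a / b\<close> depends only on the quotient, since \<open>dg\<close> is additive.
\<close>

lemma Vinf_iff:
  assumes "a \<in> Oring" "b \<in> Oring" "a \<noteq> 0" "b \<noteq> 0"
  shows "a / b \<in> Vinf \<longleftrightarrow> dg a \<le> dg b"
proof
  assume "a / b \<in> Vinf"
  then obtain p q where pq: "p \<in> Oring" "q \<in> Oring" "q \<noteq> 0" "p = 0 \<or> dg p \<le> dg q" "a / b = p / q"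
    by (auto simp: Vinf_def)
  then have "p \<noteq> 0" using assms by auto
  have "a * q = p * b" using pq assms by (simp add: frac_eq_eq)
  then have "dg a + dg q = dg p + dg b" using dg_mult pq assms \<open>p \<noteq> 0\<close> by metis
  then show "dg a \<le> dg b" using pq \<open>p \<noteq> 0\<close> by auto
qed (use assms in \<open>auto simp: Vinf_def\<close>)

lemma Vinf_place: "Vinf \<in> plc"
  unfolding places_def
proof (intro CollectI conjI ballI psubsetI)
  show "range \<iota> \<subseteq> Vinf"
  proof
    fix z assume "z \<in> range \<iota>"
    then obtain c where "z = \<iota> c" by auto
    then have "z = \<iota> c / 1 \<and> (\<iota> c = 0 \<or> dg (\<iota> c) \<le> dg 1)" using dg_emb[of c] by (cases "c = 0") auto
    then show "z \<in> Vinf" unfolding Vinf_def using O_emb[of c] O_1 one_neq_zero by blast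
  qed
  have x: "x \<noteq> 0" "dg x = 2" using dg_pe[of "[:0,1:]"] pe_X x_notin_K[of 0] by auto
  have "1 / x \<in> Vinf" using Vinf_iff[of 1 x] x by simp
  moreover have "1 / x \<notin> range \<iota>"
  proof
    assume "1 / x \<in> range \<iota>"
    then obtain c where "1 / x = \<iota> c" by auto
    then have "x = \<iota> (inverse c)" using x by (simp only: emb_inverse) (metis inverse_eq_divide inverse_inverse_eq)
    then show False using x_notin_K by blast
  qed
  ultimately show "range \<iota> \<noteq> Vinf" by auto
  show "Vinf \<subseteq> FF" using FF_I by (auto simp: Vinf_def)
  have "x / 1 \<notin> Vinf" using Vinf_iff[of x 1] x by simp
  then show "Vinf \<noteq> FF" using O_FF[of x] by auto
next
  fix a b assume "a \<in> Vinf" "b \<in> Vinf"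
  then obtain p q r s where a: "p \<in> Oring" "q \<in> Oring" "q \<noteq> 0" "a = p / q" "p = 0 \<or> dg p \<le> dg q"
    and b: "r \<in> Oring" "s \<in> Oring" "s \<noteq> 0" "b = r / s" "r = 0 \<or> dg r \<le> dg s" by (auto simp: Vinf_def)
  have mult: "p * r = 0 \<or> dg (p * r) \<le> dg (q * s)"
    if "p \<in> Oring" "q \<in> Oring" "q \<noteq> 0" "p = 0 \<or> dg p \<le> dg q" "r \<in> Oring" "s \<in> Oring" "s \<noteq> 0" "r = 0 \<or> dg r \<le> dg s"
    for p q r s
    using that dg_mult[of p r] dg_mult[of q s] by (cases "p = 0"; cases "r = 0") simp_all
  have "p * s = 0 \<or> dg (p * s) \<le> dg (q * s)" "r * q = 0 \<or> dg (r * q) \<le> dg (q * s)"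
    "p * r = 0 \<or> dg (p * r) \<le> dg (q * s)"
    using mult[of p q s s] mult[of r s q q] mult[of p q r s] a b by (simp_all add: mult.commute)
  then have "p * s - r * q = 0 \<or> dg (p * s - r * q) \<le> dg (q * s)" and 2: "p * r = 0 \<or> dg (p * r) \<le> dg (q * s)"
    using dg_diff_le[of "p * s" "r * q" "dg (q * s)"] a b by auto
  then have "(p * s - r * q) / (q * s) \<in> Vinf" "(p * r) / (q * s) \<in> Vinf"
    using a b O_mult O_diff no_zero_divisors[of q s] unfolding Vinf_def by blast+
  moreover have "a - b = (p * s - r * q) / (q * s)" "a * b = (p * r) / (q * s)"
    using a b by (simp_all add: diff_frac_eq)
  ultimately show "a - b \<in> Vinf" "a * b \<in> Vinf" by simp_all
next
  fix z assume "z \<in> FF"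
  then obtain a b where ab: "a \<in> Oring" "b \<in> Oring" "b \<noteq> 0" "z = a / b" using FF_cases by metis
  show "z \<in> Vinf \<or> inverse z \<in> Vinf"
  proof (cases "a = 0")
    case True
    then have "z = 0 / 1" using ab by simp
    then have "z \<in> Vinf" unfolding Vinf_def using O_0 O_1 one_neq_zero by blast
    then show ?thesis ..
  next
    case False
    then show ?thesis using Vinf_iff[of a b] Vinf_iff[of b a] ab by auto
  qed
qed

lemma x_notin_Vinf: "x \<notin> Vinf"
  using Vinf_iff[of x 1] dg_pe[of "[:0,1:]"] pe_X x_notin_K[of 0] by auto

context
  fixes V assumes V: "V \<in> plc" and xV: "x \<notin> V"
begin

interpretation place "range \<iota>" FF V by (rule placeI[OF V])

text \<open>
  Where \<open>x\<close> has a pole, a polynomial in \<open>x\<close> behaves like its leading term.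
\<close>

lemma pe_at_infinity:
  assumes "p \<noteq> 0" shows "\<exists>u\<in>V - max_ideal V. pe p = x ^ degree p * u"
  using assms
proof (induction p)
  case (pCons c p)
  have x0: "x \<noteq> 0" using x_notin_K[of 0] by simp
  have xi: "inverse x \<in> max_ideal V" using not_in_V xV O_FF by auto
  show ?case
  proof (cases "p = 0")
    case True
    then show ?thesis using pCons const_unit[of "\<iota> c"] by (auto simp: pe_pCons)
  next
    case False
    then obtain u where u: "u \<in> V - max_ideal V" "pe p = x ^ degree p * u" using pCons by blast
    let ?u = "u + \<iota> c * inverse x ^ Suc (degree p)"
    have "\<iota> c * inverse x ^ degree p \<in> V" using max_ideal_sub[OF xi] by (auto intro!: V_mult V_power K_sub_V[OF rangeI])
    then have "\<iota> c * inverse x ^ Suc (degree p) \<in> max_ideal V"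
      using max_ideal_mult(1)[OF xi] by (simp add: mult.left_commute)
    then have "?u \<in> V - max_ideal V" by (rule unit_add_max_ideal[OF u(1)])
    moreover have "pe (pCons c p) = x ^ degree (pCons c p) * ?u"
      using False u(2) x0 by (simp add: pe_pCons power_inverse field_simps)
    ultimately show ?thesis by blast
  qed
qed simp

text \<open>
  A local parameter at infinity: \<open>x\<close> has a pole of order two and \<open>y\<close> one of order \<open>2 g + 1\<close>.
\<close>

definition tinf :: 'a where "tinf = x ^ g / y"

lemma tinf_nz: "tinf \<noteq> 0"
  using x_notin_K[of 0] y_square' f_nonzero by (auto simp: tinf_def)

lemma tinf_mem: "tinf \<in> max_ideal V" and x_tinf: "\<exists>u\<in>V - max_ideal V. x = tinf powi (- 2) * u"
proof -
  have x0: "x \<noteq> 0" and y0: "y \<noteq> 0" using x_notin_K[of 0] y_square' f_nonzero by auto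
  obtain u where u: "u \<in> V - max_ideal V" "pe f = x ^ (2 * g + 1) * u"
    using pe_at_infinity[OF f_nonzero] degree_f by auto
  have u0: "u \<noteq> 0" using u by auto
  have sq: "tinf ^ 2 = inverse x * inverse u"
    using u x0 y0 u0 y_square' by (simp add: tinf_def power2_eq_square field_simps power_mult_distrib power_add mult_2_right)
  have "inverse x \<in> max_ideal V" using not_in_V xV O_FF by auto
  then have sqm: "tinf ^ 2 \<in> max_ideal V" unfolding sq using unit_inverse[OF u(1)] by (intro max_ideal_mult) auto
  have tF: "tinf \<in> FF" using O_FF subfield_closed[OF subfield_FF] by (auto simp: tinf_def)
  show "tinf \<in> max_ideal V"
  proof (cases "tinf \<in> V")
    case True
    then show ?thesis using max_ideal_power[OF True sqm] by simp
  next
    case False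
    then have "inverse tinf \<in> V" using not_in_V[OF tF] max_ideal_sub by auto
    then have "tinf ^ 2 * inverse tinf \<in> max_ideal V" using sqm max_ideal_mult by blast
    then show ?thesis using tinf_nz by (simp add: power2_eq_square mult.assoc)
  qed
  have "x = tinf powi (- 2) * inverse u"
    using sq x0 u0 tinf_nz by (simp add: power_int_minus power_int_numeral)
  then show "\<exists>u\<in>V - max_ideal V. x = tinf powi (- 2) * u" using unit_inverse[OF u(1)] by blast
qed

lemma pow2: "(tinf powi (- 2)) ^ n = tinf powi (- int (2 * n))"
  using power_int_mult[of tinf "- 2" "int n"] by simp

lemma pe_tinf:
  assumes "p \<noteq> 0" shows "\<exists>u\<in>V - max_ideal V. pe p = tinf powi (- int (2 * degree p)) * u"
proof -
  obtain u where u: "u \<in> V - max_ideal V" "pe p = x ^ degree p * u" using pe_at_infinity[OF assms] by blast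
  obtain w where w: "w \<in> V - max_ideal V" "x = tinf powi (- 2) * w" using x_tinf by blast
  have "pe p = tinf powi (- int (2 * degree p)) * (w ^ degree p * u)"
    by (subst u(2), subst w(2)) (simp add: power_mult_distrib pow2 mult.assoc)
  moreover have "w ^ degree p * u \<in> V - max_ideal V" using unit_mult[OF unit_power[OF w(1)] u(1)] .
  ultimately show ?thesis by blast
qed

lemma O_tinf:
  assumes "a \<in> Oring" "a \<noteq> 0" shows "\<exists>u\<in>V - max_ideal V. a = tinf powi (- int (dg a)) * u"
proof -
  obtain U W where UW: "U = re a" "W = im a" by simp
  have a: "a = pe U + pe W * y" using el_re_im[OF assms(1)] unfolding UW by (simp add: el_def)
  have y0: "y \<noteq> 0" using y_square' f_nonzero by auto
  obtain w where w: "w \<in> V - max_ideal V" "x = tinf powi (- 2) * w" using x_tinf by blast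
  have "y = x ^ g / tinf" using y0 x_notin_K[of 0] by (simp add: tinf_def)
  also have "\<dots> = tinf powi (- int (2 * g + 1)) * w ^ g"
  proof -
    have "x ^ g = tinf powi (- int (2 * g)) * w ^ g"
      by (subst w(2)) (simp add: power_mult_distrib pow2)
    moreover have "tinf powi (- int (2 * g)) / tinf = tinf powi (- int (2 * g + 1))"
    proof -
      have e: "- int (2 * g) - 1 = - int (2 * g + 1)" by simp
      show ?thesis using power_int_diff[OF disjI1[OF tinf_nz], of "- int (2 * g)" 1] unfolding e by simp
    qed
    ultimately show ?thesis by (simp only: times_divide_eq_left[symmetric])
  qed
  finally have y: "y = tinf powi (- int (2 * g + 1)) * w ^ g" .
  have im: "\<exists>u\<in>V - max_ideal V. pe W * y = tinf powi (- int (2 * g + 1 + 2 * degree W)) * u"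
    if nz: "W \<noteq> 0"
  proof -
    obtain u where u: "u \<in> V - max_ideal V" "pe W = tinf powi (- int (2 * degree W)) * u"
      using pe_tinf[OF nz] by blast
    have "tinf powi (- int (2 * g + 1 + 2 * degree W)) = tinf powi (- int (2 * degree W)) * tinf powi (- int (2 * g + 1))"
      using tinf_nz by (simp add: power_int_add[symmetric] algebra_simps)
    then have "pe W * y = tinf powi (- int (2 * g + 1 + 2 * degree W)) * (u * w ^ g)"
      by (subst u(2), subst y) (simp add: mult_ac)
    then show ?thesis using unit_mult[OF u(1) unit_power[OF w(1)]] by blast
  qed
  have sum: "\<exists>u\<in>V - max_ideal V. p + q = tinf powi m * u"
    if p: "p = tinf powi m * u" "u \<in> V - max_ideal V" and q: "q = tinf powi n * u'" "u' \<in> V" and "m < n"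
    for p q m n u u'
  proof -
    have "tinf powi (n - m) * 1 \<in> max_ideal V"
      using local_param_powi_mem(2)[OF tinf_nz tinf_mem, of 1] \<open>m < n\<close> by simp
    then have "tinf powi (n - m) * u' \<in> max_ideal V" using q(2) max_ideal_mult(1) by auto
    then have "u + tinf powi (n - m) * u' \<in> V - max_ideal V" using unit_add_max_ideal[OF p(2)] by blast
    moreover have "p + q = tinf powi m * (u + tinf powi (n - m) * u')"
      using p(1) q(1) tinf_nz by (simp add: power_int_diff algebra_simps)
    ultimately show ?thesis by blast
  qed
  have le: "dg a \<le> d \<longleftrightarrow> (U = 0 \<or> 2 * degree U \<le> d) \<and> (W = 0 \<or> 2 * g + 1 + 2 * degree W \<le> d)" for d
    unfolding UW by (rule dg_le_iff[OF assms])
  consider "W = 0" "U \<noteq> 0" | "W \<noteq> 0" "U = 0" | "W \<noteq> 0" "U \<noteq> 0"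
    using assms(2) a by force
  then show ?thesis
  proof cases
    case 1
    then have "dg a = 2 * degree U" using le[of "dg a"] le[of "2 * degree U"] by auto
    then show ?thesis using pe_tinf[of "U"] 1 a by auto
  next
    case 2
    then have "dg a = 2 * g + 1 + 2 * degree W" using le[of "dg a"] le[of "2 * g + 1 + 2 * degree W"] by auto
    then show ?thesis using im 2 a by auto
  next
    case 3
    obtain u where u: "u \<in> V - max_ideal V" "pe U = tinf powi (- int (2 * degree U)) * u"
      using pe_tinf 3 by blast
    obtain v where v: "v \<in> V - max_ideal V" "pe W * y = tinf powi (- int (2 * g + 1 + 2 * degree W)) * v"
      using im 3 by blast
    have ne: "2 * degree U \<noteq> 2 * g + 1 + 2 * degree W" by presburger
    show ?thesis
    proof (cases "2 * degree U < 2 * g + 1 + 2 * degree W")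
      case True
      then have "dg a = 2 * g + 1 + 2 * degree W"
        using le[of "dg a"] le[of "2 * g + 1 + 2 * degree W"] 3 by auto
      then show ?thesis using sum[OF v(2,1) u(2)] u(1) a True by (auto simp: add.commute)
    next
      case False
      then have "dg a = 2 * degree U"
        using le[of "dg a"] le[of "2 * degree U"] 3 ne by auto
      then show ?thesis using sum[OF u(2,1) v(2)] v(1) a False ne by (auto simp: add.commute)
    qed
  qed
qed

lemma local_param_tinf: "local_param tinf"
  unfolding local_param_def
proof (intro conjI tinf_nz tinf_mem ballI)
  fix z assume z: "z \<in> FF - {0}"
  then obtain a b where ab: "a \<in> Oring" "b \<in> Oring" "b \<noteq> 0" "z = a / b" using FF_cases by blast
  then have a0: "a \<noteq> 0" using z by auto
  obtain u where u: "u \<in> V - max_ideal V" "a = tinf powi (- int (dg a)) * u" using O_tinf ab a0 by blast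
  obtain w where w: "w \<in> V - max_ideal V" "b = tinf powi (- int (dg b)) * w" using O_tinf ab by blast
  have "z = tinf powi (- int (dg a) - - int (dg b)) * (u / w)"
    unfolding ab(4) power_int_diff[OF disjI1[OF tinf_nz]] by (subst u(2), subst w(2)) simp
  then show "\<exists>n. \<exists>u\<in>V - max_ideal V. z = tinf powi n * u" using unit_divide[OF u(1) w(1)] by blast
qed

lemma infinite_place_discrete: "discrete_place (range \<iota>) FF V"
  using local_param_tinf by unfold_locales blast

lemma infinite_place_ord:
  assumes "a \<in> Oring" "a \<noteq> 0" shows "ord_at V a = - int (dg a)"
proof -
  obtain u where u: "u \<in> V - max_ideal V" "a = tinf powi (- int (dg a)) * u" using O_tinf[OF assms] by blast
  have "ord_at V (tinf powi (- int (dg a)) * u) = - int (dg a)" by (rule ord_at_eq[OF local_param_tinf u(1)])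
  then show ?thesis using u(2) by simp
qed

text \<open>
  The orders of all elements are known from \<open>dg\<close> once \<open>x\<close> has a pole, so there is only one such place.
\<close>

lemma infinite_place_unique: "V = Vinf"
proof -
  interpret discrete_place "range \<iota>" FF V by (rule infinite_place_discrete)
  have "z \<in> V \<longleftrightarrow> z \<in> Vinf" if z: "z \<in> FF" for z
  proof (cases "z = 0")
    case True
    then have "z = 0 / 1" by simp
    then have "z \<in> Vinf" unfolding Vinf_def using O_0 O_1 one_neq_zero by blast
    then show ?thesis using True by simp
  next
    case False
    obtain a b where ab: "a \<in> Oring" "b \<in> Oring" "b \<noteq> 0" "z = a / b" using FF_cases z by blast
    then have a0: "a \<noteq> 0" using False by auto
    have "ord_at V z = int (dg b) - int (dg a)"
      unfolding ab(4) using ord_divide[of a b] infinite_place_ord[of a] infinite_place_ord[of b] ab(1-3) a0 O_FF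
      by simp
    then show ?thesis using mem_iff_ord(1)[OF z False] Vinf_iff[OF ab(1,2) a0 ab(3)] ab(4) by simp
  qed
  moreover have "Vinf \<subseteq> FF" using Vinf_place unfolding places_def by blast
  ultimately show ?thesis using V_sub_F by blast
qed

end

lemma Vinf_discrete: "discrete_place (range \<iota>) FF Vinf"
  using infinite_place_discrete[OF Vinf_place x_notin_Vinf] .

lemma ord_Vinf: "a \<in> Oring \<Longrightarrow> a \<noteq> 0 \<Longrightarrow> ord_at Vinf a = - int (dg a)"
  using infinite_place_ord[OF Vinf_place x_notin_Vinf] .

lemma place_cases: "V \<in> plc \<Longrightarrow> V = Vinf \<or> x \<in> V"
  using infinite_place_unique by blast

text \<open>
  The place at infinity is rational: if numerator and denominator have the same pole order, a constant
  cancels the leading terms.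
\<close>

lemma Vinf_residue:
  assumes "z \<in> Vinf" obtains c where "z - \<iota> c \<in> max_ideal Vinf"
proof -
  interpret discrete_place "range \<iota>" FF Vinf by (rule Vinf_discrete)
  obtain a b where ab: "a \<in> Oring" "b \<in> Oring" "b \<noteq> 0" "z = a / b" "a = 0 \<or> dg a \<le> dg b"
    using assms unfolding Vinf_def by blast
  have m: "p / b \<in> max_ideal Vinf" if "p \<in> Oring" "p = 0 \<or> dg p < dg b" for p
  proof (cases "p = 0")
    case False
    have "ord_at Vinf (p / b) > 0"
      using that False ab(2,3) ord_divide[of p b] ord_Vinf[of p] ord_Vinf[of b] O_FF by simp
    then show ?thesis using mem_iff_ord(2)[of "p / b"] FF_I[OF that(1) ab(2)] False ab(3) by simp
  qed simp
  show thesis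
  proof (cases "a = 0 \<or> dg a < dg b")
    case True
    then have "z - \<iota> 0 \<in> max_ideal Vinf" using m[OF ab(1)] ab(4) by simp
    then show thesis by (rule that)
  next
    case False
    then obtain c where c: "a - \<iota> c * b = 0 \<or> dg (a - \<iota> c * b) < dg b"
      using lead_cancel[OF ab(1,2) _ ab(3)] ab(5) by (metis le_neq_implies_less)
    have "z - \<iota> c = (a - \<iota> c * b) / b" using ab(3,4) by (simp add: diff_divide_distrib)
    moreover have "a - \<iota> c * b \<in> Oring" using ab(1,2) by (intro O_diff O_mult O_emb)
    ultimately have "z - \<iota> c \<in> max_ideal Vinf" using m c by metis
    then show thesis by (rule that)
  qed
qed

subsection \<open>Finite places\<close>

text \<open>
  A local parameter in \<open>O\<close> that witnesses at the same time that \<open>V\<close> is discrete and that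
  \<open>V\<close> is the localization of \<open>O\<close> at a maximal ideal.
\<close>

definition loc_param :: "'a set \<Rightarrow> 'a \<Rightarrow> bool" where
  "loc_param V t \<longleftrightarrow> t \<in> Oring \<and> t \<noteq> 0 \<and> t \<in> max_ideal V \<and>
     (\<forall>a\<in>Oring - {0}. \<exists>n::nat. \<exists>c\<in>Oring - max_ideal V. \<exists>d\<in>Oring - max_ideal V. a * d = t ^ n * c)"

lemma loc_param_local_param:
  assumes "V \<in> plc" "x \<in> V" "loc_param V t"
  shows "place.local_param FF V t"
proof -
  interpret place "range \<iota>" FF V by (rule placeI) fact
  have t: "t \<noteq> 0" "t \<in> max_ideal V" using assms(3) by (auto simp: loc_param_def)
  have O: "a \<in> V" if "a \<in> Oring" for a using O_sub_place[OF assms(1,2) that] .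
  have "\<exists>n::int. \<exists>u\<in>V - max_ideal V. z = t powi n * u" if z: "z \<in> FF - {0}" for z
  proof -
    obtain a b where ab: "a \<in> Oring" "b \<in> Oring" "b \<noteq> 0" "z = a / b" using FF_cases z by blast
    then have a0: "a \<noteq> 0" using z by auto
    obtain n c d where a: "c \<in> Oring - max_ideal V" "d \<in> Oring - max_ideal V" "a * d = t ^ n * c"
      using assms(3) ab(1) a0 unfolding loc_param_def by blast
    obtain m c' d' where b: "c' \<in> Oring - max_ideal V" "d' \<in> Oring - max_ideal V" "b * d' = t ^ m * c'"
      using assms(3) ab(2,3) unfolding loc_param_def by blast
    have nz: "c \<noteq> 0" "d \<noteq> 0" "c' \<noteq> 0" "d' \<noteq> 0" using a b by auto
    have "a = t ^ n * c / d" "b = t ^ m * c' / d'" using a(3) b(3) nz by (simp_all add: field_simps)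
    then have "z = t ^ n / t ^ m * ((c * d') / (c' * d))" using ab(4) by (simp add: mult_ac)
    also have "t ^ n / t ^ m = t powi (int n - int m)" using t(1) by (simp add: power_int_diff)
    finally have "z = t powi (int n - int m) * ((c * d') / (c' * d))" .
    moreover have "(c * d') / (c' * d) \<in> V - max_ideal V"
      using a b O by (intro unit_divide unit_mult) auto
    ultimately show ?thesis by blast
  qed
  then show ?thesis unfolding local_param_def using t by blast
qed

lemma loc_param_discrete:
  assumes "V \<in> plc" "x \<in> V" "loc_param V t"
  shows "discrete_place (range \<iota>) FF V" "uniformizer V t"
proof -
  interpret place "range \<iota>" FF V by (rule placeI) fact
  have *: "local_param t" by (rule loc_param_local_param[OF assms])
  show "discrete_place (range \<iota>) FF V" by unfold_locales (use * in blast)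
  show "uniformizer V t" by (rule local_param_uniformizer[OF *])
qed

text \<open>
  Common powers of \<open>t\<close> in numerator and denominator cancel, so \<open>V\<close> is the localization of \<open>O\<close>.
\<close>

lemma loc_param_fraction:
  assumes "V \<in> plc" "x \<in> V" "loc_param V t" "z \<in> V"
  obtains a b where "a \<in> Oring" "b \<in> Oring" "b \<notin> max_ideal V" "z = a / b"
proof (cases "z = 0")
  case True
  interpret place "range \<iota>" FF V by (rule placeI) fact
  show thesis using that[of 0 1] True by simp
next
  case False
  interpret discrete_place "range \<iota>" FF V by (rule loc_param_discrete[OF assms(1-3)])
  have t: "t \<noteq> 0" "t \<in> max_ideal V" "t \<in> Oring" using assms(3) by (auto simp: loc_param_def)
  have O: "a \<in> V" if "a \<in> Oring" for a using O_sub_place[OF assms(1,2) that] .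
  obtain a b where ab: "a \<in> Oring" "b \<in> Oring" "b \<noteq> 0" "z = a / b"
    using FF_cases V_sub_F assms(4) by blast
  then have a0: "a \<noteq> 0" using False by auto
  obtain n c d where a: "c \<in> Oring - max_ideal V" "d \<in> Oring - max_ideal V" "a * d = t ^ n * c"
    using assms(3) ab(1) a0 unfolding loc_param_def by blast
  obtain m c' d' where b: "c' \<in> Oring - max_ideal V" "d' \<in> Oring - max_ideal V" "b * d' = t ^ m * c'"
    using assms(3) ab(2,3) unfolding loc_param_def by blast
  have nz: "c \<noteq> 0" "d \<noteq> 0" "c' \<noteq> 0" "d' \<noteq> 0" using a b by auto
  have "a = t ^ n * c / d" "b = t ^ m * c' / d'" using a(3) b(3) nz by (simp_all add: field_simps)
  then have z: "z = t ^ n / t ^ m * ((c * d') / (c' * d))" using ab(4) by (simp add: mult_ac)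
  also have "t ^ n / t ^ m = t powi (int n - int m)" using t(1) by (simp add: power_int_diff)
  finally have z': "z = t powi (int n - int m) * ((c * d') / (c' * d))" .
  moreover have "(c * d') / (c' * d) \<in> V - max_ideal V"
    using a b O by (intro unit_divide unit_mult) auto
  ultimately have "m \<le> n" using local_param_powi_mem(1)[OF t(1,2)] assms(4) by fastforce
  then have "t ^ n / t ^ m = t ^ (n - m)" using t(1) by (simp add: power_diff)
  then have "z = (t ^ (n - m) * (c * d')) / (c' * d)" using z by simp
  moreover have "c' * d \<notin> max_ideal V" using a b O max_ideal_prime by blast
  ultimately show thesis using that[of "t ^ (n - m) * (c * d')" "c' * d"] a b t by auto
qed

subsection \<open>Rational points outside the branch locus\<close>

text \<open>
  Evaluation of an element of \<open>O\<close> at the point \<open>(\<alpha>, \<beta>)\<close>.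
\<close>

definition ev :: "'k \<Rightarrow> 'k \<Rightarrow> 'a \<Rightarrow> 'k" where
  "ev \<alpha> \<beta> a = poly (re a) \<alpha> + poly (im a) \<alpha> * \<beta>"

definition Vpt :: "'k \<Rightarrow> 'k \<Rightarrow> 'a set" where
  "Vpt \<alpha> \<beta> = {a / b | a b. a \<in> Oring \<and> b \<in> Oring \<and> ev \<alpha> \<beta> b \<noteq> 0}"

context
  fixes \<alpha> \<beta> :: 'k
  assumes pt: "\<beta> ^ 2 = poly f \<alpha>" and \<beta>: "\<beta> \<noteq> 0"
begin

abbreviation "e \<equiv> ev \<alpha> \<beta>"

lemma ev_el: "e (el u v) = poly u \<alpha> + poly v \<alpha> * \<beta>"
  by (simp add: ev_def)

lemma ev_add: "a \<in> Oring \<Longrightarrow> b \<in> Oring \<Longrightarrow> e (a + b) = e a + e b"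
  and ev_diff: "a \<in> Oring \<Longrightarrow> b \<in> Oring \<Longrightarrow> e (a - b) = e a - e b"
  by (auto simp: Oring_def ev_el el_add el_diff algebra_simps)

lemma ev_mult: "a \<in> Oring \<Longrightarrow> b \<in> Oring \<Longrightarrow> e (a * b) = e a * e b"
proof -
  assume "a \<in> Oring" "b \<in> Oring"
  then obtain u v u' v' where ab: "a = el u v" "b = el u' v'" by (auto simp: Oring_def)
  have "e (a * b) = poly u \<alpha> * poly u' \<alpha> + \<beta> ^ 2 * (poly v \<alpha> * poly v' \<alpha>) + (poly u \<alpha> * poly v' \<alpha> + poly v \<alpha> * poly u' \<alpha>) * \<beta>"
    unfolding ab el_mult ev_el pt by simp
  then show ?thesis unfolding ab ev_el by (simp add: algebra_simps power2_eq_square)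
qed

lemma ev_pe: "e (pe u) = poly u \<alpha>"
  unfolding pe_eq_el ev_el by simp

lemma ev_emb: "e (\<iota> c) = c"
  using ev_pe[of "[:c:]"] by simp

lemma ev_x: "e x = \<alpha>"
  using ev_pe[of "[:0,1:]"] unfolding pe_X by simp

lemma ev_y: "e y = \<beta>"
  using ev_el[of 0 1] unfolding y_eq_el[symmetric] by simp

lemma ev_0: "e 0 = 0" and ev_1: "e 1 = 1"
  using ev_emb[of 0] ev_emb[of 1] by (simp_all add: emb_1)

lemma ev_nonzero: "e a \<noteq> 0 \<Longrightarrow> a \<noteq> 0"
  using ev_0 by auto

definition tpt :: 'a where "tpt = x - \<iota> \<alpha>"

lemma tpt_pe: "tpt = pe [:- \<alpha>, 1:]"
  unfolding tpt_def pe_pCons by (simp add: emb_uminus emb_1)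

lemma tpt_O: "tpt \<in> Oring"
  unfolding tpt_def by (intro O_diff O_x O_emb)

lemma tpt_nz: "tpt \<noteq> 0"
  unfolding tpt_pe by simp

lemma ev_tpt: "e tpt = 0"
  unfolding tpt_pe ev_pe by simp

lemma pe_linear_approx: "\<exists>s\<in>Oring. pe u - \<iota> (poly u \<alpha>) = tpt * s"
proof -
  have "[:- \<alpha>, 1:] dvd u - [:poly u \<alpha>:]" by (simp add: poly_eq_0_iff_dvd[symmetric])
  then obtain h where "u - [:poly u \<alpha>:] = [:- \<alpha>, 1:] * h" by blast
  then have "pe (u - [:poly u \<alpha>:]) = pe ([:- \<alpha>, 1:] * h)" by simp
  then have "pe u - \<iota> (poly u \<alpha>) = tpt * pe h" unfolding pe_diff pe_mult tpt_pe by simp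
  then show ?thesis using O_pe by blast
qed

lemma y_point_product: "\<exists>h\<in>Oring. (y - \<iota> \<beta>) * (y + \<iota> \<beta>) = tpt * h"
proof -
  have "(y - \<iota> \<beta>) * (y + \<iota> \<beta>) = pe f - \<iota> (poly f \<alpha>)"
    by (simp add: y_square'[symmetric] pt[symmetric] emb_mult emb_power power2_eq_square algebra_simps)
  then show ?thesis using pe_linear_approx[of f] by metis
qed

text \<open>
  The factor \<open>y + \<beta>\<close> does not vanish at \<open>(\<alpha>, \<beta>)\<close> and turns \<open>y - \<beta>\<close> into a multiple of \<open>x - \<alpha>\<close>, so a
  function vanishing at the point becomes divisible by \<open>x - \<alpha>\<close> in \<open>O\<close>.
\<close>

lemma vanishing_step:
  assumes "a \<in> Oring" "e a = 0"
  shows "\<exists>s\<in>Oring. (y + \<iota> \<beta>) * a = tpt * s"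
proof -
  obtain u v where a: "a = el u v" using assms(1) by (auto simp: Oring_def)
  obtain s1 where s1: "s1 \<in> Oring" "pe u - \<iota> (poly u \<alpha>) = tpt * s1" using pe_linear_approx by blast
  obtain s2 where s2: "s2 \<in> Oring" "pe v - \<iota> (poly v \<alpha>) = tpt * s2" using pe_linear_approx by blast
  obtain h where h: "h \<in> Oring" "(y - \<iota> \<beta>) * (y + \<iota> \<beta>) = tpt * h" using y_point_product by blast
  have uv: "poly u \<alpha> = - (poly v \<alpha> * \<beta>)" using assms(2) unfolding a ev_el by (simp add: eq_neg_iff_add_eq_0)
  have pu: "pe u = tpt * s1 - \<iota> (poly v \<alpha>) * \<iota> \<beta>" using s1(2) uv by (simp add: emb_uminus emb_mult algebra_simps)
  have pv: "pe v = tpt * s2 + \<iota> (poly v \<alpha>)" using s2(2) by (simp add: algebra_simps)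
  have "(y + \<iota> \<beta>) * a = tpt * ((y + \<iota> \<beta>) * (s1 + s2 * y)) + \<iota> (poly v \<alpha>) * ((y - \<iota> \<beta>) * (y + \<iota> \<beta>))"
    unfolding a el_def pu pv by (simp add: algebra_simps)
  also have "\<dots> = tpt * ((y + \<iota> \<beta>) * (s1 + s2 * y) + \<iota> (poly v \<alpha>) * h)"
    unfolding h(2) by (simp add: algebra_simps)
  finally show ?thesis using s1(1) s2(1) h(1) by (metis O_add O_mult O_y O_emb)
qed

text \<open>
  Repeated use of \<open>vanishing_step\<close> removes the powers of \<open>x - \<alpha>\<close> from \<open>a\<close>. The process stops because the
  product of \<open>a\<close> with its conjugate contains only finitely many of them.
\<close>

lemma point_decomposition:
  assumes "a \<in> Oring" "a \<noteq> 0"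
  shows "\<exists>n::nat. \<exists>c\<in>Oring. \<exists>d\<in>Oring. e c \<noteq> 0 \<and> e d \<noteq> 0 \<and> a * d = tpt ^ n * c"
proof -
  \<comment> \<open>The cofactor s stays fixed while a is replaced by the quotient; m bounds the number of steps.\<close>
  have main: "\<exists>n::nat. \<exists>c\<in>Oring. \<exists>d\<in>Oring. e c \<noteq> 0 \<and> e d \<noteq> 0 \<and> a * d = tpt ^ n * c"
    if "a \<in> Oring" "s \<in> Oring" "c \<in> Oring" "e c \<noteq> 0" "a * s = tpt ^ m * c" for a s c m
    using that
  proof (induction m arbitrary: a c)
    case 0
    then have "e a * e s \<noteq> 0" using ev_mult[of a s] by simp
    then have "e a \<noteq> 0" by auto
    moreover have "a * 1 = tpt ^ 0 * a" by simp
    moreover have "e 1 \<noteq> 0" using ev_1 by simp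
    ultimately show ?case using 0(1) O_1 by blast
  next
    case (Suc m)
    show ?case
    proof (cases "e a = 0")
      case False
      moreover have "a * 1 = tpt ^ 0 * a" by simp
      moreover have "e 1 \<noteq> 0" using ev_1 by simp
      ultimately show ?thesis using Suc.prems(1) O_1 by blast
    next
      case True
      obtain a' where a': "a' \<in> Oring" "(y + \<iota> \<beta>) * a = tpt * a'"
        using vanishing_step[OF Suc.prems(1) True] by blast
      have yb: "y + \<iota> \<beta> \<in> Oring" "e (y + \<iota> \<beta>) \<noteq> 0"
      proof -
        show "y + \<iota> \<beta> \<in> Oring" by (intro O_add O_y O_emb)
        have "\<iota> (\<beta> + \<beta>) = 2 * \<iota> \<beta>" unfolding emb_add by simp
        then have "\<beta> + \<beta> \<noteq> 0" using \<beta> by (metis emb_0 emb_eq_0_iff mult_eq_0_iff zero_neq_numeral)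
        then show "e (y + \<iota> \<beta>) \<noteq> 0" using ev_add[of y "\<iota> \<beta>"] ev_y ev_emb by simp
      qed
      have "tpt * (a' * s) = tpt * (tpt ^ m * ((y + \<iota> \<beta>) * c))"
        using a'(2) Suc.prems(5) by (metis mult.assoc mult.left_commute power_Suc)
      then have "a' * s = tpt ^ m * ((y + \<iota> \<beta>) * c)" using tpt_nz by simp
      moreover have "e ((y + \<iota> \<beta>) * c) \<noteq> 0" using ev_mult[OF yb(1) Suc.prems(3)] yb(2) Suc.prems(4) by simp
      ultimately obtain n c' d' where n: "c' \<in> Oring" "d' \<in> Oring" "e c' \<noteq> 0" "e d' \<noteq> 0" "a' * d' = tpt ^ n * c'"
        using Suc.IH[OF a'(1) Suc.prems(2) O_mult[OF yb(1) Suc.prems(3)]] by blast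
      have "a * ((y + \<iota> \<beta>) * d') = ((y + \<iota> \<beta>) * a) * d'" by (simp only: mult_ac)
      also have "\<dots> = tpt * (a' * d')" unfolding a'(2) by (simp only: mult.assoc)
      also have "\<dots> = tpt ^ Suc n * c'" unfolding n(5) by (simp add: mult.assoc)
      finally have "a * ((y + \<iota> \<beta>) * d') = tpt ^ Suc n * c'" .
      moreover have "e ((y + \<iota> \<beta>) * d') \<noteq> 0" using ev_mult[OF yb(1) n(2)] yb(2) n(4) by simp
      ultimately show ?thesis using n(1,3) O_mult[OF yb(1) n(2)] by blast
    qed
  qed
  have "nrm a \<noteq> 0" using nrm_eq_0_iff assms by auto
  then obtain q where q: "nrm a = [:- \<alpha>, 1:] ^ order \<alpha> (nrm a) * q" "\<not> [:- \<alpha>, 1:] dvd q"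
    using order_decomp by blast
  have "a * cnj' a = tpt ^ order \<alpha> (nrm a) * pe q"
    unfolding mult_cnj[OF assms(1)] tpt_pe pe_power[symmetric] pe_mult[symmetric] using q(1) by simp
  moreover have "e (pe q) \<noteq> 0" unfolding ev_pe using q(2) by (simp add: poly_eq_0_iff_dvd)
  ultimately show ?thesis using main[OF assms(1) O_cnj O_pe] by blast
qed

lemma Vpt_iff:
  assumes "a \<in> Oring" "b \<in> Oring" "e b = 0" "e a \<noteq> 0" "b \<noteq> 0" shows "a / b \<notin> Vpt \<alpha> \<beta>"
proof
  assume "a / b \<in> Vpt \<alpha> \<beta>"
  then obtain c d where cd: "c \<in> Oring" "d \<in> Oring" "e d \<noteq> 0" "a / b = c / d" by (auto simp: Vpt_def)
  have "a * d = c * b" using cd(4) assms(5) ev_nonzero[OF cd(3)] by (simp add: frac_eq_eq)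
  then have "e a * e d = e c * e b" using ev_mult assms cd by metis
  then show False using assms cd by simp
qed

lemma Vpt_place: "Vpt \<alpha> \<beta> \<in> plc"
  unfolding places_def
proof (intro CollectI conjI ballI psubsetI)
  have whole: "a \<in> Vpt \<alpha> \<beta>" if "a \<in> Oring" for a
  proof -
    have "a = a / 1" "e 1 \<noteq> 0" using ev_1 by auto
    then show ?thesis unfolding Vpt_def using that O_1 by blast
  qed
  show "range \<iota> \<subseteq> Vpt \<alpha> \<beta>" using whole O_emb by blast
  show "range \<iota> \<noteq> Vpt \<alpha> \<beta>" using whole[OF O_x] x_notin_K by blast
  show "Vpt \<alpha> \<beta> \<subseteq> FF" using FF_I by (auto simp: Vpt_def)
  have "1 / tpt \<notin> Vpt \<alpha> \<beta>" using Vpt_iff[of 1 tpt] tpt_O tpt_nz ev_tpt ev_1 O_1 by simp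
  moreover have "1 / tpt \<in> FF" using FF_I[OF O_1 tpt_O] .
  ultimately show "Vpt \<alpha> \<beta> \<noteq> FF" by blast
next
  fix a b assume "a \<in> Vpt \<alpha> \<beta>" "b \<in> Vpt \<alpha> \<beta>"
  then obtain p q r s where a: "p \<in> Oring" "q \<in> Oring" "e q \<noteq> 0" "a = p / q"
    and b: "r \<in> Oring" "s \<in> Oring" "e s \<noteq> 0" "b = r / s" by (auto simp: Vpt_def)
  have qs: "q * s \<in> Oring" "e (q * s) \<noteq> 0" using a b ev_mult by auto
  have "a - b = (p * s - r * q) / (q * s)" "a * b = (p * r) / (q * s)"
    using a b ev_nonzero by (simp_all add: diff_frac_eq)
  moreover have "p * s - r * q \<in> Oring" "p * r \<in> Oring" using a b by auto
  ultimately show "a - b \<in> Vpt \<alpha> \<beta>" "a * b \<in> Vpt \<alpha> \<beta>" using qs unfolding Vpt_def by blast+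
next
  fix z assume z: "z \<in> FF"
  then obtain a b where ab: "a \<in> Oring" "b \<in> Oring" "b \<noteq> 0" "z = a / b" using FF_cases by metis
  show "z \<in> Vpt \<alpha> \<beta> \<or> inverse z \<in> Vpt \<alpha> \<beta>"
  proof (cases "a = 0")
    case True
    then have "z = 0 / 1" "e 1 \<noteq> 0" using ab ev_1 by simp_all
    then show ?thesis unfolding Vpt_def using O_0 O_1 by blast
  next
    case False
    obtain n c d where n: "c \<in> Oring" "d \<in> Oring" "e c \<noteq> 0" "e d \<noteq> 0" "a * d = tpt ^ n * c"
      using point_decomposition[OF ab(1) False] by blast
    obtain m c' d' where m: "c' \<in> Oring" "d' \<in> Oring" "e c' \<noteq> 0" "e d' \<noteq> 0" "b * d' = tpt ^ m * c'"
      using point_decomposition[OF ab(2,3)] by blast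
    note nz = ev_nonzero[OF n(3)] ev_nonzero[OF n(4)] ev_nonzero[OF m(3)] ev_nonzero[OF m(4)] tpt_nz
    have "a = tpt ^ n * c / d" "b = tpt ^ m * c' / d'" using n(5) m(5) nz by (simp_all add: field_simps)
    then have z: "z = (tpt ^ n * c * d') / (tpt ^ m * c' * d)" using ab(4) nz by simp
    show ?thesis
    proof (cases "m \<le> n")
      case True
      then have "tpt ^ n = tpt ^ m * tpt ^ (n - m)" by (simp add: power_add[symmetric])
      then have "z = (tpt ^ (n - m) * c * d') / (c' * d)" using z nz by simp
      moreover have "e (c' * d) \<noteq> 0" using ev_mult[OF m(1) n(2)] m(3) n(4) by simp
      moreover have "tpt ^ (n - m) * c * d' \<in> Oring" "c' * d \<in> Oring" using n m tpt_O by auto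
      ultimately show ?thesis unfolding Vpt_def by blast
    next
      case False
      then have "tpt ^ m = tpt ^ n * tpt ^ (m - n)" by (simp add: power_add[symmetric])
      then have "inverse z = (tpt ^ (m - n) * c' * d) / (c * d')" using z nz by simp
      moreover have "e (c * d') \<noteq> 0" using ev_mult[OF n(1) m(2)] n(3) m(4) by simp
      moreover have "tpt ^ (m - n) * c' * d \<in> Oring" "c * d' \<in> Oring" using n m tpt_O by auto
      ultimately show ?thesis unfolding Vpt_def by blast
    qed
  qed
qed

lemma Vpt_max_ideal: "tpt \<in> max_ideal (Vpt \<alpha> \<beta>)" "y - \<iota> \<beta> \<in> max_ideal (Vpt \<alpha> \<beta>)"
proof -
  have m: "a \<in> max_ideal (Vpt \<alpha> \<beta>)" if "a \<in> Oring" "e a = 0" for a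
  proof -
    have "a = a / 1" "e 1 \<noteq> 0" using ev_1 by auto
    then have "a \<in> Vpt \<alpha> \<beta>" unfolding Vpt_def using that O_1 by blast
    moreover have "inverse a \<notin> Vpt \<alpha> \<beta>" if "a \<noteq> 0"
      using Vpt_iff[OF O_1 \<open>a \<in> Oring\<close> \<open>e a = 0\<close> _ that] ev_1 by (simp add: inverse_eq_divide)
    ultimately show ?thesis by (auto simp: max_ideal_def)
  qed
  show "tpt \<in> max_ideal (Vpt \<alpha> \<beta>)" using m tpt_O ev_tpt by blast
  have "e (y - \<iota> \<beta>) = 0" using ev_diff[OF O_y O_emb] ev_y ev_emb by simp
  then show "y - \<iota> \<beta> \<in> max_ideal (Vpt \<alpha> \<beta>)" using m O_diff[OF O_y O_emb] by blast
qed

text \<open>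
  Modulo the maximal ideal, \<open>x\<close> and \<open>y\<close> are the constants \<open>\<alpha>\<close> and \<open>\<beta>\<close>.
\<close>

lemma point_max_ideal_iff:
  assumes "V \<in> plc" "tpt \<in> max_ideal V" "y - \<iota> \<beta> \<in> max_ideal V" "a \<in> Oring"
  shows "a \<in> max_ideal V \<longleftrightarrow> e a = 0"
proof -
  interpret place "range \<iota>" FF V by (rule placeI) fact
  have xV: "x \<in> V"
    using V_add[OF max_ideal_sub[OF assms(2)] K_sub_V[of "\<iota> \<alpha>"]] by (simp add: tpt_def)
  note OV = O_sub_place[OF assms(1) xV]
  have pe: "pe u - \<iota> (poly u \<alpha>) \<in> max_ideal V" for u
  proof -
    obtain s where s: "s \<in> Oring" "pe u - \<iota> (poly u \<alpha>) = tpt * s" using pe_linear_approx by blast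
    then show ?thesis using max_ideal_mult(1)[OF assms(2) OV] by simp
  qed
  obtain u v where a: "a = el u v" using assms(4) by (auto simp: Oring_def)
  have ea: "e a = poly u \<alpha> + poly v \<alpha> * \<beta>" unfolding a by (rule ev_el)
  have "a - \<iota> (e a) = (pe u - \<iota> (poly u \<alpha>)) + (pe v - \<iota> (poly v \<alpha>)) * y + \<iota> (poly v \<alpha>) * (y - \<iota> \<beta>)"
    unfolding ea unfolding a el_def by (simp add: emb_add emb_mult algebra_simps)
  also have "\<dots> \<in> max_ideal V"
    using pe assms(3) OV[OF O_y] OV[OF O_emb] by (intro max_ideal_add max_ideal_mult) auto
  finally have *: "a - \<iota> (e a) \<in> max_ideal V" .
  show ?thesis
  proof
    assume "a \<in> max_ideal V"
    then have "\<iota> (e a) \<in> max_ideal V" using max_ideal_diff[OF _ *] by fastforce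
    then show "e a = 0" using const_unit[of "\<iota> (e a)"] by auto
  next
    assume "e a = 0"
    then show "a \<in> max_ideal V" using * by simp
  qed
qed

text \<open>
  The local ring of the point is a discrete valuation ring, hence maximal, and it is contained in every
  place at which \<open>x - \<alpha>\<close> and \<open>y - \<beta>\<close> vanish.
\<close>

lemma point_loc_param:
  assumes "V \<in> plc" "tpt \<in> max_ideal V" "y - \<iota> \<beta> \<in> max_ideal V"
  shows "loc_param V tpt" "V = Vpt \<alpha> \<beta>" "x \<in> V"
proof -
  have lp: "loc_param V tpt" if "V \<in> plc" "tpt \<in> max_ideal V" "y - \<iota> \<beta> \<in> max_ideal V" for V
    unfolding loc_param_def using tpt_O tpt_nz that(2) point_decomposition point_max_ideal_iff[OF that] by blast
  have xV: "x \<in> V" if "V \<in> plc" "tpt \<in> max_ideal V" for V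
  proof -
    interpret place "range \<iota>" FF V by (rule placeI) fact
    show ?thesis using V_add[OF max_ideal_sub[OF that(2)] K_sub_V[of "\<iota> \<alpha>"]] by (simp add: tpt_def)
  qed
  show "loc_param V tpt" by (rule lp[OF assms])
  show "x \<in> V" by (rule xV[OF assms(1,2)])
  interpret V: place "range \<iota>" FF V by (rule placeI) fact
  interpret P: discrete_place "range \<iota>" FF "Vpt \<alpha> \<beta>"
    by (rule loc_param_discrete(1)[OF Vpt_place xV[OF Vpt_place Vpt_max_ideal(1)] lp[OF Vpt_place Vpt_max_ideal]])
  have "Vpt \<alpha> \<beta> \<subseteq> V"
  proof
    fix z assume "z \<in> Vpt \<alpha> \<beta>"
    then obtain a b where "a \<in> Oring" "b \<in> Oring" "e b \<noteq> 0" "z = a / b" by (auto simp: Vpt_def)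
    then show "z \<in> V"
      using V.V_divide[of a b] O_sub_place[OF assms(1) xV[OF assms(1,2)]] point_max_ideal_iff[OF assms] by auto
  qed
  then show "V = Vpt \<alpha> \<beta>" by (rule P.place_maximal) fact
qed

lemma Vpt_x: "x \<in> Vpt \<alpha> \<beta>" and Vpt_loc_param: "loc_param (Vpt \<alpha> \<beta>) tpt"
  using point_loc_param[OF Vpt_place Vpt_max_ideal] by auto

end

text \<open>
  The product \<open>(y - \<beta>) (y + \<beta>) = f - \<beta>\<^sup>2\<close> is divisible by \<open>x - \<alpha>\<close>, so one of its factors vanishes at
  every place over \<open>\<alpha>\<close>.
\<close>

lemma places_over_point:
  assumes "\<beta> ^ 2 = poly f \<alpha>" "\<beta> \<noteq> 0" "V \<in> plc" "x - \<iota> \<alpha> \<in> max_ideal V"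
  shows "V = Vpt \<alpha> \<beta> \<or> V = Vpt \<alpha> (- \<beta>)"
proof -
  interpret place "range \<iota>" FF V by (rule placeI) fact
  have t: "x - \<iota> \<alpha> \<in> V" using assms(4) max_ideal_sub by blast
  have xV: "x \<in> V" using V_add[OF t K_sub_V[of "\<iota> \<alpha>"]] by simp
  have tm: "tpt \<alpha> \<in> max_ideal V" using assms(4) tpt_def[OF assms(1,2)] by simp
  obtain h where h: "h \<in> Oring" "(y - \<iota> \<beta>) * (y + \<iota> \<beta>) = tpt \<alpha> * h"
    using y_point_product[OF assms(1,2)] by blast
  have "(y - \<iota> \<beta>) * (y + \<iota> \<beta>) \<in> max_ideal V"
    unfolding h(2) using tm O_sub_place[OF assms(3) xV h(1)] by (rule max_ideal_mult)
  then consider "y - \<iota> \<beta> \<in> max_ideal V" | "y - \<iota> (- \<beta>) \<in> max_ideal V"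
    using max_ideal_prime[of "y - \<iota> \<beta>" "y + \<iota> \<beta>"] O_sub_place[OF assms(3) xV] O_y O_emb
      V_add V_diff by (auto simp: emb_uminus)
  then show ?thesis
  proof cases
    case 1
    then show ?thesis using point_loc_param(2)[OF assms(1,2,3) tm] by blast
  next
    case 2
    have "(- \<beta>) ^ 2 = poly f \<alpha>" "- \<beta> \<noteq> 0" using assms by auto
    from point_loc_param(2)[OF this assms(3) _ 2] show ?thesis using tm by blast
  qed
qed

lemma Vpt_distinct:
  assumes "\<beta> ^ 2 = poly f \<alpha>" "\<beta> \<noteq> 0" "\<beta>' ^ 2 = poly f \<alpha>'" "\<beta>' \<noteq> 0" "Vpt \<alpha> \<beta> = Vpt \<alpha>' \<beta>'"
  shows "\<alpha> = \<alpha>'" "\<beta> = \<beta>'"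
proof -
  let ?V = "Vpt \<alpha> \<beta>"
  interpret place "range \<iota>" FF ?V by (rule placeI[OF Vpt_place[OF assms(1,2)]])
  note m = point_max_ideal_iff[OF assms(1,2) Vpt_place[OF assms(1,2)] Vpt_max_ideal[OF assms(1,2)]]
  have a: "x - \<iota> \<alpha>' \<in> max_ideal ?V" and b: "y - \<iota> \<beta>' \<in> max_ideal ?V"
    using Vpt_max_ideal[OF assms(3,4)] assms(5) tpt_def[OF assms(3,4)] by auto
  have "ev \<alpha> \<beta> (x - \<iota> \<alpha>') = \<alpha> - \<alpha>'" "ev \<alpha> \<beta> (y - \<iota> \<beta>') = \<beta> - \<beta>'"
    using ev_diff[OF assms(1,2)] ev_x[OF assms(1,2)] ev_y[OF assms(1,2)] ev_emb[OF assms(1,2)] by auto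
  moreover have "x - \<iota> \<alpha>' \<in> Oring" "y - \<iota> \<beta>' \<in> Oring" by (intro O_diff O_x O_y O_emb)+
  ultimately show "\<alpha> = \<alpha>'" "\<beta> = \<beta>'" using m a b by auto
qed

lemma Vinf_not_finite: "V \<in> plc \<Longrightarrow> x \<in> V \<Longrightarrow> V \<noteq> Vinf"
  using x_notin_Vinf by blast

end

section \<open>Degrees and the genus\<close>

lemma sum_mset_eq_sum_count:
  fixes w :: "'b \<Rightarrow> nat"
  shows "(\<Sum>V\<in>#M. w V) = (\<Sum>V\<in>set_mset M. count M V * w V)"
proof (induction M)
  case (add V M)
  have "(\<Sum>W\<in>set_mset (add_mset V M). count (add_mset V M) W * w W) =
      (\<Sum>W\<in>set_mset (add_mset V M). count M W * w W + (if W = V then w V else 0))"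
    by (intro sum.cong) auto
  also have "\<dots> = (\<Sum>W\<in>set_mset (add_mset V M). count M W * w W) + w V"
    by (simp add: sum.distrib)
  also have "(\<Sum>W\<in>set_mset (add_mset V M). count M W * w W) = (\<Sum>W\<in>set_mset M. count M W * w W)"
    by (intro sum.mono_neutral_right) (auto simp: not_in_iff)
  finally show ?case using add by simp
qed simp

lemma div_degree_superset:
  assumes "finite S" "Poly_Mapping.keys D \<subseteq> S"
  shows "div_degree K D = (\<Sum>V\<in>S. Poly_Mapping.lookup D V * int (place_degree K V))"
  unfolding div_degree_def by (intro sum.mono_neutral_left assms) (auto simp: in_keys_iff)

lemma div_degree_add: "div_degree K (D + E) = div_degree K D + div_degree K E"
proof -
  let ?S = "Poly_Mapping.keys D \<union> Poly_Mapping.keys E"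
  have "div_degree K (D + E) = (\<Sum>V\<in>?S. Poly_Mapping.lookup (D + E) V * int (place_degree K V))"
    by (rule div_degree_superset[OF _ keys_add]) simp
  then show ?thesis
    by (simp add: div_degree_superset[of ?S] lookup_add sum.distrib algebra_simps)
qed

lemma div_degree_uminus: "div_degree K (- D) = - div_degree K D"
  by (simp add: div_degree_def sum_negf)

lemma div_degree_diff: "div_degree K (D - E) = div_degree K D - div_degree K E"
  using div_degree_add[of K "D - E" E] by simp

text \<open>
  The two assumptions say that \<open>O\<close> is a Dedekind domain whose maximal ideals are the finite places, which
  for general \<open>f\<close> amounts to \<open>f\<close> being squarefree. They are verified for the pencil by means of its
  unique factorization domain.
\<close>

locale hyperelliptic_curve = hyperelliptic_field \<iota> x y f g
  for \<iota> :: "'k::field \<Rightarrow> 'a::field_char_0" and x y f g +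
  assumes ex_loc_param: "V \<in> plc \<Longrightarrow> x \<in> V \<Longrightarrow> \<exists>t. loc_param V t"
    and normal: "z \<in> FF \<Longrightarrow> (\<And>V. V \<in> plc \<Longrightarrow> x \<in> V \<Longrightarrow> z \<in> V) \<Longrightarrow> z \<in> Oring"
begin

definition fplc :: "'a set set" where "fplc = {V \<in> plc. x \<in> V}"

lemma fplc_plc: "V \<in> fplc \<Longrightarrow> V \<in> plc" and fplc_x: "V \<in> fplc \<Longrightarrow> x \<in> V"
  by (auto simp: fplc_def)

lemma plc_cases: "V \<in> plc \<longleftrightarrow> V = Vinf \<or> V \<in> fplc" and Vinf_notin_fplc: "Vinf \<notin> fplc"
  using place_cases Vinf_place x_notin_Vinf by (auto simp: fplc_def)

lemma discrete: "V \<in> plc \<Longrightarrow> discrete_place (range \<iota>) FF V"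
  using Vinf_discrete ex_loc_param loc_param_discrete(1) place_cases by metis

lemma O_sub: "V \<in> fplc \<Longrightarrow> a \<in> Oring \<Longrightarrow> a \<in> V"
  using O_sub_place by (auto simp: fplc_def)

lemma ord_O_nonneg: "V \<in> fplc \<Longrightarrow> a \<in> Oring \<Longrightarrow> a \<noteq> 0 \<Longrightarrow> 0 \<le> ord_at V a"
  using discrete_place.mem_iff_ord(1)[OF discrete[OF fplc_plc]] O_sub O_FF by blast

lemma subspace_O: "vs.subspace Oring"
  by (intro vs.subspaceI) auto

lemma subspace_max_ideal: assumes "V \<in> plc" shows "vs.subspace (max_ideal V)"
proof -
  interpret place "range \<iota>" FF V by (rule placeI) fact
  show ?thesis by (intro vs.subspaceI) (auto intro: max_ideal_add max_ideal_mult K_sub_V)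
qed

lemma subspace_scale_image: "vs.subspace W \<Longrightarrow> vs.subspace ((*) z ` W)"
  unfolding vs.subspace_def
proof safe
  fix a b assume W: "\<forall>x\<in>W. \<forall>y\<in>W. x + y \<in> W" and ab: "a \<in> W" "b \<in> W"
  then have "z * (a + b) \<in> (*) z ` W" by blast
  then show "z * a + z * b \<in> (*) z ` W" by (simp only: distrib_left)
next
  fix a c assume W: "\<forall>c. \<forall>x\<in>W. \<iota> c * x \<in> W" and "a \<in> W"
  then have "z * (\<iota> c * a) \<in> (*) z ` W" by blast
  then show "\<iota> c * (z * a) \<in> (*) z ` W" by (simp add: mult_ac)
qed (auto intro!: image_eqI[of _ _ 0])

lemma vs_subspace_Int: "vs.subspace A \<Longrightarrow> vs.subspace B \<Longrightarrow> vs.subspace (A \<inter> B)"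
  by (auto simp: vs.subspace_def)

definition monomials :: "nat \<Rightarrow> 'a set" where
  "monomials N = (\<lambda>i. x ^ i) ` {..<N} \<union> (\<lambda>i. x ^ i * y) ` {..<N}"

lemma pe_in_span:
  assumes "p = 0 \<or> degree p < N" shows "pe p \<in> vs.span (monomials N)" "pe p * y \<in> vs.span (monomials N)"
proof -
  have "pe p = (\<Sum>i<N. \<iota> (coeff p i) * x ^ i)"
  proof -
    have "pe p = (\<Sum>i\<le>degree p. \<iota> (coeff p i) * x ^ i)"
    proof (induction p)
      case (pCons c p)
      show ?case
      proof (cases "p = 0")
        case False
        then have "(\<Sum>i\<le>degree (pCons c p). \<iota> (coeff (pCons c p) i) * x ^ i) = \<iota> c + (\<Sum>i\<le>degree p. \<iota> (coeff p i) * x ^ Suc i)"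
          unfolding degree_pCons_eq[OF False] sum.atMost_Suc_shift by simp
        then show ?thesis using pCons(2) by (simp add: pe_pCons sum_distrib_left mult_ac)
      qed simp
    qed simp
    also have "\<dots> = (\<Sum>i<N. \<iota> (coeff p i) * x ^ i)"
    proof (cases "p = 0")
      case False
      then show ?thesis using assms
        by (intro sum.mono_neutral_left) (auto simp: coeff_eq_0)
    qed simp
    finally show ?thesis .
  qed
  then have eq: "pe p = (\<Sum>i<N. \<iota> (coeff p i) * x ^ i)" "pe p * y = (\<Sum>i<N. \<iota> (coeff p i) * (x ^ i * y))"
    by (simp_all add: sum_distrib_right mult.assoc)
  show "pe p \<in> vs.span (monomials N)" unfolding eq(1)
    by (intro vs.span_sum vs.span_scale vs.span_base) (auto simp: monomials_def)
  show "pe p * y \<in> vs.span (monomials N)" unfolding eq(2)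
    by (intro vs.span_sum vs.span_scale vs.span_base) (auto simp: monomials_def)
qed

text \<open>
  Division with remainder by \<open>p\<close> leaves finitely many monomials.
\<close>

lemma finite_codim:
  assumes "vs.subspace W" "p \<noteq> 0" "\<And>a. a \<in> Oring \<Longrightarrow> a * pe p \<in> W"
  obtains n where "qdim Oring W n"
proof -
  let ?N = "Suc (degree p)"
  have fin: "finite (monomials ?N)" by (simp add: monomials_def)
  have sub: "monomials ?N \<subseteq> Oring" by (auto simp: monomials_def intro!: O_mult O_power O_x O_y)
  have "\<exists>c. z - lincomb c (monomials ?N) \<in> W" if z: "z \<in> Oring" for z
  proof -
    let ?u = "re z" and ?v = "im z"
    let ?s = "pe (?u mod p) + pe (?v mod p) * y"
    have m: "q mod p = 0 \<or> degree (q mod p) < ?N" for q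
      using degree_mod_less[OF assms(2), of q] by auto
    have "?s \<in> vs.span (monomials ?N)" using pe_in_span[OF m] by (intro vs.span_add)
    then obtain c where c: "?s = lincomb c (monomials ?N)" using span_lincomb[OF fin] by metis
    have dm: "pe q = pe (q div p) * pe p + pe (q mod p)" for q
      by (metis div_mult_mod_eq pe_add pe_mult)
    have "z = pe ?u + pe ?v * y" using el_re_im[OF z] by (simp add: el_def)
    also have "\<dots> = ?s + (pe (?u div p) + pe (?v div p) * y) * pe p"
      by (subst dm[of ?u], subst dm[of ?v]) (simp add: algebra_simps)
    finally have "z - ?s = ?s + (pe (?u div p) + pe (?v div p) * y) * pe p - ?s" by (rule arg_cong)
    also have "\<dots> = (pe (?u div p) + pe (?v div p) * y) * pe p" by (rule add_diff_cancel_left')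
    finally have "z - ?s = (pe (?u div p) + pe (?v div p) * y) * pe p" .
    also have "\<dots> \<in> W" by (intro assms(3) O_add O_mult O_pe O_y)
    finally show ?thesis unfolding c by blast
  qed
  then show thesis using qdim_finite_span[OF fin sub _ assms(1)] that by metis
qed

text \<open>
  A nonzero ideal contains the norm of each of its elements, a polynomial in \<open>x\<close>.
\<close>

lemma finite_codim_ideal:
  assumes "vs.subspace W" "t \<in> Oring" "t \<noteq> 0" "\<And>a. a \<in> Oring \<Longrightarrow> a * t \<in> W"
  obtains n where "qdim Oring W n"
proof (rule finite_codim[OF assms(1)])
  show "nrm t \<noteq> 0" using nrm_eq_0_iff assms by auto
  show "a * pe (nrm t) \<in> W" if "a \<in> Oring" for a
  proof -
    have eq: "a * pe (nrm t) = (a * cnj' t) * t" by (simp add: mult_cnj[OF assms(2), symmetric] mult_ac)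
    show ?thesis unfolding eq by (rule assms(4)[OF O_mult[OF that O_cnj]])
  qed
qed

subsection \<open>Residue fields\<close>

context
  fixes V assumes V: "V \<in> fplc"
begin

interpretation discrete_place "range \<iota>" FF V by (rule discrete[OF fplc_plc[OF V]])

lemma O_residue_dim: obtains d where "qdim Oring (Oring \<inter> max_ideal V) d"
proof -
  obtain t where t: "loc_param V t" using ex_loc_param V fplc_plc fplc_x by blast
  then have "t \<in> Oring" "t \<noteq> 0" "t \<in> max_ideal V" by (auto simp: loc_param_def)
  moreover have "vs.subspace (Oring \<inter> max_ideal V)"
    by (intro vs_subspace_Int subspace_O subspace_max_ideal fplc_plc[OF V])
  ultimately show thesis using that finite_codim_ideal[of "Oring \<inter> max_ideal V" t]
      max_ideal_mult(2) O_sub[OF V] by auto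
qed

text \<open>
  The residue ring of \<open>O\<close> is a finite-dimensional domain, so multiplication by a nonzero element is
  injective, hence surjective.
\<close>

lemma O_residue_inverse:
  assumes "b \<in> Oring" "b \<notin> max_ideal V"
  obtains b' where "b' \<in> Oring" "b * b' - 1 \<in> max_ideal V"
proof -
  let ?m = "Oring \<inter> max_ideal V"
  let ?U = "{b * a + c | a c. a \<in> Oring \<and> c \<in> ?m}"
  have sm: "vs.subspace ?m" by (intro vs_subspace_Int subspace_O subspace_max_ideal fplc_plc[OF V])
  have sb: "vs.subspace ((*) b ` Oring)" by (rule subspace_scale_image[OF subspace_O])
  have "?U = {x + y |x y. x \<in> (*) b ` Oring \<and> y \<in> ?m}" by auto
  then have sU: "vs.subspace ?U" using vs.subspace_sums[OF sb sm] by simp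
  obtain d where d: "qdim Oring ?m d" by (rule O_residue_dim)
  have b0: "b \<noteq> 0" using assms by auto
  have dU: "qdim ?U ?m d"
  proof (rule qdim_transport[OF d sm subspace_O b0])
    show "b * z \<in> ?U" if "z \<in> Oring" for z
    proof -
      have "b * z = b * z + 0" "0 \<in> ?m" by auto
      then show ?thesis using that by blast
    qed
    show "\<exists>v\<in>Oring. z - b * v \<in> ?m" if "z \<in> ?U" for z
    proof -
      obtain a c where ac: "z = b * a + c" "a \<in> Oring" "c \<in> ?m" using \<open>z \<in> ?U\<close> by blast
      then have "z - b * a = c" by simp
      then show ?thesis using ac by metis
    qed
    show "b * z \<in> ?m \<longleftrightarrow> z \<in> ?m" if "z \<in> Oring" for z
      using that assms O_sub[OF V] max_ideal_prime[of b z] max_ideal_mult(2)[of z b] by auto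
  qed (rule sm)
  have m0: "?m \<subseteq> ?U"
  proof
    fix c assume "c \<in> ?m"
    then have "c = b * 0 + c" "c \<in> ?m" by auto
    then show "c \<in> ?U" using O_0 by blast
  qed
  have UO: "?U \<subseteq> Oring" using assms by auto
  obtain k l where kl: "qdim Oring ?U k" "qdim ?U ?m l" "k + l = d"
    by (rule qdim_between[OF d sU sm m0 UO])
  have "l = d" using qdim_unique[OF kl(2) dU sm] .
  then have "Oring \<subseteq> ?U" using kl qdim_0_iff by simp
  then have "1 \<in> ?U" using O_1 by blast
  then obtain a c where ac: "1 = b * a + c" "a \<in> Oring" "c \<in> max_ideal V" by blast
  then have "b * a - 1 = - c" by (simp add: algebra_simps)
  then show thesis using that[OF ac(2)] max_ideal_uminus[OF ac(3)] by simp
qed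

lemma V_eq_O_plus_max_ideal:
  assumes "z \<in> V" obtains a where "a \<in> Oring" "z - a \<in> max_ideal V"
proof -
  obtain t where t: "loc_param V t" using ex_loc_param V fplc_plc fplc_x by blast
  obtain a b where ab: "a \<in> Oring" "b \<in> Oring" "b \<notin> max_ideal V" "z = a / b"
    using loc_param_fraction[OF fplc_plc[OF V] fplc_x[OF V] t assms] .
  obtain b' where b': "b' \<in> Oring" "b * b' - 1 \<in> max_ideal V" using O_residue_inverse[OF ab(2,3)] .
  have b0: "b \<noteq> 0" using ab by auto
  have bu: "b \<in> V - max_ideal V" using ab O_sub[OF V] by auto
  have "z - a * b' = - (z * (b * b' - 1))" using ab(4) b0 by (simp add: algebra_simps)
  then have "z - a * b' \<in> max_ideal V" using max_ideal_uminus[OF max_ideal_mult(2)[OF b'(2) assms]] by simp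
  then show thesis using that ab(1) b'(1) by blast
qed

lemma place_degree_dims:
  "qdim V (max_ideal V) (place_degree (range \<iota>) V)"
  "qdim Oring (Oring \<inter> max_ideal V) (place_degree (range \<iota>) V)"
proof -
  obtain d where d: "qdim Oring (Oring \<inter> max_ideal V) d" by (rule O_residue_dim)
  have sm: "vs.subspace (max_ideal V)" by (rule subspace_max_ideal[OF fplc_plc[OF V]])
  have "qdim V (max_ideal V) d"
  proof (rule qdim_transport[OF d vs_subspace_Int[OF subspace_O sm] subspace_O one_neq_zero])
    show "\<exists>v\<in>Oring. z - 1 * v \<in> max_ideal V" if "z \<in> V" for z
      using V_eq_O_plus_max_ideal[OF that] by auto
  qed (use O_sub[OF V] sm in auto)
  moreover from this have "place_degree (range \<iota>) V = d"
    unfolding place_degree_def by (rule quot_dim_eq[OF _ sm])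
  ultimately show "qdim V (max_ideal V) (place_degree (range \<iota>) V)"
    "qdim Oring (Oring \<inter> max_ideal V) (place_degree (range \<iota>) V)" using d by auto
qed

lemma place_degree_pos: "place_degree (range \<iota>) V > 0"
proof (rule ccontr)
  assume "\<not> ?thesis"
  then have "V \<subseteq> max_ideal V" using place_degree_dims(1) qdim_0_iff by simp
  then show False using V_1 max_ideal_1 by blast
qed

lemma ex_param_in_O: obtains t where "t \<in> Oring" "t \<noteq> 0" "ord_at V t = 1"
proof -
  obtain t where t: "loc_param V t" using ex_loc_param V fplc_plc fplc_x by blast
  have "ord_at V t = 1" using loc_param_discrete(2)[OF _ _ t] V fplc_plc fplc_x ord_uniformizer by blast
  then show thesis using that t by (auto simp: loc_param_def)
qed

text \<open>
  Otherwise \<open>V\<close>, a localization of \<open>O\<close>, would be contained in \<open>W\<close>, against its maximality.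
\<close>

lemma separating_element:
  assumes W: "W \<in> fplc" "W \<noteq> V"
  obtains e where "e \<in> Oring" "e \<noteq> 0" "ord_at W e \<ge> 1" "ord_at V e = 0"
proof -
  interpret W: discrete_place "range \<iota>" FF W by (rule discrete[OF fplc_plc[OF W(1)]])
  have "\<exists>e\<in>Oring. e \<in> max_ideal W \<and> e \<notin> max_ideal V"
  proof (rule ccontr)
    assume contr: "\<not> ?thesis"
    obtain t where t: "loc_param V t" using ex_loc_param V fplc_plc fplc_x by blast
    have "V \<subseteq> W"
    proof
      fix z assume "z \<in> V"
      then obtain a b where ab: "a \<in> Oring" "b \<in> Oring" "b \<notin> max_ideal V" "z = a / b"
        using loc_param_fraction[OF fplc_plc[OF V] fplc_x[OF V] t] by metis
      then have "b \<notin> max_ideal W" using contr by blast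
      then show "z \<in> W" unfolding ab(4) using W.V_divide O_sub[OF W(1)] ab by blast
    qed
    then show False using place_maximal fplc_plc[OF W(1)] W(2) by blast
  qed
  then obtain e where e: "e \<in> Oring" "e \<in> max_ideal W" "e \<notin> max_ideal V" by blast
  then have "e \<noteq> 0" by auto
  then show thesis using that e W.mem_iff_ord(2)[OF O_FF[OF e(1)]] ord_unit[of e] O_sub[OF V e(1)] by force
qed

end

lemma qdim_Vinf: "place_degree (range \<iota>) Vinf = 1"
proof -
  interpret discrete_place "range \<iota>" FF Vinf by (rule Vinf_discrete)
  have sm: "vs.subspace (max_ideal Vinf)" by (rule subspace_max_ideal[OF Vinf_place])
  have "qdim Vinf (max_ideal Vinf) 1"
  proof (rule qdim_1I[OF V_1 max_ideal_1 sm])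
    show "\<exists>c. z - \<iota> c * 1 \<in> max_ideal Vinf" if "z \<in> Vinf" for z
      using Vinf_residue[OF that] by (metis mult.right_neutral)
  qed
  then show ?thesis unfolding place_degree_def by (rule quot_dim_eq[OF _ sm])
qed

subsection \<open>Ideals given by effective divisors\<close>

text \<open>
  The ideal of the effective divisor \<open>M\<close> of finite places, and below its degree.
\<close>

definition vanishing :: "'a set multiset \<Rightarrow> 'a set" where
  "vanishing M = {z \<in> Oring. z = 0 \<or> (\<forall>V\<in>#M. int (count M V) \<le> ord_at V z)}"

definition mdeg :: "'a set multiset \<Rightarrow> nat" where
  "mdeg M = (\<Sum>V\<in>#M. place_degree (range \<iota>) V)"

lemma subspace_vanishing:
  assumes "set_mset M \<subseteq> fplc" shows "vs.subspace (vanishing M)"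
proof (rule vs.subspaceI)
  fix a b assume ab: "a \<in> vanishing M" "b \<in> vanishing M"
  have "int (count M V) \<le> ord_at V (a + b)" if "V \<in># M" "a + b \<noteq> 0" for V
  proof -
    have "V \<in> fplc" using that assms by auto
    then interpret discrete_place "range \<iota>" FF V by (intro discrete fplc_plc)
    show ?thesis
    proof (cases "a = 0 \<or> b = 0")
      case False
      then show ?thesis using ab that by (intro ord_add) (auto simp: vanishing_def O_FF)
    qed (use ab that in \<open>auto simp: vanishing_def\<close>)
  qed
  then show "a + b \<in> vanishing M" using ab by (auto simp: vanishing_def)
next
  fix c a assume a: "a \<in> vanishing M"
  have "int (count M V) \<le> ord_at V (\<iota> c * a)" if "V \<in># M" "\<iota> c * a \<noteq> 0" for V
  proof -
    have "V \<in> fplc" using that assms by auto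
    then interpret discrete_place "range \<iota>" FF V by (intro discrete fplc_plc)
    have "ord_at V (\<iota> c) = 0" using that const_unit[of "\<iota> c"] ord_unit by auto
    then show ?thesis using a that ord_mult[of "\<iota> c" a] O_FF[OF O_emb] by (auto simp: vanishing_def O_FF)
  qed
  then show "\<iota> c * a \<in> vanishing M" using a by (auto simp: vanishing_def)
qed (auto simp: vanishing_def)

lemma vanishing_add_mset:
  assumes "V \<in> fplc"
  shows "z \<in> vanishing (add_mset V M) \<longleftrightarrow> z \<in> vanishing M \<and> (z = 0 \<or> int (count M V) + 1 \<le> ord_at V z)"
  unfolding vanishing_def by (auto; force)

text \<open>
  A parameter at \<open>V\<close> is multiplied by functions that vanish at the other places of \<open>M\<close> but not at \<open>V\<close>.
\<close>

lemma exact_vanishing_element: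
  assumes "set_mset M \<subseteq> fplc" "V \<in> fplc"
  obtains e where "e \<in> vanishing M" "e \<noteq> 0" "ord_at V e = int (count M V)"
proof -
  interpret discrete_place "range \<iota>" FF V by (intro discrete fplc_plc assms)
  obtain t where t: "t \<in> Oring" "t \<noteq> 0" "ord_at V t = 1" using ex_param_in_O[OF assms(2)] .
  let ?S = "set_mset M - {V}"
  have "\<forall>W\<in>?S. \<exists>e. e \<in> Oring \<and> e \<noteq> 0 \<and> ord_at W e \<ge> 1 \<and> ord_at V e = 0"
    using separating_element[OF assms(2)] assms(1) by (metis Diff_iff insertI1 subsetD)
  then obtain h where h: "\<And>W. W \<in> ?S \<Longrightarrow> h W \<in> Oring \<and> h W \<noteq> 0 \<and> ord_at W (h W) \<ge> 1 \<and> ord_at V (h W) = 0"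
    by metis
  define e where "e = t ^ count M V * (\<Prod>W\<in>?S. h W ^ count M W)"
  have hp: "h W ^ count M W \<in> FF \<and> h W ^ count M W \<noteq> 0" if "W \<in> ?S" for W
    using h[OF that] by (auto intro: O_FF)
  have prod: "(\<Prod>W\<in>S. h W ^ count M W) \<in> Oring" "(\<Prod>W\<in>S. h W ^ count M W) \<noteq> 0" if "S \<subseteq> ?S" "finite S" for S
    using that h by (auto intro!: O_prod O_power)
  have eO: "e \<in> Oring" "e \<noteq> 0" using t prod[OF order_refl] unfolding e_def by auto
  have "ord_at V (\<Prod>W\<in>?S. h W ^ count M W) = (\<Sum>W\<in>?S. ord_at V (h W ^ count M W))"
    using ord_prod[of ?S "\<lambda>W. h W ^ count M W"] hp by blast
  also have "\<dots> = 0" using h by (intro sum.neutral) (auto simp: ord_power O_FF)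
  finally have oV: "ord_at V e = int (count M V)"
    unfolding e_def using t prod[OF order_refl] by (subst ord_mult) (auto simp: O_FF O_power ord_power)
  have "int (count M W) \<le> ord_at W e" if W: "W \<in># M" for W
  proof (cases "W = V")
    case False
    then have WS: "W \<in> ?S" using W by auto
    have Wf: "W \<in> fplc" using W assms(1) by auto
    interpret W: discrete_place "range \<iota>" FF W by (intro discrete fplc_plc Wf)
    let ?r = "t ^ count M V * (\<Prod>W\<in>?S - {W}. h W ^ count M W)"
    have r: "?r \<in> Oring" "?r \<noteq> 0" using t prod[of "?S - {W}"] by auto
    have e: "e = h W ^ count M W * ?r" unfolding e_def using WS by (subst prod.remove[of _ W]) (auto simp: mult_ac)
    have "ord_at W e = int (count M W) * ord_at W (h W) + ord_at W ?r"
      unfolding e using hp[OF WS] r h[OF WS] by (subst W.ord_mult) (auto simp: O_FF W.ord_power)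
    moreover have "int (count M W) * 1 \<le> int (count M W) * ord_at W (h W)"
      using h[OF WS] by (intro mult_left_mono) auto
    moreover have "0 \<le> ord_at W ?r" by (rule ord_O_nonneg[OF Wf r])
    ultimately show ?thesis by linarith
  qed (use oV in simp)
  then show thesis using that[of e] eO oV by (auto simp: vanishing_def)
qed

text \<open>
  Multiplication by a function \<open>e\<close> of the ideal with exact order at \<open>V\<close> identifies the residue field of
  \<open>V\<close> with the quotient: \<open>z / e\<close> lies in \<open>V\<close> for every \<open>z\<close> in the ideal.
\<close>

lemma qdim_vanishing_step:
  assumes "set_mset M \<subseteq> fplc" "V \<in> fplc"
  shows "qdim (vanishing M) (vanishing (add_mset V M)) (place_degree (range \<iota>) V)"
proof -
  interpret discrete_place "range \<iota>" FF V by (intro discrete fplc_plc assms)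
  obtain e where e: "e \<in> vanishing M" "e \<noteq> 0" "ord_at V e = int (count M V)"
    using exact_vanishing_element[OF assms] .
  have eO: "e \<in> Oring" "e \<in> FF" using e by (auto simp: vanishing_def O_FF)
  have sm: "vs.subspace (Oring \<inter> max_ideal V)"
    by (intro vs_subspace_Int subspace_O subspace_max_ideal fplc_plc assms)
  have sv: "vs.subspace (vanishing M)" by (rule subspace_vanishing[OF assms(1)])
  have mult: "e * a \<in> vanishing M" if "a \<in> Oring" for a
  proof (cases "a = 0")
    case False
    have "int (count M W) \<le> ord_at W (e * a)" if W: "W \<in># M" for W
    proof -
      have Wf: "W \<in> fplc" using W assms(1) by auto
      interpret W: discrete_place "range \<iota>" FF W by (intro discrete fplc_plc Wf)
      have "ord_at W (e * a) = ord_at W e + ord_at W a"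
        using e eO False O_FF[OF \<open>a \<in> Oring\<close>] by (intro W.ord_mult) auto
      moreover have "int (count M W) \<le> ord_at W e" using e W by (auto simp: vanishing_def)
      ultimately show ?thesis using ord_O_nonneg[OF Wf \<open>a \<in> Oring\<close> False] by linarith
    qed
    then show ?thesis using eO that by (auto simp: vanishing_def)
  qed (auto simp: vanishing_def)
  show ?thesis
  proof (rule qdim_transport[OF place_degree_dims(2)[OF assms(2)] sm subspace_O e(2)])
    show "vs.subspace (vanishing (add_mset V M))" using assms by (intro subspace_vanishing) auto
    show "e * z \<in> vanishing M" if "z \<in> Oring" for z by (rule mult[OF that])
    show "e * z \<in> vanishing (add_mset V M) \<longleftrightarrow> z \<in> Oring \<inter> max_ideal V" if z: "z \<in> Oring" for z
    proof (cases "z = 0")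
      case False
      have "ord_at V (e * z) = int (count M V) + ord_at V z"
        using ord_mult[OF eO(2) e(2) O_FF[OF z] False] e(3) by simp
      then show ?thesis
        using mult[OF z] False e(2) z mem_iff_ord(2)[OF O_FF[OF z] False]
        unfolding vanishing_add_mset[OF assms(2)] by auto
    qed (auto simp: vanishing_def)
    show "\<exists>v\<in>Oring. z - e * v \<in> vanishing (add_mset V M)" if z: "z \<in> vanishing M" for z
    proof -
      have zO: "z \<in> Oring" "z \<in> FF" using z by (auto simp: vanishing_def O_FF)
      have "z / e \<in> V"
      proof (cases "z = 0")
        case False
        have "int (count M V) \<le> ord_at V z"
        proof (cases "V \<in># M")
          case True
          then show ?thesis using z False by (auto simp: vanishing_def)
        next
          case False
          then show ?thesis using ord_O_nonneg[OF assms(2) zO(1) \<open>z \<noteq> 0\<close>] by (simp add: not_in_iff)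
        qed
        then show ?thesis using ord_ge_iff[OF zO(2) False eO(2) e(2)] e(3) by simp
      qed simp
      then obtain a where a: "a \<in> Oring" "z / e - a \<in> max_ideal V" using V_eq_O_plus_max_ideal[OF assms(2)] by blast
      let ?w = "z - e * a"
      have w: "?w \<in> vanishing M" using z mult[OF a(1)] sv vs.subspace_diff by blast
      have wO: "?w \<in> FF" using w by (auto simp: vanishing_def O_FF)
      have "int (count M V) + 1 \<le> ord_at V ?w" if w0: "?w \<noteq> 0"
      proof -
        have eq: "z / e - a = ?w / e" using e(2) by (simp add: diff_divide_distrib)
        have "?w / e \<in> FF" "?w / e \<noteq> 0" using subfield_closed(3)[OF subfield_F wO eO(2)] w0 e(2) by auto
        then have "0 < ord_at V (?w / e)" using a(2) mem_iff_ord(2) unfolding eq by blast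
        then show ?thesis using ord_divide[OF wO w0 eO(2) e(2)] e(3) by simp
      qed
      then have "?w \<in> vanishing (add_mset V M)" unfolding vanishing_add_mset[OF assms(2)] using w by blast
      then show ?thesis using a(1) by blast
    qed
  qed
qed

text \<open>The Chinese remainder theorem in the form of a dimension count.\<close>

lemma qdim_vanishing:
  assumes "set_mset M \<subseteq> fplc" shows "qdim Oring (vanishing M) (mdeg M)"
  using assms
proof (induction M)
  case empty
  have "vanishing {#} = Oring" by (auto simp: vanishing_def)
  then show ?case using qdim_0_iff by (simp add: mdeg_def)
next
  case (add V M)
  then have "qdim Oring (vanishing (add_mset V M)) (mdeg M + place_degree (range \<iota>) V)"
    by (intro qdim_add[of _ "vanishing M"] qdim_vanishing_step subspace_vanishing)
      (auto simp: vanishing_add_mset, auto simp: vanishing_def)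
  then show ?case by (simp add: mdeg_def add.commute)
qed

text \<open>
  The ideal of \<open>n\<close> distinct zeros of \<open>z\<close> has codimension at least \<open>n\<close> and contains \<open>z O\<close>, which has finite
  codimension.
\<close>

lemma finite_zeros:
  assumes "z \<in> Oring" "z \<noteq> 0" shows "finite {V \<in> fplc. ord_at V z \<noteq> 0}"
proof -
  let ?zO = "(*) z ` Oring"
  have szO: "vs.subspace ?zO" by (rule subspace_scale_image[OF subspace_O])
  obtain N where N: "qdim Oring ?zO N"
    using finite_codim_ideal[OF szO assms] by (metis imageI mult.commute)
  have "finite S \<and> card S \<le> N" if S: "S \<subseteq> {V \<in> fplc. ord_at V z \<noteq> 0}" "finite S" for S
  proof -
    let ?M = "mset_set S"
    have MS: "set_mset ?M \<subseteq> fplc" using S by auto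
    have "?zO \<subseteq> vanishing ?M"
    proof
      fix w assume "w \<in> ?zO"
      then obtain a where a: "a \<in> Oring" "w = z * a" by auto
      have "int (count ?M V) \<le> ord_at V w" if "w \<noteq> 0" "V \<in># ?M" for V
      proof -
        have V: "V \<in> S" "V \<in> fplc" "ord_at V z \<noteq> 0" using that S by auto
        interpret discrete_place "range \<iota>" FF V by (intro discrete fplc_plc V)
        have "ord_at V w = ord_at V z + ord_at V a"
          unfolding a(2) using that a assms by (intro ord_mult) (auto simp: O_FF)
        moreover have "ord_at V a \<ge> 0" "ord_at V z \<ge> 0" using ord_O_nonneg[OF V(2)] a that assms by auto
        ultimately show ?thesis using V S(2) by simp
      qed
      then show "w \<in> vanishing ?M" using a assms by (auto simp: vanishing_def)
    qed
    moreover have "vanishing ?M \<subseteq> Oring" by (auto simp: vanishing_def)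
    ultimately obtain k l where kl: "qdim Oring (vanishing ?M) k" "k + l = N"
      by (rule qdim_between[OF N subspace_vanishing[OF MS] szO])
    have "mdeg ?M \<le> N" using qdim_unique[OF kl(1) qdim_vanishing[OF MS] subspace_vanishing[OF MS]] kl(2) by simp
    moreover have "card S \<le> mdeg ?M"
    proof -
      have "mdeg ?M = (\<Sum>V\<in>S. place_degree (range \<iota>) V)"
        unfolding mdeg_def by (simp add: sum_unfold_sum_mset)
      moreover have "(\<Sum>V\<in>S. 1) \<le> (\<Sum>V\<in>S. place_degree (range \<iota>) V)"
        using S place_degree_pos by (intro sum_mono) (force simp: Suc_le_eq)
      ultimately show ?thesis by simp
    qed
    ultimately show ?thesis using S(2) by simp
  qed
  then show ?thesis using finite_if_finite_subsets_card_bdd[of "{V \<in> fplc. ord_at V z \<noteq> 0}" N] by blast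
qed

subsection \<open>Functions with a pole only at infinity\<close>

text \<open>
  The functions with no pole except one of order at most \<open>n\<close> at infinity. For negative \<open>n\<close>, which arbitrary
  divisors of negative degree lead to, only \<open>0\<close> remains.
\<close>

definition LL :: "int \<Rightarrow> 'a set" where
  "LL n = {a \<in> Oring. a = 0 \<or> int (dg a) \<le> n}"

lemma dg_scale: "a \<in> Oring \<Longrightarrow> \<iota> c * a = 0 \<or> dg (\<iota> c * a) = dg a"
  by (cases "c = 0"; cases "a = 0") (auto simp: dg_mult dg_emb)

lemma subspace_LL: "vs.subspace (LL n)"
proof (rule vs.subspaceI)
  fix a b assume "a \<in> LL n" "b \<in> LL n"
  then show "a + b \<in> LL n"
    using dg_add_le[of a b "nat n"] by (cases "a = 0"; cases "b = 0") (auto simp: LL_def le_nat_iff)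
next
  fix c a assume "a \<in> LL n"
  then show "\<iota> c * a \<in> LL n" using dg_scale[of a c] by (auto simp: LL_def)
qed (simp add: LL_def)

lemma LL_O: "LL n \<subseteq> Oring" and LL_mono: "m \<le> n \<Longrightarrow> LL m \<subseteq> LL n"
  by (auto simp: LL_def)

text \<open>
  Two functions with the same pole order have proportional leading terms, so each pole order that
  occurs in the ideal \<open>I\<close> contributes one dimension.
\<close>

lemma qdim_LL_step:
  assumes "vs.subspace I" "I \<subseteq> Oring"
  shows "qdim (LL (n + 1) \<inter> I) (LL n \<inter> I) (if \<exists>e\<in>I. e \<noteq> 0 \<and> int (dg e) = n + 1 then 1 else 0)"
proof (cases "\<exists>e\<in>I. e \<noteq> 0 \<and> int (dg e) = n + 1")
  case True
  then obtain e where e: "e \<in> I" "e \<noteq> 0" "int (dg e) = n + 1" by blast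
  then have eO: "e \<in> Oring" using assms by auto
  have "qdim (LL (n + 1) \<inter> I) (LL n \<inter> I) 1"
  proof (rule qdim_1I[of e])
    show "vs.subspace (LL n \<inter> I)" by (intro vs_subspace_Int subspace_LL assms)
    fix z assume z: "z \<in> LL (n + 1) \<inter> I"
    show "\<exists>c. z - \<iota> c * e \<in> LL n \<inter> I"
    proof (cases "z = 0 \<or> int (dg z) \<le> n")
      case True
      then have "z - \<iota> 0 * e \<in> LL n \<inter> I" using z by (auto simp: LL_def)
      then show ?thesis by blast
    next
      case False
      then have d: "dg z = dg e" using z e by (auto simp: LL_def)
      obtain c where c: "z - \<iota> c * e = 0 \<or> dg (z - \<iota> c * e) < dg e"
        using lead_cancel[OF _ eO _ e(2) d] z False by (auto simp: LL_def)
      have "z - \<iota> c * e \<in> I" using z e(1) vs.subspace_diff[OF assms(1)] vs.subspace_scale[OF assms(1)] by auto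
      moreover have "z - \<iota> c * e = 0 \<or> int (dg (z - \<iota> c * e)) \<le> n" using c e(3) by linarith
      ultimately show ?thesis using assms(2) by (auto simp: LL_def intro!: exI[of _ c])
    qed
  qed (use e eO in \<open>auto simp: LL_def\<close>)
  then show ?thesis using True by simp
next
  case False
  then have "LL (n + 1) \<inter> I \<subseteq> LL n \<inter> I" using zle_add1_eq_le by (force simp: LL_def)
  then have "qdim (LL (n + 1) \<inter> I) (LL n \<inter> I) 0" by (simp only: qdim_0_iff)
  then show ?thesis unfolding if_not_P[OF False] .
qed

lemma odd_dg_ge:
  assumes "a \<in> Oring" "a \<noteq> 0" "odd (dg a)" shows "2 * g + 1 \<le> dg a"
proof (rule ccontr)
  assume *: "\<not> ?thesis"
  then have "im a = 0" using dg_le_iff[OF assms(1,2), of "dg a"] by auto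
  then have a: "a = pe (re a)" using el_re_im[OF assms(1)] by (simp add: el_def)
  then have "re a \<noteq> 0" using assms(2) re_im_nonzero[OF assms(1,2)] \<open>im a = 0\<close> by blast
  then have "dg a = 2 * degree (re a)" by (subst a) (rule dg_pe)
  then show False using assms(3) by simp
qed

text \<open>
  Even pole orders come from powers of \<open>x\<close>, odd ones from powers of \<open>x\<close> times \<open>y\<close>.
\<close>

lemma dg_values: "(\<exists>e\<in>Oring. e \<noteq> 0 \<and> dg e = n) \<longleftrightarrow> even n \<or> 2 * g + 1 \<le> n"
proof
  assume "even n \<or> 2 * g + 1 \<le> n"
  then consider k where "n = 2 * k" | k where "n = 2 * g + 1 + 2 * k"
  proof (cases "even n")
    case False
    assume *: "\<And>k. n = 2 * g + 1 + 2 * k \<Longrightarrow> thesis" "even n \<or> 2 * g + 1 \<le> n"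
    then have "n = 2 * g + 1 + 2 * ((n - (2 * g + 1)) div 2)" using False by presburger
    then show ?thesis by (rule *)
  qed auto
  then show "\<exists>e\<in>Oring. e \<noteq> 0 \<and> dg e = n"
  proof cases
    case 1
    have "dg (pe (monom 1 k)) = n" using dg_pe[of "monom 1 k"] 1 by (simp add: degree_monom_eq monom_eq_0_iff)
    moreover have "pe (monom 1 k) \<noteq> 0" by (simp add: monom_eq_0_iff)
    ultimately show ?thesis using O_pe by blast
  next
    case 2
    have y0: "y \<noteq> 0" using y_square' f_nonzero by auto
    have m0: "pe (monom 1 k) \<noteq> 0" by (simp add: monom_eq_0_iff)
    have "dg (pe (monom 1 k) * y) = n"
      using dg_mult[OF O_pe O_y m0 y0] dg_pe[of "monom 1 k"] 2 dg_y by (simp add: degree_monom_eq monom_eq_0_iff)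
    moreover have "pe (monom 1 k) * y \<noteq> 0" using y0 m0 by simp
    ultimately show ?thesis using O_mult[OF O_pe O_y] by blast
  qed
qed (use odd_dg_ge in auto)

lemma qdim_LL_small: "qdim (LL (int n)) {0} (if n < 2 * g then n div 2 + 1 else n + 1 - g)"
proof (induction n)
  case 0
  have "LL (- 1) = {0}" by (auto simp: LL_def)
  moreover have "\<exists>e\<in>Oring. e \<noteq> 0 \<and> int (dg e) = - 1 + 1" using dg_values[of 0] by auto
  ultimately have "qdim (LL 0) {0} 1"
    using qdim_LL_step[OF subspace_O order_refl, of "- 1"] LL_O by (auto simp: inf.absorb1)
  then show ?case by auto
next
  case (Suc n)
  have ex: "(\<exists>e\<in>Oring. e \<noteq> 0 \<and> int (dg e) = int n + 1) \<longleftrightarrow> even (Suc n) \<or> 2 * g + 1 \<le> Suc n"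
    using dg_values[of "Suc n"] by (metis of_nat_Suc of_nat_eq_iff add.commute)
  have "qdim (LL (int n + 1)) (LL (int n)) (if even (Suc n) \<or> 2 * g + 1 \<le> Suc n then 1 else 0)"
    using qdim_LL_step[OF subspace_O order_refl, of "int n"] LL_O unfolding ex by (auto simp: inf.absorb1)
  from qdim_add[OF this Suc subspace_LL _ LL_mono] have *: "qdim (LL (int n + 1)) {0}
    ((if even (Suc n) \<or> 2 * g + 1 \<le> Suc n then 1 else 0) + (if n < 2 * g then n div 2 + 1 else n + 1 - g))"
    by (simp add: LL_def)
  have "(if even (Suc n) \<or> 2 * g + 1 \<le> Suc n then 1 else 0) + (if n < 2 * g then n div 2 + 1 else n + 1 - g) =
    (if Suc n < 2 * g then Suc n div 2 + 1 else Suc n + 1 - g)"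
    by (auto split: if_splits; presburger)
  then show ?case using * by (simp add: add.commute)
qed

lemma qdim_LL: "2 * g \<le> n \<Longrightarrow> qdim (LL (int n)) {0} (n + 1 - g)"
  using qdim_LL_small[of n] by simp

text \<open>
  Finitely many representatives have bounded pole order.
\<close>

lemma LL_exhausts:
  assumes "qdim Oring W s"
  obtains n0 where "\<And>n z. n0 \<le> n \<Longrightarrow> z \<in> Oring \<Longrightarrow> \<exists>v\<in>LL (int n). z - v \<in> W"
proof -
  obtain E where E: "quot_basis Oring W E" using assms by (auto simp: qdim_def)
  have fin: "finite E" and sub: "E \<subseteq> Oring" using E by (auto simp: quot_basis_def)
  show thesis
  proof (rule that[of "\<Sum>e\<in>E. dg e"])
    fix n z assume n: "(\<Sum>e\<in>E. dg e) \<le> n" and z: "z \<in> Oring"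
    have "E \<subseteq> LL (int n)"
    proof
      fix e assume e: "e \<in> E"
      then have "dg e \<le> (\<Sum>e\<in>E. dg e)" using fin by (intro member_le_sum) auto
      then show "e \<in> LL (int n)" using e n sub by (auto simp: LL_def)
    qed
    then have "lincomb c E \<in> LL (int n)" for c by (rule lincomb_in_subspace[OF subspace_LL])
    then show "\<exists>v\<in>LL (int n). z - v \<in> W" using E z unfolding quot_basis_def by blast
  qed
qed

text \<open>
  For large \<open>n\<close> the conditions of vanishing on \<open>M\<close> are independent on the functions of pole order at most
  \<open>n\<close>, since these represent all of \<open>O\<close> modulo the ideal.
\<close>

lemma qdim_LL_vanishing:
  assumes "set_mset M \<subseteq> fplc"
  obtains n0 where "\<And>n. n0 \<le> n \<Longrightarrow> 2 * g \<le> n \<and> mdeg M + g \<le> n + 1 \<and>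
    qdim (LL (int n) \<inter> vanishing M) {0} (n + 1 - g - mdeg M)"
proof -
  let ?I = "vanishing M"
  have sI: "vs.subspace ?I" by (rule subspace_vanishing[OF assms])
  have IO: "?I \<subseteq> Oring" by (auto simp: vanishing_def)
  obtain n0 where n0: "\<And>n z. n0 \<le> n \<Longrightarrow> z \<in> Oring \<Longrightarrow> \<exists>v\<in>LL (int n). z - v \<in> ?I"
    using LL_exhausts[OF qdim_vanishing[OF assms]] by blast
  show thesis
  proof (rule that[of "max n0 (2 * g)"])
    fix n assume "max n0 (2 * g) \<le> n"
    then have n: "n0 \<le> n" "2 * g \<le> n" by auto
    have sLI: "vs.subspace (LL (int n) \<inter> ?I)" by (intro vs_subspace_Int subspace_LL sI)
    have z: "0 \<in> LL (int n) \<inter> ?I" by (auto simp: LL_def vanishing_def)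
    obtain k l where kl: "qdim (LL (int n)) (LL (int n) \<inter> ?I) k" "qdim (LL (int n) \<inter> ?I) {0} l" "k + l = n + 1 - g"
      by (rule qdim_between[OF qdim_LL[OF n(2)] sLI vs.subspace_single_0]) (use z in auto)
    have "qdim Oring ?I k"
      by (rule qdim_transport[OF kl(1) sLI subspace_LL one_neq_zero _ _ _ sI]) (use n0[OF n(1)] LL_O in auto)
    then have "k = mdeg M" using qdim_unique[OF _ qdim_vanishing[OF assms] sI] by blast
    then show "2 * g \<le> n \<and> mdeg M + g \<le> n + 1 \<and> qdim (LL (int n) \<inter> ?I) {0} (n + 1 - g - mdeg M)"
    proof -
      have "l = n + 1 - g - mdeg M" using kl(3) \<open>k = mdeg M\<close> by linarith
      then show ?thesis using kl(2,3) n \<open>k = mdeg M\<close> by auto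
    qed
  qed
qed

subsection \<open>Principal divisors have degree zero\<close>

lemma ex_mset:
  assumes "finite S" "\<And>V. V \<notin> S \<Longrightarrow> h V = (0::nat)" "\<And>V. h V \<noteq> 0 \<Longrightarrow> V \<in> fplc"
  obtains M where "\<And>V. count M V = h V" "set_mset M \<subseteq> fplc"
proof -
  have "finite {V. h V > 0}" by (rule finite_subset[OF _ assms(1)]) (use assms(2) in fastforce)
  then have c: "count (Abs_multiset h) = h" by (rule count_Abs_multiset)
  then have "set_mset (Abs_multiset h) \<subseteq> fplc" using assms(3) by (auto simp: set_mset_def)
  then show thesis using that c by metis
qed

lemma zero_divisor:
  assumes "z \<in> Oring" "z \<noteq> 0"
  obtains M where "\<And>V. count M V = (if V \<in> fplc then nat (ord_at V z) else 0)" "set_mset M \<subseteq> fplc"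
  by (rule ex_mset[OF finite_zeros[OF assms], of "\<lambda>V. if V \<in> fplc then nat (ord_at V z) else 0"]) (auto split: if_splits)

text \<open>
  The codimension of \<open>z O\<close> in \<open>O\<close> is counted twice. By normality \<open>z O\<close> is the ideal of the zeros of \<open>z\<close>, which
  gives the degree of the divisor of zeros. Filtering by pole order at infinity, multiplication by \<open>z\<close> shifts
  the filtration by \<open>dg z\<close>, which gives the order of the pole.
\<close>

lemma degree_zero_divisor:
  assumes "z \<in> Oring" "z \<noteq> 0" "\<And>V. count M V = (if V \<in> fplc then nat (ord_at V z) else 0)" "set_mset M \<subseteq> fplc"
  shows "mdeg M = dg z"
proof -
  let ?zO = "(*) z ` Oring"
  have zF: "z \<in> FF" by (rule O_FF[OF assms(1)])
  have szO: "vs.subspace ?zO" by (rule subspace_scale_image[OF subspace_O])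
  have eq: "vanishing M = ?zO"
  proof safe
    fix w assume w: "w \<in> vanishing M"
    have wF: "w \<in> FF" "w \<in> Oring" using w by (auto simp: vanishing_def O_FF)
    have "w / z \<in> Oring"
    proof (cases "w = 0")
      case False
      show ?thesis
      proof (rule normal)
        show "w / z \<in> FF" using subfield_closed(3)[OF subfield_FF wF(1) zF] .
        fix V assume "V \<in> plc" "x \<in> V"
        then have V: "V \<in> fplc" by (simp add: fplc_def)
        interpret discrete_place "range \<iota>" FF V by (intro discrete fplc_plc V)
        have "ord_at V z \<le> ord_at V w"
        proof (cases "V \<in># M")
          case True
          then have "int (count M V) \<le> ord_at V w" using w False by (auto simp: vanishing_def)
          then show ?thesis using assms(3)[of V] V ord_O_nonneg[OF V assms(1,2)] by simp
        next
          case False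
          then have "nat (ord_at V z) = 0" using assms(3)[of V] V by (simp add: not_in_iff)
          then show ?thesis using ord_O_nonneg[OF V wF(2) \<open>w \<noteq> 0\<close>] by simp
        qed
        then show "w / z \<in> V" using ord_ge_iff[OF wF(1) False zF assms(2)] by simp
      qed
    qed simp
    moreover have "w = z * (w / z)" using assms(2) by simp
    ultimately show "w \<in> ?zO" by blast
  next
    fix a assume a: "a \<in> Oring"
    have "int (count M V) \<le> ord_at V (z * a)" if "V \<in># M" "z * a \<noteq> 0" for V
    proof -
      have V: "V \<in> fplc" using that assms(4) by auto
      interpret discrete_place "range \<iota>" FF V by (intro discrete fplc_plc V)
      have "ord_at V (z * a) = ord_at V z + ord_at V a" using that zF a assms(2) by (intro ord_mult) (auto simp: O_FF)
      then show ?thesis using assms(3)[of V] V ord_O_nonneg[OF V a] ord_O_nonneg[OF V assms(1,2)] that by auto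
    qed
    then show "z * a \<in> vanishing M" using a assms(1) by (auto simp: vanishing_def)
  qed
  have s: "qdim Oring ?zO (mdeg M)" using qdim_vanishing[OF assms(4)] eq by simp
  obtain n0 where n0: "\<And>n w. n0 \<le> n \<Longrightarrow> w \<in> Oring \<Longrightarrow> \<exists>v\<in>LL (int n). w - v \<in> ?zO"
    using LL_exhausts[OF s] by blast
  define n where "n = n0 + 2 * g + dg z"
  \<comment> \<open>Large enough that both filtration steps have the generic dimension and exhaust O modulo z O.\<close>
  define m where "m = n0 + 2 * g"
  have z0: "0 \<in> ?zO" using vs.subspace_0[OF szO] .
  have szL: "vs.subspace ((*) z ` LL (int m))" by (rule subspace_scale_image[OF subspace_LL])
  have zL: "(*) z ` LL (int m) = LL (int n) \<inter> ?zO"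
  proof safe
    fix a assume a: "a \<in> LL (int m)"
    show "z * a \<in> LL (int n)"
    proof (cases "a = 0")
      case False
      then show ?thesis using a assms(1) dg_mult[OF assms(1) _ assms(2) False] by (auto simp: LL_def m_def n_def)
    qed (simp add: LL_def)
    show "z * a \<in> ?zO" using a LL_O by auto
  next
    fix a assume a: "a \<in> Oring" "z * a \<in> LL (int n)"
    have "a \<in> LL (int m)"
    proof (cases "a = 0")
      case False
      then show ?thesis using a assms(2) dg_mult[OF assms(1) a(1) assms(2) False] by (auto simp: LL_def m_def n_def)
    qed (simp add: LL_def)
    then show "z * a \<in> (*) z ` LL (int m)" by blast
  qed
  have 1: "qdim ((*) z ` LL (int m)) {0} (m + 1 - g)"
    by (rule qdim_transport[OF qdim_LL vs.subspace_single_0 subspace_LL assms(2)]) (auto simp: m_def assms(2) vs.subspace_single_0)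
  have 2: "qdim (LL (int n)) {0} (n + 1 - g)" by (rule qdim_LL) (simp add: n_def)
  obtain k l where kl: "qdim (LL (int n)) ((*) z ` LL (int m)) k" "qdim ((*) z ` LL (int m)) {0} l" "k + l = n + 1 - g"
    by (rule qdim_between[OF 2 szL vs.subspace_single_0]) (use zL z0 in \<open>auto simp: LL_def\<close>)
  have "l = m + 1 - g" by (rule qdim_unique[OF kl(2) 1 vs.subspace_single_0])
  then have k: "k = dg z" using kl(3) by (simp add: m_def n_def)
  have "qdim Oring ?zO k"
  proof (rule qdim_transport[OF kl(1) szL subspace_LL one_neq_zero _ _ _ szO])
    show "\<exists>v\<in>LL (int n). w - 1 * v \<in> ?zO" if "w \<in> Oring" for w using n0[of n w] that by (simp add: n_def)
    show "1 * w \<in> ?zO \<longleftrightarrow> w \<in> (*) z ` LL (int m)" if "w \<in> LL (int n)" for w using that zL by auto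
  qed (use LL_O in auto)
  then show ?thesis using k qdim_unique[OF s _ szO] by simp
qed

lemma finite_ord_support:
  assumes "z \<in> FF" "z \<noteq> 0" shows "finite {V \<in> plc. ord_at V z \<noteq> 0}"
proof -
  obtain a b where ab: "a \<in> Oring" "b \<in> Oring" "b \<noteq> 0" "z = a / b" using FF_cases[OF assms(1)] .
  then have a0: "a \<noteq> 0" using assms by auto
  have "{V \<in> plc. ord_at V z \<noteq> 0} \<subseteq> insert Vinf ({V \<in> fplc. ord_at V a \<noteq> 0} \<union> {V \<in> fplc. ord_at V b \<noteq> 0})"
  proof (intro subsetI)
    fix V assume V: "V \<in> {V \<in> plc. ord_at V z \<noteq> 0}"
    interpret discrete_place "range \<iota>" FF V using V by (intro discrete) auto
    have "ord_at V z = ord_at V a - ord_at V b" unfolding ab(4) using ab a0 by (intro ord_divide) (auto simp: O_FF)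
    then show "V \<in> insert Vinf ({V \<in> fplc. ord_at V a \<noteq> 0} \<union> {V \<in> fplc. ord_at V b \<noteq> 0})"
      using V plc_cases[of V] by auto
  qed
  then show ?thesis using finite_zeros[OF ab(1) a0] finite_zeros[OF ab(2,3)] finite_subset by blast
qed

abbreviation "dv \<equiv> div_of (range \<iota>) FF"
abbreviation "ddeg \<equiv> div_degree (range \<iota>)"

lemma lookup_dv:
  assumes "z \<in> FF" "z \<noteq> 0"
  shows "Poly_Mapping.lookup (dv z) V = (if V \<in> plc then ord_at V z else 0)"
proof -
  have "finite {V. (if V \<in> plc then ord_at V z else 0) \<noteq> 0}"
    using finite_ord_support[OF assms] by (rule finite_subset[rotated]) auto
  then show ?thesis unfolding div_of_def by simp
qed

lemma keys_dv: "z \<in> FF \<Longrightarrow> z \<noteq> 0 \<Longrightarrow> Poly_Mapping.keys (dv z) \<subseteq> plc"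
  by (auto simp: in_keys_iff lookup_dv split: if_splits)

lemma dv_mult:
  assumes "z \<in> FF" "z \<noteq> 0" "w \<in> FF" "w \<noteq> 0" shows "dv (z * w) = dv z + dv w"
proof (rule poly_mapping_eqI)
  fix V
  have "z * w \<in> FF" "z * w \<noteq> 0" using assms subfieldD(4)[OF subfield_FF] by auto
  then show "Poly_Mapping.lookup (dv (z * w)) V = Poly_Mapping.lookup (dv z + dv w) V"
    using assms discrete_place.ord_mult[OF discrete, of V z w] by (simp add: lookup_add lookup_dv)
qed

lemma dv_1: "dv 1 = 0"
  by (rule poly_mapping_eqI)
    (auto simp: lookup_dv O_FF discrete_place.ord_1[OF discrete])

lemma ddeg_mset:
  assumes "set_mset M \<subseteq> fplc" "\<And>V. V \<in> fplc \<Longrightarrow> Poly_Mapping.lookup D V = int (count M V)"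
    "Poly_Mapping.lookup D Vinf = k" "Poly_Mapping.keys D \<subseteq> plc"
  shows "ddeg D = int (mdeg M) + k"
proof -
  let ?S = "insert Vinf (set_mset M)"
  have sub: "Poly_Mapping.keys D \<subseteq> ?S"
  proof
    fix V assume V: "V \<in> Poly_Mapping.keys D"
    show "V \<in> ?S"
    proof (cases "V = Vinf")
      case False
      then have "V \<in> fplc" using V assms(4) plc_cases by blast
      then show ?thesis using V assms(2)[of V] by (auto simp: in_keys_iff)
    qed simp
  qed
  have nin: "Vinf \<notin> set_mset M" using assms(1) Vinf_notin_fplc by auto
  have "ddeg D = (\<Sum>V\<in>?S. Poly_Mapping.lookup D V * int (place_degree (range \<iota>) V))"
    by (rule div_degree_superset[OF _ sub]) simp
  also have "\<dots> = k + (\<Sum>V\<in>set_mset M. Poly_Mapping.lookup D V * int (place_degree (range \<iota>) V))"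
    using nin qdim_Vinf assms(3) by simp
  also have "(\<Sum>V\<in>set_mset M. Poly_Mapping.lookup D V * int (place_degree (range \<iota>) V)) =
      int (\<Sum>V\<in>set_mset M. count M V * place_degree (range \<iota>) V)"
    using assms(1,2) by (auto simp: of_nat_sum intro!: sum.cong)
  finally show ?thesis by (simp add: mdeg_def sum_mset_eq_sum_count)
qed

lemma ddeg_dv_O: assumes "z \<in> Oring" "z \<noteq> 0" shows "ddeg (dv z) = 0"
proof -
  obtain M where M: "\<And>V. count M V = (if V \<in> fplc then nat (ord_at V z) else 0)" "set_mset M \<subseteq> fplc"
    using zero_divisor[OF assms] by blast
  have zF: "z \<in> FF" by (rule O_FF[OF assms(1)])
  have "ddeg (dv z) = int (mdeg M) + ord_at Vinf z"
    using M assms zF keys_dv[OF zF assms(2)] fplc_plc Vinf_place ord_O_nonneg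
    by (intro ddeg_mset) (auto simp: lookup_dv)
  then show ?thesis using degree_zero_divisor[OF assms M] ord_Vinf[OF assms] by simp
qed

lemma ddeg_dv: assumes "z \<in> FF" "z \<noteq> 0" shows "ddeg (dv z) = 0"
proof -
  obtain a b where ab: "a \<in> Oring" "b \<in> Oring" "b \<noteq> 0" "z = a / b" using FF_cases[OF assms(1)] .
  then have a0: "a \<noteq> 0" using assms by auto
  have "dv (z * b) = dv z + dv b" using assms ab by (intro dv_mult) (auto simp: O_FF)
  then have "ddeg (dv a) = ddeg (dv z) + ddeg (dv b)" using ab div_degree_add by simp
  then show ?thesis using ddeg_dv_O ab a0 by simp
qed

subsection \<open>The genus\<close>

abbreviation "RR \<equiv> riemann_roch_space (range \<iota>) FF"

text \<open>
  Up to a principal divisor every divisor is \<open>m Vinf - M\<close> with \<open>M\<close> effective and finite. Its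
  Riemann--Roch space consists of the elements of \<open>O\<close> that vanish on \<open>M\<close> and have pole order at most \<open>m\<close>;
  their dimension is known for large \<open>m\<close> and drops by at most one when \<open>m\<close> is lowered by one.
\<close>

lemma riemann_inequality:
  assumes "Poly_Mapping.keys E \<subseteq> plc"
  shows "ddeg E - int (quot_dim (range \<iota>) (RR E) {0}) + 1 \<le> int g"
proof -
  let ?S = "Poly_Mapping.keys E \<inter> fplc"
  have "\<forall>V\<in>?S. \<exists>t. t \<in> Oring \<and> t \<noteq> 0 \<and> ord_at V t = 1" using ex_param_in_O by (metis IntD2)
  then obtain t where t: "\<And>V. V \<in> ?S \<Longrightarrow> t V \<in> Oring \<and> t V \<noteq> 0 \<and> ord_at V (t V) = 1" by metis
  \<comment> \<open>A common denominator: at every finite place the order of p is at least the coefficient of E.\<close>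
  define p where "p = (\<Prod>V\<in>?S. t V ^ nat (Poly_Mapping.lookup E V))"
  have prod: "(\<Prod>V\<in>S. t V ^ nat (Poly_Mapping.lookup E V)) \<in> Oring"
    "(\<Prod>V\<in>S. t V ^ nat (Poly_Mapping.lookup E V)) \<noteq> 0" if "S \<subseteq> ?S" "finite S" for S
    using t that by (auto intro!: O_prod O_power)
  have p: "p \<in> Oring" "p \<noteq> 0" using prod[OF order_refl] by (auto simp: p_def)
  have pF: "p \<in> FF" by (rule O_FF[OF p(1)])
  have ordp: "Poly_Mapping.lookup E V \<le> ord_at V p" if V: "V \<in> fplc" for V
  proof (cases "V \<in> ?S")
    case True
    interpret discrete_place "range \<iota>" FF V by (intro discrete fplc_plc V)
    let ?r = "\<Prod>W\<in>?S - {V}. t W ^ nat (Poly_Mapping.lookup E W)"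
    have r: "?r \<in> Oring" "?r \<noteq> 0" using prod[of "?S - {V}"] by auto
    have "p = t V ^ nat (Poly_Mapping.lookup E V) * ?r" unfolding p_def using True by (subst prod.remove[of _ V]) auto
    then have "ord_at V p = int (nat (Poly_Mapping.lookup E V)) + ord_at V ?r"
      using t[OF True] r by (simp only:) (subst ord_mult, auto simp: O_FF O_power ord_power)
    then show ?thesis using ord_O_nonneg[OF V r] by linarith
  next
    case False
    then have "Poly_Mapping.lookup E V = 0" using V by (simp add: in_keys_iff)
    then show ?thesis using ord_O_nonneg[OF V p] by simp
  qed
  obtain M where M: "\<And>V. count M V = (if V \<in> fplc then nat (ord_at V p - Poly_Mapping.lookup E V) else 0)" "set_mset M \<subseteq> fplc"
  proof (rule ex_mset[of "{V \<in> fplc. ord_at V p \<noteq> 0} \<union> Poly_Mapping.keys E" "\<lambda>V. if V \<in> fplc then nat (ord_at V p - Poly_Mapping.lookup E V) else 0"])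
    show "finite ({V \<in> fplc. ord_at V p \<noteq> 0} \<union> Poly_Mapping.keys E)" using finite_zeros[OF p] by simp
  qed (auto simp: in_keys_iff split: if_splits)
  define m where "m = Poly_Mapping.lookup E Vinf + int (dg p)"
  have "ddeg (dv p - E) = int (mdeg M) + (- m)"
  proof (rule ddeg_mset[OF M(2)])
    show "Poly_Mapping.lookup (dv p - E) V = int (count M V)" if "V \<in> fplc" for V
      using that M(1)[of V] ordp[OF that] fplc_plc[OF that] by (simp add: lookup_minus lookup_dv[OF pF p(2)])
    show "Poly_Mapping.lookup (dv p - E) Vinf = - m"
      using ord_Vinf[OF p] Vinf_place by (simp add: lookup_minus lookup_dv[OF pF p(2)] m_def)
    show "Poly_Mapping.keys (dv p - E) \<subseteq> plc"
      using keys_diff[of "dv p" E] keys_dv[OF pF p(2)] assms by blast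
  qed
  then have degE: "ddeg E = m - int (mdeg M)" using div_degree_diff[of "range \<iota>" "dv p" E] ddeg_dv[OF pF p(2)] by simp
  let ?I = "vanishing M"
  have sI: "vs.subspace ?I" by (rule subspace_vanishing[OF M(2)])
  have IO: "?I \<subseteq> Oring" by (auto simp: vanishing_def)
  have RR_iff: "z \<in> RR E \<longleftrightarrow> z * p \<in> LL m \<inter> ?I" if z: "z \<in> FF" for z
  proof (cases "z = 0")
    case True
    then show ?thesis using z by (simp add: riemann_roch_space_def LL_def vanishing_def)
  next
    case False
    have zp: "z * p \<in> FF" "z * p \<noteq> 0" using z pF p(2) False subfieldD(4)[OF subfield_FF] by auto
    have ordzp: "ord_at V (z * p) = ord_at V z + ord_at V p" if "V \<in> plc" for V
      using discrete_place.ord_mult[OF discrete[OF that] z False pF p(2)] .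
    have "z \<in> RR E \<longleftrightarrow> (\<forall>V\<in>plc. ord_at V z \<ge> - Poly_Mapping.lookup E V)"
      using z False by (simp add: riemann_roch_space_def)
    also have "\<dots> \<longleftrightarrow> (\<forall>V\<in>fplc. ord_at V (z * p) \<ge> int (count M V)) \<and> ord_at Vinf (z * p) \<ge> - m"
    proof -
      have "ord_at V z \<ge> - Poly_Mapping.lookup E V \<longleftrightarrow> ord_at V (z * p) \<ge> int (count M V)" if "V \<in> fplc" for V
        using ordzp[OF fplc_plc[OF that]] M(1)[of V] that ordp[OF that] by auto
      moreover have "ord_at Vinf z \<ge> - Poly_Mapping.lookup E Vinf \<longleftrightarrow> ord_at Vinf (z * p) \<ge> - m"
        using ordzp[OF Vinf_place] ord_Vinf[OF p] by (auto simp: m_def)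
      ultimately show ?thesis using plc_cases Vinf_place by metis
    qed
    also have "\<dots> \<longleftrightarrow> z * p \<in> LL m \<inter> ?I"
    proof
      assume *: "(\<forall>V\<in>fplc. ord_at V (z * p) \<ge> int (count M V)) \<and> ord_at Vinf (z * p) \<ge> - m"
      have O: "z * p \<in> Oring"
      proof (rule normal[OF zp(1)])
        fix V assume V: "V \<in> plc" "x \<in> V"
        then have "0 \<le> ord_at V (z * p)" using * by (force simp: fplc_def)
        then show "z * p \<in> V" using discrete_place.mem_iff_ord(1)[OF discrete[OF V(1)] zp] by simp
      qed
      then show "z * p \<in> LL m \<inter> ?I" using * M(2) ord_Vinf[OF O zp(2)] by (auto simp: LL_def vanishing_def)
    next
      assume *: "z * p \<in> LL m \<inter> ?I"
      then have O: "z * p \<in> Oring" by (simp add: LL_def)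
      have "ord_at V (z * p) \<ge> int (count M V)" if "V \<in> fplc" for V
      proof (cases "V \<in># M")
        case True
        then show ?thesis using * zp by (auto simp: vanishing_def)
      next
        case False
        then show ?thesis using ord_O_nonneg[OF that O zp(2)] by (simp add: not_in_iff)
      qed
      then show "(\<forall>V\<in>fplc. ord_at V (z * p) \<ge> int (count M V)) \<and> ord_at Vinf (z * p) \<ge> - m"
        using * ord_Vinf[OF O zp(2)] zp(2) by (auto simp: LL_def)
    qed
    finally show ?thesis .
  qed
  obtain n0 where n0: "\<And>n. n0 \<le> n \<Longrightarrow> 2 * g \<le> n \<and> mdeg M + g \<le> n + 1 \<and>
    qdim (LL (int n) \<inter> ?I) {0} (n + 1 - g - mdeg M)" using qdim_LL_vanishing[OF M(2)] by blast
  define n where "n = max n0 (nat m)"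
  have n: "2 * g \<le> n" "mdeg M + g \<le> n + 1" "qdim (LL (int n) \<inter> ?I) {0} (n + 1 - g - mdeg M)"
    using n0[of n] by (auto simp: n_def)
  \<comment> \<open>From the multiple n of infinity, for which the dimension is known, down to m: each step loses at most one.\<close>
  have chain: "\<exists>k\<le>j. qdim (LL (m + int j) \<inter> ?I) (LL m \<inter> ?I) k" for j
  proof (induction j)
    case 0
    then show ?case using qdim_0_iff by auto
  next
    case (Suc j)
    then obtain k where k: "k \<le> j" "qdim (LL (m + int j) \<inter> ?I) (LL m \<inter> ?I) k" by blast
    define i :: nat where "i = (if \<exists>e\<in>?I. e \<noteq> 0 \<and> int (dg e) = m + int j + 1 then 1 else 0)"
    have i: "i \<le> 1" "qdim (LL (m + int j + 1) \<inter> ?I) (LL (m + int j) \<inter> ?I) i"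
      using qdim_LL_step[OF sI IO, of "m + int j"] unfolding i_def by simp_all
    have "qdim (LL (m + int j + 1) \<inter> ?I) (LL m \<inter> ?I) (i + k)"
    proof (rule qdim_add[OF i(2) k(2)])
      show "LL m \<inter> ?I \<subseteq> LL (m + int j) \<inter> ?I" using LL_mono[of m "m + int j"] by auto
      show "LL (m + int j) \<inter> ?I \<subseteq> LL (m + int j + 1) \<inter> ?I" using LL_mono[of "m + int j" "m + int j + 1"] by auto
    qed (intro vs_subspace_Int subspace_LL sI)
    then show ?case using i(1) k(1) by (intro exI[of _ "i + k"]) (simp add: add.assoc add.commute[of 1])
  qed
  define j where "j = nat (int n - m)"
  have "m \<le> int n" unfolding n_def by linarith
  then have mj: "m + int j = int n" by (simp add: j_def)
  obtain k where k: "k \<le> j" "qdim (LL (int n) \<inter> ?I) (LL m \<inter> ?I) k" using chain[of j] mj by auto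
  obtain k' l where kl: "qdim (LL (int n) \<inter> ?I) (LL m \<inter> ?I) k'" "qdim (LL m \<inter> ?I) {0} l" "k' + l = n + 1 - g - mdeg M"
  proof (rule qdim_between[OF n(3), of "LL m \<inter> ?I"])
    show "LL m \<inter> ?I \<subseteq> LL (int n) \<inter> ?I" using LL_mono[of m "int n"] mj by auto
    show "{0} \<subseteq> LL m \<inter> ?I" by (auto simp: LL_def vanishing_def)
  qed (auto intro!: vs_subspace_Int subspace_LL sI vs.subspace_single_0)
  have "k' = k" using qdim_unique[OF kl(1) k(2)] vs_subspace_Int[OF subspace_LL sI] by blast
  have "qdim (RR E) {0} l"
  proof (rule qdim_transport[OF kl(2) vs.subspace_single_0 _ nonzero_imp_inverse_nonzero[OF p(2)]])
    show "vs.subspace (LL m \<inter> ?I)" by (intro vs_subspace_Int subspace_LL sI)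
    show "inverse p * z \<in> RR E" if "z \<in> LL m \<inter> ?I" for z
    proof -
      have "z \<in> FF" using that by (auto simp: LL_def O_FF)
      then have "inverse p * z \<in> FF" using subfieldD(4,5)[OF subfield_FF] pF by blast
      then show ?thesis using RR_iff[of "inverse p * z"] that p(2) by (simp add: field_simps)
    qed
    show "\<exists>v\<in>LL m \<inter> ?I. z - inverse p * v \<in> {0}" if "z \<in> RR E" for z
    proof -
      have "z \<in> FF" using that by (auto simp: riemann_roch_space_def)
      then have "z * p \<in> LL m \<inter> ?I" using RR_iff that by blast
      then show ?thesis using p(2) by (intro bexI[of _ "z * p"]) auto
    qed
  qed (use p(2) in \<open>auto simp: vs.subspace_single_0\<close>)
  then have "quot_dim (range \<iota>) (RR E) {0} = l" by (rule quot_dim_eq[OF _ vs.subspace_single_0])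
  moreover have "int l \<ge> int n + 1 - int g - int (mdeg M) - (int n - m)"
    using kl(3) \<open>k' = k\<close> k(1) n(2) mj by linarith
  ultimately show ?thesis using degE by linarith
qed

text \<open>
  The divisor \<open>2 g\<close> times infinity attains the bound of \<open>riemann_inequality\<close>.
\<close>

theorem genus_eq: "genus (range \<iota>) FF = int g"
  unfolding genus_def
proof (rule cSup_eq_maximum)
  define D :: "'a set \<Rightarrow>\<^sub>0 int" where "D = Poly_Mapping.single Vinf (2 * int g)"
  have lk: "Poly_Mapping.lookup D V = (if V = Vinf then 2 * int g else 0)" for V
    by (simp add: D_def lookup_single)
  have keys: "Poly_Mapping.keys D \<subseteq> plc" using Vinf_place by (auto simp: in_keys_iff lk split: if_splits)
  have deg: "ddeg D = 2 * int g"
  proof -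
    have "Poly_Mapping.lookup D V = int (count {#} V)" if "V \<in> fplc" for V
      using that lk[of V] Vinf_notin_fplc by auto
    then show ?thesis using ddeg_mset[of "{#}" D "2 * int g"] keys lk[of Vinf] by (simp add: mdeg_def)
  qed
  have "RR D = LL (2 * int g)"
  proof safe
    fix z assume z: "z \<in> RR D"
    then have zF: "z \<in> FF" by (auto simp: riemann_roch_space_def)
    show "z \<in> LL (2 * int g)"
    proof (cases "z = 0")
      case False
      have o: "\<forall>V\<in>plc. - Poly_Mapping.lookup D V \<le> ord_at V z" using z False by (simp add: riemann_roch_space_def)
      have O: "z \<in> Oring"
      proof (rule normal[OF zF])
        fix V assume V: "V \<in> plc" "x \<in> V"
        then show "z \<in> V" using o lk[of V] Vinf_not_finite[OF V] discrete_place.mem_iff_ord(1)[OF discrete[OF V(1)] zF False] by force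
      qed
      then show ?thesis using o Vinf_place lk ord_Vinf[OF O False] by (force simp: LL_def)
    qed (simp add: LL_def)
  next
    fix z assume z: "z \<in> LL (2 * int g)"
    then have O: "z \<in> Oring" by (simp add: LL_def)
    show "z \<in> RR D"
    proof (cases "z = 0")
      case False
      have "- Poly_Mapping.lookup D V \<le> ord_at V z" if "V \<in> plc" for V
        using that ord_Vinf[OF O False] ord_O_nonneg[OF _ O False, of V] z False plc_cases[of V] Vinf_notin_fplc
        by (auto simp: lk LL_def)
      then show ?thesis using O_FF[OF O] by (simp add: riemann_roch_space_def)
    qed (simp add: riemann_roch_space_def subfieldD(1)[OF subfield_FF])
  qed
  then have "qdim (RR D) {0} (g + 1)" using qdim_LL[of "2 * g"] by simp
  then have "quot_dim (range \<iota>) (RR D) {0} = g + 1" by (rule quot_dim_eq[OF _ vs.subspace_single_0])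
  then have "int g = ddeg D - int (quot_dim (range \<iota>) (RR D) {0}) + 1" using deg by simp
  moreover have "D \<in> carrier (divisor_group (range \<iota>) FF)" using keys by (simp add: divisor_group_def)
  ultimately show "int g \<in> {ddeg D - int (quot_dim (range \<iota>) (RR D) {0}) + 1 | D. D \<in> carrier (divisor_group (range \<iota>) FF)}"
    by blast
next
  fix v assume "v \<in> {ddeg D - int (quot_dim (range \<iota>) (RR D) {0}) + 1 | D. D \<in> carrier (divisor_group (range \<iota>) FF)}"
  then show "v \<le> int g" using riemann_inequality by (auto simp: divisor_group_def)
qed

subsection \<open>Functions with one double pole\<close>

text \<open>
  At infinity a double pole means \<open>dg h' \<le> 2\<close>, which leaves the polynomials in \<open>x\<close> of degree one. Suppose
  \<open>W\<close> is a finite rational place, given by a point \<open>(a, b)\<close>; as \<open>f\<close> has no root, \<open>b \<noteq> 0\<close> and \<open>(a, - b)\<close> is a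
  second place over \<open>a\<close>. Then \<open>(x - a)\<^sup>2 h'\<close> lies in \<open>O\<close> and has pole order at most four, less than that of
  \<open>y\<close>, so it is a polynomial in \<open>x\<close>. It vanishes doubly at \<open>(a, - b)\<close>, hence is divisible by
  \<open>(x - a)\<^sup>2\<close>, and \<open>h'\<close> has no pole at \<open>W\<close>.
\<close>

lemma double_pole:
  assumes g2: "2 \<le> g" and noroot: "\<And>a. poly f a \<noteq> 0"
    and hF: "h' \<in> FF" "h' \<notin> W" and W: "W \<in> plc"
    and other: "\<And>V. V \<in> plc \<Longrightarrow> V \<noteq> W \<Longrightarrow> h' \<in> V"
    and double: "\<And>s. s \<in> max_ideal W \<Longrightarrow> s ^ 2 * h' \<in> W"
    and rational: "\<And>z. z \<in> W \<Longrightarrow> \<exists>c. z - \<iota> c \<in> max_ideal W"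
  obtains a b where "a \<noteq> 0" "h' = pe [:b, a:]"
proof -
  interpret W: discrete_place "range \<iota>" FF W by (rule discrete[OF W])
  have h0: "h' \<noteq> 0" using hF by auto
  show thesis
  proof (cases "W = Vinf")
    case True
    have O: "h' \<in> Oring"
      by (rule normal[OF hF(1)]) (use other Vinf_not_finite True in blast)
    obtain s where s: "uniformizer W s" "s \<noteq> 0" "s \<in> max_ideal W" "s \<in> FF" using W.uniformizer_obtain by metis
    have "s ^ 2 * h' \<in> FF" "s ^ 2 * h' \<noteq> 0" using double[OF s(3)] W.V_sub_F s(2) h0 by auto
    then have "0 \<le> ord_at W (s ^ 2 * h')" using double[OF s(3)] W.mem_iff_ord(1) by blast
    also have "\<dots> = 2 + ord_at W h'"
      using s hF(1) h0 W.ord_uniformizer[OF s(1)] W.ord_mult[of "s ^ 2" h'] W.ord_power[of s 2]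
        subfield_closed(4)[OF subfield_FF s(4)] by simp
    finally have "dg h' \<le> 2" using ord_Vinf[OF O h0] True by simp
    then have *: "im h' = 0" "degree (re h') \<le> 1"
      using dg_le_iff[OF O h0, of 2] g2 by (cases "re h' = 0"; auto)+
    then have Xp: "h' = pe (re h')" using el_re_im[OF O] by (simp add: el_def)
    obtain a b where ab: "re h' = [:b, a:]" 
    proof -
      obtain b q where 1: "re h' = pCons b q" by (cases "re h'")
      then have "degree q = 0" using *(2) by (auto split: if_splits)
      then obtain a where "q = [:a:]" by (rule degree_eq_zeroE)
      then show thesis using that 1 by blast
    qed
    have "a \<noteq> 0"
    proof
      assume "a = 0"
      then have "h' = \<iota> b" using Xp ab by simp
      then show False using hF(2) W.K_sub_V by blast
    qed
    then show thesis using that Xp ab by metis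
  next
    case False
    then have xW: "x \<in> W" using place_cases[OF W] by blast
    note OW = O_sub_place[OF W xW]
    obtain a where a: "x - \<iota> a \<in> max_ideal W" using rational[OF xW] by blast
    obtain b where b: "y - \<iota> b \<in> max_ideal W" using rational[OF OW[OF O_y]] by blast
    have xaO: "x - \<iota> a \<in> Oring" by (intro O_diff O_x O_emb)
    have "[:- a, 1:] dvd f - [:poly f a:]" by (simp add: poly_eq_0_iff_dvd[symmetric])
    then obtain h where "f - [:poly f a:] = [:- a, 1:] * h" by blast
    then have "pe (f - [:poly f a:]) = pe ([:- a, 1:] * h)" by simp
    then have "pe f - \<iota> (poly f a) = (x - \<iota> a) * pe h" unfolding pe_diff pe_mult by (simp add: pe_pCons emb_uminus emb_1)
    then have 1: "pe f - \<iota> (poly f a) \<in> max_ideal W" using W.max_ideal_mult(1)[OF a OW[OF O_pe]] by simp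
    have "(y - \<iota> b) * (y + \<iota> b) \<in> max_ideal W" using W.max_ideal_mult(1)[OF b] OW O_add[OF O_y O_emb] by blast
    then have 2: "pe f - \<iota> (b ^ 2) \<in> max_ideal W"
      by (simp add: y_square'[symmetric] emb_mult power2_eq_square algebra_simps)
    have "\<iota> (poly f a - b ^ 2) \<in> max_ideal W" using W.max_ideal_diff[OF 2 1] by (simp add: emb_diff)
    then have pt: "b ^ 2 = poly f a" using W.const_unit[of "\<iota> (poly f a - b ^ 2)"] by fastforce
    then have b0: "b \<noteq> 0" using noroot[of a] by auto
    have pt': "(- b) ^ 2 = poly f a" "- b \<noteq> 0" using pt b0 by auto
    let ?P = "Vpt a (- b)"
    have Pplc: "?P \<in> plc" by (rule Vpt_place[OF pt'])
    interpret P: place "range \<iota>" FF ?P by (rule placeI[OF Pplc])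
    have t: "tpt a = x - \<iota> a" by (rule tpt_def[OF pt b0])
    have Wpt: "W = Vpt a b" using point_loc_param(2)[OF pt b0 W] a b t by simp
    have "b \<noteq> - b"
    proof
      assume "b = - b"
      then have "b + b = 0" by (simp only: eq_neg_iff_add_eq_0)
      then have "\<iota> b + \<iota> b = 0" unfolding emb_add[symmetric] by (simp only: emb_0)
      then have "2 * \<iota> b = 0" by (simp only: mult_2)
      then show False using b0 by simp
    qed
    then have PW: "?P \<noteq> W" using Vpt_distinct(2)[OF pt' pt b0] Wpt by metis
    have XP: "h' \<in> ?P" by (rule other[OF Pplc PW])
    have Xinf: "h' \<in> Vinf" using other[OF Vinf_place] False by blast
    let ?w = "(x - \<iota> a) ^ 2 * h'"
    have wF: "?w \<in> FF" using subfieldD(4)[OF subfield_FF O_FF[OF O_power[OF xaO]] hF(1)] .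
    have tn: "x - \<iota> a \<noteq> 0" using x_notin_K[of a] by simp
    have w0: "?w \<noteq> 0" using h0 tn by simp
    have wO: "?w \<in> Oring"
    proof (rule normal[OF wF])
      fix V assume V: "V \<in> plc" "x \<in> V"
      interpret V: place "range \<iota>" FF V by (rule placeI[OF V(1)])
      show "?w \<in> V"
      proof (cases "V = W")
        case True
        then show ?thesis using double[OF a] by simp
      next
        case False
        then show ?thesis using other[OF V(1) False] O_sub_place[OF V O_power[OF xaO]] V.V_mult by blast
      qed
    qed
    have "dg (x - \<iota> a) = 2"
    proof -
      have "x - \<iota> a = pe [:- a, 1:]" by (simp add: pe_pCons emb_uminus emb_1)
      then show ?thesis using dg_pe[of "[:- a, 1:]"] by simp
    qed
    then have "ord_at Vinf ((x - \<iota> a) ^ 2) = - 4"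
      using discrete_place.ord_power[OF Vinf_discrete O_FF[OF xaO] tn] ord_Vinf[OF xaO tn] by simp
    moreover have "0 \<le> ord_at Vinf h'" using Xinf discrete_place.mem_iff_ord(1)[OF Vinf_discrete hF(1) h0] by simp
    moreover have "ord_at Vinf ?w = ord_at Vinf ((x - \<iota> a) ^ 2) + ord_at Vinf h'"
      using tn by (intro discrete_place.ord_mult[OF Vinf_discrete O_FF[OF O_power[OF xaO]] _ hF(1) h0]) simp
    ultimately have "dg ?w \<le> 4" using ord_Vinf[OF wO w0] by simp
    then have "im ?w = 0" using dg_le_iff[OF wO w0, of 4] g2 by auto
    then obtain u where u: "?w = pe u" using el_re_im[OF wO] by (metis pe_eq_el)
    have tP: "x - \<iota> a \<in> max_ideal ?P" using Vpt_max_ideal(1)[OF pt'] tpt_def[OF pt'] by simp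
    have strip: "\<exists>u'. z = pe u'" if z: "(x - \<iota> a) * z = pe u" "z \<in> ?P" for z u
    proof -
      have "pe u \<in> max_ideal ?P" unfolding z(1)[symmetric] by (rule P.max_ideal_mult(1)[OF tP z(2)])
      then have "poly u a = 0"
        using point_max_ideal_iff[OF pt' Pplc Vpt_max_ideal[OF pt'] O_pe] ev_pe[OF pt'] by simp
      then obtain u' where "u = [:- a, 1:] * u'" by (auto simp: poly_eq_0_iff_dvd)
      then have "(x - \<iota> a) * z = (x - \<iota> a) * pe u'" using z(1) by (simp only: pe_mult) (simp add: pe_pCons emb_uminus emb_1)
      then show ?thesis using tn by auto
    qed
    have "(x - \<iota> a) * ((x - \<iota> a) * h') = pe u" using u by (simp add: power2_eq_square mult.assoc)
    moreover have "(x - \<iota> a) * h' \<in> ?P" using P.V_mult[OF P.max_ideal_sub[OF tP] XP] .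
    ultimately obtain u1 where u1: "(x - \<iota> a) * h' = pe u1" using strip by blast
    then obtain u2 where "h' = pe u2" using strip XP by blast
    then have "h' \<in> W" using OW[OF O_pe] by simp
    then show thesis using hF(2) by simp
  qed
qed

end

section \<open>The pencil of curves\<close>

subsection \<open>Evaluation of iterated polynomials\<close>

definition is_hom :: "('r::comm_ring_1 \<Rightarrow> 's::comm_ring_1) \<Rightarrow> bool" where
  "is_hom h \<longleftrightarrow> h 0 = 0 \<and> h 1 = 1 \<and> (\<forall>a b. h (a + b) = h a + h b \<and> h (a * b) = h a * h b)"

lemma is_homD:
  assumes "is_hom h"
  shows "h 0 = 0" "h 1 = 1" "h (a + b) = h a + h b" "h (a * b) = h a * h b"
  using assms by (auto simp: is_hom_def)

lemma is_hom_more: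
  assumes "is_hom h"
  shows "h (- a) = - h a" "h (a - b) = h a - h b" "h (a ^ n) = h a ^ n" "h (of_nat n) = of_nat n"
proof -
  note h = is_homD[OF assms]
  show neg: "h (- a) = - h a" for a using h(3)[of a "- a"] h(1) by (simp add: eq_neg_iff_add_eq_0 add.commute)
  show "h (a - b) = h a - h b" using h(3)[of a "- b"] neg by simp
  show "h (a ^ n) = h a ^ n" by (induction n) (simp_all add: h)
  show "h (of_nat n) = of_nat n" by (induction n) (simp_all add: h)
qed

lemma is_hom_prod: "is_hom h \<Longrightarrow> h (prod k S) = (\<Prod>s\<in>S. h (k s))"
  by (induction S rule: infinite_finite_induct) (simp_all add: is_homD)

lemma is_hom_dvd: "is_hom h \<Longrightarrow> a dvd b \<Longrightarrow> h a dvd h b"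
  by (auto simp: dvd_def is_homD)

lemma is_hom_comp: "is_hom h \<Longrightarrow> is_hom k \<Longrightarrow> is_hom (\<lambda>a. h (k a))"
  by (simp add: is_hom_def)

lemma is_hom_map_poly: "is_hom h \<Longrightarrow> is_hom (map_poly h)"
  unfolding is_hom_def[of "map_poly h"]
  using map_poly_hom_add[of h] map_poly_hom_mult[of h] is_homD[of h]
  by (auto simp: one_pCons map_poly_pCons)

lemma is_hom_eval: "is_hom h \<Longrightarrow> is_hom (\<lambda>p. poly (map_poly h p) a)"
  using is_hom_map_poly[of h] by (simp add: is_hom_def)

lemma is_hom_const: "is_hom (\<lambda>a. [:a:])"
  by (simp add: is_hom_def one_pCons)

lemma is_hom_to_fract: "is_hom to_fract"
  by (simp add: is_hom_def)

lemma eval_pCons: "is_hom h \<Longrightarrow> poly (map_poly h (pCons c p)) a = h c + a * poly (map_poly h p) a"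
  by (simp add: map_poly_pCons is_homD)

abbreviation lift_const :: "'r::comm_ring_1 poly \<Rightarrow> 'r poly poly" where
  "lift_const \<equiv> map_poly (\<lambda>a. [:a:])"

text \<open>
  Exchange of the two variables: an involution between \<open>k[x][T]\<close> and \<open>k[T][x]\<close>.
\<close>

definition swap :: "'r::comm_ring_1 poly poly \<Rightarrow> 'r poly poly" where
  "swap H = poly (map_poly lift_const H) [:[:0, 1:]:]"

lemma is_hom_lift_const: "is_hom (lift_const :: 'r::comm_ring_1 poly \<Rightarrow> 'r poly poly)"
  by (intro is_hom_map_poly is_hom_const)

lemma is_hom_swap: "is_hom (swap :: 'r::comm_ring_1 poly poly \<Rightarrow> 'r poly poly)"
  unfolding swap_def[abs_def] by (intro is_hom_eval is_hom_lift_const)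

lemmas swap_simps = is_homD[OF is_hom_swap] is_hom_more[OF is_hom_swap]

lemma swap_pCons: "swap (pCons c H) = lift_const c + smult [:0, 1:] (swap H)"
  by (simp add: swap_def eval_pCons[OF is_hom_lift_const])

lemma coeff_swap: "coeff (coeff (swap H) i) j = coeff (coeff H j) i"
proof (induction H arbitrary: j)
  case 0
  show ?case by (simp add: swap_simps(1))
next
  case (pCons c H)
  show ?case using pCons(2) by (cases j) (simp_all add: swap_pCons coeff_map_poly)
qed

lemma swap_swap [simp]: "swap (swap H) = H"
  by (intro poly_eqI) (simp add: coeff_swap)

lemma swap_eq_iff [simp]: "swap H = swap H' \<longleftrightarrow> H = H'"
  by (metis swap_swap)

lemma swap_const: "swap [:c:] = lift_const c"
  using swap_pCons[of c 0] by (simp add: swap_simps(1))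

lemma swap_lift_const: "swap (lift_const c) = [:c:]"
  using swap_const[of c] swap_swap by metis

lemma swap_dvd_iff: "swap H dvd swap H' \<longleftrightarrow> H dvd H'"
  using is_hom_dvd[OF is_hom_swap] swap_swap by metis

lemma swap_dvd_lift_const: "swap H dvd lift_const c \<longleftrightarrow> H dvd [:c:]"
  using swap_dvd_iff[of H "[:c:]"] by (simp add: swap_const)

lemma lift_const_dvd_swap: "lift_const c dvd swap H \<longleftrightarrow> [:c:] dvd H"
  using swap_dvd_iff[of "[:c:]" H] by (simp add: swap_const)

subsection \<open>A parity argument\<close>

text \<open>
  The degree of \<open>P\<close> modulo the prime \<open>p\<close> is \<open>n\<close>.
\<close>

definition top_coeff :: "'r::idom \<Rightarrow> 'r poly \<Rightarrow> nat \<Rightarrow> bool" where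
  "top_coeff p P n \<longleftrightarrow> \<not> p dvd coeff P n \<and> (\<forall>i>n. p dvd coeff P i)"

lemma top_coeff_exists:
  assumes "\<not> [:p:] dvd P" obtains n where "top_coeff p P n"
proof -
  let ?S = "{i. \<not> p dvd coeff P i}"
  have "?S \<subseteq> {..degree P}"
  proof
    fix i assume "i \<in> ?S"
    then have "coeff P i \<noteq> 0" by auto
    then show "i \<in> {..degree P}" using le_degree by simp
  qed
  then have fin: "finite ?S" by (rule finite_subset) simp
  have ne: "?S \<noteq> {}" using assms by (auto simp: const_poly_dvd_iff)
  have "top_coeff p P (Max ?S)"
    using Max_in[OF fin ne] Max_ge[OF fin] by (auto simp: top_coeff_def) (meson not_le)
  then show thesis by (rule that)
qed

lemma top_coeff_mult:
  fixes p :: "'r::idom"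
  assumes pr: "\<And>a b. p dvd a * b \<Longrightarrow> p dvd a \<or> p dvd b" and "top_coeff p P m" "top_coeff p Q n"
  shows "top_coeff p (P * Q) (m + n)"
  unfolding top_coeff_def
proof (intro conjI allI impI)
  have rest: "p dvd coeff P i * coeff Q (m + n - i)" if "i \<le> m + n" "i \<noteq> m" for i
  proof (cases "m < i")
    case True
    then show ?thesis using assms(2) by (simp add: top_coeff_def)
  next
    case False
    then have "n < m + n - i" using that by linarith
    then show ?thesis using assms(3) by (simp add: top_coeff_def)
  qed
  have "coeff (P * Q) (m + n) = coeff P m * coeff Q n + (\<Sum>i\<in>{..m + n} - {m}. coeff P i * coeff Q (m + n - i))"
    unfolding coeff_mult by (subst sum.remove[of _ m]) auto
  moreover have "p dvd (\<Sum>i\<in>{..m + n} - {m}. coeff P i * coeff Q (m + n - i))"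
    by (intro dvd_sum rest) auto
  ultimately show "\<not> p dvd coeff (P * Q) (m + n)"
    using pr assms(2,3) by (auto simp: top_coeff_def dvd_add_left_iff)
next
  fix j assume "m + n < j"
  show "p dvd coeff (P * Q) j" unfolding coeff_mult
  proof (intro dvd_sum)
    fix i assume "i \<in> {..j}"
    show "p dvd coeff P i * coeff Q (j - i)"
    proof (cases "m < i")
      case False
      then have "n < j - i" using \<open>m + n < j\<close> by linarith
      then show ?thesis using assms(3) by (simp add: top_coeff_def)
    qed (use assms(2) in \<open>simp add: top_coeff_def\<close>)
  qed
qed

lemma top_coeff_diff:
  assumes "top_coeff p P m" "\<And>i. m \<le> i \<Longrightarrow> p dvd coeff Q i"
  shows "\<not> [:p:] dvd P - Q" "\<not> [:p:] dvd Q - P"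
proof -
  have "\<not> p dvd coeff (P - Q) m" "\<not> p dvd coeff (Q - P) m"
    using assms(1) assms(2)[of m] by (auto simp: top_coeff_def dvd_diff_left_iff dvd_diff_right_iff)
  then show "\<not> [:p:] dvd P - Q" "\<not> [:p:] dvd Q - P" by (auto simp: const_poly_dvd_iff)
qed

text \<open>
  Modulo the prime \<open>p\<close>, the degree of \<open>U\<^sup>2\<close> is even and that of \<open>F V\<^sup>2\<close> is odd.
\<close>

lemma parity:
  fixes p :: "'r::idom"
  assumes pr: "\<And>a b. p dvd a * b \<Longrightarrow> p dvd a \<or> p dvd b"
    and F: "odd (degree F)" "\<not> p dvd lead_coeff F" and dvd: "[:p:] dvd U * U - F * (V * V)"
  shows "[:p:] dvd U" "[:p:] dvd V"
proof -
  have tF: "top_coeff p F (degree F)" using F(2) by (auto simp: top_coeff_def coeff_eq_0)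
  have main: "[:p:] dvd U \<and> [:p:] dvd V"
  proof (rule ccontr)
    assume not: "\<not> ?thesis"
    have sq: "top_coeff p (P * P) (2 * n)" if "top_coeff p P n" for P n
      using top_coeff_mult[OF pr that that] by (simp add: mult_2)
    show False
    proof (cases "[:p:] dvd V")
      case True
      then obtain m where m: "top_coeff p U m" using not top_coeff_exists by blast
      have "[:p:] dvd F * (V * V)" using True by simp
      then have "p dvd coeff (F * (V * V)) i" for i unfolding const_poly_dvd_iff by blast
      then show False using top_coeff_diff(1)[OF sq[OF m]] dvd by blast
    next
      case False
      then obtain n where n: "top_coeff p V n" using top_coeff_exists by blast
      have tV: "top_coeff p (F * (V * V)) (degree F + 2 * n)" by (rule top_coeff_mult[OF pr tF sq[OF n]])
      show False
      proof (cases "[:p:] dvd U")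
        case True
        then have "[:p:] dvd U * U" by simp
        then have "p dvd coeff (U * U) i" for i unfolding const_poly_dvd_iff by blast
        then show False using top_coeff_diff(2)[OF tV] dvd by blast
      next
        case False
        then obtain m where m: "top_coeff p U m" using top_coeff_exists by blast
        have "2 * m \<noteq> degree F + 2 * n" using F(1) by presburger
        then consider "2 * m < degree F + 2 * n" | "degree F + 2 * n < 2 * m" by linarith
        then show False
        proof cases
          case 1
          then show False using top_coeff_diff(2)[OF tV, of "U * U"] sq[OF m] dvd by (auto simp: top_coeff_def)
        next
          case 2
          then show False using top_coeff_diff(1)[OF sq[OF m], of "F * (V * V)"] tV dvd by (auto simp: top_coeff_def)
        qed
      qed
    qed
  qed
  then show "[:p:] dvd U" "[:p:] dvd V" by auto
qed

subsection \<open>The surface as a rational surface\<close>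

definition pencil_A :: "(nat \<Rightarrow> 'k::field) \<Rightarrow> nat \<Rightarrow> 'k poly" where
  "pencil_A \<alpha> r = (\<Prod>i<r. [:- \<alpha> i, 1:])"

text \<open>
  The polynomial \<open>A T + B\<close>, written as a polynomial in \<open>x\<close> over \<open>k[T]\<close>.
\<close>

definition pencil_poly :: "(nat \<Rightarrow> 'k::field) \<Rightarrow> nat \<Rightarrow> 'k poly \<Rightarrow> 'k poly poly" where
  "pencil_poly \<alpha> r B = swap [:B, pencil_A \<alpha> r:]"

lemma pencil_A_nonzero: "pencil_A \<alpha> r \<noteq> 0" and degree_pencil_A: "degree (pencil_A \<alpha> r) = r"
  by (auto simp: pencil_A_def degree_prod_eq_sum_degree)

lemma monic_pencil_A: "lead_coeff (pencil_A \<alpha> r) = 1"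
  unfolding pencil_A_def by (simp add: lead_coeff_prod)

lemma coprime_pencil_A:
  fixes \<alpha> :: "nat \<Rightarrow> 'k::field_gcd"
  assumes "\<And>i. i < r \<Longrightarrow> poly B (\<alpha> i) \<noteq> 0" shows "coprime (pencil_A \<alpha> r) B"
  unfolding pencil_A_def
proof (rule prod_coprime_left)
  fix i assume "i \<in> {..<r}"
  then have "\<not> [:- \<alpha> i, 1:] dvd B" using assms by (simp add: poly_eq_0_iff_dvd)
  then show "coprime [:- \<alpha> i, 1:] B"
    using prime_elem_imp_coprime[OF prime_elem_linear_field_poly[of 1 "- \<alpha> i"]] by simp
qed

lemma degree_pencil_poly:
  assumes "degree B = Suc n" "r \<le> n" "lead_coeff B = 1"
  shows "degree (pencil_poly \<alpha> r B) = Suc n" "lead_coeff (pencil_poly \<alpha> r B) = 1"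
proof -
  have eq: "pencil_poly \<alpha> r B = lift_const B + smult [:0, 1:] (lift_const (pencil_A \<alpha> r))"
    by (simp add: pencil_poly_def swap_pCons swap_simps(1))
  have d1: "degree (lift_const B) = Suc n" using assms by (simp add: degree_map_poly)
  have "degree (smult [:0, 1:] (lift_const (pencil_A \<alpha> r))) \<le> n"
    using assms degree_pencil_A[of \<alpha> r] by (simp add: degree_map_poly)
  then show d: "degree (pencil_poly \<alpha> r B) = Suc n" unfolding eq using d1 by (subst degree_add_eq_left) auto
  have "coeff (pencil_A \<alpha> r) (Suc n) = 0" using degree_pencil_A[of \<alpha> r] assms(2) by (simp add: coeff_eq_0)
  then show "lead_coeff (pencil_poly \<alpha> r B) = 1"
    unfolding d unfolding eq using assms by (simp add: coeff_map_poly)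
qed

text \<open>
  In \<open>T\<close> it has degree one and coprime coefficients \<open>A\<close> and \<open>B\<close>.
\<close>

lemma irreducible_pencil_poly:
  fixes \<alpha> :: "nat \<Rightarrow> 'k::field_gcd"
  assumes "\<And>i. i < r \<Longrightarrow> poly B (\<alpha> i) \<noteq> 0" shows "irreducible (pencil_poly \<alpha> r B)"
proof (rule irreducibleI)
  let ?L = "[:B, pencil_A \<alpha> r:]"
  have L0: "?L \<noteq> 0" "degree ?L = 1" using pencil_A_nonzero by auto
  have unit: "swap H dvd 1 \<longleftrightarrow> H dvd 1" for H :: "'k poly poly"
    using swap_dvd_iff[of H 1] by (simp add: swap_simps(2))
  show "pencil_poly \<alpha> r B \<noteq> 0" using L0 swap_eq_iff[of ?L 0] by (simp add: pencil_poly_def swap_simps(1) del: swap_eq_iff)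
  show "\<not> pencil_poly \<alpha> r B dvd 1" unfolding pencil_poly_def unit using L0 by (auto simp: is_unit_poly_iff)
  have factor: "P dvd 1" if PQ: "P * Q = ?L" and deg: "degree P = 0" for P Q :: "'k poly poly"
  proof -
    obtain \<rho> where \<rho>: "P = [:\<rho>:]" using deg by (rule degree_eq_zeroE)
    then have "[:\<rho>:] dvd ?L" using PQ by (metis dvd_triv_left)
    then have "\<rho> dvd coeff ?L 0" "\<rho> dvd coeff ?L 1" unfolding const_poly_dvd_iff by blast+
    then have "\<rho> dvd B" "\<rho> dvd pencil_A \<alpha> r" by auto
    moreover have "coprime (pencil_A \<alpha> r) B" by (rule coprime_pencil_A) (rule assms)
    ultimately have "\<rho> dvd 1" by (metis coprime_common_divisor)
    then show ?thesis using \<rho> by (simp add: is_unit_const_poly_iff)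
  qed
  fix P Q assume "pencil_poly \<alpha> r B = P * Q"
  then have PQ: "swap P * swap Q = ?L" by (metis pencil_poly_def swap_swap swap_simps(4))
  then have "degree (swap P) + degree (swap Q) = 1" using L0 by (metis degree_mult_eq mult_zero_left mult_zero_right)
  then consider "degree (swap P) = 0" | "degree (swap Q) = 0" by linarith
  then show "P dvd 1 \<or> Q dvd 1"
    using factor[OF PQ] factor[of "swap Q" "swap P"] PQ unit by (cases; metis mult.commute)
qed

text \<open>
  The curve \<open>y\<^sup>2 = A T + B\<close> over \<open>K = k(T)\<close>, with rational points \<open>(\<alpha> i, \<beta> i)\<close> and \<open>(\<alpha> i, - \<beta> i)\<close> over the
  zeros of \<open>A\<close>.
\<close>

locale pencil = field_embedding \<iota>
  for \<iota> :: "'k::field_gcd poly fract \<Rightarrow> 'a::field_char_0" +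
  fixes x y :: 'a and \<alpha> \<beta> :: "nat \<Rightarrow> 'k" and r g :: nat and B :: "'k poly"
  assumes trans_x: "\<And>p. poly (map_poly \<iota> p) x = 0 \<Longrightarrow> p = 0"
    and y_sq: "y ^ 2 = poly (map_poly \<iota> (fract_poly (pencil_poly \<alpha> r B))) x"
    and degree_B: "degree B = 2 * g + 1" and monic_B: "lead_coeff B = 1" and r_le: "r \<le> 2 * g" and g_pos: "0 < g"
    and inj_\<alpha>: "inj_on \<alpha> {..<r}"
    and B_square: "\<And>i. i < r \<Longrightarrow> poly B (\<alpha> i) = \<beta> i ^ 2" and \<beta>_nonzero: "\<And>i. i < r \<Longrightarrow> \<beta> i \<noteq> 0"
begin

abbreviation "A \<equiv> pencil_A \<alpha> r"
abbreviation "f0 \<equiv> pencil_poly \<alpha> r B"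
abbreviation "L \<equiv> [:B, A:]"

lemma degree_f0: "degree f0 = 2 * g + 1" and monic_f0: "lead_coeff f0 = 1"
  using degree_pencil_poly[of B "2 * g" r \<alpha>] degree_B monic_B r_le by auto

sublocale hyperelliptic_field \<iota> x y "fract_poly f0" g
  by unfold_locales (use trans_x y_sq degree_f0 in \<open>auto simp: degree_map_poly\<close>)

lemma irreducible_f: "irreducible (fract_poly f0)"
proof -
  have "irreducible f0" using irreducible_pencil_poly[of r B \<alpha>] B_square \<beta>_nonzero by simp
  then show ?thesis using nonconst_poly_irreducible_iff[of f0] degree_f0 by simp
qed

text \<open>
  Evaluation maps into the ambient field: of \<open>k[x]\<close>, of \<open>k[x][T]\<close> and of \<open>k[x][y]\<close>. The last one is injective
  (\<open>e2_0_iff\<close>), because \<open>x\<close> and \<open>y\<close> are algebraically independent over \<open>k\<close>.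
\<close>

definition px :: "'k poly \<Rightarrow> 'a" where "px p = pe (fract_poly (lift_const p))"
definition EE :: "'k poly poly \<Rightarrow> 'a" where "EE H = pe (fract_poly (swap H))"
definition e2 :: "'k poly poly \<Rightarrow> 'a" where "e2 Q = poly (map_poly px Q) y"
definition TT :: 'a where "TT = \<iota> (to_fract [:0, 1:])"

lemma is_hom_pe: "is_hom pe"
  by (simp add: is_hom_def pe_add pe_mult)

lemma is_hom_fract_poly: "is_hom (fract_poly :: 'k poly poly \<Rightarrow> _)"
  by (intro is_hom_map_poly is_hom_to_fract)

lemma is_hom_EE: "is_hom EE"
  unfolding EE_def[abs_def] by (intro is_hom_comp[OF is_hom_pe] is_hom_comp[OF is_hom_fract_poly] is_hom_swap)

lemma px_EE: "px p = EE [:p:]"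
  by (simp add: px_def EE_def swap_const)

lemma is_hom_px: "is_hom px"
  using is_hom_comp[OF is_hom_EE is_hom_const] by (simp add: px_EE[abs_def])

lemma is_hom_e2: "is_hom e2"
  unfolding e2_def[abs_def] by (intro is_hom_eval is_hom_px)

lemmas EE_simps = is_homD[OF is_hom_EE] is_hom_more[OF is_hom_EE]
lemmas px_simps = is_homD[OF is_hom_px] is_hom_more[OF is_hom_px]
lemmas e2_simps = is_homD[OF is_hom_e2] is_hom_more[OF is_hom_e2]

lemma EE_T: "EE [:0, 1:] = TT"
  by (simp add: EE_def swap_pCons swap_simps(1) TT_def map_poly_pCons)

lemma EE_pCons: "EE (pCons c H) = px c + TT * EE H"
proof -
  have "pCons c H = [:c:] + [:0, 1:] * H" by simp
  then show ?thesis by (simp only: EE_simps(3,4) EE_T px_EE)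
qed

lemma e2_pCons: "e2 (pCons c Q) = px c + y * e2 Q"
  unfolding e2_def by (rule eval_pCons[OF is_hom_px])

lemma e2_const: "e2 [:c:] = px c"
  using e2_pCons[of c 0] by (simp add: e2_simps)

lemma e2_Y: "e2 [:0, 1:] = y"
  using e2_pCons[of 0 "1"] by (simp add: px_simps e2_simps one_pCons[symmetric])

lemma px_const: "px [:c:] = \<iota> (to_fract [:c:])"
  by (simp add: px_def map_poly_pCons)

lemma px_X: "px [:0, 1:] = x"
  by (simp add: px_def map_poly_pCons pe_pCons one_pCons[symmetric] emb_1)

lemma px_linear: "px [:- c, 1:] = x - \<iota> (to_fract [:c:])"
proof -
  have "[:- c, 1:] = [:0, 1:] - [:c:]" by simp
  then show ?thesis by (simp only: px_simps(6) px_X px_const)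
qed

lemma y_EE: "y * y = EE L"
  by (simp add: EE_def y_square' pencil_poly_def)

lemma EE_0_iff [simp]: "EE H = 0 \<longleftrightarrow> H = 0"
proof -
  have "EE H = 0 \<longleftrightarrow> swap H = swap 0" unfolding EE_def by (simp add: swap_simps(1) del: swap_eq_iff)
  then show ?thesis by simp
qed

lemma px_0_iff [simp]: "px p = 0 \<longleftrightarrow> p = 0"
  by (simp add: px_EE)

lemma EE_O [simp]: "EE H \<in> Oring" and px_O [simp]: "px p \<in> Oring"
  by (simp_all add: EE_def px_def)

lemma e2_O [simp]: "e2 Q \<in> Oring"
  by (induction Q) (auto simp: e2_simps e2_pCons intro!: O_add O_mult O_y)

lemma EE_el: "EE U + y * EE V = el (fract_poly (swap U)) (fract_poly (swap V))"
  by (simp add: EE_def el_def mult.commute)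

text \<open>
  Substitution of \<open>y\<^sup>2 = A T + B\<close> turns \<open>Q\<close> into \<open>U + y V\<close>. Divisibility of \<open>Q\<close> by a prime of
  \<open>k[x]\<close> outside \<open>A\<close> is visible in \<open>U\<close> and \<open>V\<close>; the zero ideal is included, so that
  injectivity of \<open>e2\<close> is a special case.
\<close>

lemma e2_even_odd:
  "\<exists>U V. e2 Q = EE U + y * EE V \<and>
     (\<forall>p. (\<forall>a b. p dvd a * b \<longrightarrow> p dvd a \<or> p dvd b) \<longrightarrow> \<not> p dvd A \<longrightarrow> [:p:] dvd U \<longrightarrow> [:p:] dvd V \<longrightarrow> [:p:] dvd Q)"
proof (induction Q)
  case 0
  show ?case by (intro exI[of _ 0]) (simp add: e2_simps EE_simps)
next
  case (pCons c Q)
  then obtain U V where UV: "e2 Q = EE U + y * EE V"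
    "\<And>p. (\<And>a b. p dvd a * b \<Longrightarrow> p dvd a \<or> p dvd b) \<Longrightarrow> \<not> p dvd A \<Longrightarrow> [:p:] dvd U \<Longrightarrow> [:p:] dvd V \<Longrightarrow> [:p:] dvd Q"
    by blast
  have "e2 (pCons c Q) = px c + (y * y) * EE V + y * EE U"
    by (simp add: e2_pCons UV(1) algebra_simps)
  also have "\<dots> = EE ([:c:] + L * V) + y * EE U"
    by (simp only: EE_simps(3,4) y_EE px_EE)
  finally have eq: "e2 (pCons c Q) = EE ([:c:] + L * V) + y * EE U" .
  have "[:p:] dvd pCons c Q"
    if pr: "\<And>a b. p dvd a * b \<Longrightarrow> p dvd a \<or> p dvd b" and pA: "\<not> p dvd A"
      and d1: "[:p:] dvd [:c:] + L * V" and d2: "[:p:] dvd U" for p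
  proof -
    have co: "coeff ([:c:] + L * V) (Suc j) = B * coeff V (Suc j) + A * coeff V j" for j
      by simp
    have "[:p:] dvd V"
    proof (rule ccontr)
      assume "\<not> [:p:] dvd V"
      then obtain n where n: "top_coeff p V n" using top_coeff_exists by blast
      have "p dvd B * coeff V (Suc n) + A * coeff V n" using d1 unfolding const_poly_dvd_iff co[symmetric] by blast
      moreover have "p dvd B * coeff V (Suc n)" using n by (simp add: top_coeff_def)
      ultimately have "p dvd A * coeff V n" by (simp add: dvd_add_right_iff)
      then show False using pr pA n by (auto simp: top_coeff_def)
    qed
    then have "[:p:] dvd Q" using UV(2)[OF pr pA d2] by blast
    moreover have "p dvd c"
    proof -
      have "p dvd c + B * coeff V 0" using d1 unfolding const_poly_dvd_iff
        by (drule_tac x = 0 in spec) simp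
      moreover have "p dvd coeff V 0" using \<open>[:p:] dvd V\<close> unfolding const_poly_dvd_iff by blast
      ultimately show ?thesis by (simp add: dvd_add_left_iff)
    qed
    ultimately show ?thesis by (auto simp: const_poly_dvd_iff coeff_pCons split: nat.splits)
  qed
  then show ?case using eq by blast
qed

lemma A_nonzero [simp]: "A \<noteq> 0"
  by (rule pencil_A_nonzero)

lemma e2_0_iff [simp]: "e2 Q = 0 \<longleftrightarrow> Q = 0"
proof
  assume Q: "e2 Q = 0"
  obtain U V where UV: "e2 Q = EE U + y * EE V"
    "\<And>p. (\<And>a b. p dvd a * b \<Longrightarrow> p dvd a \<or> p dvd b) \<Longrightarrow> \<not> p dvd A \<Longrightarrow> [:p:] dvd U \<Longrightarrow> [:p:] dvd V \<Longrightarrow> [:p:] dvd Q"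
    using e2_even_odd[of Q] by blast
  have "fract_poly (swap U) = 0 \<and> fract_poly (swap V) = 0" using Q UV(1) EE_el by simp
  then have "U = 0" "V = 0" using swap_eq_iff[of U 0] swap_eq_iff[of V 0] by (simp_all add: swap_simps(1) del: swap_eq_iff)
  then have "[:0:] dvd Q" by (intro UV(2)) (auto simp: A_nonzero)
  then show "Q = 0" by simp
next
  assume "Q = 0"
  then show "e2 Q = 0" by (simp only: e2_simps(1))
qed

lemma e2_eq_iff: "e2 Q = e2 Q' \<longleftrightarrow> Q = Q'"
proof
  assume "e2 Q = e2 Q'"
  then have "e2 (Q - Q') = 0" unfolding e2_simps(6) by simp
  then show "Q = Q'" by simp
next
  assume "Q = Q'"
  then show "e2 Q = e2 Q'" by (rule arg_cong)
qed

text \<open>The ring \<open>k[x, y, 1/A]\<close>, which contains \<open>T = (y\<^sup>2 - B) / A\<close>.\<close>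

definition RA :: "'a set" where "RA = {z. \<exists>Q N. z * px A ^ N = e2 Q}"

lemma pxA_nonzero [simp]: "px A \<noteq> 0"
  by (simp add: A_nonzero)

lemma RA_e2 [simp]: "e2 Q \<in> RA"
proof -
  have "e2 Q * px A ^ 0 = e2 Q" by simp
  then show ?thesis unfolding RA_def by blast
qed

lemma RA_closed:
  assumes "a \<in> RA" "b \<in> RA" shows "a + b \<in> RA" "a * b \<in> RA"
proof -
  obtain P M Q N where a: "a * px A ^ M = e2 P" and b: "b * px A ^ N = e2 Q" using assms by (auto simp: RA_def)
  have "(a + b) * px A ^ (M + N) = (a * px A ^ M) * px A ^ N + (b * px A ^ N) * px A ^ M"
    by (simp add: power_add algebra_simps)
  also have "\<dots> = e2 (P * [:A:] ^ N + Q * [:A:] ^ M)"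
    unfolding a b by (simp add: e2_simps e2_const)
  finally show "a + b \<in> RA" by (auto simp: RA_def)
  have "(a * b) * px A ^ (M + N) = (a * px A ^ M) * (b * px A ^ N)" by (simp add: power_add algebra_simps)
  also have "\<dots> = e2 (P * Q)" unfolding a b by (simp add: e2_simps)
  finally show "a * b \<in> RA" by (auto simp: RA_def)
qed

lemma RA_EE: "EE H \<in> RA"
proof (induction H)
  case (pCons c H)
  have "TT * px A ^ 1 = e2 ([:0, 1:] ^ 2 - [:B:])"
  proof -
    have "EE L = px B + TT * px A" by (simp add: EE_pCons EE_simps)
    then have "TT * px A = y * y - px B" by (simp add: y_EE)
    then show ?thesis by (simp only: e2_simps(4,6,7) e2_const e2_Y power2_eq_square power_one_right)
  qed
  then have "TT \<in> RA" unfolding RA_def by blast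
  moreover have "px c \<in> RA" using RA_e2[of "[:c:]"] by (simp add: e2_const)
  ultimately show ?case unfolding EE_pCons using pCons RA_closed by blast
qed (use RA_e2[of 0] in \<open>simp add: EE_simps e2_simps\<close>)

lemma RA_const: "\<iota> (to_fract d) \<in> RA"
proof -
  have "\<iota> (to_fract d) = EE (swap [:d:])" by (simp add: EE_def map_poly_pCons)
  then show ?thesis using RA_EE by simp
qed

lemma clear_denominator:
  obtains d P where "d \<noteq> 0" "\<iota> (to_fract d) * pe u = EE P"
proof -
  obtain c P where u: "u = smult c (fract_poly P)" using content_decompose_fract[of u] by metis
  define n d where "n = fst (quot_of_fract c)" and "d = snd (quot_of_fract c)"
  have d0: "d \<noteq> 0" by (simp add: d_def)
  have c: "c = to_fract n / to_fract d"
    unfolding n_def d_def using Fract_quot_of_fract[of c] Fract_conv_to_fract by metis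
  have "smult (to_fract d) u = fract_poly (smult n P)" using d0 unfolding u c by simp
  then have "\<iota> (to_fract d) * pe u = EE (swap (smult n P))" unfolding EE_def swap_swap by (metis pe_smult)
  then show thesis using that d0 by blast
qed

lemma O_clear:
  assumes "a \<in> Oring" obtains d N Q where "d \<noteq> 0" "a * (\<iota> (to_fract d) * px A ^ N) = e2 Q"
proof -
  obtain u v where a: "a = pe u + pe v * y" using assms by (auto simp: Oring_def el_def)
  obtain d1 P1 where 1: "d1 \<noteq> 0" "\<iota> (to_fract d1) * pe u = EE P1" by (rule clear_denominator)
  obtain d2 P2 where 2: "d2 \<noteq> 0" "\<iota> (to_fract d2) * pe v = EE P2" by (rule clear_denominator)
  have "a * \<iota> (to_fract (d1 * d2)) = \<iota> (to_fract d2) * EE P1 + \<iota> (to_fract d1) * (EE P2 * e2 [:0, 1:])"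
    unfolding a 1(2)[symmetric] 2(2)[symmetric] e2_Y by (simp add: emb_mult algebra_simps)
  also have "\<dots> \<in> RA" by (intro RA_closed RA_const RA_EE RA_e2)
  finally obtain Q N where "a * \<iota> (to_fract (d1 * d2)) * px A ^ N = e2 Q" by (auto simp: RA_def)
  then show thesis using that[of "d1 * d2"] 1 2 by (simp add: mult.assoc)
qed

lemma const_clear: obtains N Q where "\<iota> (to_fract d) * px A ^ N = e2 Q"
  using RA_const[of d] by (auto simp: RA_def)

text \<open>
  All elements of \<open>k(T)\<close> are fractions in \<open>x\<close> and \<open>y\<close>, so the function field is \<open>k(x, y)\<close>; reduced fractions exist by
  unique factorization in \<open>k[x][y]\<close>.
\<close>

lemma FF_fraction:
  assumes "z \<in> FF" obtains P Q where "Q \<noteq> 0" "coprime P Q" "z = e2 P / e2 Q"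
proof -
  obtain a b where ab: "a \<in> Oring" "b \<in> Oring" "b \<noteq> 0" "z = a / b" using FF_cases[OF assms] .
  obtain d1 N1 Q1 where 1: "d1 \<noteq> 0" "a * (\<iota> (to_fract d1) * px A ^ N1) = e2 Q1" using O_clear[OF ab(1)] .
  obtain d2 N2 Q2 where 2: "d2 \<noteq> 0" "b * (\<iota> (to_fract d2) * px A ^ N2) = e2 Q2" using O_clear[OF ab(2)] .
  obtain M1 D1 where D1: "\<iota> (to_fract d1) * px A ^ M1 = e2 D1" by (rule const_clear)
  obtain M2 D2 where D2: "\<iota> (to_fract d2) * px A ^ M2 = e2 D2" by (rule const_clear)
  let ?P = "Q1 * D2 * [:A:] ^ (N2 + M1)" and ?Q = "Q2 * D1 * [:A:] ^ (N1 + M2)"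
  define w where "w = \<iota> (to_fract d1) * \<iota> (to_fract d2) * px A ^ (N1 + N2 + M1 + M2)"
  have w0: "w \<noteq> 0" using 1 2 by (simp add: w_def)
  have "e2 ?P = e2 Q1 * e2 D2 * px A ^ (N2 + M1)" by (simp add: e2_simps e2_const)
  also have "\<dots> = a * w" unfolding 1(2)[symmetric] D2[symmetric] w_def by (simp add: power_add mult_ac)
  finally have P: "e2 ?P = a * w" .
  have "e2 ?Q = e2 Q2 * e2 D1 * px A ^ (N1 + M2)" by (simp add: e2_simps e2_const)
  also have "\<dots> = b * w" unfolding 2(2)[symmetric] D1[symmetric] w_def by (simp add: power_add mult_ac)
  finally have Q: "e2 ?Q = b * w" .
  have Q0: "?Q \<noteq> 0" using Q ab(3) w0 by (metis e2_0_iff mult_eq_0_iff)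
  obtain P' Q' where g: "?P = P' * gcd ?P ?Q" "?Q = Q' * gcd ?P ?Q" "coprime P' Q'"
    using gcd_coprime_exists[of ?P ?Q] Q0 by auto
  have g0: "gcd ?P ?Q \<noteq> 0" "Q' \<noteq> 0" using Q0 g(2) by auto
  have "z = (a * w) / (b * w)" using ab w0 by simp
  also have "\<dots> = (e2 P' * e2 (gcd ?P ?Q)) / (e2 Q' * e2 (gcd ?P ?Q))"
    unfolding P[symmetric] Q[symmetric] using g(1,2) by (metis e2_simps(4))
  also have "\<dots> = e2 P' / e2 Q'" using g0 by simp
  finally show thesis using that g0 g(3) by blast
qed

end

subsection \<open>Places of the pencil\<close>

text \<open>
  The polynomials in \<open>x\<close> vanishing at \<open>W\<close> form a proper ideal of \<open>K[x]\<close>, generated by an element of least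
  degree.
\<close>

lemma (in hyperelliptic_field) irreducible_dvd_of_mem:
  assumes W: "W \<in> plc" "x \<in> W" and p: "irreducible p" "pe p \<in> max_ideal W" and q: "pe q \<in> max_ideal W"
  shows "p dvd q"
proof -
  interpret place "range \<iota>" FF W by (rule placeI[OF W(1)])
  note OW = O_sub_place[OF W]
  define P where "P = (\<lambda>n. \<exists>d. d \<noteq> 0 \<and> pe d \<in> max_ideal W \<and> degree d = n)"
  have "P (degree p)" unfolding P_def using p by (intro exI[of _ p]) auto
  then have "P (LEAST n. P n)" by (rule LeastI)
  then obtain d where d: "d \<noteq> 0" "pe d \<in> max_ideal W" "degree d = (LEAST n. P n)" unfolding P_def by blast
  have dvd: "d dvd u" if u: "pe u \<in> max_ideal W" for u
  proof -
    have "pe (u mod d) = pe u - pe (u div d) * pe d"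
      by (simp add: pe_diff[symmetric] pe_mult[symmetric] minus_div_mult_eq_mod)
    also have "\<dots> \<in> max_ideal W" using u max_ideal_mult(2)[OF d(2) OW[OF O_pe]] by (rule max_ideal_diff)
    finally have m: "pe (u mod d) \<in> max_ideal W" .
    have "u mod d = 0"
    proof (rule ccontr)
      assume nz: "u mod d \<noteq> 0"
      then have "P (degree (u mod d))" unfolding P_def using m by blast
      then have "degree d \<le> degree (u mod d)" unfolding d(3) by (rule Least_le)
      then show False using degree_mod_less[OF d(1), of u] nz by auto
    qed
    then show ?thesis by (simp add: dvd_eq_mod_eq_0)
  qed
  obtain e where e: "p = d * e" using dvd[OF p(2)] by blast
  have "\<not> d dvd 1"
  proof
    assume "d dvd 1"
    then obtain c where "d = [:c:]" by (auto simp: is_unit_poly_iff)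
    then have "\<iota> c \<in> max_ideal W" "c \<noteq> 0" using d by auto
    then show False using const_unit[of "\<iota> c"] by auto
  qed
  then have "e dvd 1" using irreducibleD[OF p(1) e] by blast
  then have "p dvd d" unfolding e by (simp add: mult_unit_dvd_iff)
  then show ?thesis using dvd[OF q] dvd_trans by blast
qed

context pencil
begin

lemma px_unit_const:
  assumes "W \<in> plc" "c \<noteq> 0" shows "\<iota> (to_fract c) \<in> W - max_ideal W"
proof -
  interpret place "range \<iota>" FF W by (rule placeI[OF assms(1)])
  show ?thesis using const_unit[of "\<iota> (to_fract c)"] assms(2) by auto
qed

text \<open>
  At a place where a prime \<open>p\<close> of \<open>k[x]\<close> vanishes, the residue of \<open>T\<close> is transcendental over
  \<open>k[x] / p\<close>, by Gauss's lemma.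
\<close>

lemma EE_vanishing:
  assumes W: "W \<in> plc" "x \<in> W" and p: "prime_elem p" "px p \<in> max_ideal W" and H: "EE H \<in> max_ideal W"
  shows "[:p:] dvd H"
proof -
  interpret place "range \<iota>" FF W by (rule placeI[OF W(1)])
  have p0: "degree p \<noteq> 0"
  proof
    assume "degree p = 0"
    then obtain c where c: "p = [:c:]" by (rule degree_eq_zeroE)
    then have "c \<noteq> 0" using p(1) by auto
    then show False using px_unit_const[OF W(1), of "[:c:]"] p(2) unfolding c px_const by auto
  qed
  have deg: "degree (lift_const p) \<noteq> 0" using p0 by (simp add: degree_map_poly)
  have "irreducible [:p:]" by (intro prime_elem_imp_irreducible lift_prime_elem_poly p(1))
  moreover have "irreducible (lift_const p)" if irr: "irreducible [:p:]"
  proof (rule irreducibleI)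
    show "lift_const p \<noteq> 0" using deg by auto
    show "\<not> lift_const p dvd 1" using deg by (auto simp: is_unit_poly_iff)
    fix a b assume "lift_const p = a * b"
    then have "[:p:] = swap a * swap b" by (metis swap_lift_const swap_simps(4))
    then have "swap a dvd 1 \<or> swap b dvd 1" using irr irreducibleD by blast
    then show "a dvd 1 \<or> b dvd 1" using swap_dvd_iff[of a 1] swap_dvd_iff[of b 1] unfolding swap_simps(2) by blast
  qed
  ultimately have irr: "irreducible (lift_const p)" by blast
  then have irr': "irreducible (fract_poly (lift_const p))" "content (lift_const p) = 1"
    using nonconst_poly_irreducible_iff[OF deg] by auto
  have "fract_poly (lift_const p) dvd fract_poly (swap H)"
    using irreducible_dvd_of_mem[OF W irr'(1)] p(2) H unfolding px_def EE_def by blast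
  then have "lift_const p dvd swap H" using fract_poly_dvdD irr'(2) by blast
  then show ?thesis by (simp add: lift_const_dvd_swap)
qed

text \<open>
  The norm of \<open>e2 Z = U + y V\<close> vanishes at \<open>W\<close>, so \<open>p\<close> divides \<open>U\<^sup>2 - (A T + B) V\<^sup>2\<close> and \<open>parity\<close> applies in the
  variable \<open>T\<close>.
\<close>

lemma e2_vanishing:
  assumes W: "W \<in> plc" "x \<in> W" and p: "prime_elem p" "px p \<in> max_ideal W" "\<not> p dvd A" and Z: "e2 Z \<in> max_ideal W"
  shows "[:p:] dvd Z"
proof -
  interpret place "range \<iota>" FF W by (rule placeI[OF W(1)])
  note OW = O_sub_place[OF W]
  obtain U V where UV: "e2 Z = EE U + y * EE V"
    "\<And>p. (\<And>a b. p dvd a * b \<Longrightarrow> p dvd a \<or> p dvd b) \<Longrightarrow> \<not> p dvd A \<Longrightarrow> [:p:] dvd U \<Longrightarrow> [:p:] dvd V \<Longrightarrow> [:p:] dvd Z"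
    using e2_even_odd[of Z] by blast
  have pr: "p dvd a \<or> p dvd b" if "p dvd a * b" for a b using p(1) that by (rule prime_elem_dvd_multD)
  have "EE (U * U - L * (V * V)) = EE U * EE U - (y * y) * (EE V * EE V)" by (simp only: EE_simps(4,6) y_EE)
  also have "\<dots> = e2 Z * (EE U - y * EE V)" unfolding UV(1) by (simp add: algebra_simps)
  also have "\<dots> \<in> max_ideal W" by (rule max_ideal_mult(1)[OF Z OW]) (intro O_diff O_mult EE_O O_y)
  finally have "[:p:] dvd U * U - L * (V * V)" by (rule EE_vanishing[OF W p(1,2)])
  moreover have "odd (degree L)" "\<not> p dvd lead_coeff L" using p(3) by auto
  ultimately have "[:p:] dvd U" "[:p:] dvd V" using parity[of p L U V] pr by blast+
  then show ?thesis using UV(2) pr p(3) by blast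
qed

lemma prime_factor_in_max_ideal:
  assumes W: "W \<in> plc" "x \<in> W" and "Z \<noteq> 0" "e2 Z \<in> max_ideal W"
  obtains q where "prime_elem q" "q dvd Z" "e2 q \<in> max_ideal W"
proof -
  interpret place "range \<iota>" FF W by (rule placeI[OF W(1)])
  note OW = O_sub_place[OF W]
  have "Z \<noteq> 0 \<longrightarrow> e2 Z \<in> max_ideal W \<longrightarrow> (\<exists>q. prime_elem q \<and> q dvd Z \<and> e2 q \<in> max_ideal W)"
  proof (induction Z rule: prime_divisors_induct)
    case (unit u)
    then obtain v where "1 = u * v" by (auto elim: dvdE)
    then have "e2 u * e2 v = 1" by (metis e2_simps(2,4))
    then have "e2 u \<notin> max_ideal W" using max_ideal_mult(1)[OF _ OW[OF e2_O[of v]], of "e2 u"] max_ideal_1 by metis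
    then show ?case by simp
  next
    case (factor p Z)
    show ?case
    proof (intro impI)
      assume "p * Z \<noteq> 0" "e2 (p * Z) \<in> max_ideal W"
      then have "e2 p * e2 Z \<in> max_ideal W" "Z \<noteq> 0" by (simp_all add: e2_simps(4))
      then consider "e2 p \<in> max_ideal W" | "e2 Z \<in> max_ideal W" "Z \<noteq> 0"
        using max_ideal_prime[OF OW[OF e2_O] OW[OF e2_O]] by blast
      then show "\<exists>q. prime_elem q \<and> q dvd p * Z \<and> e2 q \<in> max_ideal W"
      proof cases
        case 1
        then show ?thesis using factor(1) by (intro exI[of _ p]) auto
      next
        case 2
        then show ?thesis using factor(2) by (meson dvd_mult)
      qed
    qed
  qed simp
  then show thesis using assms that by blast
qed

text \<open>
  The centre of a place away from the zeros of \<open>A\<close> is a curve in the \<open>(x, y)\<close>-plane, not a point: a nonzero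
  constant of \<open>K = k(T)\<close> does not vanish. An element of least degree in \<open>y\<close> among those vanishing
  at \<open>W\<close> has a prime factor \<open>q\<close> that vanishes there. If \<open>q\<close> involves \<open>y\<close>, pseudo-division by \<open>q\<close> shows that it divides all
  others; if \<open>q\<close> lies in \<open>k[x]\<close>, this is \<open>e2_vanishing\<close>.
\<close>

lemma centre:
  assumes W: "W \<in> plc" "x \<in> W" and A: "px A \<notin> max_ideal W"
  obtains q where "prime_elem q" "\<And>Z. e2 Z \<in> max_ideal W \<longleftrightarrow> q dvd Z"
proof -
  interpret place "range \<iota>" FF W by (rule placeI[OF W(1)])
  note OW = O_sub_place[OF W]
  have Au: "px A \<in> W - max_ideal W" using A OW[OF px_O] by blast
  define P where "P = (\<lambda>n. \<exists>Z. Z \<noteq> 0 \<and> e2 Z \<in> max_ideal W \<and> degree Z = n)"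
  have "\<exists>n. P n"
  proof -
    obtain z where z: "z \<in> FF" "z \<notin> W" using V_neq_F V_sub_F by blast
    then have "inverse z \<in> max_ideal W" "inverse z \<noteq> 0" using not_in_V by auto
    obtain a b where ab: "a \<in> Oring" "b \<in> Oring" "b \<noteq> 0" "inverse z = a / b"
      using FF_cases[OF V_sub_F[OF max_ideal_sub[OF \<open>inverse z \<in> max_ideal W\<close>]]] .
    have am: "a \<in> max_ideal W"
      using max_ideal_mult(1)[OF \<open>inverse z \<in> max_ideal W\<close> OW[OF ab(2)]] ab(3,4) by simp
    have a0: "a \<noteq> 0" using ab \<open>inverse z \<noteq> 0\<close> by auto
    obtain d N Q where Q: "d \<noteq> 0" "a * (\<iota> (to_fract d) * px A ^ N) = e2 Q" using O_clear[OF ab(1)] .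
    have "e2 Q \<in> max_ideal W" unfolding Q(2)[symmetric]
      using am px_unit_const[OF W(1) Q(1)] Au by (intro max_ideal_mult V_mult V_power) auto
    moreover have "e2 Q \<noteq> 0" unfolding Q(2)[symmetric] using a0 Q(1) by simp
    ultimately show ?thesis unfolding P_def by auto
  qed
  then have "P (LEAST n. P n)" by (metis LeastI)
  then obtain Z0 where Z0: "Z0 \<noteq> 0" "e2 Z0 \<in> max_ideal W" "degree Z0 = (LEAST n. P n)" unfolding P_def by blast
  obtain q where q: "prime_elem q" "q dvd Z0" "e2 q \<in> max_ideal W"
    using prime_factor_in_max_ideal[OF W Z0(1,2)] .
  have min: "degree q \<le> degree Z" if "Z \<noteq> 0" "e2 Z \<in> max_ideal W" for Z
  proof -
    have "P (degree Z)" unfolding P_def using that by blast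
    then have "degree Z0 \<le> degree Z" unfolding Z0(3) by (rule Least_le)
    then show ?thesis using dvd_imp_degree_le[OF q(2) Z0(1)] by linarith
  qed
  have "q dvd Z" if Z: "e2 Z \<in> max_ideal W" for Z
  proof (cases "degree q = 0")
    case True
    then obtain p where p: "q = [:p:]" by (rule degree_eq_zeroE)
    have pp: "prime_elem p" using q(1) unfolding p by (simp add: prime_elem_const_poly_iff)
    have pm: "px p \<in> max_ideal W" using q(3) unfolding p e2_const .
    have "\<not> p dvd A"
    proof
      assume "p dvd A"
      then obtain h where "A = p * h" by blast
      then have "px A = px p * px h" by (simp only: px_simps(4))
      then show False using max_ideal_mult(1)[OF pm OW[OF px_O]] A by metis
    qed
    then show ?thesis unfolding p using e2_vanishing[OF W pp pm _ Z] by blast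
  next
    case False
    have q0: "q \<noteq> 0" using q(1) by auto
    obtain a s where as: "a \<noteq> 0" "smult a Z = q * s + pseudo_mod Z q" using pseudo_mod(1)[OF q0] by blast
    have "pseudo_mod Z q = [:a:] * Z - q * s" using as(2) by simp
    then have "e2 (pseudo_mod Z q) = px a * e2 Z - e2 q * e2 s" by (simp only: e2_simps(4,6) e2_const)
    also have "\<dots> \<in> max_ideal W"
      using max_ideal_mult(2)[OF Z OW[OF px_O]] max_ideal_mult(1)[OF q(3) OW[OF e2_O]] by (rule max_ideal_diff)
    finally have "pseudo_mod Z q = 0" using min[of "pseudo_mod Z q"] pseudo_mod(2)[OF q0, of Z] by fastforce
    then have "q dvd [:a:] * Z" using as(2) by simp
    then consider "q dvd [:a:]" | "q dvd Z" using prime_elem_dvd_multD[OF q(1)] by blast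
    then show ?thesis
    proof cases
      case 1
      then have "degree q \<le> 0" using dvd_imp_degree_le[OF 1] as(1) by simp
      then show ?thesis using False by simp
    qed
  qed
  moreover have "e2 Z \<in> max_ideal W" if "q dvd Z" for Z
  proof -
    obtain h where "Z = q * h" using \<open>q dvd Z\<close> by (rule dvdE)
    then show ?thesis using max_ideal_mult(1)[OF q(3) OW[OF e2_O[of h]]] by (simp only: e2_simps(4))
  qed
  ultimately show thesis using that q(1) by blast
qed

text \<open>
  Clearing denominators turns an element of \<open>O\<close> into an element of \<open>k[x][y]\<close> up to units at \<open>W\<close>, and there the
  power of \<open>q\<close> can be split off.
\<close>

lemma loc_param_centre:
  assumes W: "W \<in> plc" "x \<in> W" and A: "px A \<notin> max_ideal W"
    and q: "prime_elem q" "\<And>Z. e2 Z \<in> max_ideal W \<longleftrightarrow> q dvd Z"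
  shows "loc_param W (e2 q)"
proof -
  interpret place "range \<iota>" FF W by (rule placeI[OF W(1)])
  note OW = O_sub_place[OF W]
  have Au: "px A \<in> W - max_ideal W" using A OW[OF px_O] by blast
  have q0: "q \<noteq> 0" using q(1) by auto
  have "\<exists>n::nat. \<exists>c\<in>Oring - max_ideal W. \<exists>d\<in>Oring - max_ideal W. a * d = e2 q ^ n * c"
    if a: "a \<in> Oring - {0}" for a
  proof -
    obtain d N Q where Q: "d \<noteq> 0" "a * (\<iota> (to_fract d) * px A ^ N) = e2 Q" using O_clear a by blast
    obtain Q' where Q': "Q = q ^ multiplicity q Q * Q'" "\<not> q dvd Q'"
    proof -
      have "Q \<noteq> 0" using Q a by (metis DiffD2 e2_0_iff emb_eq_0_iff insertI1 mult_eq_0_iff power_eq_0_iff pxA_nonzero to_fract_eq_0_iff)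
      then show thesis using multiplicity_decompose'[of Q q] q(1) that by (metis prime_elem_not_unit)
    qed
    have "e2 Q = e2 q ^ multiplicity q Q * e2 Q'" by (subst Q'(1)) (simp only: e2_simps(4,7))
    moreover have "e2 Q' \<in> Oring - max_ideal W" using q(2) Q'(2) by simp
    moreover have "\<iota> (to_fract d) * px A ^ N \<in> Oring - max_ideal W"
      using unit_mult[OF px_unit_const[OF W(1) Q(1)] unit_power[OF Au]] by (auto intro!: O_mult O_power)
    ultimately show ?thesis using Q(2) by metis
  qed
  then show ?thesis unfolding loc_param_def using q(2)[of q] q0 by auto
qed

text \<open>
  The points \<open>(\<alpha> i, \<beta> i)\<close> and \<open>(\<alpha> i, - \<beta> i)\<close> with coordinates in \<open>K\<close>, and their places.
\<close>

definition fibre_point :: "nat \<Rightarrow> 'k poly fract" where "fibre_point i = to_fract [:\<alpha> i:]"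
definition fibre_value :: "nat \<Rightarrow> 'k poly fract" where "fibre_value i = to_fract [:\<beta> i:]"

definition Ppt :: "nat \<Rightarrow> 'a set" where "Ppt i = Vpt (fibre_point i) (fibre_value i)"
definition Npt :: "nat \<Rightarrow> 'a set" where "Npt i = Vpt (fibre_point i) (- fibre_value i)"

lemma poly_fract_poly: "poly (fract_poly P) (to_fract c) = to_fract (poly P c)"
  by (induction P) (simp_all add: map_poly_pCons)

lemma poly_lift_const: "poly (lift_const p) [:c:] = [:poly p c:]"
  by (induction p) (simp_all add: map_poly_pCons)

lemma point_on_curve:
  assumes "i < r"
  shows "fibre_value i ^ 2 = poly (fract_poly f0) (fibre_point i)" "fibre_value i \<noteq> 0"
    "(- fibre_value i) ^ 2 = poly (fract_poly f0) (fibre_point i)" "- fibre_value i \<noteq> 0"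
proof -
  have "poly A (\<alpha> i) = 0" using assms by (auto simp: pencil_A_def poly_prod)
  then have "poly f0 [:\<alpha> i:] = [:\<beta> i ^ 2:]"
    using B_square[OF assms] by (simp add: pencil_poly_def swap_pCons swap_simps(1) poly_lift_const)
  then show 1: "fibre_value i ^ 2 = poly (fract_poly f0) (fibre_point i)"
    by (simp add: fibre_point_def fibre_value_def poly_fract_poly power2_eq_square to_fract_mult[symmetric] del: to_fract_mult)
  show 2: "fibre_value i \<noteq> 0" using \<beta>_nonzero[OF assms] by (simp add: fibre_value_def)
  show "(- fibre_value i) ^ 2 = poly (fract_poly f0) (fibre_point i)" "- fibre_value i \<noteq> 0" using 1 2 by auto
qed

lemma pxA_prod: "px A = (\<Prod>i<r. (x - \<iota> (fibre_point i)))"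
  unfolding pencil_A_def is_hom_prod[OF is_hom_px] px_linear fibre_point_def ..

lemma place_over_A:
  assumes W: "W \<in> plc" "x \<in> W" and A: "px A \<in> max_ideal W"
  obtains i where "i < r" "W = Ppt i \<or> W = Npt i"
proof -
  interpret place "range \<iota>" FF W by (rule placeI[OF W(1)])
  have "\<exists>i\<in>S. x - \<iota> (fibre_point i) \<in> max_ideal W"
    if "(\<Prod>i\<in>S. (x - \<iota> (fibre_point i))) \<in> max_ideal W" "finite S" for S
    using that(2,1)
  proof (induction S rule: finite_induct)
    case (insert i S)
    have "x - \<iota> (fibre_point i) \<in> W" "(\<Prod>i\<in>S. (x - \<iota> (fibre_point i))) \<in> W"
      by (intro O_sub_place[OF W] O_diff O_x O_emb O_prod)+
    then show ?case using insert max_ideal_prime by (auto simp: prod.insert)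
  qed simp
  from this[of "{..<r}"] obtain i where "i < r" "x - \<iota> (fibre_point i) \<in> max_ideal W"
    using A unfolding pxA_prod by auto
  then show thesis using that places_over_point[OF point_on_curve(1,2) W(1)] by (auto simp: Ppt_def Npt_def)
qed

lemma Ppt_place: "i < r \<Longrightarrow> Ppt i \<in> plc" and Npt_place: "i < r \<Longrightarrow> Npt i \<in> plc"
  and Ppt_x: "i < r \<Longrightarrow> x \<in> Ppt i" and Npt_x: "i < r \<Longrightarrow> x \<in> Npt i"
  unfolding Ppt_def Npt_def using Vpt_place Vpt_x point_on_curve by blast+

lemma pencil_loc_param:
  assumes W: "W \<in> plc" "x \<in> W" shows "\<exists>t. loc_param W t"
proof (cases "px A \<in> max_ideal W")
  case True
  then obtain i where "i < r" "W = Ppt i \<or> W = Npt i" using place_over_A[OF W] by blast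
  then show ?thesis using Vpt_loc_param point_on_curve unfolding Ppt_def Npt_def by metis
next
  case False
  obtain q where "prime_elem q" "\<And>Z. e2 Z \<in> max_ideal W \<longleftrightarrow> q dvd Z" using centre[OF W False] by blast
  then show ?thesis using loc_param_centre[OF W False] by blast
qed

subsection \<open>Normality\<close>

definition in_all :: "'a \<Rightarrow> bool" where
  "in_all z \<longleftrightarrow> z \<in> FF \<and> (\<forall>V\<in>plc. x \<in> V \<longrightarrow> z \<in> V)"

text \<open>
  An element by which functions regular at all finite places may be divided without leaving \<open>O\<close>.
\<close>

definition strip :: "'a \<Rightarrow> bool" where
  "strip t \<longleftrightarrow> t \<in> Oring \<and> (\<forall>w. in_all w \<longrightarrow> t * w \<in> Oring \<longrightarrow> w \<in> Oring)"

lemma strip_mult: assumes "strip s" "strip t" shows "strip (s * t)"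
proof -
  have "in_all (t * w)" if "in_all w" for w
    unfolding in_all_def
  proof (intro conjI ballI impI)
    have t: "t \<in> Oring" using assms(2) by (simp add: strip_def)
    show "t * w \<in> FF" using subfieldD(4)[OF subfield_FF O_FF[OF t]] that by (simp add: in_all_def)
    fix V assume V: "V \<in> plc" "x \<in> V"
    show "t * w \<in> V"
      using place.V_mult[OF placeI[OF V(1)] O_sub_place[OF V t]] that V by (simp add: in_all_def)
  qed
  moreover have "s * t \<in> Oring" using assms O_mult by (simp add: strip_def)
  ultimately show ?thesis using assms unfolding strip_def mult.assoc by blast
qed

lemma strip_1: "strip 1"
  by (simp add: strip_def)

text \<open>
  A product \<open>(x - a) w\<close> in \<open>O\<close> with \<open>w\<close> regular vanishes at both points over \<open>a\<close>. So both of its components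
  vanish at \<open>a\<close> and are divisible by \<open>x - a\<close>.
\<close>

lemma strip_point:
  assumes "b ^ 2 = poly (fract_poly f0) a" "b \<noteq> 0"
  shows "strip (x - \<iota> a)"
  unfolding strip_def
proof (intro conjI allI impI)
  show "x - \<iota> a \<in> Oring" by (intro O_diff O_x O_emb)
  fix w assume w: "in_all w" and tw: "(x - \<iota> a) * w \<in> Oring"
  have neg: "(- b) ^ 2 = poly (fract_poly f0) a" "- b \<noteq> 0" using assms by auto
  have zero: "ev a c ((x - \<iota> a) * w) = 0" if c: "c ^ 2 = poly (fract_poly f0) a" "c \<noteq> 0" for c
  proof -
    interpret place "range \<iota>" FF "Vpt a c" by (rule placeI[OF Vpt_place[OF c]])
    have "w \<in> Vpt a c" using w Vpt_place[OF c] Vpt_x[OF c] by (auto simp: in_all_def)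
    then have "(x - \<iota> a) * w \<in> max_ideal (Vpt a c)"
      using max_ideal_mult(1) Vpt_max_ideal(1)[OF c] tpt_def[OF c] by metis
    then show ?thesis using point_max_ideal_iff[OF c Vpt_place[OF c] Vpt_max_ideal[OF c] tw] by simp
  qed
  obtain u v where uv: "(x - \<iota> a) * w = el u v" using tw by (auto simp: Oring_def)
  have 1: "poly u a + poly v a * b = 0" "poly u a - poly v a * b = 0"
    using zero[OF assms] zero[OF neg] unfolding uv by (simp_all add: ev_def)
  then have "\<iota> (poly u a) + \<iota> (poly u a) = 0"
    unfolding emb_add[symmetric] by (simp add: add_eq_0_iff)
  then have "2 * \<iota> (poly u a) = 0" by (simp only: mult_2)
  then have "poly u a = 0" by simp
  moreover from this 1 have "poly v a = 0" using assms(2) by simp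
  ultimately have "[:- a, 1:] dvd u" "[:- a, 1:] dvd v" by (simp_all only: poly_eq_0_iff_dvd)
  then obtain u' v' where uv': "u = [:- a, 1:] * u'" "v = [:- a, 1:] * v'" unfolding dvd_def by blast
  have t: "pe [:- a, 1:] = x - \<iota> a" by (simp add: pe_pCons emb_uminus emb_1)
  have "(x - \<iota> a) * w = (x - \<iota> a) * el u' v'"
    unfolding uv el_def uv' pe_mult t by (simp add: algebra_simps)
  then have "w = el u' v'" using x_notin_K[of a] by simp
  then show "w \<in> Oring" by simp
qed

lemma strip_A_power: "strip (px A ^ N)"
proof -
  have "strip (\<Prod>i\<in>S. (x - \<iota> (fibre_point i)))" if "S \<subseteq> {..<r}" "finite S" for S
    using that(2,1) by (induction S rule: finite_induct) (auto intro!: strip_mult strip_1 strip_point[OF point_on_curve(1,2)])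
  then have "strip (px A)" unfolding pxA_prod by simp
  then show ?thesis by (induction N) (auto intro: strip_mult strip_1)
qed

text \<open>
  The elements that become units when \<open>A\<close> and the nonzero polynomials in \<open>T\<close> are inverted. A prime
  \<open>q\<close> of \<open>k[x, y]\<close> that is not of this kind defines a place, namely the localization \<open>Vq\<close> of
  \<open>k[x, y]\<close> at \<open>q\<close>.
\<close>

definition removable :: "'k poly poly \<Rightarrow> bool" where
  "removable Q \<longleftrightarrow> (\<exists>R d N. d \<noteq> 0 \<and> e2 (Q * R) = \<iota> (to_fract d) * px A ^ N)"

lemma removable_mult: assumes "removable P" "removable Q" shows "removable (P * Q)"
proof -
  obtain R d N where 1: "d \<noteq> 0" "e2 (P * R) = \<iota> (to_fract d) * px A ^ N" using assms by (auto simp: removable_def)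
  obtain R' d' N' where 2: "d' \<noteq> 0" "e2 (Q * R') = \<iota> (to_fract d') * px A ^ N'" using assms by (auto simp: removable_def)
  have "e2 ((P * Q) * (R * R')) = e2 (P * R) * e2 (Q * R')" by (simp only: e2_simps(4) mult_ac)
  also have "\<dots> = \<iota> (to_fract (d * d')) * px A ^ (N + N')" unfolding 1 2 by (simp add: emb_mult power_add mult_ac)
  finally show ?thesis unfolding removable_def using 1(1) 2(1) by (metis mult_eq_0_iff)
qed

definition Vq :: "'k poly poly \<Rightarrow> 'a set" where
  "Vq q = {e2 P / e2 Q | P Q. \<not> q dvd Q}"

text \<open>
  If \<open>q\<close> is not removable, no nonzero constant of \<open>K\<close> becomes divisible by \<open>q\<close>, so \<open>Vq q\<close> contains \<open>K\<close>. It is a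
  valuation ring since numerator and denominator of a reduced fraction are not both divisible by \<open>q\<close>.
\<close>

lemma Vq_place:
  assumes q: "prime_elem q" "\<not> removable q" shows "Vq q \<in> plc" "x \<in> Vq q"
proof -
  have q0: "q \<noteq> 0" and qu: "\<not> q dvd 1" using q(1) by auto
  have whole: "e2 P \<in> Vq q" for P
  proof -
    have "e2 P = e2 P / e2 1" by (simp add: e2_simps(2))
    then show ?thesis unfolding Vq_def using qu by blast
  qed
  show xV: "x \<in> Vq q" using whole[of "[:[:0, 1:]:]"] by (simp only: e2_const px_X)
  show "Vq q \<in> plc" unfolding places_def
  proof (intro CollectI conjI ballI psubsetI)
    show "range \<iota> \<subseteq> Vq q"
    proof
      fix z assume "z \<in> range \<iota>"
      then obtain c where z: "z = \<iota> c" by auto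
      define n d where "n = fst (quot_of_fract c)" and "d = snd (quot_of_fract c)"
      have d0: "d \<noteq> 0" by (simp add: d_def)
      have c: "c = to_fract n / to_fract d"
        unfolding n_def d_def using Fract_quot_of_fract[of c] Fract_conv_to_fract by metis
      obtain M1 D1 where D1: "\<iota> (to_fract n) * px A ^ M1 = e2 D1" by (rule const_clear)
      obtain M2 D2 where D2: "\<iota> (to_fract d) * px A ^ M2 = e2 D2" by (rule const_clear)
      have den: "e2 (D2 * [:A:] ^ M1) = \<iota> (to_fract d) * px A ^ (M1 + M2)"
        by (simp add: e2_simps(4,7) e2_const D2[symmetric] power_add mult_ac)
      have num: "e2 (D1 * [:A:] ^ M2) = \<iota> (to_fract n) * px A ^ (M1 + M2)"
        by (simp add: e2_simps(4,7) e2_const D1[symmetric] power_add mult_ac)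
      have "z = e2 (D1 * [:A:] ^ M2) / e2 (D2 * [:A:] ^ M1)"
        unfolding num den z c emb_divide by simp
      moreover have "\<not> q dvd D2 * [:A:] ^ M1"
      proof
        assume "q dvd D2 * [:A:] ^ M1"
        then obtain R where "D2 * [:A:] ^ M1 = q * R" by blast
        then show False using q(2) den d0 unfolding removable_def by metis
      qed
      ultimately show "z \<in> Vq q" unfolding Vq_def by blast
    qed
    show "range \<iota> \<noteq> Vq q" using xV x_notin_K by blast
    show "Vq q \<subseteq> FF" using FF_I by (auto simp: Vq_def)
    have "1 / e2 q \<notin> Vq q"
    proof
      assume "1 / e2 q \<in> Vq q"
      then obtain P Q where PQ: "1 / e2 q = e2 P / e2 Q" "\<not> q dvd Q" by (auto simp: Vq_def)
      then have "Q \<noteq> 0" by auto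
      then have "e2 Q = e2 (P * q)" using PQ(1) q0 by (simp add: frac_eq_eq e2_simps(4))
      then have "Q = P * q" by (simp only: e2_eq_iff)
      then show False using PQ(2) by simp
    qed
    then show "Vq q \<noteq> FF" using FF_I[OF O_1 e2_O] by blast
  next
    fix a b assume "a \<in> Vq q" "b \<in> Vq q"
    then obtain P Q R S where a: "a = e2 P / e2 Q" "\<not> q dvd Q" and b: "b = e2 R / e2 S" "\<not> q dvd S"
      by (auto simp: Vq_def)
    have nz: "e2 Q \<noteq> 0" "e2 S \<noteq> 0" using a b by auto
    have "a - b = e2 (P * S - R * Q) / e2 (Q * S)" "a * b = e2 (P * R) / e2 (Q * S)"
      unfolding a b using nz by (simp_all add: diff_frac_eq e2_simps(4,6))
    moreover have "\<not> q dvd Q * S" using prime_elem_dvd_multD[OF q(1)] a b by blast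
    ultimately show "a - b \<in> Vq q" "a * b \<in> Vq q" unfolding Vq_def by blast+
  next
    fix z assume "z \<in> FF"
    then obtain P Q where PQ: "Q \<noteq> 0" "coprime P Q" "z = e2 P / e2 Q" by (rule FF_fraction)
    then have "\<not> q dvd P \<or> \<not> q dvd Q" using qu coprime_common_divisor by blast
    moreover have "inverse z = e2 Q / e2 P" using PQ by simp
    ultimately show "z \<in> Vq q \<or> inverse z \<in> Vq q" unfolding Vq_def using PQ(3) by blast
  qed
qed

text \<open>
  In a reduced fraction \<open>e2 P / e2 Q\<close> without poles at finite places, all prime factors of \<open>Q\<close> are
  removable, as the others define places where the fraction has a pole. Hence a power of \<open>A\<close> is a denominator over \<open>O\<close>,
  which \<open>strip_A_power\<close> removes.
\<close>

lemma pencil_normal: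
  assumes "in_all z" shows "z \<in> Oring"
proof -
  have zF: "z \<in> FF" using assms by (simp add: in_all_def)
  obtain P Q where PQ: "Q \<noteq> 0" "coprime P Q" "z = e2 P / e2 Q" using FF_fraction[OF zF] .
  have rem: "removable q" if q: "prime_elem q" "q dvd Q" for q
  proof (rule ccontr)
    assume nr: "\<not> removable q"
    have "z \<in> Vq q" using assms Vq_place[OF q(1) nr] by (auto simp: in_all_def)
    then obtain R S where RS: "z = e2 R / e2 S" "\<not> q dvd S" by (auto simp: Vq_def)
    then have "S \<noteq> 0" by auto
    then have "e2 (P * S) = e2 (R * Q)" using PQ RS by (simp add: frac_eq_eq e2_simps(4))
    then have "P * S = R * Q" by (simp only: e2_eq_iff)
    then have "q dvd P * S" using q(2) by simp
    then have "q dvd P" using prime_elem_dvd_multD[OF q(1)] RS(2) by blast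
    then show False using q PQ(2) coprime_common_divisor prime_elem_not_unit by blast
  qed
  have all: "Q' dvd Q \<longrightarrow> Q' \<noteq> 0 \<longrightarrow> removable Q'" for Q'
  proof (induction Q' rule: prime_divisors_induct)
    case (unit u)
    then obtain v where "1 = u * v" by (auto elim: dvdE)
    then have "e2 (u * v) = \<iota> (to_fract 1) * px A ^ 0" by (simp add: e2_simps(2) emb_1)
    then show ?case unfolding removable_def by (metis one_neq_zero)
  next
    case (factor p Q')
    then show ?case using removable_mult[OF rem, of p Q'] by (auto dest: dvd_mult_left dvd_mult_right)
  qed simp
  have "removable Q" using all[of Q] PQ(1) by simp
  then obtain R d N where R: "d \<noteq> 0" "e2 (Q * R) = \<iota> (to_fract d) * px A ^ N" unfolding removable_def by blast
  have "px A ^ N * z = \<iota> (inverse (to_fract d)) * e2 (P * R)"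
  proof -
    have "\<iota> (to_fract d) * (px A ^ N * z) = e2 (Q * R) * z" using R(2) by simp
    also have "\<dots> = e2 (P * R)" unfolding PQ(3) using PQ(1) by (simp add: e2_simps(4))
    finally have "\<iota> (inverse (to_fract d)) * (\<iota> (to_fract d) * (px A ^ N * z)) = \<iota> (inverse (to_fract d)) * e2 (P * R)" by simp
    moreover have "\<iota> (inverse (to_fract d)) * \<iota> (to_fract d) = 1"
      using R(1) by (simp add: emb_inverse)
    ultimately show ?thesis unfolding mult.assoc[symmetric] by simp
  qed
  also have "\<dots> \<in> Oring" by (intro O_mult O_emb e2_O)
  finally show ?thesis using strip_A_power[of N] assms by (auto simp: strip_def)
qed

sublocale hyperelliptic_curve \<iota> x y "fract_poly f0" g
  by unfold_locales (use pencil_loc_param pencil_normal in \<open>auto simp: in_all_def\<close>)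

end

context pencil
begin

section \<open>The divisor class group of the pencil\<close>

lemma swap_f0: "swap f0 = L"
  by (simp add: pencil_poly_def)

text \<open>
  As a polynomial in \<open>T\<close>, \<open>P\<^sup>2\<close> has even and \<open>(A T + B) Q\<^sup>2\<close> odd degree.
\<close>

lemma degree_norm_pos:
  fixes P Q :: "'k poly poly"
  assumes "Q \<noteq> 0" shows "degree (P * P - L * (Q * Q)) \<noteq> 0"
proof -
  have LQ: "degree (L * (Q * Q)) = 1 + 2 * degree Q" using assms by (subst degree_mult_eq) (auto simp: degree_mult_eq)
  show ?thesis
  proof (cases "P = 0")
    case False
    then have PP: "degree (P * P) = 2 * degree P" by (simp add: degree_mult_eq)
    have "2 * degree P \<noteq> 1 + 2 * degree Q" by presburger
    then consider "degree (P * P) < degree (L * (Q * Q))" | "degree (L * (Q * Q)) < degree (P * P)"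
      using LQ PP by linarith
    then show ?thesis
    proof cases
      case 1
      then have "degree (P * P - L * (Q * Q)) = degree (L * (Q * Q))"
        unfolding diff_conv_add_uminus by (subst degree_add_eq_right) (simp_all only: degree_minus 1)
      then show ?thesis using LQ by simp
    next
      case 2
      then have "degree (P * P - L * (Q * Q)) = degree (P * P)"
        unfolding diff_conv_add_uminus by (subst degree_add_eq_left) (simp_all only: degree_minus 2)
      then show ?thesis using 2 by simp
    qed
  next
    case True
    have "degree (P * P - L * (Q * Q)) = degree (L * (Q * Q))"
      unfolding True by (simp only: mult_zero_left diff_0 degree_minus)
    then show ?thesis using LQ by simp
  qed
qed

text \<open>
  After clearing contents the norm \<open>U\<^sup>2 - f V\<^sup>2\<close> of \<open>w\<close> is primitive over \<open>k[T]\<close>, by \<open>parity\<close> in the variable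
  \<open>x\<close>, and divides a polynomial of \<open>k[x]\<close>, hence has degree zero in \<open>T\<close>. But \<open>U\<^sup>2\<close> has even degree
  in \<open>T\<close> and \<open>f V\<^sup>2\<close> has odd degree unless \<open>V = 0\<close>.
\<close>

lemma factor_of_A_power:
  assumes w: "w \<in> Oring" "w' \<in> Oring" "w * w' = px A ^ M" shows "im w = 0"
proof (rule ccontr)
  assume v0: "im w \<noteq> 0"
  have "w \<noteq> 0" using v0 by auto
  obtain c1 U1 where U1: "re w = smult c1 (fract_poly U1)" "content U1 = 1" using content_decompose_fract[of "re w"] by metis
  obtain c2 V1 where V1: "im w = smult c2 (fract_poly V1)" "content V1 = 1" using content_decompose_fract[of "im w"] by metis
  define n1 d1 n2 d2 where "n1 = fst (quot_of_fract c1)" and "d1 = snd (quot_of_fract c1)"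
    and "n2 = fst (quot_of_fract c2)" and "d2 = snd (quot_of_fract c2)"
  have d0: "d1 \<noteq> 0" "d2 \<noteq> 0" by (simp_all add: d1_def d2_def)
  have c1: "c1 = to_fract n1 / to_fract d1"
    unfolding n1_def d1_def using Fract_quot_of_fract[of c1] Fract_conv_to_fract by metis
  have c2: "c2 = to_fract n2 / to_fract d2"
    unfolding n2_def d2_def using Fract_quot_of_fract[of c2] Fract_conv_to_fract by metis
  have n2: "n2 \<noteq> 0" using v0 V1 c2 by auto
  \<comment> \<open>Up to a common constant c0, both components become multiples of primitive polynomials by coprime p1 and p2.\<close>
  define \<gamma> where "\<gamma> = gcd (n1 * d2) (n2 * d1)"
  have g0: "\<gamma> \<noteq> 0" using n2 d0 by (simp add: \<gamma>_def)
  obtain p1 p2 where p: "n1 * d2 = p1 * \<gamma>" "n2 * d1 = p2 * \<gamma>" "coprime p1 p2"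
    using gcd_coprime_exists[OF g0[unfolded \<gamma>_def]] unfolding \<gamma>_def by blast
  have p20: "p2 \<noteq> 0" using p(2) n2 d0 by auto
  define U V c0 where "U = smult p1 U1" and "V = smult p2 V1" and "c0 = to_fract \<gamma> / to_fract (d1 * d2)"
  have "c1 = to_fract (n1 * d2) / to_fract (d1 * d2)" "c2 = to_fract (n2 * d1) / to_fract (d1 * d2)"
    unfolding c1 c2 using d0 by simp_all
  then have "c1 = c0 * to_fract p1" "c2 = c0 * to_fract p2" unfolding p c0_def by simp_all
  then have re: "re w = smult c0 (fract_poly U)" and im: "im w = smult c0 (fract_poly V)"
    unfolding U1 V1 U_def V_def by simp_all
  have c00: "c0 \<noteq> 0" using g0 d0 by (simp add: c0_def)
  have V0: "V \<noteq> 0" using v0 im by auto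
  define H where "H = U * U - f0 * (V * V)"
  have nrmw: "nrm w = smult (c0 * c0) (fract_poly H)"
    unfolding nrm_def nm_def re im H_def by (simp add: smult_diff_right mult.assoc)
  have H0: "H \<noteq> 0" using nrmw nrm_eq_0_iff[OF w(1)] \<open>w \<noteq> 0\<close> by auto
  have content: "content H = 1"
  proof (rule ccontr)
    assume "content H \<noteq> 1"
    then have "\<not> is_unit (content H)" by (simp add: is_unit_content_iff)
    then obtain \<pi> where \<pi>: "\<pi> dvd content H" "prime \<pi>" using prime_divisor_exists[of "content H"] H0 by auto
    have pr: "\<pi> dvd a \<or> \<pi> dvd b" if "\<pi> dvd a * b" for a b using \<pi>(2) that prime_dvd_multD by blast
    have nu: "\<not> \<pi> dvd 1" using \<pi>(2) not_prime_unit by blast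
    have "[:\<pi>:] dvd U * U - f0 * (V * V)" using \<pi>(1) unfolding H_def const_poly_dvd_iff_dvd_content .
    moreover have "odd (degree f0)" "\<not> \<pi> dvd lead_coeff f0" using degree_f0 monic_f0 nu by auto
    ultimately have "[:\<pi>:] dvd U" "[:\<pi>:] dvd V" using parity[of \<pi> f0 U V] pr by blast+
    then have "\<pi> dvd p1" "\<pi> dvd p2"
      unfolding const_poly_dvd_iff_dvd_content U_def V_def using U1(2) V1(2) by simp_all
    then show False using p(3) nu coprime_common_divisor by blast
  qed
  have "nrm w dvd nrm (px A ^ M)" using nrm_mult[OF w(1,2)] w(3) by simp
  also have "px A ^ M = pe (fract_poly (lift_const (A ^ M)))" using px_simps(7)[of A M] by (simp add: px_def)
  also have "nrm \<dots> = fract_poly (lift_const (A ^ M)) * fract_poly (lift_const (A ^ M))"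
    unfolding nrm_def pe_eq_el by (simp add: nm_def)
  finally have "fract_poly H dvd fract_poly (lift_const (A ^ M) * lift_const (A ^ M))"
    using c00 unfolding nrmw by (simp add: smult_dvd_iff)
  then have "H dvd lift_const (A ^ M) * lift_const (A ^ M)" using fract_poly_dvdD content by blast
  also have "lift_const (A ^ M) * lift_const (A ^ M) = lift_const (A ^ M * A ^ M)"
    by (simp only: is_homD(4)[OF is_hom_lift_const])
  finally have "swap H dvd [:A ^ M * A ^ M:]" using swap_dvd_lift_const[of "swap H"] by simp
  then have "degree (swap H) \<le> degree [:A ^ M * A ^ M:]" by (rule dvd_imp_degree_le) simp
  moreover have "swap H = swap U * swap U - L * (swap V * swap V)"
    unfolding H_def by (simp only: swap_simps(4,6) swap_f0)
  moreover have "swap V \<noteq> 0" using V0 swap_eq_iff[of V 0] by (simp add: swap_simps(1) del: swap_eq_iff)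
  ultimately show False using degree_norm_pos[of "swap V" "swap U"] by simp
qed

subsection \<open>Functions without zeros and poles outside the fibre over \<open>A = 0\<close>\<close>

text \<open>
  The finite places outside the fibre over \<open>A = 0\<close>.
\<close>

definition npl :: "'a set set" where
  "npl = {V \<in> fplc. \<forall>i<r. V \<noteq> Ppt i \<and> V \<noteq> Npt i}"

lemma Ppt_fplc: "i < r \<Longrightarrow> Ppt i \<in> fplc" and Npt_fplc: "i < r \<Longrightarrow> Npt i \<in> fplc"
  using Ppt_place Npt_place Ppt_x Npt_x by (auto simp: fplc_def)

lemma fplc_cases: "V \<in> fplc \<Longrightarrow> V \<in> npl \<or> (\<exists>i<r. V = Ppt i \<or> V = Npt i)"
  by (auto simp: npl_def)

lemma npl_fplc: "V \<in> npl \<Longrightarrow> V \<in> fplc" and npl_plc: "V \<in> npl \<Longrightarrow> V \<in> plc"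
  by (auto simp: npl_def fplc_def)

lemma npl_A: assumes "V \<in> npl" shows "px A \<notin> max_ideal V"
  using assms place_over_A[of V] by (auto simp: npl_def fplc_def)

text \<open>
  At an unramified point over \<open>a\<close>, \<open>x - a\<close> is a local parameter, so orders of polynomials in \<open>x\<close> are multiplicities of
  roots; in particular they agree at \<open>(a, b)\<close> and \<open>(a, - b)\<close>.
\<close>

lemma ord_pe_point:
  assumes pt: "b ^ 2 = poly (fract_poly f0) a" "b \<noteq> 0" and u: "u \<noteq> 0"
  shows "ord_at (Vpt a b) (pe u) = int (order a u)"
proof -
  let ?V = "Vpt a b"
  interpret discrete_place "range \<iota>" FF ?V by (rule discrete[OF Vpt_place[OF pt]])
  have t: "uniformizer ?V (tpt a)" "tpt a = pe [:- a, 1:]" "tpt a \<noteq> 0"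
    using loc_param_discrete(2)[OF Vpt_place[OF pt] Vpt_x[OF pt] Vpt_loc_param[OF pt]] tpt_pe[OF pt] tpt_nz[OF pt] by auto
  obtain q where q: "u = [:- a, 1:] ^ order a u * q" "\<not> [:- a, 1:] dvd q" using order_decomp[OF u] by blast
  have q0: "q \<noteq> 0" using q(2) by auto
  have "poly q a \<noteq> 0" using q(2) by (simp add: poly_eq_0_iff_dvd)
  then have "pe q \<notin> max_ideal ?V"
    using point_max_ideal_iff[OF pt Vpt_place[OF pt] Vpt_max_ideal[OF pt] O_pe[of q]] ev_pe[OF pt, of q] by simp
  then have oq: "ord_at ?V (pe q) = 0" using ord_unit[of "pe q"] O_sub_place[OF Vpt_place[OF pt] Vpt_x[OF pt] O_pe] by blast
  have "pe u = tpt a ^ order a u * pe q" using q(1) unfolding t(2) by (metis pe_mult pe_power)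
  then have "ord_at ?V (pe u) = ord_at ?V (tpt a ^ order a u * pe q)" by simp
  also have "\<dots> = ord_at ?V (tpt a ^ order a u) + ord_at ?V (pe q)"
    using t(3) q0 tpt_O[OF pt] by (intro ord_mult) (auto simp: O_FF O_power)
  also have "\<dots> = int (order a u)"
    using ord_power[OF O_FF[OF tpt_O[OF pt]] t(3)] ord_uniformizer[OF t(1)] oq by simp
  finally show ?thesis .
qed

lemma ord_pe_Ppt: "i < r \<Longrightarrow> u \<noteq> 0 \<Longrightarrow> ord_at (Ppt i) (pe u) = int (order (fibre_point i) u)"
  and ord_pe_Npt: "i < r \<Longrightarrow> u \<noteq> 0 \<Longrightarrow> ord_at (Npt i) (pe u) = int (order (fibre_point i) u)"
  unfolding Ppt_def Npt_def using ord_pe_point point_on_curve by blast+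

lemma pxA_pe: "px A = pe (fract_poly (lift_const A))"
  by (simp add: px_def)

lemma pxA_in_point:
  assumes "i < r" "V = Ppt i \<or> V = Npt i" shows "1 \<le> ord_at V (px A)"
proof -
  have V: "V \<in> plc" "x \<in> V" using assms Ppt_place Npt_place Ppt_x Npt_x by auto
  interpret discrete_place "range \<iota>" FF V by (rule discrete[OF V(1)])
  have t: "x - \<iota> (fibre_point i) \<in> max_ideal V"
    using assms Vpt_max_ideal(1)[OF point_on_curve(1,2)[OF assms(1)]] tpt_def[OF point_on_curve(1,2)[OF assms(1)]]
      Vpt_max_ideal(1)[OF point_on_curve(3,4)[OF assms(1)]] tpt_def[OF point_on_curve(3,4)[OF assms(1)]]
    by (auto simp: Ppt_def Npt_def)
  have "px A = (x - \<iota> (fibre_point i)) * (\<Prod>j\<in>{..<r} - {i}. (x - \<iota> (fibre_point j)))"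
    unfolding pxA_prod using assms(1) by (subst prod.remove[of _ i]) auto
  moreover have "(\<Prod>j\<in>{..<r} - {i}. (x - \<iota> (fibre_point j))) \<in> V"
    by (intro O_sub_place[OF V] O_prod O_diff O_x O_emb)
  ultimately have "px A \<in> max_ideal V" using max_ideal_mult(1)[OF t] by simp
  then show ?thesis using mem_iff_ord(2)[OF O_FF[OF px_O] pxA_nonzero] by simp
qed

text \<open>
  For a power \<open>t\<close> of \<open>A\<close> large enough to absorb all zeros and poles over \<open>A = 0\<close>, both \<open>z t\<close> and \<open>t / z\<close> lie in
  \<open>O\<close>. Their product is a power of \<open>A\<close>, so \<open>z t\<close> is a polynomial in \<open>x\<close> by \<open>factor_of_A_power\<close>.
\<close>

lemma units_symmetric:
  assumes z: "z \<in> FF" "z \<noteq> 0" and ord0: "\<And>V. V \<in> npl \<Longrightarrow> ord_at V z = 0" and i: "i < r"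
  shows "ord_at (Ppt i) z = ord_at (Npt i) z"
proof -
  define N where "N = (\<Sum>i<r. nat \<bar>ord_at (Ppt i) z\<bar> + nat \<bar>ord_at (Npt i) z\<bar>)"
  have bound: "\<bar>ord_at V z\<bar> \<le> int N" if "j < r" "V = Ppt j \<or> V = Npt j" for j V
  proof -
    have "nat \<bar>ord_at (Ppt j) z\<bar> + nat \<bar>ord_at (Npt j) z\<bar> \<le> N"
      unfolding N_def using that(1) by (intro member_le_sum) auto
    then show ?thesis using that(2) by auto
  qed
  define t where "t = px A ^ N"
  have tO: "t \<in> Oring" "t \<in> FF" "t \<noteq> 0" by (auto simp: t_def O_FF O_power)
  have ge: "\<bar>ord_at V z\<bar> \<le> ord_at V t" if V: "V \<in> fplc" for V
  proof (cases "V \<in> npl")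
    case True
    then show ?thesis using ord0[OF True] ord_O_nonneg[OF V tO(1,3)] by simp
  next
    case False
    then obtain j where j: "j < r" "V = Ppt j \<or> V = Npt j" using fplc_cases[OF V] by blast
    have "ord_at V t = int N * ord_at V (px A)"
      unfolding t_def using discrete_place.ord_power[OF discrete[OF fplc_plc[OF V]] O_FF[OF px_O] pxA_nonzero] .
    moreover have "int N * 1 \<le> int N * ord_at V (px A)" using pxA_in_point[OF j] by (intro mult_left_mono) auto
    ultimately show ?thesis using bound[OF j] by linarith
  qed
  have zt: "z * t \<in> FF" "z * t \<noteq> 0" "t / z \<in> FF" "t / z \<noteq> 0"
    using z tO subfieldD(4)[OF subfield_FF] subfield_closed(3)[OF subfield_FF] by auto
  have 1: "z * t \<in> Oring"
  proof (rule normal[OF zt(1)])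
    fix V assume V: "V \<in> plc" "x \<in> V"
    interpret discrete_place "range \<iota>" FF V by (rule discrete[OF V(1)])
    have "0 \<le> ord_at V (z * t)" using ord_mult[OF z tO(2,3)] ge[of V] V by (auto simp: fplc_def)
    then show "z * t \<in> V" using mem_iff_ord(1)[OF zt(1,2)] by simp
  qed
  have 2: "t / z \<in> Oring"
  proof (rule normal[OF zt(3)])
    fix V assume V: "V \<in> plc" "x \<in> V"
    interpret discrete_place "range \<iota>" FF V by (rule discrete[OF V(1)])
    have "0 \<le> ord_at V (t / z)" using ord_divide[OF tO(2,3) z] ge[of V] V by (auto simp: fplc_def)
    then show "t / z \<in> V" using mem_iff_ord(1)[OF zt(3,4)] by simp
  qed
  have "(z * t) * (t / z) = px A ^ (N + N)" using z(2) by (simp add: t_def power_add)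
  then have "im (z * t) = 0" using factor_of_A_power[OF 1 2] by blast
  then have w: "z * t = pe (re (z * t))" using el_re_im[OF 1] by (simp add: el_def)
  then have u0: "re (z * t) \<noteq> 0" using zt(2) by auto
  have A0: "fract_poly (lift_const A) ^ N \<noteq> 0" using pxA_nonzero unfolding pxA_pe by auto
  have tp: "t = pe (fract_poly (lift_const A) ^ N)" by (simp add: t_def pxA_pe pe_power)
  have "ord_at (Ppt i) (z * t) = ord_at (Npt i) (z * t)"
    using ord_pe_Ppt[OF i u0] ord_pe_Npt[OF i u0] w by simp
  moreover have "ord_at (Ppt i) t = ord_at (Npt i) t"
    unfolding tp using ord_pe_Ppt[OF i A0] ord_pe_Npt[OF i A0] by simp
  moreover have "ord_at (Ppt i) (z * t) = ord_at (Ppt i) z + ord_at (Ppt i) t"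
    using discrete_place.ord_mult[OF discrete[OF Ppt_place[OF i]] z tO(2,3)] .
  moreover have "ord_at (Npt i) (z * t) = ord_at (Npt i) z + ord_at (Npt i) t"
    using discrete_place.ord_mult[OF discrete[OF Npt_place[OF i]] z tO(2,3)] .
  ultimately show ?thesis by linarith
qed

subsection \<open>Places outside the fibre over \<open>A = 0\<close> are principal there\<close>

text \<open>
  The centre \<open>q\<close> of \<open>V\<close> gives the function. Were it to vanish at a second place \<open>W\<close>, the centre of \<open>W\<close> would be
  associated to \<open>q\<close> and the two places would have the same local ring.
\<close>

lemma principal_place:
  assumes V: "V \<in> npl"
  obtains z where "z \<in> FF" "z \<noteq> 0" "ord_at V z = 1" "\<And>W. W \<in> npl \<Longrightarrow> W \<noteq> V \<Longrightarrow> ord_at W z = 0"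
proof -
  have Vp: "V \<in> plc" "x \<in> V" using V by (auto simp: npl_def fplc_def)
  obtain q where q: "prime_elem q" "\<And>Z. e2 Z \<in> max_ideal V \<longleftrightarrow> q dvd Z" using centre[OF Vp npl_A[OF V]] by blast
  interpret V: discrete_place "range \<iota>" FF V by (rule discrete[OF Vp(1)])
  have lp: "loc_param V (e2 q)" by (rule loc_param_centre[OF Vp npl_A[OF V] q])
  have "ord_at V (e2 q) = 1" using V.ord_uniformizer loc_param_discrete(2)[OF Vp lp] by blast
  moreover have "ord_at W (e2 q) = 0" if W: "W \<in> npl" "W \<noteq> V" for W
  proof -
    have Wp: "W \<in> plc" "x \<in> W" using W by (auto simp: npl_def fplc_def)
    interpret W: discrete_place "range \<iota>" FF W by (rule discrete[OF Wp(1)])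
    obtain q' where q': "prime_elem q'" "\<And>Z. e2 Z \<in> max_ideal W \<longleftrightarrow> q' dvd Z" using centre[OF Wp npl_A[OF W(1)]] by blast
    have "e2 q \<notin> max_ideal W"
    proof
      assume "e2 q \<in> max_ideal W"
      then have "q' dvd q" using q' by blast
      then have qq: "q dvd q'" using q(1) q'(1) by (metis prime_elem_imp_irreducible irreducibleD' prime_elem_not_unit)
      have "V \<subseteq> W"
      proof
        fix z assume "z \<in> V"
        then obtain a b where ab: "a \<in> Oring" "b \<in> Oring" "b \<notin> max_ideal V" "z = a / b"
          using loc_param_fraction[OF Vp lp] by metis
        obtain d N Q where Q: "d \<noteq> 0" "b * (\<iota> (to_fract d) * px A ^ N) = e2 Q" using O_clear[OF ab(2)] .
        have "b * (\<iota> (to_fract d) * px A ^ N) \<in> V - max_ideal V"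
          using ab(2,3) npl_A[OF V] O_sub_place[OF Vp] px_unit_const[OF Vp(1) Q(1)]
          by (intro V.unit_mult V.unit_power) auto
        then have "\<not> q dvd Q" using q(2) Q(2) by auto
        then have "\<not> q' dvd Q" using qq dvd_trans by blast
        then have nm: "e2 Q \<notin> max_ideal W" using q'(2) by blast
        have "b \<notin> max_ideal W"
        proof
          assume "b \<in> max_ideal W"
          then have "b * (\<iota> (to_fract d) * px A ^ N) \<in> max_ideal W"
            by (intro W.max_ideal_mult(1) O_sub_place[OF Wp] O_mult O_power O_emb px_O)
          then show False using nm Q(2) by simp
        qed
        then show "z \<in> W" unfolding ab(4) using W.V_divide[of a b] O_sub_place[OF Wp] ab(1,2) by auto
      qed
      then show False using V.place_maximal Wp(1) W(2) by blast
    qed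
    then show ?thesis using W.ord_unit[of "e2 q"] O_sub_place[OF Wp e2_O] by blast
  qed
  moreover have "e2 q \<noteq> 0" using q(1) by auto
  ultimately show thesis using that O_FF[OF e2_O] by blast
qed

definition gen_fun :: "'a set \<Rightarrow> 'a" where
  "gen_fun V = (SOME z. z \<in> FF \<and> z \<noteq> 0 \<and> ord_at V z = 1 \<and> (\<forall>W\<in>npl. W \<noteq> V \<longrightarrow> ord_at W z = 0))"

lemma gen_fun:
  assumes "V \<in> npl"
  shows "gen_fun V \<in> FF" "gen_fun V \<noteq> 0" "W \<in> npl \<Longrightarrow> ord_at W (gen_fun V) = (if W = V then 1 else 0)"
proof -
  have "\<exists>z. z \<in> FF \<and> z \<noteq> 0 \<and> ord_at V z = 1 \<and> (\<forall>W\<in>npl. W \<noteq> V \<longrightarrow> ord_at W z = 0)"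
    using principal_place[OF assms] by metis
  from someI_ex[OF this, folded gen_fun_def] show "gen_fun V \<in> FF" "gen_fun V \<noteq> 0"
    "W \<in> npl \<Longrightarrow> ord_at W (gen_fun V) = (if W = V then 1 else 0)" by auto
qed

text \<open>The functions of \<open>principal_place\<close> are multiplied, with the coefficients of \<open>D\<close> as exponents.\<close>

lemma principal_outside:
  assumes "finite (Poly_Mapping.keys D)"
  obtains z where "z \<in> FF" "z \<noteq> 0" "\<And>V. V \<in> npl \<Longrightarrow> ord_at V z = Poly_Mapping.lookup D V"
proof -
  let ?S = "Poly_Mapping.keys D \<inter> npl"
  define z where "z = (\<Prod>V\<in>?S. gen_fun V powi Poly_Mapping.lookup D V)"
  have fac: "gen_fun V powi Poly_Mapping.lookup D V \<in> FF \<and> gen_fun V powi Poly_Mapping.lookup D V \<noteq> 0" if "V \<in> ?S" for V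
    using gen_fun[of V] that subfield_closed(5)[OF subfield_FF] by auto
  have "ord_at V z = Poly_Mapping.lookup D V" if V: "V \<in> npl" for V
  proof -
    interpret discrete_place "range \<iota>" FF V by (rule discrete[OF npl_plc[OF V]])
    have "ord_at V z = (\<Sum>W\<in>?S. ord_at V (gen_fun W powi Poly_Mapping.lookup D W))"
      unfolding z_def using ord_prod[of ?S "\<lambda>V. gen_fun V powi Poly_Mapping.lookup D V"] fac by blast
    also have "\<dots> = (\<Sum>W\<in>?S. if W = V then Poly_Mapping.lookup D W else 0)"
      using V gen_fun by (intro sum.cong) (auto simp: ord_powi)
    also have "\<dots> = Poly_Mapping.lookup D V" using V by (auto simp: in_keys_iff)
    finally show ?thesis .
  qed
  moreover have "z \<in> FF" "z \<noteq> 0"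
  proof -
    interpret discrete_place "range \<iota>" FF Vinf by (rule Vinf_discrete)
    show "z \<in> FF" unfolding z_def using ord_prod[of ?S "\<lambda>V. gen_fun V powi Poly_Mapping.lookup D V"] fac by blast
    show "z \<noteq> 0" unfolding z_def using fac by simp
  qed
  ultimately show thesis using that by blast
qed

subsection \<open>The class group is free on the points over \<open>A = 0\<close>\<close>

lemma ord_linear:
  assumes i: "i < r"
  shows "V \<in> npl \<Longrightarrow> ord_at V (x - \<iota> (fibre_point i)) = 0"
    "j < r \<Longrightarrow> ord_at (Ppt j) (x - \<iota> (fibre_point i)) = (if j = i then 1 else 0)"
    "j < r \<Longrightarrow> ord_at (Npt j) (x - \<iota> (fibre_point i)) = (if j = i then 1 else 0)"
    "x - \<iota> (fibre_point i) \<in> FF" "x - \<iota> (fibre_point i) \<noteq> 0"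
proof -
  let ?t = "x - \<iota> (fibre_point i)"
  have tO: "?t \<in> Oring" by (intro O_diff O_x O_emb)
  show FF: "?t \<in> FF" "?t \<noteq> 0" using O_FF[OF tO] x_notin_K by auto
  have tp: "?t = pe [:- fibre_point i, 1:]" by (simp add: pe_pCons emb_uminus emb_1)
  show "ord_at V ?t = 0" if V: "V \<in> npl"
  proof -
    have Vp: "V \<in> plc" "x \<in> V" using V by (auto simp: npl_def fplc_def)
    interpret discrete_place "range \<iota>" FF V by (rule discrete[OF Vp(1)])
    have "?t \<notin> max_ideal V"
      using places_over_point[OF point_on_curve(1,2)[OF i] Vp(1)] V i by (auto simp: npl_def Ppt_def Npt_def)
    then show ?thesis using ord_unit[of ?t] O_sub_place[OF Vp tO] by blast
  qed
  have order: "order (fibre_point j) [:- fibre_point i, 1:] = (if j = i then 1 else 0)" if j: "j < r"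
  proof (cases "j = i")
    case True
    then show ?thesis using order_power_n_n[of "fibre_point i" 1] by simp
  next
    case False
    then have "fibre_point j \<noteq> fibre_point i" using inj_\<alpha> i j by (auto simp: fibre_point_def inj_on_def)
    then show ?thesis using False by (simp add: order_0I)
  qed
  show "j < r \<Longrightarrow> ord_at (Ppt j) ?t = (if j = i then 1 else 0)" "j < r \<Longrightarrow> ord_at (Npt j) ?t = (if j = i then 1 else 0)"
    unfolding tp using ord_pe_Ppt ord_pe_Npt order by simp_all
qed

lemma Ppt_distinct:
  assumes "i < r" "j < r" shows "Ppt i = Ppt j \<longleftrightarrow> i = j" "Ppt i \<noteq> Npt j"
proof -
  have fp: "fibre_point i = fibre_point j \<longleftrightarrow> i = j" using inj_\<alpha> assms by (auto simp: fibre_point_def inj_on_def)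
  show "Ppt i = Ppt j \<longleftrightarrow> i = j"
    using Vpt_distinct(1)[OF point_on_curve(1,2)[OF assms(1)] point_on_curve(1,2)[OF assms(2)]] fp
    by (auto simp: Ppt_def)
  show "Ppt i \<noteq> Npt j"
  proof
    assume eq: "Ppt i = Npt j"
    note d = Vpt_distinct[OF point_on_curve(1,2)[OF assms(1)] point_on_curve(3,4)[OF assms(2)] eq[unfolded Ppt_def Npt_def]]
    then have "fibre_value i = - fibre_value i" using fp by auto
    then have "fibre_value i + fibre_value i = 0" by (simp only: eq_neg_iff_add_eq_0)
    then have "\<iota> (fibre_value i) + \<iota> (fibre_value i) = 0" unfolding emb_add[symmetric] by (simp only: emb_0)
    then have "2 * \<iota> (fibre_value i) = 0" by (simp only: mult_2)
    then show False using point_on_curve(2)[OF assms(1)] by simp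
  qed
qed

text \<open>
  The functions \<open>x - \<alpha> i\<close> correct the orders at the points \<open>Npt i\<close>. So every divisor is equivalent to a
  combination of the \<open>Ppt i\<close> and infinity.
\<close>

lemma reduced_representative:
  obtains w where "w \<in> FF" "w \<noteq> 0" "\<And>V. V \<in> npl \<Longrightarrow> ord_at V w = Poly_Mapping.lookup D V"
    "\<And>i. i < r \<Longrightarrow> ord_at (Npt i) w = Poly_Mapping.lookup D (Npt i)"
proof -
  obtain z where z: "z \<in> FF" "z \<noteq> 0" "\<And>V. V \<in> npl \<Longrightarrow> ord_at V z = Poly_Mapping.lookup D V"
    using principal_outside[of D] by auto
  define n where "n i = Poly_Mapping.lookup D (Npt i) - ord_at (Npt i) z" for i
  define t where "t = (\<Prod>i<r. (x - \<iota> (fibre_point i)) powi n i)"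
  have fac: "(x - \<iota> (fibre_point i)) powi n i \<in> FF \<and> (x - \<iota> (fibre_point i)) powi n i \<noteq> 0" if "i < r" for i
    using ord_linear(4,5)[OF that] subfield_closed(5)[OF subfield_FF] by auto
  have ordt: "ord_at V t = (\<Sum>i<r. n i * ord_at V (x - \<iota> (fibre_point i)))" if "V \<in> plc" for V
  proof -
    interpret discrete_place "range \<iota>" FF V by (rule discrete[OF that])
    have "ord_at V t = (\<Sum>i<r. ord_at V ((x - \<iota> (fibre_point i)) powi n i))"
      unfolding t_def using ord_prod[of "{..<r}" "\<lambda>i. (x - \<iota> (fibre_point i)) powi n i"] fac by blast
    then show ?thesis using ord_linear(4,5) by (auto simp: ord_powi intro!: sum.cong)
  qed
  have t: "t \<in> FF" "t \<noteq> 0"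
  proof -
    interpret discrete_place "range \<iota>" FF Vinf by (rule Vinf_discrete)
    show "t \<in> FF" unfolding t_def using ord_prod[of "{..<r}" "\<lambda>i. (x - \<iota> (fibre_point i)) powi n i"] fac by blast
    show "t \<noteq> 0" unfolding t_def using fac by simp
  qed
  have ordzt: "ord_at V (z * t) = ord_at V z + ord_at V t" if "V \<in> plc" for V
    using discrete_place.ord_mult[OF discrete[OF that] z(1,2) t] .
  show thesis
  proof (rule that[of "z * t"])
    show "z * t \<in> FF" "z * t \<noteq> 0" using z t subfieldD(4)[OF subfield_FF] by auto
    show "ord_at V (z * t) = Poly_Mapping.lookup D V" if V: "V \<in> npl" for V
      using ordzt[OF npl_plc[OF V]] z(3)[OF V] ordt[OF npl_plc[OF V]] ord_linear(1)[OF _ V] by simp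
    show "ord_at (Npt i) (z * t) = Poly_Mapping.lookup D (Npt i)" if i: "i < r" for i
    proof -
      have "ord_at (Npt i) t = (\<Sum>j<r. if j = i then n i else 0)"
        unfolding ordt[OF Npt_place[OF i]] using ord_linear(3) i by (intro sum.cong) auto
      then have "ord_at (Npt i) t = n i" using i by simp
      then show ?thesis using ordzt[OF Npt_place[OF i]] by (simp add: n_def)
    qed
  qed
qed

text \<open>
  Degrees are zero on both sides, so the coefficient at infinity is determined by the others.
\<close>

lemma principalI:
  assumes D: "Poly_Mapping.keys D \<subseteq> plc" "ddeg D = 0" and w: "w \<in> FF" "w \<noteq> 0"
    and eq: "\<And>V. V \<in> fplc \<Longrightarrow> Poly_Mapping.lookup D V = ord_at V w"
  shows "D = dv w"
proof -
  let ?E = "D - dv w"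
  have E0: "Poly_Mapping.lookup ?E V = 0" if "V \<noteq> Vinf" for V
  proof (cases "V \<in> plc")
    case True
    then have "V \<in> fplc" using that plc_cases by blast
    then show ?thesis using eq True by (simp add: lookup_minus lookup_dv[OF w])
  next
    case False
    then show ?thesis using D(1) by (auto simp: lookup_minus lookup_dv[OF w] in_keys_iff)
  qed
  have "ddeg ?E = 0" using D(2) ddeg_dv[OF w] by (simp add: div_degree_diff)
  moreover have "ddeg ?E = (\<Sum>V\<in>{Vinf}. Poly_Mapping.lookup ?E V * int (place_degree (range \<iota>) V))"
    by (rule div_degree_superset) (use E0 in \<open>auto simp: in_keys_iff\<close>)
  ultimately have "Poly_Mapping.lookup ?E Vinf = 0" by (simp add: qdim_Vinf)
  then have "?E = 0" using E0 by (intro poly_mapping_eqI) (metis lookup_zero)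
  then show ?thesis by simp
qed

text \<open>
  The difference of the coefficients at \<open>Ppt i\<close> and \<open>Npt i\<close>, after subtraction of a principal divisor that
  agrees with \<open>D\<close> on \<open>npl\<close>. By \<open>units_symmetric\<close> the choice of this divisor does not matter.
\<close>

definition class_coords :: "('a set \<Rightarrow>\<^sub>0 int) \<Rightarrow> nat \<Rightarrow> int" where
  "class_coords D i = (let z = (SOME z. z \<in> FF \<and> z \<noteq> 0 \<and> (\<forall>V\<in>npl. ord_at V z = Poly_Mapping.lookup D V)) in
     Poly_Mapping.lookup D (Ppt i) - Poly_Mapping.lookup D (Npt i) - (ord_at (Ppt i) z - ord_at (Npt i) z))"

lemma class_coords_eq:
  assumes w: "w \<in> FF" "w \<noteq> 0" "\<And>V. V \<in> npl \<Longrightarrow> ord_at V w = Poly_Mapping.lookup D V" and i: "i < r"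
  shows "class_coords D i = Poly_Mapping.lookup D (Ppt i) - Poly_Mapping.lookup D (Npt i) - (ord_at (Ppt i) w - ord_at (Npt i) w)"
proof -
  define z where "z = (SOME z. z \<in> FF \<and> z \<noteq> 0 \<and> (\<forall>V\<in>npl. ord_at V z = Poly_Mapping.lookup D V))"
  have "w \<in> FF \<and> w \<noteq> 0 \<and> (\<forall>V\<in>npl. ord_at V w = Poly_Mapping.lookup D V)" using w by blast
  then have z: "z \<in> FF" "z \<noteq> 0" "\<And>V. V \<in> npl \<Longrightarrow> ord_at V z = Poly_Mapping.lookup D V"
    unfolding z_def by (rule someI2, blast)+
  have zw: "z / w \<in> FF" "z / w \<noteq> 0" using z w subfield_closed(3)[OF subfield_FF] by auto
  have d: "ord_at V (z / w) = ord_at V z - ord_at V w" if "V \<in> plc" for V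
    using discrete_place.ord_divide[OF discrete[OF that] z(1,2) w(1,2)] .
  have "ord_at (Ppt i) (z / w) = ord_at (Npt i) (z / w)"
    by (rule units_symmetric[OF zw _ i]) (use d z w npl_plc in simp)
  then have "ord_at (Ppt i) z - ord_at (Npt i) z = ord_at (Ppt i) w - ord_at (Npt i) w"
    using d[OF Ppt_place[OF i]] d[OF Npt_place[OF i]] by linarith
  then show ?thesis unfolding class_coords_def z_def[symmetric] Let_def by simp
qed

lemma class_coords_add: assumes "i < r" shows "class_coords (D + E) i = class_coords D i + class_coords E i"
proof -
  obtain z where z: "z \<in> FF" "z \<noteq> 0" "\<And>V. V \<in> npl \<Longrightarrow> ord_at V z = Poly_Mapping.lookup D V"
    using principal_outside[of D] by auto
  obtain w where w: "w \<in> FF" "w \<noteq> 0" "\<And>V. V \<in> npl \<Longrightarrow> ord_at V w = Poly_Mapping.lookup E V"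
    using principal_outside[of E] by auto
  have zw: "z * w \<in> FF" "z * w \<noteq> 0" using z w subfieldD(4)[OF subfield_FF] by auto
  have m: "ord_at V (z * w) = ord_at V z + ord_at V w" if "V \<in> plc" for V
    using discrete_place.ord_mult[OF discrete[OF that] z(1,2) w(1,2)] .
  have "class_coords (D + E) i = Poly_Mapping.lookup (D + E) (Ppt i) - Poly_Mapping.lookup (D + E) (Npt i)
      - (ord_at (Ppt i) (z * w) - ord_at (Npt i) (z * w))"
    by (rule class_coords_eq[OF zw _ assms]) (use m npl_plc z w in \<open>simp add: lookup_add\<close>)
  then show ?thesis
    using class_coords_eq[OF z assms] class_coords_eq[OF w assms] m[OF Ppt_place[OF assms]] m[OF Npt_place[OF assms]]
    by (simp add: lookup_add)
qed

definition class_hom :: "('a set \<Rightarrow>\<^sub>0 int) \<Rightarrow> (nat \<Rightarrow>\<^sub>0 int)" where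
  "class_hom D = Abs_poly_mapping (\<lambda>i. if i < r then class_coords D i else 0)"

lemma lookup_class_hom: "Poly_Mapping.lookup (class_hom D) i = (if i < r then class_coords D i else 0)"
proof -
  have "finite {i. (if i < r then class_coords D i else 0) \<noteq> 0}" by (rule finite_subset[of _ "{..<r}"]) auto
  then show ?thesis by (simp add: class_hom_def)
qed

abbreviation "DD \<equiv> Div0 (range \<iota>) FF"
abbreviation "Zr \<equiv> free_Abelian_group {..<r}"

lemma carrier_DD: "D \<in> carrier DD \<longleftrightarrow> Poly_Mapping.keys D \<subseteq> plc \<and> ddeg D = 0"
  by (simp add: Div0_def divisor_group_def)

lemma group_DD: "group DD" and one_DD: "\<one>\<^bsub>DD\<^esub> = 0" and mult_DD: "D \<otimes>\<^bsub>DD\<^esub> E = D + E"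
proof -
  let ?G = "divisor_group (range \<iota>) FF"
  have G: "group ?G" by (simp add: divisor_group_def)
  have "subgroup {D \<in> carrier ?G. ddeg D = 0} ?G"
  proof (rule group.subgroupI[OF G])
    have "0 \<in> {D \<in> carrier ?G. ddeg D = 0}" by (simp add: divisor_group_def div_degree_def)
    then show "{D \<in> carrier ?G. ddeg D = 0} \<noteq> {}" by blast
    fix D assume "D \<in> {D \<in> carrier ?G. ddeg D = 0}"
    then show "inv\<^bsub>?G\<^esub> D \<in> {D \<in> carrier ?G. ddeg D = 0}" by (simp add: divisor_group_def div_degree_uminus)
  next
    fix D E assume "D \<in> {D \<in> carrier ?G. ddeg D = 0}" "E \<in> {D \<in> carrier ?G. ddeg D = 0}"
    then show "D \<otimes>\<^bsub>?G\<^esub> E \<in> {D \<in> carrier ?G. ddeg D = 0}"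
      using keys_add[of D E] by (auto simp: divisor_group_def div_degree_add)
  qed auto
  then show "group DD" unfolding Div0_def by (rule group.subgroup_imp_group[OF G])
  show "\<one>\<^bsub>DD\<^esub> = 0" "D \<otimes>\<^bsub>DD\<^esub> E = D + E" by (simp_all add: Div0_def divisor_group_def free_Abelian_group_def)
qed

lemma group_hom_class: "group_hom DD Zr class_hom"
proof (rule group_hom.intro[OF group_DD])
  show "group Zr" by simp
  show "group_hom_axioms DD Zr class_hom"
  proof
    show "class_hom \<in> hom DD Zr"
    proof (rule homI)
      fix D show "class_hom D \<in> carrier Zr" by (auto simp: in_keys_iff lookup_class_hom split: if_splits)
      fix E show "class_hom (D \<otimes>\<^bsub>DD\<^esub> E) = class_hom D \<otimes>\<^bsub>Zr\<^esub> class_hom E"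
        by (intro poly_mapping_eqI) (simp add: mult_DD lookup_class_hom lookup_add class_coords_add)
    qed
  qed
qed

lemma dv_in_DD: "z \<in> FF \<Longrightarrow> z \<noteq> 0 \<Longrightarrow> dv z \<in> carrier DD"
  by (simp add: carrier_DD keys_dv ddeg_dv)

lemma class_hom_kernel: "kernel DD Zr class_hom = principal_divisors (range \<iota>) FF"
proof safe
  fix D assume D: "D \<in> kernel DD Zr class_hom"
  then have DD: "Poly_Mapping.keys D \<subseteq> plc" "ddeg D = 0" and h0: "class_hom D = 0"
    by (auto simp: kernel_def carrier_DD)
  obtain w where w: "w \<in> FF" "w \<noteq> 0" "\<And>V. V \<in> npl \<Longrightarrow> ord_at V w = Poly_Mapping.lookup D V"
    "\<And>i. i < r \<Longrightarrow> ord_at (Npt i) w = Poly_Mapping.lookup D (Npt i)" using reduced_representative[of D] by blast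
  have "Poly_Mapping.lookup D V = ord_at V w" if "V \<in> fplc" for V
    using fplc_cases[OF that]
  proof
    assume "\<exists>i<r. V = Ppt i \<or> V = Npt i"
    then obtain i where i: "i < r" "V = Ppt i \<or> V = Npt i" by blast
    have "class_coords D i = 0" using h0 lookup_class_hom[of D i] i(1) by simp
    then show ?thesis using class_coords_eq[OF w(1-3) i(1)] w(4)[OF i(1)] i(2) by auto
  qed (use w in simp)
  then have "D = dv w" by (rule principalI[OF DD w(1,2)])
  then show "D \<in> principal_divisors (range \<iota>) FF" using w by (auto simp: principal_divisors_def)
next
  fix D assume "D \<in> principal_divisors (range \<iota>) FF"
  then obtain z where z: "z \<in> FF" "z \<noteq> 0" "D = dv z" by (auto simp: principal_divisors_def)
  have "class_coords D i = 0" if i: "i < r" for i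
    using class_coords_eq[OF z(1,2), of D i] i z Ppt_place Npt_place npl_plc by (simp add: lookup_dv)
  then have "class_hom D = 0" by (intro poly_mapping_eqI) (simp add: lookup_class_hom)
  then show "D \<in> kernel DD Zr class_hom" using dv_in_DD[OF z(1,2)] z(3) by (simp add: kernel_def)
qed

lemma class_hom_surj: "class_hom ` carrier DD = carrier Zr"
proof safe
  fix D assume "D \<in> carrier DD"
  then show "class_hom D \<in> carrier Zr" using group_hom.hom_closed[OF group_hom_class] by blast
next
  fix n :: "nat \<Rightarrow>\<^sub>0 int" assume n: "n \<in> carrier Zr"
  define D1 where "D1 = (\<Sum>i<r. Poly_Mapping.single (Ppt i) (Poly_Mapping.lookup n i))"
  define D where "D = D1 + Poly_Mapping.single Vinf (- ddeg D1)"
  have l1: "Poly_Mapping.lookup D1 V = (\<Sum>i<r. if Ppt i = V then Poly_Mapping.lookup n i else 0)" for V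
    unfolding D1_def by (simp add: lookup_sum lookup_single when_def)
  have lP: "Poly_Mapping.lookup D1 (Ppt i) = Poly_Mapping.lookup n i" if "i < r" for i
  proof -
    have "(\<Sum>j<r. if Ppt j = Ppt i then Poly_Mapping.lookup n j else 0) = (\<Sum>j<r. if j = i then Poly_Mapping.lookup n j else 0)"
      using Ppt_distinct(1) that by (intro sum.cong) auto
    then show ?thesis using that l1 by simp
  qed
  have l0: "Poly_Mapping.lookup D1 V = 0" if "\<And>i. i < r \<Longrightarrow> Ppt i \<noteq> V" for V
    unfolding l1 using that by (intro sum.neutral) auto
  have lD: "Poly_Mapping.lookup D V = Poly_Mapping.lookup D1 V" if "V \<in> fplc" for V
    using that Vinf_notin_fplc by (auto simp: D_def lookup_add lookup_single when_def)
  have k1: "Poly_Mapping.keys D1 \<subseteq> plc"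
  proof
    fix V assume "V \<in> Poly_Mapping.keys D1"
    then obtain i where "i < r" "Ppt i = V" using l0[of V] by (auto simp: in_keys_iff)
    then show "V \<in> plc" using Ppt_place by blast
  qed
  have kD: "Poly_Mapping.keys D \<subseteq> plc"
    unfolding D_def using keys_add[of D1 "Poly_Mapping.single Vinf (- ddeg D1)"] k1 Vinf_place by (auto split: if_splits)
  have "ddeg (Poly_Mapping.single Vinf m) = m" for m
    using div_degree_superset[of "{Vinf}" "Poly_Mapping.single Vinf m"] qdim_Vinf by simp
  then have "ddeg D = 0" by (simp add: D_def div_degree_add)
  then have DD: "D \<in> carrier DD" using kD by (simp add: carrier_DD)
  have "class_coords D i = Poly_Mapping.lookup n i" if i: "i < r" for i
  proof -
    have "class_coords D i = Poly_Mapping.lookup D (Ppt i) - Poly_Mapping.lookup D (Npt i) - (ord_at (Ppt i) 1 - ord_at (Npt i) 1)"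
    proof (rule class_coords_eq[OF O_FF[OF O_1] one_neq_zero _ i])
      show "ord_at V 1 = Poly_Mapping.lookup D V" if V: "V \<in> npl" for V
        using lD[OF npl_fplc[OF V]] l0[of V] V discrete_place.ord_1[OF discrete[OF npl_plc[OF V]]]
        by (auto simp: npl_def)
    qed
    moreover have "Poly_Mapping.lookup D1 (Npt i) = 0" using l0 Ppt_distinct(2) i by blast
    ultimately show ?thesis
      using lD[OF Ppt_fplc[OF i]] lD[OF Npt_fplc[OF i]] lP[OF i]
        discrete_place.ord_1[OF discrete[OF Ppt_place[OF i]]] discrete_place.ord_1[OF discrete[OF Npt_place[OF i]]] by simp
  qed
  then have "class_hom D = n"
    using n by (intro poly_mapping_eqI) (auto simp: lookup_class_hom in_keys_iff)
  then show "n \<in> class_hom ` carrier DD" using DD by blast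
qed

text \<open>
  The homomorphism \<open>class_hom\<close> reads off the coordinates with respect to the classes of \<open>Ppt i - Vinf\<close>.
\<close>

theorem Pic0_iso: "Pic0 (range \<iota>) FF \<cong> Zr"
  unfolding Pic0_def class_hom_kernel[symmetric]
  by (rule group_hom.FactGroup_iso[OF group_hom_class class_hom_surj])

lemma principal_normal: "principal_divisors (range \<iota>) FF \<lhd> DD"
  unfolding class_hom_kernel[symmetric] by (rule group_hom.normal_kernel[OF group_hom_class])

end

section \<open>Free class groups, the trace, and isomorphisms\<close>

lemma finitely_generated_of_rank_free:
  assumes "G \<cong> free_Abelian_group {..<r}" shows "finitely_generated_of_rank G r"
proof -
  define H :: "nat monoid" where "H = \<lparr>carrier = {0}, monoid.mult = (\<lambda>_ _. 0), one = 0\<rparr>"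
  have H: "comm_group H"
    by (rule comm_groupI) (auto simp: H_def)
  obtain h where h: "h \<in> iso G (free_Abelian_group {..<r})" using assms by (auto simp: is_iso_def)
  have "(\<lambda>x. (h x, 0)) \<in> iso G (free_Abelian_group {..<r} \<times>\<times> H)"
    using h unfolding iso_iff by (auto simp: hom_def DirProd_def H_def inj_on_def)
  then have "G \<cong> free_Abelian_group {..<r} \<times>\<times> H" by (auto simp: is_iso_def)
  moreover have "finite (carrier H)" by (simp add: H_def)
  ultimately show ?thesis using H unfolding finitely_generated_of_rank_def by blast
qed

text \<open>
  A coordinate divisible by every positive integer is zero.
\<close>

lemma max_divisible_free:
  assumes G: "group G" and iso: "G \<cong> free_Abelian_group S" shows "max_divisible G = {\<one>\<^bsub>G\<^esub>}"
proof -
  interpret group G by (rule G)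
  obtain \<phi> where \<phi>: "\<phi> \<in> iso G (free_Abelian_group S)" using iso by (auto simp: is_iso_def)
  then have "\<phi> \<in> hom G (free_Abelian_group S)" by (simp add: iso_def)
  then interpret h: group_hom G "free_Abelian_group S" \<phi>
    using G group_free_Abelian_group by (intro group_hom.intro group_hom_axioms.intro)
  have inj: "inj_on \<phi> (carrier G)" using \<phi> by (auto simp: iso_iff)
  have "h = \<one>\<^bsub>G\<^esub>" if H: "subgroup H G" and div: "\<forall>h\<in>H. \<forall>n>0. \<exists>x\<in>H. x [^]\<^bsub>G\<^esub> (n::nat) = h" and h: "h \<in> H" for H h
  proof -
    have hG: "h \<in> carrier G" using subgroup.subset[OF H] h by auto
    have "Poly_Mapping.lookup (\<phi> h) i = 0" for i
    proof -
      define n where "n = Suc (nat \<bar>Poly_Mapping.lookup (\<phi> h) i\<bar>)"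
      obtain x where x: "x \<in> H" "x [^]\<^bsub>G\<^esub> n = h" using div h n_def by blast
      then have xG: "x \<in> carrier G" using subgroup.subset[OF H] by auto
      have "\<phi> h = frag_cmul (int n) (\<phi> x)" using h.hom_nat_pow[OF xG, of n] x(2) by simp
      then have "Poly_Mapping.lookup (\<phi> h) i = int n * Poly_Mapping.lookup (\<phi> x) i" by simp
      then have "int n dvd Poly_Mapping.lookup (\<phi> h) i" by simp
      then show ?thesis using dvd_imp_le_int[of "Poly_Mapping.lookup (\<phi> h) i" "int n"] by (auto simp: n_def)
    qed
    then have "\<phi> h = 0" by (intro poly_mapping_eqI) simp
    then have "\<phi> h = \<phi> \<one>\<^bsub>G\<^esub>" using h.hom_one by simp
    then show ?thesis using inj_onD[OF inj] hG by simp
  qed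
  then have "max_divisible G \<subseteq> {\<one>\<^bsub>G\<^esub>}" unfolding max_divisible_def by blast
  moreover have "\<forall>h\<in>{\<one>\<^bsub>G\<^esub>}. \<forall>n>0. \<exists>x\<in>{\<one>\<^bsub>G\<^esub>}. x [^]\<^bsub>G\<^esub> (n::nat) = h" by simp
  then have "\<one>\<^bsub>G\<^esub> \<in> max_divisible G" unfolding max_divisible_def using triv_subgroup by blast
  ultimately show ?thesis by blast
qed

subsection \<open>Extension of constants\<close>

text \<open>
  The same pencil over \<open>k(T)\<close> and over \<open>k'(T)\<close> for an extension \<open>k'\<close> of \<open>k\<close>; \<open>k\<close> and \<open>k'\<close> are types, linked only
  by their images in the ambient field.
\<close>

locale pencil_extension =
  lo: pencil \<iota> x y \<alpha> \<beta> r g B + hi: pencil \<iota>' x y \<alpha>' \<beta>' r g B'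
  for \<iota> :: "'k::field_gcd poly fract \<Rightarrow> 'a::field_char_0" and \<iota>' :: "'l::field_gcd poly fract \<Rightarrow> 'a"
    and x y \<alpha> \<beta> \<alpha>' \<beta>' r g B B' +
  assumes range_sub: "range \<iota> \<subseteq> range \<iota>'"
    and points: "\<And>i. i < r \<Longrightarrow> \<iota>' (hi.fibre_point i) = \<iota> (lo.fibre_point i)"
      "\<And>i. i < r \<Longrightarrow> \<iota>' (hi.fibre_value i) = \<iota> (lo.fibre_value i)"
begin

lemma O_sub_hi: "lo.Oring \<subseteq> hi.Oring"
proof -
  have "lo.pe p \<in> hi.Oring" for p
  proof (induction p)
    case (pCons c p)
    have "\<iota> c \<in> hi.Oring" using range_sub hi.O_emb by (metis imageE rangeI subsetD)
    then show ?case using pCons by (auto simp: lo.pe_pCons intro!: hi.O_add hi.O_mult hi.O_x)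
  qed simp
  then show ?thesis by (auto simp: lo.Oring_def lo.el_def intro!: hi.O_add hi.O_mult hi.O_y)
qed

lemma F_sub_hi: "z \<in> lo.FF \<Longrightarrow> z \<in> hi.FF"
  using O_sub_hi hi.FF_I by (auto elim!: lo.FF_cases)

lemma restrict_place:
  assumes V: "V \<in> hi.plc" "\<not> lo.FF \<subseteq> V" "range \<iota> \<noteq> V \<inter> lo.FF"
  shows "V \<inter> lo.FF \<in> lo.plc" "max_ideal (V \<inter> lo.FF) = max_ideal V \<inter> lo.FF"
proof -
  interpret V: place "range \<iota>'" hi.FF V by (rule hi.placeI[OF V(1)])
  note F = subfieldD[OF lo.subfield_FF]
  show "V \<inter> lo.FF \<in> lo.plc"
    unfolding places_def
  proof (intro CollectI conjI ballI psubsetI)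
    show "range \<iota> \<subseteq> V \<inter> lo.FF" using range_sub V.K_sub_V lo.O_FF[OF lo.O_emb] by blast
    show "V \<inter> lo.FF \<noteq> lo.FF" using V(2) by blast
    fix z assume "z \<in> lo.FF"
    then show "z \<in> V \<inter> lo.FF \<or> inverse z \<in> V \<inter> lo.FF" using V.V_cases[OF F_sub_hi] F(5) by blast
  qed (use V F in \<open>auto intro: V.V_diff V.V_mult\<close>)
  show "max_ideal (V \<inter> lo.FF) = max_ideal V \<inter> lo.FF" using F(5) by (auto simp: max_ideal_def)
qed

lemma ord_extension:
  assumes V: "V \<in> hi.plc" "V \<inter> lo.FF \<in> lo.plc" and t: "uniformizer (V \<inter> lo.FF) t" and w: "w \<in> lo.FF" "w \<noteq> 0"
  shows "ord_at V w = ord_at V t * ord_at (V \<inter> lo.FF) w" "0 < ord_at V t" "t \<in> lo.FF" "t \<noteq> 0"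
proof -
  interpret V: discrete_place "range \<iota>'" hi.FF V by (rule hi.discrete[OF V(1)])
  interpret U: discrete_place "range \<iota>" lo.FF "V \<inter> lo.FF" by (rule lo.discrete[OF V(2)])
  have lp: "U.local_param t" by (rule U.uniformizer_local_param[OF t])
  then have t0: "t \<noteq> 0" "t \<in> max_ideal (V \<inter> lo.FF)" by (auto simp: U.local_param_def)
  show tF: "t \<in> lo.FF" "t \<noteq> 0" using t0 U.max_ideal_sub by auto
  have "t \<in> max_ideal V" using t0(2) subfieldD(5)[OF lo.subfield_FF] by (auto simp: max_ideal_def)
  then show "0 < ord_at V t" using V.mem_iff_ord(2)[OF F_sub_hi[OF tF(1)] t0(1)] by simp
  obtain u where u: "u \<in> (V \<inter> lo.FF) - max_ideal (V \<inter> lo.FF)" "w = t powi (ord_at (V \<inter> lo.FF) w) * u"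
    using U.ord_decomp[OF w lp] .
  have u': "u \<noteq> 0" "u \<in> V" "inverse u \<in> V" "u \<in> lo.FF" using u(1) unfolding U.unit_iff by auto
  then have "ord_at V u = 0" using V.ord_unit[of u] V.unit_iff[of u] by blast
  moreover have "ord_at V w = ord_at V (t powi (ord_at (V \<inter> lo.FF) w) * u)" using u(2) by simp
  ultimately show "ord_at V w = ord_at V t * ord_at (V \<inter> lo.FF) w"
    using V.ord_mult[of "t powi (ord_at (V \<inter> lo.FF) w)" u] u' t0(1) F_sub_hi tF(1)
      V.ord_powi[OF F_sub_hi[OF tF(1)] t0(1)] subfield_closed(5)[OF hi.subfield_FF] by simp
qed

text \<open>
  Both places are characterized by the vanishing of the same two functions. In particular a place of
  the extension lies over \<open>A = 0\<close> if and only if its restriction does.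
\<close>

lemma restrict_point:
  assumes i: "i < r" and b: "b ^ 2 = poly (fract_poly lo.f0) (lo.fibre_point i)" "b \<noteq> 0"
    and b': "b' ^ 2 = poly (fract_poly hi.f0) (hi.fibre_point i)" "b' \<noteq> 0" and bb: "\<iota>' b' = \<iota> b"
    and V: "V \<in> hi.plc"
  shows "V = hi.Vpt (hi.fibre_point i) b' \<longleftrightarrow> V \<inter> lo.FF = lo.Vpt (lo.fibre_point i) b"
proof
  let ?P = "lo.Vpt (lo.fibre_point i) b"
  interpret V: place "range \<iota>'" hi.FF V by (rule hi.placeI[OF V])
  have t: "lo.tpt (lo.fibre_point i) = x - \<iota> (lo.fibre_point i)" "hi.tpt (hi.fibre_point i) = x - \<iota> (lo.fibre_point i)"
    using lo.tpt_def[OF b] hi.tpt_def[OF b'] points(1)[OF i] by auto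
  have tF: "x - \<iota> (lo.fibre_point i) \<in> lo.FF" "y - \<iota> b \<in> lo.FF"
    by (intro lo.O_FF lo.O_diff lo.O_x lo.O_y lo.O_emb)+
  have tn: "x - \<iota> (lo.fibre_point i) \<noteq> 0" using lo.x_notin_K by auto
  {
    assume "V \<inter> lo.FF = ?P"
    then have *: "max_ideal (V \<inter> lo.FF) = max_ideal ?P" by simp
    then have "x - \<iota> (lo.fibre_point i) \<in> max_ideal (V \<inter> lo.FF)" "y - \<iota> b \<in> max_ideal (V \<inter> lo.FF)"
      using lo.Vpt_max_ideal[OF b] t by auto
    then have "x - \<iota> (lo.fibre_point i) \<in> max_ideal V" "y - \<iota> b \<in> max_ideal V"
      using subfieldD(5)[OF lo.subfield_FF] by (auto simp: max_ideal_def)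
    then show "V = hi.Vpt (hi.fibre_point i) b'" using hi.point_loc_param(2)[OF b' V] t bb by simp
  next
    assume VP: "V = hi.Vpt (hi.fibre_point i) b'"
    then have m: "x - \<iota> (lo.fibre_point i) \<in> max_ideal V" "y - \<iota> b \<in> max_ideal V"
      using hi.Vpt_max_ideal[OF b'] t bb by auto
    have nsub: "\<not> lo.FF \<subseteq> V"
    proof
      assume "lo.FF \<subseteq> V"
      then have "inverse (x - \<iota> (lo.fibre_point i)) \<in> V" using subfieldD(5)[OF lo.subfield_FF tF(1)] by blast
      then show False using m(1) tn by (auto simp: max_ideal_def)
    qed
    have "x \<in> V \<inter> lo.FF" using VP hi.Vpt_x[OF b'] lo.O_FF[OF lo.O_x] by simp
    then have "range \<iota> \<noteq> V \<inter> lo.FF" using lo.x_notin_K by blast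
    note R = restrict_place[OF V nsub this]
    show "V \<inter> lo.FF = ?P" using lo.point_loc_param(2)[OF b R(1)] m tF t unfolding R(2) by simp
  }
qed

lemma restrict_Ppt: "i < r \<Longrightarrow> V \<in> hi.plc \<Longrightarrow> V = hi.Ppt i \<longleftrightarrow> V \<inter> lo.FF = lo.Ppt i"
  and restrict_Npt: "i < r \<Longrightarrow> V \<in> hi.plc \<Longrightarrow> V = hi.Npt i \<longleftrightarrow> V \<inter> lo.FF = lo.Npt i"
proof -
  assume i: "i < r" and V: "V \<in> hi.plc"
  show "V = hi.Ppt i \<longleftrightarrow> V \<inter> lo.FF = lo.Ppt i" unfolding hi.Ppt_def lo.Ppt_def
    by (rule restrict_point[OF i lo.point_on_curve(1,2)[OF i] hi.point_on_curve(1,2)[OF i] points(2)[OF i] V])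
  have "\<iota>' (- hi.fibre_value i) = \<iota> (- lo.fibre_value i)"
    using points(2)[OF i] by (simp add: hi.emb_uminus lo.emb_uminus)
  then show "V = hi.Npt i \<longleftrightarrow> V \<inter> lo.FF = lo.Npt i" unfolding hi.Npt_def lo.Npt_def
    by (rule restrict_point[OF i lo.point_on_curve(3,4)[OF i] hi.point_on_curve(3,4)[OF i] _ V])
qed

abbreviation "con \<equiv> conorm lo.FF (range \<iota>') hi.FF"

lemma lookup_conorm:
  assumes D: "Poly_Mapping.keys D \<subseteq> lo.plc"
  shows "Poly_Mapping.lookup (con D) V = (if V \<in> hi.plc
     then ord_at V (SOME t. uniformizer (V \<inter> lo.FF) t) * Poly_Mapping.lookup D (V \<inter> lo.FF) else 0)"
proof -
  let ?t = "\<lambda>U. SOME t. uniformizer U t"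
  let ?f = "\<lambda>V. if V \<in> hi.plc then ord_at V (?t (V \<inter> lo.FF)) * Poly_Mapping.lookup D (V \<inter> lo.FF) else 0"
  have "{V. ?f V \<noteq> 0} \<subseteq> (\<Union>U\<in>Poly_Mapping.keys D. {V \<in> hi.plc. ord_at V (?t U) \<noteq> 0})"
    by (auto simp: in_keys_iff split: if_splits)
  moreover have "finite {V \<in> hi.plc. ord_at V (?t U) \<noteq> 0}" if "U \<in> Poly_Mapping.keys D" for U
  proof -
    interpret U: discrete_place "range \<iota>" lo.FF U by (rule lo.discrete) (use that D in blast)
    obtain t where "uniformizer U t" using U.uniformizer_obtain by blast
    then have "uniformizer U (?t U)" by (rule someI)
    then have "U.local_param (?t U)" by (rule U.uniformizer_local_param)
    then have "?t U \<noteq> 0" "?t U \<in> lo.FF" using U.max_ideal_sub U.V_sub_F by (auto simp: U.local_param_def)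
    then show ?thesis using hi.finite_ord_support F_sub_hi by blast
  qed
  then have "finite (\<Union>U\<in>Poly_Mapping.keys D. {V \<in> hi.plc. ord_at V (?t U) \<noteq> 0})"
    by (intro finite_UN_I) auto
  ultimately have "finite {V. ?f V \<noteq> 0}" by (rule finite_subset)
  then show ?thesis unfolding conorm_def by simp
qed

text \<open>
  Subtraction of the divisor of a function \<open>w\<close> leaves a combination of the points \<open>Ppt i\<close> and infinity. If
  \<open>D\<close> becomes the divisor of \<open>z\<close> upstairs, then \<open>z / w\<close> has no zeros and poles outside the fibre over
  \<open>A = 0\<close> and order zero at the \<open>Npt i\<close>, so by \<open>units_symmetric\<close> also at the \<open>Ppt i\<close>.
\<close>

lemma conorm_principal:
  assumes D: "D \<in> carrier lo.DD" and con: "con D = hi.dv z" "z \<in> hi.FF" "z \<noteq> 0"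
  shows "D \<in> principal_divisors (range \<iota>) lo.FF"
proof -
  have DD: "Poly_Mapping.keys D \<subseteq> lo.plc" "lo.ddeg D = 0" using D lo.carrier_DD by auto
  obtain w where w: "w \<in> lo.FF" "w \<noteq> 0" "\<And>V. V \<in> lo.npl \<Longrightarrow> ord_at V w = Poly_Mapping.lookup D V"
    "\<And>i. i < r \<Longrightarrow> ord_at (lo.Npt i) w = Poly_Mapping.lookup D (lo.Npt i)" using lo.reduced_representative[of D] by blast
  have wF: "w \<in> hi.FF" by (rule F_sub_hi[OF w(1)])
  define t where "t U = (SOME t. uniformizer U t)" for U :: "'a set"
  have t: "uniformizer U (t U)" if "U \<in> lo.plc" for U
  proof -
    interpret U: discrete_place "range \<iota>" lo.FF U by (rule lo.discrete[OF that])
    obtain s where "uniformizer U s" using U.uniformizer_obtain by blast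
    then show ?thesis unfolding t_def by (rule someI)
  qed
  have ordz: "ord_at V z = ord_at V (t (V \<inter> lo.FF)) * Poly_Mapping.lookup D (V \<inter> lo.FF)" if "V \<in> hi.plc" for V
    using lookup_conorm[OF DD(1), of V] con that hi.lookup_dv[OF con(2,3), of V] by (simp add: t_def)
  have same: "ord_at V z = ord_at V w" if V: "V \<in> hi.plc" "V \<inter> lo.FF \<in> lo.plc"
    "Poly_Mapping.lookup D (V \<inter> lo.FF) = ord_at (V \<inter> lo.FF) w" for V
    using ordz[OF V(1)] ord_extension(1)[OF V(1,2) t[OF V(2)] w(1,2)] V(3) by simp
  \<comment> \<open>If V contains the smaller function field, both orders vanish; otherwise V restricts to a place.\<close>
  have 1: "ord_at V z = ord_at V w" if V: "V \<in> hi.npl" for V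
  proof (cases "lo.FF \<subseteq> V")
    case True
    have Vp: "V \<in> hi.plc" by (rule hi.npl_plc[OF V])
    interpret V: discrete_place "range \<iota>'" hi.FF V by (rule hi.discrete[OF Vp])
    have "V \<inter> lo.FF = lo.FF" using True by blast
    then have "V \<inter> lo.FF \<notin> lo.plc" by (auto simp: places_def)
    then have "Poly_Mapping.lookup D (V \<inter> lo.FF) = 0" using DD(1) by (auto simp: in_keys_iff)
    then have "ord_at V z = 0" using ordz[OF Vp] by simp
    moreover have "w \<in> V" "inverse w \<in> V" using True w(1) subfieldD(5)[OF lo.subfield_FF] by auto
    then have "ord_at V w = 0" using V.ord_unit[of w] V.unit_iff[of w] w(2) by blast
    ultimately show ?thesis by simp
  next
    case False
    have Vp: "V \<in> hi.plc" "x \<in> V" using V hi.npl_plc hi.npl_fplc hi.fplc_x by blast+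
    have xV: "x \<in> V \<inter> lo.FF" using Vp lo.O_FF[OF lo.O_x] by blast
    then have "range \<iota> \<noteq> V \<inter> lo.FF" using lo.x_notin_K by blast
    then have R: "V \<inter> lo.FF \<in> lo.plc" by (rule restrict_place(1)[OF Vp(1) False])
    have "V \<inter> lo.FF \<in> lo.npl"
      using R xV V restrict_Ppt[OF _ Vp(1)] restrict_Npt[OF _ Vp(1)] by (auto simp: lo.npl_def lo.fplc_def hi.npl_def)
    then show ?thesis using same[OF Vp(1) R] w(3) by simp
  qed
  have PN: "lo.Ppt i \<in> lo.plc" "lo.Npt i \<in> lo.plc" "hi.Ppt i \<inter> lo.FF = lo.Ppt i" "hi.Npt i \<inter> lo.FF = lo.Npt i" if "i < r" for i
    using lo.Ppt_place lo.Npt_place restrict_Ppt[OF that hi.Ppt_place[OF that]] restrict_Npt[OF that hi.Npt_place[OF that]] that by auto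
  have P: "Poly_Mapping.lookup D (lo.Ppt i) = ord_at (lo.Ppt i) w" if i: "i < r" for i
  proof -
    have zw: "z / w \<in> hi.FF" "z / w \<noteq> 0" using con(2,3) wF w(2) subfield_closed(3)[OF hi.subfield_FF] by auto
    have d: "ord_at V (z / w) = ord_at V z - ord_at V w" if "V \<in> hi.plc" for V
      using discrete_place.ord_divide[OF hi.discrete[OF that] con(2,3) wF w(2)] .
    have "ord_at (hi.Ppt i) (z / w) = ord_at (hi.Npt i) (z / w)"
      by (rule hi.units_symmetric[OF zw _ i]) (use d 1 hi.npl_plc in simp)
    moreover have "ord_at (hi.Npt i) z = ord_at (hi.Npt i) w"
      using same[OF hi.Npt_place[OF i]] PN[OF i] w(4)[OF i] by simp
    ultimately have "ord_at (hi.Ppt i) z = ord_at (hi.Ppt i) w"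
      using d[OF hi.Ppt_place[OF i]] d[OF hi.Npt_place[OF i]] by simp
    moreover have "ord_at (hi.Ppt i) w = ord_at (hi.Ppt i) (t (lo.Ppt i)) * ord_at (lo.Ppt i) w" "0 < ord_at (hi.Ppt i) (t (lo.Ppt i))"
      using ord_extension(1,2)[OF hi.Ppt_place[OF i] _ _ w(1,2)] PN[OF i] t[OF PN(1)[OF i]] by simp_all
    ultimately show ?thesis using ordz[OF hi.Ppt_place[OF i]] PN(3)[OF i] by simp
  qed
  have "Poly_Mapping.lookup D V = ord_at V w" if "V \<in> lo.fplc" for V
    using lo.fplc_cases[OF that] w(3,4) P by auto
  then have "D = lo.dv w" by (rule lo.principalI[OF DD w(1,2)])
  then show ?thesis using w(1,2) by (auto simp: principal_divisors_def)
qed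

text \<open>
  The class group over \<open>k'(T)\<close> is free, so its only divisible subgroup is trivial.
\<close>

theorem trace_trivial:
  "{C \<in> carrier (Pic0 (range \<iota>) lo.FF). \<exists>D\<in>C. \<exists>C' \<in> max_divisible (Pic0 (range \<iota>') hi.FF). con D \<in> C'}
     = {\<one>\<^bsub>Pic0 (range \<iota>) lo.FF\<^esub>}"
proof -
  interpret normal "principal_divisors (range \<iota>) lo.FF" lo.DD by (rule lo.principal_normal)
  let ?N = "principal_divisors (range \<iota>) lo.FF" and ?N' = "principal_divisors (range \<iota>') hi.FF"
  have "group (Pic0 (range \<iota>') hi.FF)" unfolding Pic0_def by (rule normal.factorgroup_is_group[OF hi.principal_normal])
  then have md: "max_divisible (Pic0 (range \<iota>') hi.FF) = {?N'}"
    using max_divisible_free[OF _ hi.Pic0_iso] by (simp add: Pic0_def)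
  have one: "\<one>\<^bsub>Pic0 (range \<iota>) lo.FF\<^esub> = ?N" by (simp add: Pic0_def)
  have zero: "0 \<in> ?N" "0 \<in> ?N'"
  proof -
    have "0 = lo.dv 1" "0 = hi.dv 1" using lo.dv_1 hi.dv_1 by auto
    moreover have "1 \<in> lo.FF - {0}" "1 \<in> hi.FF - {0}" using lo.O_FF[OF lo.O_1] hi.O_FF[OF hi.O_1] by auto
    ultimately show "0 \<in> ?N" "0 \<in> ?N'" unfolding principal_divisors_def by blast+
  qed
  show ?thesis unfolding one md
  proof safe
    fix C D assume C: "C \<in> carrier (Pic0 (range \<iota>) lo.FF)" and D: "D \<in> C" and con: "con D \<in> ?N'"
    obtain E where E: "E \<in> carrier lo.DD" "C = ?N #>\<^bsub>lo.DD\<^esub> E"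
      using C unfolding Pic0_def carrier_FactGroup by blast
    have CD: "C = ?N #>\<^bsub>lo.DD\<^esub> D" using repr_independence[OF _ E(1) subgroup_axioms] D E(2) by metis
    have Dc: "D \<in> carrier lo.DD" using r_coset_subset_G[OF subset E(1)] D E(2) by blast
    obtain z where "z \<in> hi.FF - {0}" "con D = hi.dv z" using con unfolding principal_divisors_def by blast
    then have "D \<in> ?N" using conorm_principal[OF Dc] by blast
    then have "C = ?N" unfolding CD by (rule coset_join2[OF Dc subgroup_axioms])
    then show "x \<in> C \<Longrightarrow> x \<in> ?N" "x \<in> ?N \<Longrightarrow> x \<in> C" for x by auto
  next
    show "?N \<in> carrier (Pic0 (range \<iota>) lo.FF)"
      using group.is_monoid[OF factorgroup_is_group] monoid.one_closed unfolding Pic0_def by fastforce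
    have "con 0 = 0" by (simp add: conorm_def cong: if_cong)
    then show "\<exists>D\<in>?N. \<exists>C'\<in>{?N'}. con D \<in> C'" using zero by force
  qed
qed

end

subsection \<open>Isomorphisms of curves\<close>

text \<open>
  The image of the place at infinity is a rational place at which \<open>\<phi> x\<close> has a double pole, and \<open>\<phi> x\<close> has no other
  pole. By \<open>double_pole\<close>, \<open>\<phi> x = a x + b\<close>. Then \<open>\<phi> y1\<close> is integral, hence of the form \<open>u + v y2\<close>, with square \<open>f1 (a x + b)\<close> in
  \<open>K[x]\<close>; so \<open>u v = 0\<close>, and comparison of degrees leaves \<open>u = 0\<close> and \<open>v\<close> constant.
\<close>

lemma curve_isomorphism_affine:
  fixes \<iota> :: "'k::field \<Rightarrow> 'a::field_char_0"
  assumes c1: "hyperelliptic_curve \<iota> x y1 f1 g" and c2: "hyperelliptic_curve \<iota> x y2 f2 g"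
    and g2: "2 \<le> g" and noroot: "\<And>a. poly f2 a \<noteq> 0"
    and bij: "bij_betw \<phi> (hyperelliptic_field.FF \<iota> x y1) (hyperelliptic_field.FF \<iota> x y2)"
    and hom: "\<And>a b. a \<in> hyperelliptic_field.FF \<iota> x y1 \<Longrightarrow> b \<in> hyperelliptic_field.FF \<iota> x y1 \<Longrightarrow>
      \<phi> (a + b) = \<phi> a + \<phi> b \<and> \<phi> (a * b) = \<phi> a * \<phi> b"
    and const: "\<And>c. \<phi> (\<iota> c) = \<iota> c"
  obtains a b e where "a \<noteq> 0" "e \<noteq> 0" "pcompose f1 [:b, a:] = smult (e ^ 2) f2"
proof -
  interpret c1: hyperelliptic_curve \<iota> x y1 f1 g by (rule c1)
  interpret c2: hyperelliptic_curve \<iota> x y2 f2 g by (rule c2)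
  note F1 = subfieldD[OF c1.subfield_FF] and F2 = subfieldD[OF c2.subfield_FF]
  have add: "\<phi> (a + b) = \<phi> a + \<phi> b" and mult: "\<phi> (a * b) = \<phi> a * \<phi> b" if "a \<in> c1.FF" "b \<in> c1.FF" for a b
    using hom that by blast+
  have \<phi>0: "\<phi> 0 = 0" and \<phi>1: "\<phi> 1 = 1" using const[of 0] const[of 1] by (simp_all add: c1.emb_1)
  have diff: "\<phi> (a - b) = \<phi> a - \<phi> b" if "a \<in> c1.FF" "b \<in> c1.FF" for a b
    using add[OF F1(3)[OF that] that(2)] by simp
  have inj: "\<phi> a = \<phi> b \<longleftrightarrow> a = b" if "a \<in> c1.FF" "b \<in> c1.FF" for a b
    using bij that by (auto simp: bij_betw_def inj_on_def)
  have inv: "\<phi> (inverse a) = inverse (\<phi> a)" if a: "a \<in> c1.FF" for a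
  proof (cases "a = 0")
    case False
    then have "\<phi> a * \<phi> (inverse a) = 1" using mult[OF a F1(5)[OF a]] \<phi>1 by simp
    then show ?thesis by (simp add: inverse_unique)
  qed (simp add: \<phi>0)
  have im: "\<phi> a \<in> c2.FF" if "a \<in> c1.FF" for a using bij that by (auto simp: bij_betw_def)
  have surj: "\<exists>a\<in>c1.FF. z = \<phi> a" if "z \<in> c2.FF" for z using bij that by (auto simp: bij_betw_def)
  let ?V = "c1.Vinf" and ?W = "\<phi> ` c1.Vinf"
  interpret V: discrete_place "range \<iota>" c1.FF ?V by (rule c1.Vinf_discrete)
  have memW: "\<phi> a \<in> ?W \<longleftrightarrow> a \<in> ?V" if "a \<in> c1.FF" for a
    using inj that V.V_sub_F by (auto simp: image_iff)
  have W: "?W \<in> c2.plc" unfolding places_def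
  proof (intro CollectI conjI ballI psubsetI)
    show "range \<iota> \<subseteq> ?W" using V.K_sub_V const by (metis image_eqI image_subsetI rangeI)
    show "range \<iota> \<noteq> ?W"
    proof
      assume eq: "range \<iota> = ?W"
      have "z \<in> range \<iota>" if z: "z \<in> ?V" for z
      proof -
        obtain c where "\<phi> z = \<iota> c" using eq z by blast
        then have "\<phi> z = \<phi> (\<iota> c)" using const by simp
        then show ?thesis using inj[OF V.V_sub_F[OF z] c1.O_FF[OF c1.O_emb]] by simp
      qed
      then have "?V \<subseteq> range \<iota>" by blast
      then show False using c1.Vinf_place by (auto simp: places_def)
    qed
    show "?W \<subseteq> c2.FF" using im V.V_sub_F by blast
    show "?W \<noteq> c2.FF"
      using im[OF c1.O_FF[OF c1.O_x]] memW[OF c1.O_FF[OF c1.O_x]] c1.x_notin_Vinf by blast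
    fix z assume "z \<in> c2.FF"
    then obtain a where a: "a \<in> c1.FF" "z = \<phi> a" using surj by blast
    then show "z \<in> ?W \<or> inverse z \<in> ?W" using V.V_cases[OF a(1)] inv[OF a(1)] by (metis image_eqI)
  next
    fix a b assume "a \<in> ?W" "b \<in> ?W"
    then obtain p q where pq: "p \<in> ?V" "q \<in> ?V" "a = \<phi> p" "b = \<phi> q" by blast
    then have "a - b = \<phi> (p - q)" "a * b = \<phi> (p * q)" using diff mult V.V_sub_F by auto
    then show "a - b \<in> ?W" "a * b \<in> ?W" using pq V.V_diff V.V_mult by auto
  qed
  have mW: "\<phi> a \<in> max_ideal ?W \<longleftrightarrow> a \<in> max_ideal ?V" if "a \<in> c1.FF" for a
    unfolding max_ideal_def using memW[OF that] memW[OF F1(5)[OF that]] inv[OF that] inj[OF that F1(1)] \<phi>0 by auto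
  have xF: "x \<in> c1.FF" by (rule c1.O_FF[OF c1.O_x])
  obtain a b where ab: "a \<noteq> 0" "\<phi> x = c2.pe [:b, a:]"
  proof (rule c2.double_pole[OF g2 noroot im[OF xF] _ W])
    show "\<phi> x \<notin> ?W" using memW[OF xF] c1.x_notin_Vinf by simp
    show "\<phi> x \<in> U" if U: "U \<in> c2.plc" "U \<noteq> ?W" for U
    proof (rule ccontr)
      interpret U: place "range \<iota>" c2.FF U by (rule c2.placeI[OF U(1)])
      assume not: "\<phi> x \<notin> U"
      let ?U = "{z \<in> c1.FF. \<phi> z \<in> U}"
      have "?U \<in> c1.plc" unfolding places_def
      proof (intro CollectI conjI ballI psubsetI)
        show "range \<iota> \<subseteq> ?U" using U.K_sub_V const c1.O_FF[OF c1.O_emb] by auto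
        show "?U \<noteq> c1.FF" using not xF by blast
        have xi: "inverse x \<in> ?U" using U.V_cases[OF im[OF xF]] not inv[OF xF] F1(5)[OF xF] by auto
        show "range \<iota> \<noteq> ?U"
        proof
          assume "range \<iota> = ?U"
          then obtain c where "inverse x = \<iota> c" using xi by blast
          then have "x = \<iota> (inverse c)" by (metis c1.emb_inverse inverse_inverse_eq)
          then show False using c1.x_notin_K by blast
        qed
        fix z assume "z \<in> c1.FF"
        then show "z \<in> ?U \<or> inverse z \<in> ?U" using U.V_cases[OF im] inv F1(5) by auto
      qed (use F1 diff mult in \<open>auto intro: U.V_diff U.V_mult\<close>)
      then have "?U = ?V" using c1.infinite_place_unique not by blast
      then have "\<phi> ` ?U = ?W" by simp
      moreover have "\<phi> ` ?U = U" using surj U.V_sub_F by (auto simp: image_iff)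
      ultimately show False using U(2) by simp
    qed
    show "s ^ 2 * \<phi> x \<in> ?W" if s: "s \<in> max_ideal ?W" for s
    proof -
      have "s \<in> ?W" using s by (auto simp: max_ideal_def)
      then obtain p where p: "p \<in> ?V" "s = \<phi> p" by blast
      have pF: "p \<in> c1.FF" by (rule V.V_sub_F[OF p(1)])
      have pm: "p \<in> max_ideal ?V" using mW[OF pF] s p(2) by simp
      have "p ^ 2 * x \<in> ?V"
      proof (cases "p = 0")
        case False
        have x0: "x \<noteq> 0" using c1.x_notin_K[of 0] by simp
        have "1 \<le> ord_at ?V p" using V.mem_iff_ord(2)[OF pF False] pm by simp
        moreover have "ord_at ?V x = - 2" using c1.ord_Vinf[OF c1.O_x x0] c1.dg_pe[of "[:0, 1:]"] c1.pe_X by simp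
        moreover have p2: "p ^ 2 \<in> c1.FF" "p ^ 2 \<noteq> 0" using subfield_closed(4)[OF c1.subfield_FF pF] False by auto
        ultimately have "0 \<le> ord_at ?V (p ^ 2 * x)"
          using V.ord_mult[OF p2 xF x0] V.ord_power[OF pF False, of 2] by simp
        then show ?thesis using V.mem_iff_ord(1)[OF F1(4)[OF p2(1) xF]] p2 x0 by simp
      qed simp
      moreover have "s ^ 2 * \<phi> x = \<phi> (p ^ 2 * x)"
        using mult[OF F1(4)[OF pF pF] xF] mult[OF pF pF] p(2) by (simp add: power2_eq_square)
      ultimately show ?thesis by blast
    qed
    show "\<exists>c. z - \<iota> c \<in> max_ideal ?W" if z: "z \<in> ?W" for z
    proof -
      obtain p where p: "p \<in> ?V" "z = \<phi> p" using z by blast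
      obtain c where c: "p - \<iota> c \<in> max_ideal ?V" using c1.Vinf_residue[OF p(1)] .
      have pc: "p \<in> c1.FF" "\<iota> c \<in> c1.FF" using V.V_sub_F[OF p(1)] c1.O_FF[OF c1.O_emb] by auto
      have "\<phi> (p - \<iota> c) \<in> max_ideal ?W" using mW[OF F1(3)[OF pc]] c by blast
      then have "z - \<iota> c \<in> max_ideal ?W" using diff[OF pc] const p(2) by simp
      then show ?thesis ..
    qed
  qed
  have peq: "\<phi> (c1.pe p) = c2.pe (pcompose p [:b, a:])" for p
  proof (induction p)
    case (pCons c p)
    have "\<phi> (c1.pe (pCons c p)) = \<iota> c + \<phi> x * \<phi> (c1.pe p)"
      unfolding c1.pe_pCons using add mult c1.O_FF[OF c1.O_emb] c1.O_FF[OF c1.O_pe] xF F1(4) const by simp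
    then show ?case unfolding pCons(2) ab(2) pcompose_pCons c2.pe_add c2.pe_mult c2.pe_const .
  qed (simp add: \<phi>0)
  let ?f = "pcompose f1 [:b, a:]"
  have yF: "y1 \<in> c1.FF" by (rule c1.O_FF[OF c1.O_y])
  have Y2: "\<phi> y1 * \<phi> y1 = c2.pe ?f" using mult[OF yF yF] peq[of f1] c1.y_square' by simp
  have YO: "\<phi> y1 \<in> c2.Oring"
  proof (rule c2.normal[OF im[OF yF]])
    fix U assume U: "U \<in> c2.plc" "x \<in> U"
    interpret U: place "range \<iota>" c2.FF U by (rule c2.placeI[OF U(1)])
    show "\<phi> y1 \<in> U"
    proof (rule ccontr)
      assume not: "\<phi> y1 \<notin> U"
      then have m: "inverse (\<phi> y1) \<in> max_ideal U" using U.not_in_V[OF im[OF yF]] by blast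
      have "inverse (\<phi> y1) * (inverse (\<phi> y1) * c2.pe ?f) \<in> max_ideal U"
        using m U.max_ideal_sub[OF m] c2.O_sub_place[OF U c2.O_pe] by (intro U.max_ideal_mult(1) U.V_mult)
      moreover have "\<phi> y1 \<noteq> 0" using not by auto
      ultimately have "1 \<in> max_ideal U" unfolding Y2[symmetric] by (simp add: field_simps)
      then show False by simp
    qed
  qed
  obtain u v where uv: "\<phi> y1 = c2.el u v" using YO by (auto simp: c2.Oring_def)
  have "c2.el (u * u + f2 * (v * v)) (u * v + v * u) = c2.el ?f 0"
    using Y2 unfolding uv c2.el_mult c2.pe_eq_el .
  then have eq: "?f = u * u + f2 * (v * v)" "u * v + v * u = 0" by simp_all
  have "c2.pe (u * v) + c2.pe (u * v) = 0" using eq(2) by (simp add: c2.pe_add[symmetric] mult.commute)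
  then have "2 * c2.pe (u * v) = 0" by (simp only: mult_2)
  then have uv0: "u = 0 \<or> v = 0" by simp
  have degf: "degree ?f = 2 * g + 1" using degree_pcompose[of f1 "[:b, a:]"] ab(1) c1.degree_f by simp
  have v0: "v \<noteq> 0"
  proof
    assume "v = 0"
    then have "?f = u * u" using eq(1) by simp
    then have "degree ?f = 2 * degree u" by (cases "u = 0") (simp_all add: degree_mult_eq)
    then show False using degf by presburger
  qed
  then have f: "?f = f2 * (v * v)" using uv0 eq(1) by simp
  then have "degree ?f = degree f2 + 2 * degree v" using v0 c2.f_nonzero by (simp add: degree_mult_eq)
  then have "degree v = 0" using degf c2.degree_f by simp
  then obtain e where e: "v = [:e:]" by (rule degree_eq_zeroE)
  show thesis
  proof (rule that[OF ab(1)])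
    show "e \<noteq> 0" using v0 e by simp
    show "?f = smult (e ^ 2) f2" unfolding f e by (simp add: power2_eq_square)
  qed
qed

section \<open>Algebraic elements\<close>

lemma is_hom_sum: "is_hom h \<Longrightarrow> h (sum k S) = (\<Sum>s\<in>S. h (k s))"
  by (induction S rule: infinite_finite_induct) (simp_all add: is_homD)

context field_embedding
begin

lemma is_hom_emb: "is_hom \<iota>"
  by (simp add: is_hom_def emb_add emb_mult emb_1)

definition alg :: "'a \<Rightarrow> bool" where
  "alg t \<longleftrightarrow> (\<exists>p. p \<noteq> 0 \<and> poly (map_poly \<iota> p) t = 0)"

lemma span_mult_right:
  assumes "v \<in> vs.span S" "\<And>s. s \<in> S \<Longrightarrow> s * w \<in> vs.span S'" shows "v * w \<in> vs.span S'"
  using assms(1)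
proof (induction rule: vs.span_induct_alt)
  case (step c s v)
  have "\<iota> c * (s * w) + v * w \<in> vs.span S'" by (intro vs.span_add vs.span_scale assms(2) step)
  then show ?case by (simp add: algebra_simps)
qed (simp add: vs.span_zero)

text \<open>
  The powers of \<open>t\<close> all lie in a finite-dimensional space; if \<open>t\<close> were transcendental, they would be distinct
  and independent.
\<close>

lemma finite_module_alg:
  assumes S: "finite S" "1 \<in> vs.span S" and t: "\<And>s. s \<in> S \<Longrightarrow> t * s \<in> vs.span S"
  shows "alg t"
proof (rule ccontr)
  assume not: "\<not> alg t"
  have tr: "p = 0" if "poly (map_poly \<iota> p) t = 0" for p using not that by (auto simp: alg_def)
  note h = is_hom_eval[OF is_hom_emb, of t]
  have mono: "poly (map_poly \<iota> (monom c i)) t = \<iota> c * t ^ i" for c i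
    by (simp add: map_poly_monom poly_monom)
  have "vs.independent (range ((^) t))"
    unfolding vs.independent_explicit_finite_subsets
  proof (intro allI impI ballI)
    fix E u v assume E: "E \<subseteq> range ((^) t)" "finite E" and z: "(\<Sum>v\<in>E. \<iota> (u v) * v) = 0" and v: "v \<in> E"
    obtain J where J: "finite J" "E = (^) t ` J" "inj_on ((^) t) J"
      using finite_subset_image[OF E(2,1)] E by (metis subset_image_inj finite_imageD)
    define p where "p = (\<Sum>j\<in>J. monom (u (t ^ j)) j)"
    have "poly (map_poly \<iota> p) t = (\<Sum>j\<in>J. \<iota> (u (t ^ j)) * t ^ j)"
      unfolding p_def is_hom_sum[OF h] mono ..
    also have "\<dots> = (\<Sum>v\<in>E. \<iota> (u v) * v)" unfolding J(2) by (subst sum.reindex[OF J(3)]) simp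
    finally have "p = 0" using z tr by simp
    moreover obtain i where i: "i \<in> J" "v = t ^ i" using v J(2) by blast
    have "coeff p i = u v" unfolding p_def i(2) coeff_sum using J(1) i(1) by (simp add: sum.delta)
    ultimately show "u v = 0" by simp
  qed
  moreover have tv: "v * t \<in> vs.span S" if "v \<in> vs.span S" for v
    using span_mult_right[OF that, of t S] t by (simp add: mult.commute)
  have "t ^ i \<in> vs.span S" for i
  proof (induction i)
    case (Suc i)
    then show ?case using tv by (simp only: power_Suc2)
  qed (use S(2) in simp)
  then have "range ((^) t) \<subseteq> vs.span S" by blast
  ultimately have "finite (range ((^) t))" using vs.independent_span_bound[OF S(1)] by blast
  moreover have "inj ((^) t)"
  proof (rule injI)
    fix i j assume "t ^ i = t ^ j"
    then have "poly (map_poly \<iota> (monom 1 i - monom 1 j)) t = 0"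
      using is_hom_more(2)[OF h] mono by (simp add: emb_1)
    then have "monom (1::'k) i = monom 1 j" using tr by fastforce
    then show "i = j" by (simp add: monom_eq_iff')
  qed
  ultimately show False using finite_imageD infinite_UNIV_nat by blast
qed

text \<open>
  The products \<open>s t\<^sup>j\<close> with \<open>j\<close> below the degree of the monic equation span a space stable under \<open>t\<close>, and under
  everything under which the span of \<open>S\<close> is stable. Coefficients are only required to preserve the
  span of \<open>S\<close>, so the lemma covers equations over the base field as well as over an algebraic extension.
\<close>

lemma stable_adjoin:
  assumes S: "finite S" "1 \<in> vs.span S" and p: "lead_coeff p = 1" "poly p t = 0"
    and c: "\<And>i s. s \<in> S \<Longrightarrow> coeff p i * s \<in> vs.span S"
  obtains S' where "finite S'" "1 \<in> vs.span S'" "\<And>s. s \<in> S' \<Longrightarrow> t * s \<in> vs.span S'"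
    "\<And>c s. (\<And>s. s \<in> S \<Longrightarrow> c * s \<in> vs.span S) \<Longrightarrow> s \<in> S' \<Longrightarrow> c * s \<in> vs.span S'"
proof -
  define d where "d = degree p"
  define S' where "S' = (\<lambda>(s, j). s * t ^ j) ` (S \<times> {..<d})"
  have in_S': "v * t ^ j \<in> vs.span S'" if "v \<in> vs.span S" "j < d" for v j
    by (rule span_mult_right[OF that(1)]) (use that(2) in \<open>auto simp: S'_def intro!: vs.span_base\<close>)
  have d: "0 < d"
  proof (rule ccontr)
    assume "\<not> 0 < d"
    then have "p = 1" using p(1) by (metis d_def degree_eq_zeroE gr0I lead_coeff_pCons(2) one_pCons)
    then show False using p(2) by simp
  qed
  have "poly p t = (\<Sum>j<d. coeff p j * t ^ j) + t ^ d"
    using p(1) by (simp add: poly_altdef d_def lessThan_Suc_atMost[symmetric])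
  then have td: "t ^ d = - (\<Sum>j<d. coeff p j * t ^ j)" using p(2) by (simp add: eq_neg_iff_add_eq_0 add.commute)
  have top: "s * t ^ d \<in> vs.span S'" if "s \<in> S" for s
  proof -
    have "s * t ^ d = - (\<Sum>j<d. (coeff p j * s) * t ^ j)" unfolding td by (simp add: sum_distrib_left mult_ac)
    also have "\<dots> \<in> vs.span S'" by (intro vs.span_neg vs.span_sum in_S' c that) simp
    finally show ?thesis .
  qed
  show thesis
  proof (rule that[of S'])
    show "finite S'" using S by (simp add: S'_def)
    show "1 \<in> vs.span S'" using in_S'[OF S(2) d] by simp
    fix s assume "s \<in> S'"
    then obtain s0 j where s: "s0 \<in> S" "j < d" "s = s0 * t ^ j" by (auto simp: S'_def)
    show "t * s \<in> vs.span S'"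
    proof (cases "Suc j = d")
      case True
      then have "t * s = s0 * t ^ d" using s(3) by (simp add: mult_ac flip: True)
      then show ?thesis using top[OF s(1)] by simp
    next
      case False
      then have "s0 * t ^ Suc j \<in> vs.span S'" using s by (intro in_S' vs.span_base) auto
      then show ?thesis using s(3) by (simp add: mult_ac)
    qed
    fix c assume "\<And>s. s \<in> S \<Longrightarrow> c * s \<in> vs.span S"
    then have "(c * s0) * t ^ j \<in> vs.span S'" using s by (intro in_S') auto
    then show "c * s \<in> vs.span S'" using s(3) by (simp add: mult_ac)
  qed
qed

lemma alg_monic:
  assumes "alg t" obtains p where "lead_coeff p = 1" "poly (map_poly \<iota> p) t = 0"
proof -
  obtain q where q: "q \<noteq> 0" "poly (map_poly \<iota> q) t = 0" using assms by (auto simp: alg_def)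
  have "poly (map_poly \<iota> (smult (inverse (lead_coeff q)) q)) t = 0"
    using q(2) is_homD(4)[OF is_hom_eval[OF is_hom_emb, of t], of "[:inverse (lead_coeff q):]" q] by simp
  then show ?thesis using that[of "smult (inverse (lead_coeff q)) q"] q(1) by simp
qed

lemma finite_module_exists:
  assumes "finite Z" "\<And>z. z \<in> Z \<Longrightarrow> alg z"
  shows "\<exists>S. finite S \<and> 1 \<in> vs.span S \<and> (\<forall>z\<in>Z. \<forall>s\<in>S. z * s \<in> vs.span S)"
  using assms
proof (induction Z rule: finite_induct)
  case empty
  then show ?case using vs.span_base[of 1 "{1}"] by (intro exI[of _ "{1}"]) auto
next
  case (insert z Z)
  then obtain S where S: "finite S" "1 \<in> vs.span S" "\<And>z s. z \<in> Z \<Longrightarrow> s \<in> S \<Longrightarrow> z * s \<in> vs.span S" by blast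
  obtain p where p: "lead_coeff p = 1" "poly (map_poly \<iota> p) z = 0" using alg_monic[of z] insert.prems by blast
  have lc: "lead_coeff (map_poly \<iota> p) = 1" using p(1) by (simp add: coeff_map_poly degree_map_poly emb_1)
  have c: "coeff (map_poly \<iota> p) i * s \<in> vs.span S" if "s \<in> S" for i s
    using that by (simp add: coeff_map_poly vs.span_base vs.span_scale)
  obtain S' where "finite S'" "1 \<in> vs.span S'" "\<And>s. s \<in> S' \<Longrightarrow> z * s \<in> vs.span S'"
    "\<And>c s. (\<And>s. s \<in> S \<Longrightarrow> c * s \<in> vs.span S) \<Longrightarrow> s \<in> S' \<Longrightarrow> c * s \<in> vs.span S'"
    by (rule stable_adjoin[OF S(1,2) lc p(2) c]) blast+
  then show ?case using S(3) by (intro exI[of _ S']) auto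
qed

lemma alg_emb: "alg (\<iota> c)"
  unfolding alg_def by (rule exI[of _ "[:- c, 1:]"]) (simp add: map_poly_pCons emb_uminus emb_1)

lemma alg_closed:
  assumes "alg a" "alg b" shows "alg (a + b)" "alg (a - b)" "alg (a * b)"
proof -
  obtain S where S: "finite S" "1 \<in> vs.span S" and s: "\<And>s. s \<in> S \<Longrightarrow> a * s \<in> vs.span S" "\<And>s. s \<in> S \<Longrightarrow> b * s \<in> vs.span S"
    using finite_module_exists[of "{a, b}"] assms by (metis finite.emptyI finite.insertI insertCI insertE singletonD)
  show "alg (a + b)"
    by (rule finite_module_alg[OF S]) (use vs.span_add s in \<open>simp add: algebra_simps\<close>)
  show "alg (a - b)"
    by (rule finite_module_alg[OF S]) (use vs.span_diff s in \<open>simp add: algebra_simps\<close>)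
  show "alg (a * b)"
  proof (rule finite_module_alg[OF S])
    fix u assume "u \<in> S"
    then have "(b * u) * a \<in> vs.span S" using s by (intro span_mult_right[OF s(2)]) (simp_all add: mult.commute)
    then show "a * b * u \<in> vs.span S" by (simp add: mult_ac)
  qed
qed

lemma alg_inverse:
  assumes "alg a" shows "alg (inverse a)"
proof (cases "a = 0")
  case False
  obtain p where p: "p \<noteq> 0" "poly (map_poly \<iota> p) a = 0" using assms by (auto simp: alg_def)
  have eq: "map_poly \<iota> (reflect_poly p) = reflect_poly (map_poly \<iota> p)"
    by (rule poly_eqI) (simp add: coeff_map_poly coeff_reflect_poly degree_map_poly)
  have "poly (map_poly \<iota> (reflect_poly p)) (inverse a) = 0"
    unfolding eq using False p(2) by (simp add: poly_reflect_poly_nz)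
  then show ?thesis using p(1) unfolding alg_def by (intro exI[of _ "reflect_poly p"]) simp
qed (use assms in simp)

text \<open>
  A common finite-dimensional space stable under all coefficients of the monic equation is enlarged to one
  stable under \<open>t\<close>.
\<close>

lemma alg_trans:
  assumes p: "p \<noteq> 0" "poly p t = 0" "\<And>i. alg (coeff p i)" shows "alg t"
proof -
  let ?q = "smult (inverse (lead_coeff p)) p"
  have "finite (coeff ?q ` {..degree ?q})" by simp
  moreover have q: "alg (coeff ?q i)" for i using alg_closed(3)[OF alg_inverse p(3)] p(3) by simp
  ultimately obtain S where S: "finite S" "1 \<in> vs.span S"
    "\<And>i s. i \<le> degree ?q \<Longrightarrow> s \<in> S \<Longrightarrow> coeff ?q i * s \<in> vs.span S"
    using finite_module_exists[of "coeff ?q ` {..degree ?q}"] by blast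
  have c: "coeff ?q i * s \<in> vs.span S" if "s \<in> S" for i s
  proof (cases "i \<le> degree ?q")
    case False
    then have "coeff ?q i = 0" by (intro coeff_eq_0) simp
    then show ?thesis by (simp only: mult_zero_left vs.span_zero)
  qed (use S(3) that in blast)
  have "lead_coeff ?q = 1" "poly ?q t = 0" using p(1,2) by simp_all
  then obtain S' where "finite S'" "1 \<in> vs.span S'" "\<And>s. s \<in> S' \<Longrightarrow> t * s \<in> vs.span S'"
    using stable_adjoin[OF S(1,2) _ _ c] by metis
  then show ?thesis by (rule finite_module_alg)
qed

lemma alg_poly:
  assumes "\<And>i. alg (coeff p i)" "alg t" shows "alg (poly p t)"
  using assms(1)
proof (induction p)
  case (pCons c p)
  have "alg c" "alg (poly p t)" using pCons.prems[of 0] pCons.IH pCons.prems[of "Suc _"] by auto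
  then show ?case using alg_closed assms(2) by simp
qed (use alg_emb[of 0] in simp)

end

subsection \<open>Extension of a homomorphism to fractions\<close>

text \<open>
  The unique extension of an injective homomorphism to the field of fractions.
\<close>

definition fract_hom :: "('r::{factorial_ring_gcd, semiring_gcd_mult_normalize} \<Rightarrow> 'a::field) \<Rightarrow> 'r fract \<Rightarrow> 'a" where
  "fract_hom h q = h (fst (quot_of_fract q)) / h (snd (quot_of_fract q))"

lemma fract_hom_quotient:
  assumes h: "is_hom h" "\<And>a. h a = 0 \<Longrightarrow> a = 0" and b: "b \<noteq> 0"
  shows "fract_hom h (to_fract a / to_fract b) = h a / h b"
proof -
  let ?q = "to_fract a / to_fract b" let ?c = "fst (quot_of_fract ?q)" let ?d = "snd (quot_of_fract ?q)"
  have d: "?d \<noteq> 0" by simp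
  have "to_fract ?c / to_fract ?d = ?q" by (metis Fract_conv_to_fract Fract_quot_of_fract)
  then have "to_fract (?c * b) = to_fract (a * ?d)" using d b by (simp add: field_simps)
  then have "?c * b = a * ?d" by (simp only: to_fract_eq_iff)
  then have "h ?c * h b = h a * h ?d" using is_homD(4)[OF h(1)] by metis
  then show ?thesis using h(2) d b unfolding fract_hom_def by (metis frac_eq_eq)
qed

lemma field_embedding_fract_hom:
  assumes h: "is_hom h" "\<And>a. h a = 0 \<Longrightarrow> a = 0" shows "field_embedding (fract_hom h)"
    and "fract_hom h (to_fract a) = h a"
proof -
  note q = fract_hom_quotient[OF h]
  have one: "fract_hom h (to_fract a) = h a" for a using q[of 1 a] is_homD(2)[OF h(1)] by simp
  then show "fract_hom h (to_fract a) = h a" .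
  have rep: "\<exists>a b. z = to_fract a / to_fract b \<and> b \<noteq> 0" for z :: "'a fract"
    by (metis Fract_cases Fract_conv_to_fract)
  show "field_embedding (fract_hom h)"
  proof
    fix z w :: "'a fract"
    obtain a b c d where zw: "z = to_fract a / to_fract b" "b \<noteq> 0" "w = to_fract c / to_fract d" "d \<noteq> 0"
      using rep by metis
    have hz: "h b \<noteq> 0" "h d \<noteq> 0" using h(2) zw by auto
    have "z + w = to_fract (a * d + c * b) / to_fract (b * d)" using zw by (simp add: field_simps)
    then have "fract_hom h (z + w) = h (a * d + c * b) / h (b * d)" using q[of "b * d" "a * d + c * b"] zw by (simp only: mult_eq_0_iff simp_thms)
    also have "\<dots> = h a / h b + h c / h d" using hz by (simp add: is_homD[OF h(1)] field_simps)
    finally show "fract_hom h (z + w) = fract_hom h z + fract_hom h w" using q zw by simp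
    have "z * w = to_fract (a * c) / to_fract (b * d)" using zw by simp
    then have "fract_hom h (z * w) = h (a * c) / h (b * d)" using q[of "b * d" "a * c"] zw by (simp only: mult_eq_0_iff simp_thms)
    then show "fract_hom h (z * w) = fract_hom h z * fract_hom h w" using q zw is_homD(4)[OF h(1)] by simp
  next
    show "fract_hom h 1 = 1" using one[of 1] is_homD(2)[OF h(1)] by simp
  qed
qed

section \<open>Fields of constants\<close>

definition const_emb :: "QT \<Rightarrow> ambient" where "const_emb c = to_ac (to_fract [:c:])"
definition x_gen :: ambient where "x_gen = to_ac (to_fract [:0, 1:])"
definition T_gen :: ambient where "T_gen = const_emb (to_fract [:0, 1:])"

interpretation const: field_embedding const_emb
  by unfold_locales (simp_all add: const_emb_def flip: to_fract_add to_ac_add to_fract_mult to_ac_mult one_pCons)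

interpretation rational: field_embedding "of_rat :: rat \<Rightarrow> ambient"
  by unfold_locales (simp_all add: of_rat_add of_rat_mult)

lemma eval_const_emb: "poly (map_poly const_emb p) x_gen = to_ac (to_fract p)"
proof (induction p)
  case (pCons c p)
  have "poly (map_poly const_emb (pCons c p)) x_gen = const_emb c + x_gen * to_ac (to_fract p)"
    using pCons eval_pCons[OF const.is_hom_emb] by simp
  also have "\<dots> = to_ac (to_fract ([:c:] + [:0, 1:] * p))"
    unfolding const_emb_def x_gen_def by (simp only: to_fract_add to_fract_mult to_ac_add to_ac_mult)
  finally show ?case by simp
qed simp

lemma x_gen_transcendental: "\<not> const.alg x_gen"
  by (simp add: const.alg_def eval_const_emb)

lemma const_emb_rat: "const_emb (to_fract [:c:]) = of_rat c"
proof -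
  interpret h: field_embedding "\<lambda>c. const_emb (to_fract [:c:])"
    by unfold_locales (simp_all add: const.emb_1 flip: const.emb_add const.emb_mult to_fract_add to_fract_mult one_pCons)
  have int: "const_emb (to_fract [:of_int n:]) = of_int n" for n
    by (cases n) (simp_all add: h.emb_of_nat h.emb_uminus h.emb_diff h.emb_1 del: of_nat_Suc)
  show ?thesis
  proof (cases c)
    case (Fract a b)
    then have c: "c = of_int a / of_int b" by (simp add: Fract_of_int_quotient)
    show ?thesis unfolding c h.emb_divide int by (simp add: of_rat_divide)
  qed
qed

lemma alg_rational_iff: "rational.alg z \<longleftrightarrow> algebraic z"
proof
  assume "rational.alg z"
  then obtain p where "p \<noteq> 0" "poly (map_poly of_rat p) z = 0" by (auto simp: rational.alg_def)
  then show "algebraic z" by (intro algebraicI'[of "map_poly of_rat p"]) (auto simp: coeff_map_poly map_poly_eq_0_iff)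
next
  assume "algebraic z"
  then obtain p where p: "p \<noteq> 0" "poly (map_poly of_int p) z = 0" by (rule algebraicE')
  have "map_poly of_rat (map_poly of_int p :: rat poly) = (map_poly of_int p :: ambient poly)"
    by (rule poly_eqI) (simp add: coeff_map_poly)
  then show "rational.alg z" using p unfolding rational.alg_def
    by (intro exI[of _ "map_poly of_int p"]) (auto simp: map_poly_eq_0_iff)
qed

lemma T_gen_transcendental: "\<not> algebraic T_gen"
proof -
  have "poly (map_poly of_rat p) T_gen = const_emb (to_fract p)" for p :: "rat poly"
  proof (induction p)
    case (pCons c p)
    have "poly (map_poly of_rat (pCons c p)) T_gen = const_emb (to_fract [:c:]) + T_gen * const_emb (to_fract p)"
      using pCons eval_pCons[OF rational.is_hom_emb] const_emb_rat by simp
    also have "\<dots> = const_emb (to_fract ([:c:] + [:0, 1:] * p))"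
      unfolding T_gen_def by (simp only: to_fract_add to_fract_mult const.emb_add const.emb_mult)
    finally show ?case by simp
  qed simp
  then have "\<not> rational.alg T_gen" by (simp add: rational.alg_def)
  then show ?thesis by (simp add: alg_rational_iff)
qed

subsection \<open>The field of algebraic numbers\<close>

text \<open>
  The algebraic numbers as a type, so that the results on pencils over \<open>k(T)\<close> apply with \<open>k\<close> this field.
\<close>

typedef algebraic_number = "{z::ambient. algebraic z}" morphisms an_val an_of
  by (rule exI[of _ 0]) simp

lemma algebraic_closed:
  fixes a b :: ambient
  assumes "algebraic a" "algebraic b" shows "algebraic (a + b)" "algebraic (a - b)" "algebraic (a * b)"
  using assms rational.alg_closed by (simp_all add: alg_rational_iff)

lemma algebraic_1_ambient [simp]: "algebraic (1::ambient)"
  using rational.alg_emb[of 1] by (simp add: alg_rational_iff)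

lemma algebraic_an_val: "algebraic (an_val a)"
  using an_val[of a] by simp

lemma an_val_of: "algebraic z \<Longrightarrow> an_val (an_of z) = z"
  using an_of_inverse[of z] by simp

instantiation algebraic_number :: field
begin

definition "0 = an_of 0"
definition "1 = an_of 1"
definition "a + b = an_of (an_val a + an_val b)"
definition "a - b = an_of (an_val a - an_val b)"
definition "- a = an_of (- an_val a)"
definition "a * b = an_of (an_val a * an_val b)"
definition "inverse a = an_of (inverse (an_val a))"
definition "a div b = an_of (an_val a / an_val b)"

lemmas an_defs = zero_algebraic_number_def one_algebraic_number_def plus_algebraic_number_def
  minus_algebraic_number_def uminus_algebraic_number_def times_algebraic_number_def
  inverse_algebraic_number_def divide_algebraic_number_def

instance
  by standard (simp_all add: an_defs an_val_inject[symmetric] an_val_of algebraic_an_val algebraic_closed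
    algebraic_inverse algebraic_minus divide_inverse algebra_simps)

end

lemma an_val_simps:
  "an_val 0 = 0" "an_val 1 = 1" "an_val (a + b) = an_val a + an_val b" "an_val (a * b) = an_val a * an_val b"
  by (simp_all add: an_defs an_val_of algebraic_an_val algebraic_closed)

lemma is_hom_an_val: "is_hom an_val"
  by (simp add: is_hom_def an_val_simps)

instance algebraic_number :: field_char_0
proof
  show "inj (of_nat :: nat \<Rightarrow> algebraic_number)"
    by (rule injI) (metis is_hom_more(4)[OF is_hom_an_val] of_nat_eq_iff)
qed

instantiation algebraic_number ::
  "{unique_euclidean_ring, normalization_euclidean_semiring, normalization_semidom_multiplicative}"
begin

definition [simp]: "normalize_algebraic_number = (normalize_field :: algebraic_number \<Rightarrow> _)"
definition [simp]: "unit_factor_algebraic_number = (unit_factor_field :: algebraic_number \<Rightarrow> _)"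
definition [simp]: "modulo_algebraic_number = (mod_field :: algebraic_number \<Rightarrow> _)"
definition [simp]: "euclidean_size_algebraic_number = (euclidean_size_field :: algebraic_number \<Rightarrow> _)"
definition [simp]: "division_segment (a :: algebraic_number) = 1"

instance
  by standard (simp_all add: dvd_field_iff field_split_simps split: if_splits)

end

instantiation algebraic_number :: euclidean_ring_gcd
begin

definition "gcd_algebraic_number = (Euclidean_Algorithm.gcd :: algebraic_number \<Rightarrow> _)"
definition "lcm_algebraic_number = (Euclidean_Algorithm.lcm :: algebraic_number \<Rightarrow> _)"
definition "Gcd_algebraic_number = (Euclidean_Algorithm.Gcd :: algebraic_number set \<Rightarrow> _)"
definition "Lcm_algebraic_number = (Euclidean_Algorithm.Lcm :: algebraic_number set \<Rightarrow> _)"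

instance
  by standard (simp_all add: gcd_algebraic_number_def lcm_algebraic_number_def
    Gcd_algebraic_number_def Lcm_algebraic_number_def)

end

instance algebraic_number :: field_gcd ..

subsection \<open>The constants over the algebraic numbers\<close>

text \<open>
  Evaluation at \<open>T\<close>, injective because \<open>T\<close> is transcendental over the algebraic numbers.
\<close>

definition an_eval :: "algebraic_number poly \<Rightarrow> ambient" where
  "an_eval p = poly (map_poly an_val p) T_gen"

lemma is_hom_an_eval: "is_hom an_eval"
  using is_hom_eval[OF is_hom_an_val] by (simp add: an_eval_def[abs_def])

lemma an_val_0_iff [simp]: "an_val a = 0 \<longleftrightarrow> a = 0"
  by (metis an_val_inject an_val_simps(1))

lemma an_eval_0: "an_eval p = 0 \<Longrightarrow> p = 0"
proof (rule ccontr)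
  assume p: "an_eval p = 0" "p \<noteq> 0"
  have "rational.alg T_gen"
  proof (rule rational.alg_trans)
    show "map_poly an_val p \<noteq> 0" using p(2) by (simp add: map_poly_eq_0_iff an_val_simps)
    show "poly (map_poly an_val p) T_gen = 0" using p(1) by (simp add: an_eval_def)
    show "rational.alg (coeff (map_poly an_val p) i)" for i
      by (simp add: coeff_map_poly an_val_simps alg_rational_iff algebraic_an_val)
  qed
  then show False using T_gen_transcendental by (simp add: alg_rational_iff)
qed

definition bar_emb :: "algebraic_number poly fract \<Rightarrow> ambient" where "bar_emb = fract_hom an_eval"

interpretation bar: field_embedding bar_emb
  unfolding bar_emb_def by (rule field_embedding_fract_hom(1)[OF is_hom_an_eval an_eval_0])

lemma bar_emb_to_fract: "bar_emb (to_fract p) = an_eval p"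
  unfolding bar_emb_def by (rule field_embedding_fract_hom(2)[OF is_hom_an_eval an_eval_0])

lemma bar_emb_const: "bar_emb (to_fract [:a:]) = an_val a"
  by (simp add: bar_emb_to_fract an_eval_def map_poly_pCons an_val_simps)

lemma bar_emb_T: "bar_emb (to_fract [:0, 1:]) = T_gen"
  by (simp add: bar_emb_to_fract an_eval_def map_poly_pCons an_val_simps)

lemma obtain_quotient: obtains a b where "q = to_fract a / to_fract b" "b \<noteq> 0"
  by (metis Fract_cases Fract_conv_to_fract)

lemma alg_const_rational:
  assumes "rational.alg z" shows "const.alg z"
proof -
  obtain p :: "rat poly" where p: "p \<noteq> 0" "poly (map_poly of_rat p) z = 0" using assms by (auto simp: rational.alg_def)
  have "map_poly const_emb (map_poly (\<lambda>c. to_fract [:c:]) p) = map_poly of_rat p"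
    by (rule poly_eqI) (simp add: coeff_map_poly const_emb_rat)
  then show ?thesis using p unfolding const.alg_def
    by (intro exI[of _ "map_poly (\<lambda>c. to_fract [:c:]) p"]) (auto simp: map_poly_eq_0_iff)
qed

lemma alg_bar_emb: "const.alg (bar_emb q)"
proof -
  obtain a b where q: "q = to_fract a / to_fract b" by (rule obtain_quotient)
  have "const.alg (an_eval p)" for p
    unfolding an_eval_def
  proof (rule const.alg_poly)
    show "const.alg T_gen" unfolding T_gen_def by (rule const.alg_emb)
    show "const.alg (coeff (map_poly an_val p) i)" for i
      by (rule alg_const_rational) (simp add: coeff_map_poly an_val_simps alg_rational_iff algebraic_an_val)
  qed
  then show ?thesis unfolding q bar.emb_divide bar_emb_to_fract
    by (simp add: divide_inverse const.alg_closed const.alg_inverse)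
qed

text \<open>
  The rational functions in \<open>T\<close> over the algebraic numbers are algebraic over \<open>\<rat>(T)\<close>, and \<open>x\<close> is not.
\<close>

lemma x_gen_transcendental_bar: "poly (map_poly bar_emb p) x_gen = 0 \<Longrightarrow> p = 0"
proof (rule ccontr)
  assume p: "poly (map_poly bar_emb p) x_gen = 0" "p \<noteq> 0"
  have "const.alg x_gen"
  proof (rule const.alg_trans)
    show "map_poly bar_emb p \<noteq> 0" using p(2) by (simp add: map_poly_eq_0_iff)
    show "const.alg (coeff (map_poly bar_emb p) i)" for i by (simp add: coeff_map_poly alg_bar_emb)
  qed (rule p(1))
  then show False using x_gen_transcendental by simp
qed

section \<open>The family of curves\<close>

subsection \<open>Coefficients\<close>

text \<open>
  The sum \<open>0 + 1 + ... + (r - 1)\<close> cancels the second coefficient of \<open>A x\<^sup>k\<close>, so that the term of degree \<open>r + k - 1\<close>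
  vanishes; \<open>c\<close> is the parameter of the family.
\<close>

definition family_B :: "nat \<Rightarrow> nat \<Rightarrow> nat \<Rightarrow> 'k::field_char_0 poly" where
  "family_B r k c = 1 + pencil_A of_nat r * ([:0, 1:] ^ k + of_nat (\<Sum>{..<r}) * [:0, 1:] ^ (k - 1) + of_nat c)"

definition family :: "nat \<Rightarrow> nat \<Rightarrow> nat \<Rightarrow> 'k::field_char_0 poly fract poly" where
  "family r k c = fract_poly (pencil_poly of_nat r (family_B r k c))"

lemma pencil_A_Suc: "pencil_A \<alpha> (Suc r) = pencil_A \<alpha> r * [:- \<alpha> r, 1:]"
  by (simp add: pencil_A_def)

lemma coeff_pencil_A_top: "coeff (pencil_A \<alpha> r) r = 1"
  using monic_pencil_A[of \<alpha> r] degree_pencil_A[of \<alpha> r] by simp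

lemma coeff_pencil_A_beyond: "r < n \<Longrightarrow> coeff (pencil_A \<alpha> r) n = 0"
  using degree_pencil_A[of \<alpha> r] by (simp add: coeff_eq_0)

lemma coeff_pencil_A_second: "coeff (pencil_A (of_nat :: nat \<Rightarrow> 'k::field) (Suc r)) r = - of_nat (\<Sum>{..<Suc r})"
proof (induction r)
  case (Suc r)
  have "coeff (pencil_A (of_nat :: nat \<Rightarrow> 'k) (Suc (Suc r))) (Suc r) =
      coeff (pencil_A (of_nat :: nat \<Rightarrow> 'k) (Suc r)) r - of_nat (Suc r) * coeff (pencil_A (of_nat :: nat \<Rightarrow> 'k) (Suc r)) (Suc r)"
    unfolding pencil_A_Suc[of _ "Suc r"] by (simp add: mult.commute[of _ "[:_, 1:]"]) (simp add: algebra_simps)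
  then show ?case using Suc coeff_pencil_A_top[of "of_nat :: nat \<Rightarrow> 'k" "Suc r"] by simp
qed (simp add: pencil_A_def)

lemma coeff_family_B:
  "coeff (family_B r k c :: 'k::field_char_0 poly) n = (if n = 0 then 1 else 0) +
     (if k \<le> n then coeff (pencil_A of_nat r) (n - k) else 0) +
     of_nat (\<Sum>{..<r}) * (if k - 1 \<le> n then coeff (pencil_A of_nat r) (n - (k - 1)) else 0) +
     of_nat c * coeff (pencil_A of_nat r) n"
proof -
  let ?A = "pencil_A of_nat r :: 'k poly"
  have monom: "[:0, 1:] ^ m = monom (1::'k) m" for m by (simp add: monom_altdef)
  have "family_B r k c = 1 + monom 1 k * ?A + smult (of_nat (\<Sum>{..<r})) (monom 1 (k - 1) * ?A) + smult (of_nat c) ?A"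
    unfolding family_B_def monom of_nat_poly by (simp add: algebra_simps)
  then show ?thesis by (simp add: coeff_monom_mult)
qed

lemma family_B_monic:
  assumes "2 \<le> k" shows "degree (family_B r k c :: 'k::field_char_0 poly) = r + k" "lead_coeff (family_B r k c :: 'k poly) = 1"
proof -
  have top: "coeff (family_B r k c :: 'k poly) (r + k) = 1"
    using assms by (simp add: coeff_family_B coeff_pencil_A_top coeff_pencil_A_beyond)
  have "degree (family_B r k c :: 'k poly) \<le> r + k"
    by (rule degree_le) (use assms in \<open>auto simp: coeff_family_B coeff_pencil_A_beyond\<close>)
  then show d: "degree (family_B r k c :: 'k poly) = r + k" using le_degree[of "family_B r k c :: 'k poly" "r + k"] top by simp
  show "lead_coeff (family_B r k c :: 'k poly) = 1" using top d by simp
qed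

lemma poly_family_B: "i < r \<Longrightarrow> poly (family_B r k c) (of_nat i) = (1 :: 'k::field_char_0) ^ 2"
  by (auto simp: family_B_def pencil_A_def poly_prod)

lemma coeff_pencil_poly: "coeff (pencil_poly \<alpha> r B) n = [:coeff B n, coeff (pencil_A \<alpha> r) n:]"
  by (simp add: pencil_poly_def swap_pCons swap_simps(1) coeff_map_poly)

lemma coeff_family: "coeff (family r k c) n = to_fract [:coeff (family_B r k c) n, coeff (pencil_A of_nat r) n:]"
  unfolding family_def by (subst coeff_map_poly) (simp_all only: coeff_pencil_poly to_fract_0)

lemma coeff_family_second:
  assumes "2 \<le> k" "0 < r" shows "coeff (family r k c :: 'k::field_char_0 poly fract poly) (r + k - 1) = 0"
proof -
  obtain s where s: "r = Suc s" using assms(2) gr0_conv_Suc by auto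
  have "r + k - 1 - k = s" "r + k - 1 - (k - 1) = r" "\<not> r + k - 1 = 0" "r < r + k - 1" using assms s by auto
  then have "coeff (family_B r k c :: 'k poly) (r + k - 1) = 0"
    using assms coeff_pencil_A_second[of s, where 'k = 'k] s
    by (simp add: coeff_family_B coeff_pencil_A_top coeff_pencil_A_beyond)
  then show ?thesis using \<open>r < r + k - 1\<close> by (simp add: coeff_family coeff_pencil_A_beyond)
qed

lemma coeff_family_r: "coeff (family r k c) r = to_fract [:coeff (family_B r k 0) r + of_nat c, 1:]"
  by (simp add: coeff_family coeff_pencil_A_top coeff_family_B)

text \<open>
  The right-hand side involves only \<open>x\<close> and the image of \<open>T\<close>. So the same \<open>y\<close> serves over \<open>\<rat>\<close> and over the
  algebraic numbers.
\<close>

lemma poly_family: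
  fixes \<iota> :: "'k::field_char_0 poly fract \<Rightarrow> 'a::field" and x :: 'a and r k c :: nat
  assumes "field_embedding \<iota>"
  defines "P \<equiv> (\<Prod>i<r. x - of_nat i)"
  shows "poly (map_poly \<iota> (family r k c)) x = \<iota> (to_fract [:0, 1:]) * P +
    (1 + P * (x ^ k + of_nat (\<Sum>{..<r}) * x ^ (k - 1) + of_nat c))"
proof -
  interpret field_embedding \<iota> by (rule assms(1))
  define e where "e G = poly (map_poly \<iota> (fract_poly G)) x" for G :: "'k poly poly"
  have e: "is_hom e" unfolding e_def
    by (intro is_hom_comp[OF is_hom_eval is_hom_map_poly] is_hom_emb is_hom_to_fract)
  have lift: "is_hom (\<lambda>p. e (lift_const p))" by (intro is_hom_comp[OF e is_hom_lift_const])
  note l = is_homD[OF lift] is_hom_more[OF lift]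
  have var: "e (lift_const [:0, 1:]) = x" by (simp add: e_def map_poly_pCons emb_1 flip: one_pCons)
  have lin: "[:- of_nat i, 1:] = [:0, 1:] - (of_nat i :: 'k poly)" for i by (simp add: of_nat_poly)
  have A: "e (lift_const (pencil_A of_nat r)) = P"
    unfolding pencil_A_def is_hom_prod[OF lift] lin l var P_def ..
  have B: "e (lift_const (family_B r k c)) = 1 + P * (x ^ k + of_nat (\<Sum>{..<r}) * x ^ (k - 1) + of_nat c)"
    unfolding family_B_def l A var ..
  have "pencil_poly of_nat r (family_B r k c) = lift_const (family_B r k c) + [:[:0, 1:]:] * lift_const (pencil_A of_nat r)"
    by (simp add: pencil_poly_def swap_pCons swap_simps(1))
  then have "e (pencil_poly of_nat r (family_B r k c)) = e (lift_const (family_B r k c)) + e [:[:0, 1:]:] * P"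
    using is_homD[OF e] A by metis
  moreover have "e [:[:0, 1:]:] = \<iota> (to_fract [:0, 1:])" by (simp add: e_def map_poly_pCons)
  ultimately show ?thesis unfolding family_def e_def[symmetric] B by simp
qed

subsection \<open>Affine equivalence within the family\<close>

lemma coeff_pcompose_second:
  fixes p :: "'k::comm_ring_1 poly"
  assumes "degree p = Suc m"
  shows "coeff (pcompose p [:b, a:]) (Suc m) = a ^ Suc m * lead_coeff p \<and>
    coeff (pcompose p [:b, a:]) m = a ^ m * (of_nat (Suc m) * b * lead_coeff p + coeff p m)"
  using assms
proof (induction m arbitrary: p)
  case 0
  obtain c0 q where p: "p = pCons c0 q" by (cases p)
  then have "degree q = 0" using 0 by (auto split: if_splits)
  then obtain c1 where "p = [:c0, c1:]" using p by (metis degree_eq_zeroE)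
  then show ?case using 0 by (simp add: pcompose_pCons mult.commute)
next
  case (Suc m)
  obtain c q where p: "p = pCons c q" by (cases p)
  then have q: "degree q = Suc m" using Suc.prems by (auto split: if_splits)
  then have "q \<noteq> 0" by auto
  then have lc: "coeff p (Suc (Suc m)) = lead_coeff q" using p q by simp
  have beyond: "coeff (pcompose q [:b, a:]) (Suc (Suc m)) = 0"
    using degree_pcompose_le[of q "[:b, a:]"] q by (intro coeff_eq_0) (auto split: if_splits)
  have "coeff (pcompose p [:b, a:]) (Suc n) = b * coeff (pcompose q [:b, a:]) (Suc n) + a * coeff (pcompose q [:b, a:]) n" for n
    unfolding p pcompose_pCons by simp
  then show ?case using Suc.IH[OF q] beyond lc Suc.prems p q by (simp add: algebra_simps)
qed

text \<open>
  If \<open>s \<noteq> t\<close>, then at \<open>- s\<close> the left-hand side of the equation has order one and the right-hand side has order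
  divisible by \<open>k\<close>.
\<close>

lemma linear_power_quotient:
  fixes a :: "'k::field_gcd poly fract"
  assumes "2 \<le> k" "to_fract [:s, 1:] = a ^ k * to_fract [:t, 1:]" shows "s = t"
proof (rule ccontr)
  assume st: "s \<noteq> t"
  obtain p q where a: "a = to_fract p / to_fract q" "q \<noteq> 0" by (rule obtain_quotient)
  have "to_fract ([:s, 1:] * q ^ k) = to_fract (p ^ k * [:t, 1:])"
    unfolding to_fract_mult is_hom_more(3)[OF is_hom_to_fract] assms(2) using a by (simp add: power_divide)
  then have eq: "[:s, 1:] * q ^ k = p ^ k * [:t, 1:]" by (simp only: to_fract_eq_iff)
  have ord_pow: "order (- s) (w ^ n) = n * order (- s) w" if "w \<noteq> 0" for w :: "'k poly" and n
    by (induction n) (use that in \<open>simp_all add: order_mult\<close>)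
  have nz: "[:s, 1:] * q ^ k \<noteq> 0"
    using a by (metis mult_eq_0_iff one_neq_zero pCons_eq_0_iff power_eq_0_iff)
  then have p: "p \<noteq> 0" using eq nz by (metis assms(1) mult_zero_left not_numeral_le_zero power_0_left)
  have "order (- s) ([:s, 1:] * q ^ k) = 1 + k * order (- s) q"
    unfolding order_mult[OF nz] using order_power_n_n[of "- s" 1] ord_pow[OF a(2)] by simp
  moreover have "order (- s) (p ^ k * [:t, 1:]) = k * order (- s) p"
    unfolding order_mult[OF nz[unfolded eq]] using st ord_pow[OF p] by (simp add: order_0I)
  ultimately have "k dvd 1" using eq by (metis dvd_add_left_iff dvd_triv_left)
  then show False using assms(1) by simp
qed

text \<open>
  Vanishing of the coefficients of degree \<open>r + k - 1\<close> gives \<open>b = 0\<close>. Comparison of the coefficients of degree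
  \<open>r\<close> and \<open>r + k\<close> then leaves the equation of \<open>linear_power_quotient\<close>.
\<close>

lemma family_affine_rigid:
  fixes c1 c2 :: nat and a b e :: "'k::{field_char_0, field_gcd} poly fract"
  assumes k: "2 \<le> k" and r: "0 < r" and a: "a \<noteq> 0"
    and eq: "pcompose (family r k c1) [:b, a:] = smult (e ^ 2) (family r k c2)"
  shows "c1 = c2"
proof -
  let ?f = "\<lambda>c. family r k c :: 'k poly fract poly"
  have top: "degree (?f c) = r + k" "lead_coeff (?f c) = 1" for c
    using degree_pencil_poly[of "family_B r k c :: 'k poly" "r + k - 1" r of_nat] family_B_monic[OF k, of r c, where 'k = 'k] k
    by (simp_all add: family_def degree_map_poly coeff_map_poly)
  obtain m where m: "r + k = Suc m" using k by (metis Suc_diff_1 add_gr_0 less_le_trans pos2)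
  have lc: "coeff (?f c) (Suc m) = 1" for c using top[of c] m by simp
  have sec: "coeff (?f c) m = 0" for c using coeff_family_second[OF k r, of c, where 'k = 'k] m by simp
  note E = arg_cong[OF eq, of "\<lambda>p. coeff p _"]
  note C = coeff_pcompose_second[of "?f c1" m b a]
  have e: "a ^ Suc m = e ^ 2" using C E[of "Suc m"] lc top m by simp
  have "a ^ m * (of_nat (Suc m) * b) = 0" using C E[of m] lc sec top m by simp
  moreover have n: "(of_nat (Suc m) :: 'k poly fract) \<noteq> 0"
    by (metis is_hom_more(4)[OF is_hom_to_fract] of_nat_neq_0 to_fract_eq_0_iff)
  ultimately have b: "b = 0" using a n by (metis mult_eq_0_iff power_eq_0_iff)
  define \<rho> :: 'k where "\<rho> = coeff (family_B r k 0) r"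
  have \<rho>: "coeff (?f c) r = to_fract [:\<rho> + of_nat c, 1:]" for c unfolding \<rho>_def by (rule coeff_family_r)
  have "a ^ r * to_fract [:\<rho> + of_nat c1, 1:] = a ^ Suc m * to_fract [:\<rho> + of_nat c2, 1:]"
    using E[of r] \<rho> unfolding b e by (simp add: coeff_pcompose_linear)
  then have "to_fract [:\<rho> + of_nat c1, 1:] = a ^ k * to_fract [:\<rho> + of_nat c2, 1:]"
    using a unfolding m[symmetric] power_add by (simp only: mult.assoc mult_cancel_left power_eq_0_iff) simp
  then have "\<rho> + of_nat c1 = \<rho> + of_nat c2" by (rule linear_power_quotient[OF k])
  then show ?thesis by simp
qed

subsection \<open>The function fields\<close>

lemma (in hyperelliptic_field) FF_minimal:
  assumes L: "is_subfield L" "range \<iota> \<subseteq> L" "x \<in> L" "y \<in> L" shows "FF \<subseteq> L"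
proof -
  have pe: "pe p \<in> L" for p
  proof (induction p)
    case (pCons c p)
    then show ?case unfolding pe_pCons using L by (intro subfield_closed(2)[OF L(1)] subfieldD(4)[OF L(1)]) auto
  qed (simp add: subfieldD(1)[OF L(1)])
  have "a \<in> L" if "a \<in> Oring" for a
    using that pe L(4) subfieldD(4)[OF L(1)] subfield_closed(2)[OF L(1)] by (auto simp: Oring_def el_def)
  then show ?thesis using subfield_closed(3)[OF L(1)] by (auto elim!: FF_cases)
qed

lemma const_field_eq: "const_field = range const_emb"
  by (simp add: const_field_def const_emb_def[abs_def])

lemma range_bar_emb_minimal:
  assumes L: "is_subfield L" "T_gen \<in> L" "{z. algebraic z} \<subseteq> L" shows "range bar_emb \<subseteq> L"
proof -
  have "an_eval p \<in> L" for p
    unfolding an_eval_def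
  proof (induction p)
    case (pCons c p)
    have "an_val c \<in> L" using L(3) algebraic_an_val by blast
    then show ?case unfolding eval_pCons[OF is_hom_an_val]
      using L pCons by (intro subfield_closed(2)[OF L(1)] subfieldD(4)[OF L(1)])
  qed (simp add: subfieldD(1)[OF L(1)])
  then have "bar_emb (to_fract a / to_fract b) \<in> L" for a b
    by (simp add: bar.emb_divide bar_emb_to_fract subfield_closed(3)[OF L(1)])
  then show ?thesis by (metis image_subsetI obtain_quotient)
qed

lemma algebraic_range_bar: "algebraic z \<Longrightarrow> z \<in> range bar_emb"
  by (metis an_val_of bar_emb_const rangeI)

lemma const_range_bar: "range const_emb \<subseteq> range bar_emb"
proof -
  note S = bar.subfield_K
  have "const_emb (to_fract p) \<in> range bar_emb" for p
  proof (induction p)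
    case (pCons c p)
    have eq: "to_fract (pCons c p) = to_fract [:c:] + to_fract [:0, 1:] * to_fract p"
      by (simp flip: to_fract_add to_fract_mult)
    have "algebraic (of_rat c :: ambient)" using rational.alg_emb by (simp add: alg_rational_iff)
    then have "of_rat c \<in> range bar_emb" by (rule algebraic_range_bar)
    moreover have "T_gen \<in> range bar_emb" by (metis bar_emb_T rangeI)
    ultimately show ?case unfolding eq const.emb_add const.emb_mult const_emb_rat T_gen_def[symmetric]
      using pCons by (intro subfield_closed(2)[OF S] subfieldD(4)[OF S])
  qed (simp add: subfieldD(1)[OF S])
  then have "const_emb (to_fract a / to_fract b) \<in> range bar_emb" for a b
    by (simp add: const.emb_divide subfield_closed(3)[OF S])
  then show ?thesis by (metis image_subsetI obtain_quotient)
qed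

lemma T_gen_const: "T_gen \<in> range const_emb"
  by (simp add: T_gen_def)

lemma const_field_bar_eq: "const_field_bar = range bar_emb"
  unfolding const_field_bar_def const_field_eq
proof (rule hull_unique)
  show "range const_emb \<union> {z. algebraic z} \<subseteq> range bar_emb" using const_range_bar algebraic_range_bar by blast
  show "is_subfield (range bar_emb)" by (rule bar.subfield_K)
  show "range bar_emb \<subseteq> L" if "range const_emb \<union> {z. algebraic z} \<subseteq> L" "is_subfield L" for L
    using that T_gen_const by (intro range_bar_emb_minimal) blast+
qed

lemma curve_field_eq:
  assumes y: "y ^ 2 = to_ac (to_fract f)" and f: "hyperelliptic_field const_emb x_gen y f g"
  shows "curve_field f = hyperelliptic_field.FF const_emb x_gen y"
proof -
  interpret hyperelliptic_field const_emb x_gen y f g by (rule f)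
  have pe: "pe p = to_ac (to_fract p)" for p by (simp add: pe_def eval_const_emb)
  have gen: "range to_ac \<subseteq> FF"
  proof
    fix z :: ambient assume "z \<in> range to_ac"
    then obtain q where "z = to_ac q" by blast
    moreover obtain a b where "q = to_fract a / to_fract b" by (rule obtain_quotient)
    ultimately have "z = pe a / pe b" by (simp add: pe)
    then show "z \<in> FF" using FF_I[OF O_pe O_pe] by simp
  qed
  have roots: "z \<in> FF" if "z ^ 2 = to_ac (to_fract f)" for z
  proof -
    have "z = y \<or> z = - y" using that y by (metis power2_eq_iff)
    then show ?thesis using O_FF[OF O_y] subfield_closed(1)[OF subfield_FF] by auto
  qed
  show ?thesis unfolding curve_field_def
  proof (rule hull_unique)
    show "range to_ac \<union> {y. y\<^sup>2 = to_ac (to_fract f)} \<subseteq> FF" using gen roots by blast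
    show "FF \<subseteq> L" if L: "range to_ac \<union> {y. y\<^sup>2 = to_ac (to_fract f)} \<subseteq> L" "is_subfield L" for L
      by (rule FF_minimal[OF L(2)]) (use L(1) y in \<open>auto simp: const_emb_def x_gen_def\<close>)
  qed (rule subfield_FF)
qed

subsection \<open>The members of the family as pencils\<close>

lemma family_pencil:
  fixes \<iota> :: "'k::{field_char_0, field_gcd} poly fract \<Rightarrow> 'a::field_char_0"
  assumes "field_embedding \<iota>" "\<And>p. poly (map_poly \<iota> p) x = 0 \<Longrightarrow> p = 0"
    and "y ^ 2 = poly (map_poly \<iota> (family r k c)) x" "r + k = 2 * g + 1" "2 \<le> k" "0 < g"
  shows "pencil \<iota> x y of_nat (\<lambda>_. 1) r g (family_B r k c)"
proof -
  interpret field_embedding \<iota> by (rule assms(1))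
  show ?thesis
    by unfold_locales (use assms family_B_monic[OF assms(5), of r c, where 'k = 'k] in
      \<open>auto simp: family_def[symmetric] poly_family_B inj_on_def\<close>)
qed

theorem theorem1p2:
  fixes g r :: nat
  assumes "g \<ge> 3" and "5 \<le> r" and "r \<le> 2 * g - 1"
  shows "\<exists>S. infinite S \<and>
    (\<forall>f\<in>S. imaginary_hyperelliptic g f \<and>
      trace_points f = {\<one>\<^bsub>jacobian_points f\<^esub>} \<and>
      finitely_generated_of_rank (jacobian_points f) r) \<and>
    (\<forall>f1\<in>S. \<forall>f2\<in>S. isomorphic_curves f1 f2 \<longrightarrow> f1 = f2)"
proof -
  define k where "k = 2 * g + 1 - r"
  have k: "r + k = 2 * g + 1" "2 \<le> k" and g: "0 < g" "2 \<le> g" and r: "0 < r" using assms by (auto simp: k_def)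
  define F :: "nat \<Rightarrow> QT poly" where "F c = family r k c" for c
  \<comment> \<open>One square root of f serves over both fields of constants.\<close>
  define sq where "sq c = (SOME y. y ^ 2 = to_ac (to_fract (F c)))" for c
  have sq: "sq c ^ 2 = to_ac (to_fract (F c))" for c
    unfolding sq_def by (rule someI_ex) (rule nth_root_exists, simp)
  have val: "sq c ^ 2 = poly (map_poly const_emb (F c)) x_gen" for c by (simp add: sq eval_const_emb)
  have val_bar: "sq c ^ 2 = poly (map_poly bar_emb (family r k c)) x_gen" for c
    unfolding val F_def poly_family[OF const.field_embedding_axioms] poly_family[OF bar.field_embedding_axioms]
      bar_emb_T T_gen_def ..
  have tr: "p = 0" if "poly (map_poly const_emb p) x_gen = 0" for p
    using that by (simp add: eval_const_emb)
  have lo: "pencil const_emb x_gen (sq c) of_nat (\<lambda>_. 1) r g (family_B r k c)" for c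
    by (rule family_pencil[OF const.field_embedding_axioms tr val[unfolded F_def] k g(1)])
  have hi: "pencil bar_emb x_gen (sq c) of_nat (\<lambda>_. 1) r g (family_B r k c)" for c
    by (rule family_pencil[OF bar.field_embedding_axioms x_gen_transcendental_bar val_bar k g(1)])
  have ext: "pencil_extension const_emb bar_emb x_gen (sq c) of_nat (\<lambda>_. 1) of_nat (\<lambda>_. 1) r g (family_B r k c) (family_B r k c)" for c
  proof -
    interpret lo: pencil const_emb x_gen "sq c" of_nat "\<lambda>_. 1" r g "family_B r k c" by (rule lo)
    interpret hi: pencil bar_emb x_gen "sq c" of_nat "\<lambda>_. 1" r g "family_B r k c" by (rule hi)
    have "an_val (of_nat i) = of_nat i" for i using is_hom_more(4)[OF is_hom_an_val] .
    then show ?thesis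
      by unfold_locales (simp_all add: const_range_bar hi.fibre_point_def lo.fibre_point_def hi.fibre_value_def
        lo.fibre_value_def bar_emb_const const_emb_rat an_val_simps)
  qed
  have props: "imaginary_hyperelliptic g (F c) \<and> trace_points (F c) = {\<one>\<^bsub>jacobian_points (F c)\<^esub>} \<and>
    finitely_generated_of_rank (jacobian_points (F c)) r \<and> curve_field (F c) = hyperelliptic_field.FF const_emb x_gen (sq c) \<and>
    hyperelliptic_curve const_emb x_gen (sq c) (F c) g \<and> (\<forall>a. poly (F c) a \<noteq> 0)" for c
  proof -
    interpret pencil_extension const_emb bar_emb x_gen "sq c" of_nat "\<lambda>_. 1" of_nat "\<lambda>_. 1" r g "family_B r k c" "family_B r k c"
      by (rule ext)
    have fF: "fract_poly lo.f0 = F c" by (simp add: F_def family_def)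
    have hf: "hyperelliptic_field const_emb x_gen (sq c) (F c) g"
      using lo.hyperelliptic_field_axioms unfolding fF .
    have C: "curve_field (F c) = lo.FF" by (rule curve_field_eq[OF sq hf])
    have CB: "curve_field_bar (F c) = hi.FF"
      unfolding curve_field_bar_def C
    proof (rule hull_unique)
      show "lo.FF \<union> {z. algebraic z} \<subseteq> hi.FF" using F_sub_hi algebraic_range_bar hi.O_FF[OF hi.O_emb] by blast
      show "hi.FF \<subseteq> L" if L: "lo.FF \<union> {z. algebraic z} \<subseteq> L" "is_subfield L" for L
      proof (rule hi.FF_minimal[OF L(2)])
        have LF: "z \<in> L" if "z \<in> lo.FF" for z using L(1) that by auto
        show "x_gen \<in> L" "sq c \<in> L" by (intro LF lo.O_FF lo.O_x lo.O_y)+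
        have "T_gen \<in> L" unfolding T_gen_def by (intro LF lo.O_FF lo.O_emb)
        moreover have "{z. algebraic z} \<subseteq> L" using L(1) by simp
        ultimately show "range bar_emb \<subseteq> L" by (rule range_bar_emb_minimal[OF L(2)])
      qed
    qed (rule hi.subfield_FF)
    have deg: "degree (F c) = 2 * g + 1" using lo.degree_f unfolding fF .
    have irr: "irreducible (F c)" using lo.irreducible_f unfolding fF .
    have sf: "squarefree (F c)"
    proof (rule squarefreeI)
      fix z assume "z ^ 2 dvd F c"
      then obtain w where w: "F c = z * (z * w)" by (auto simp: dvd_def power2_eq_square mult.assoc)
      then show "z dvd 1" using irreducibleD[OF irr w] by (auto intro: dvd_mult_left)
    qed
    have noroot: "poly (F c) a \<noteq> 0" for a
    proof
      assume "poly (F c) a = 0"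
      then obtain w where w: "F c = [:- a, 1:] * w" by (auto simp: poly_eq_0_iff_dvd dvd_def)
      have "\<not> [:- a, 1:] dvd 1" by (simp add: is_unit_pCons_iff)
      then have "w dvd 1" using irreducibleD[OF irr w] by blast
      then have "degree w = 0" by (metis is_unit_polyE degree_pCons_0)
      then have "degree (F c) \<le> 1" unfolding w using degree_mult_le[of "[:- a, 1:]" w] by simp
      then show False using deg g by simp
    qed
    have "genus const_field (curve_field (F c)) = int g" unfolding C const_field_eq by (rule lo.genus_eq)
    moreover have "trace_points (F c) = {\<one>\<^bsub>jacobian_points (F c)\<^esub>}"
      unfolding trace_points_def jacobian_points_def C CB const_field_eq const_field_bar_eq by (rule trace_trivial)
    moreover have "finitely_generated_of_rank (jacobian_points (F c)) r"
      unfolding jacobian_points_def C const_field_eq by (rule finitely_generated_of_rank_free[OF lo.Pic0_iso])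
    moreover have "hyperelliptic_curve const_emb x_gen (sq c) (F c) g"
      using lo.hyperelliptic_curve_axioms unfolding fF .
    ultimately show ?thesis using C sf deg noroot by (auto simp: imaginary_hyperelliptic_def)
  qed
  have "inj F" by (rule injI) (metis F_def coeff_family_r add_left_cancel of_nat_eq_iff pCons_eq_iff to_fract_eq_iff)
  then have inf: "infinite (range F)" using finite_imageD infinite_UNIV_nat by blast
  have rigid: "c1 = c2" if iso: "isomorphic_curves (F c1) (F c2)" for c1 c2
  proof -
    let ?K1 = "hyperelliptic_field.FF const_emb x_gen (sq c1)" and ?K2 = "hyperelliptic_field.FF const_emb x_gen (sq c2)"
    have K: "curve_field (F c1) = ?K1" "curve_field (F c2) = ?K2" using props by blast+
    obtain \<phi> where \<phi>: "bij_betw \<phi> ?K1 ?K2" "\<forall>a\<in>?K1. \<forall>b\<in>?K1. \<phi> (a + b) = \<phi> a + \<phi> b \<and> \<phi> (a * b) = \<phi> a * \<phi> b"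
      "\<forall>z\<in>const_field. \<phi> z = z"
      using iso unfolding isomorphic_curves_def K by blast
    have \<phi>': "\<phi> (a + b) = \<phi> a + \<phi> b \<and> \<phi> (a * b) = \<phi> a * \<phi> b" if "a \<in> ?K1" "b \<in> ?K1" for a b
      using bspec[OF bspec[OF \<phi>(2) that(1)] that(2)] .
    have \<phi>'': "\<phi> (const_emb z) = const_emb z" for z
      using \<phi>(3) unfolding const_field_eq by (rule bspec) simp
    have H: "hyperelliptic_curve const_emb x_gen (sq c1) (F c1) g" "hyperelliptic_curve const_emb x_gen (sq c2) (F c2) g"
      "\<And>a. poly (F c2) a \<noteq> 0" using props by blast+
    obtain a b e where "a \<noteq> 0" "pcompose (F c1) [:b, a:] = smult (e ^ 2) (F c2)"
      using curve_isomorphism_affine[OF H(1,2) g(2) H(3) \<phi>(1) \<phi>' \<phi>''] by metis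
    then show ?thesis unfolding F_def by (rule family_affine_rigid[OF k(2) r])
  qed
  show ?thesis
    by (rule exI[of _ "range F"]) (use inf props rigid in blast)
qed

end
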